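(* Let $\vec\omega=(\omega_0,\ldots,\omega_{n+1})$, $n\ge 0$, be a primitive algebraic key sequence in normal form, let $\vec\theta=(\theta_1,\ldots,\theta_n)\in(\mathbb{C}^* )^n$, and let $\bar X:=\bar X_{\vec\omega,\vec\theta}$ be the corresponding normal primitive compactification of $X=\mathbb{C}^2$ with coordinates $(x,y)$ on $X$. Let $$k_{\bar X}:=-\Big(\omega_0+\omega_{n+1}+1-\sum_{k=1}^n(\alpha_k-1)\omega_k\Big),\qquad m_{\vec\omega}:=\lfloor -(k_{\bar X}+\omega_1+1)/\omega_1\rfloor .$$ (1) $\bar X$ admits the structure of a $\mathbb{G}_a^2$-surface if and only if $\omega_0+k_{\bar X}<0$. (2) Assume $\bar X\not\cong\mathbb{P}^2$ and that $\sigma:\mathbb{G}_a^2\times\bar X\to\bar X$ is an action which makes $\bar X$ a $\mathbb{G}_a^2$-surface. Then there is an automorphism $F$ of $\bar X$ such that $X$ is invariant under the conjugated action $(t,p)\mapsto F(\sigma(t,F^{-1}(p)))$, and the restriction of this conjugated action to $X$ is of the form $$(t_1,t_2)\cdot(x,y)=\Big(x+\sum_{i=0}^{m_{\vec\omega}}g_i(c_1t_1+c_2t_2)\,y^i+\mu(\bar c_2t_1-\bar c_1t_2),\ y+c_1t_1+c_2t_2\Big),\qquad( * )$$ where $(c_1,c_2)\in\mathbb{C}^2\setminus\{(0,0)\}$, $\mu\in\mathbb{C}\setminus\{0\}$, $\bar c_j$ is the complex conjugate of $c_j$, and for some $\lambda_0,\ldots,\lambda_{m_{\vec\omega}}\in\mathbb{C}$,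 $$g_i(r)=\sum_{j=i}^{m_{\vec\omega}}\frac{\lambda_j}{j-i+1}\binom{j}{j-i}r^{j-i+1},\qquad 0\le i\le m_{\vec\omega}.$$ (3) Conversely, if $\omega_0+k_{\bar X}<0$, then for all $(c_1,c_2)\in\mathbb{C}^2\setminus\{(0,0)\}$, $\mu\in\mathbb{C}\setminus\{0\}$, $\lambda_0,\ldots,\lambda_{m_{\vec\omega}}\in\mathbb{C}$ and $g_i$ defined from the $\lambda_j$ as in (2), formula $( * )$ defines a $\mathbb{G}_a^2$-structure on $\bar X$ (that is, the action $( * )$ on $X$ extends to an action on $\bar X$ making it a $\mathbb{G}_a^2$-surface).
   Context: **$\mathbb{G}_a^2$-surfaces.** $\mathbb{G}_a^2$ is $\mathbb{C}^2$ with its additive group structure. A $\mathbb{G}_a^2$-surface is a variety $Y$ with a fixed left (algebraic) action of $\mathbb{G}_a^2$ such that the stabilizer of a generic point is trivial and the orbit of a generic point is dense; such an action is called a $\mathbb{G}_a^2$-structure on $Y$. **Key sequences.** A key sequence is a sequence of integers $\vec\omega=(\omega_0,\ldots,\omega_{n+1})$, $n\ge0$, with $\omega_0\ge1$ such that, setting $e_k:=\gcd(|\omega_0|,\ldots,|\omega_k|)$ ($0\le k\le n+1$) and $\alpha_k:=e_{k-1}/e_k$ ($1\le k\le n+1$), one has $e_{n+1}=1$ and $\omega_{k+1}<\alpha_k\omega_k$ for $1\le k\le n$. It is primitive if $\omega_{n+1}>0$ (equivalently all $\omega_k>0$), and algebraic if $\alpha_k\omega_k\in\mathbb{Z}_{\ge0}\langle\omega_0,\ldots,\omega_{k-1}\rangle$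 for $1\le k\le n$. The essential subsequence of $\vec\omega$ is $(\omega_{i_0},\omega_{i_1},\ldots,\omega_{i_l},\omega_{i_{l+1}})$ with $i_0=0$, $i_{l+1}=n+1$, and $i_1<\cdots<i_l$ the indices $k\in\{1,\ldots,n\}$ with $\alpha_k\ge2$. For $1\le k\le n$ one can uniquely write $\alpha_k\omega_k=\sum_{j=0}^{k-1}\beta_{k,j}\omega_j$ with integers $\beta_{k,j}$ such that $0\le\beta_{k,j}<\alpha_j$ for $j\ge1$; if $\vec\omega$ is algebraic then $\beta_{k,0}\ge0$. **The surface $\bar X_{\vec\omega,\vec\theta}$.** For a primitive algebraic key sequence $\vec\omega$ and $\vec\theta\in(\mathbb{C}^* )^n$, $\bar X_{\vec\omega,\vec\theta}$ is the subvariety of the weighted projective space $\mathbb{P}^{n+2}(1,\omega_0,\ldots,\omega_{n+1})$ with weighted homogeneous coordinates $[w:y_0:\cdots:y_{n+1}]$ defined by $$w^{\alpha_k\omega_k-\omega_{k+1}}y_{k+1}-\Big(y_k^{\alpha_k}-\theta_k\prod_{j=0}^{k-1}y_j^{\beta_{k,j}}\Big)=0,\quad 1\le k\le n.$$ It is a normal compactification of $X:=\bar X_{\vec\omega,\vec\theta}\cap\{w\ne0\}\cong\mathbb{C}^2$, with coordinates $x:=y_0/w^{\omega_0}$, $y:=y_1/w^{\omega_1}$, and with irreducible curve at infinity (a "primitive compactification" of $\mathbb{C}^2$). **Normal form.** For a primitive key sequence $\vec\omega$ with essential subsequence $(\omega_{i_0},\omega_{i_1},\ldots,\omega_{i_l},\omega_{i_{l+1}})$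 (where $i_0=0$, $i_{l+1}=n+1$, and $i_1<\cdots<i_l$ are the indices $k\in\{1,\ldots,n\}$ with $\alpha_k\ge2$), put $\chi_j:=\frac1{\omega_0}\big(\omega_{i_j}-\sum_{k=1}^{j-1}(\alpha_{i_k}-1)\omega_{i_k}\big)$, $1\le j\le l+1$, and $$\mathcal{E}_{\vec\omega}:=\{k\tfrac{\omega_1}{\omega_0}-1: k\in\mathbb{Z},\ \max\{0,(\chi_{l+1}+1)\tfrac{\omega_0}{\omega_1}\}<k<\tfrac{\omega_0}{\omega_1}+1\}\cup\{0\}.$$ For $\beta\in\mathbb{Q}$ let $\hat k(\beta):=0$ if $\beta\ge\chi_1$ and $\hat k(\beta):=\max\{k:1\le k\le l+1,\ \beta<\chi_k\}$ otherwise; $\hat\omega_\beta:=\omega_0\beta+\sum_{j=1}^{\hat k(\beta)}(\alpha_{i_j}-1)\omega_{i_j}$; $\hat I_\beta:=\{i: i_{\hat k(\beta)}<i<i_{\hat k(\beta)+1}\}$ if $\hat k(\beta)\le l$, and $\hat I_\beta:=\emptyset$ if $\hat k(\beta)=l+1$. The primitive key sequence $\vec\omega$ is in normal form if either (N0) $n=0$ and $\omega_0\ge\omega_1$; or (N1) $n\ge1$, $\omega_0>\omega_1$, $\omega_1/\omega_0\notin\{1/k:k\in\mathbb{Z},k\ge1\}\cup\{0\}$, and for each $\beta\in\mathcal{E}_{\vec\omega}$ there is no $i\in\hat I_\beta$ with $\omega_i=\hat\omega_\beta$. *)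

theory Defs
  imports "HOL-Analysis.Analysis" "HOL-Library.Poly_Mapping"
begin

section \<open>Spaces with functions over the complex numbers\<close>

text \<open>Varieties are classical (reduced, complex points only): a Zariski topology together with the
  regular functions on each open set. A function counts as regular on \<open>U\<close> according to its values on
  \<open>U\<close> only. A space is given by pairs \<open>(D, g)\<close>, with \<open>D\<close> a basic open set and \<open>g\<close> a function that is
  regular on \<open>D\<close>; the regular functions are those that are locally of this form.\<close>

record 'a fspace =
  zar :: "'a topology"
  regf :: "'a set \<Rightarrow> ('a \<Rightarrow> complex) set"

abbreviation pts :: "'a fspace \<Rightarrow> 'a set" where
  "pts Y \<equiv> topspace (zar Y)"

definition fspace_of :: "('a set \<times> ('a \<Rightarrow> complex)) set \<Rightarrow> 'a fspace" where
  "fspace_of P =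
    (let T = topology_generated_by (fst ` P) in
     \<lparr>zar = T,
      regf = (\<lambda>U. {f. openin T U \<and>
        (\<forall>p\<in>U. \<exists>(D, g)\<in>P. p \<in> D \<and> D \<subseteq> U \<and> (\<forall>q\<in>D. f q = g q))})\<rparr>)"

definition subspace_of :: "'a fspace \<Rightarrow> 'a set \<Rightarrow> 'a fspace" where
  "subspace_of Y S = fspace_of {(D \<inter> S, g) | D g. openin (zar Y) D \<and> g \<in> regf Y D}"

text \<open>The product of varieties: locally, its regular functions are the quotients of finite sums of
  products of regular functions on the factors.\<close>

definition prod_fspace :: "'a fspace \<Rightarrow> 'b fspace \<Rightarrow> ('a \<times> 'b) fspace" where
  "prod_fspace Y Z = fspace_of
    {(D, g) | D g. \<exists>U V.
       openin (zar Y) U \<and> openin (zar Z) V \<and>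
       (\<exists>(M :: nat) (N :: nat) a b f h.
          (\<forall>i<M. a i \<in> regf Y U \<and> b i \<in> regf Z V) \<and>
          (\<forall>i<N. f i \<in> regf Y U \<and> h i \<in> regf Z V) \<and>
          D = {(p, q). p \<in> U \<and> q \<in> V \<and> (\<Sum>i<N. f i p * h i q) \<noteq> 0} \<and>
          g = (\<lambda>(p, q). (\<Sum>i<M. a i p * b i q) / (\<Sum>i<N. f i p * h i q)))}"

definition morphism :: "'a fspace \<Rightarrow> 'b fspace \<Rightarrow> ('a \<Rightarrow> 'b) \<Rightarrow> bool" where
  "morphism Y Z \<phi> \<longleftrightarrow> continuous_map (zar Y) (zar Z) \<phi> \<and>
    (\<forall>V f. openin (zar Z) V \<and> f \<in> regf Z V \<longrightarrow> f \<circ> \<phi> \<in> regf Y {p \<in> pts Y. \<phi> p \<in> V})"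

definition iso_maps :: "'a fspace \<Rightarrow> 'b fspace \<Rightarrow> ('a \<Rightarrow> 'b) \<Rightarrow> ('b \<Rightarrow> 'a) \<Rightarrow> bool" where
  "iso_maps Y Z F G \<longleftrightarrow> morphism Y Z F \<and> morphism Z Y G \<and>
    (\<forall>p\<in>pts Y. G (F p) = p) \<and> (\<forall>q\<in>pts Z. F (G q) = q)"

definition isomorphic :: "'a fspace \<Rightarrow> 'b fspace \<Rightarrow> bool" where
  "isomorphic Y Z \<longleftrightarrow> (\<exists>F G. iso_maps Y Z F G)"


section \<open>The affine plane and weighted projective spaces\<close>

definition poly_eval :: "((nat \<Rightarrow>\<^sub>0 nat) \<Rightarrow>\<^sub>0 complex) \<Rightarrow> (nat \<Rightarrow> complex) \<Rightarrow> complex" where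
  "poly_eval p z =
    (\<Sum>m\<in>Poly_Mapping.keys p. Poly_Mapping.lookup p m *
      (\<Prod>i\<in>Poly_Mapping.keys m. z i ^ Poly_Mapping.lookup m i))"

definition is_whomog ::
    "nat \<Rightarrow> (nat \<Rightarrow> nat) \<Rightarrow> nat \<Rightarrow> ((nat \<Rightarrow>\<^sub>0 nat) \<Rightarrow>\<^sub>0 complex) \<Rightarrow> bool" where
  "is_whomog N a d p \<longleftrightarrow>
    (\<forall>m\<in>Poly_Mapping.keys p. Poly_Mapping.keys m \<subseteq> {..N} \<and>
      (\<Sum>i\<in>Poly_Mapping.keys m. a i * Poly_Mapping.lookup m i) = d)"

text \<open>A bivariate polynomial is evaluated by sending the variable 0 to \<open>s\<close> and every other variable
  to \<open>t\<close>.\<close>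

definition affine_plane :: "(complex \<times> complex) fspace" where
  "affine_plane = fspace_of
    {(D, g) | D g. \<exists>F G.
       D = {(s, t). poly_eval G (\<lambda>i. if i = 0 then s else t) \<noteq> 0} \<and>
       g = (\<lambda>(s, t). poly_eval F (\<lambda>i. if i = 0 then s else t) /
                     poly_eval G (\<lambda>i. if i = 0 then s else t))}"

text \<open>A point of the weighted projective space with weights \<open>a 0, \<dots>, a N\<close> is the set of all its
  vectors of homogeneous coordinates, i.e. an orbit of the weighted action of the nonzero complex
  numbers. A coordinate vector is a function on \<open>nat\<close> that vanishes beyond the index \<open>N\<close>.\<close>

definition worbit :: "(nat \<Rightarrow> nat) \<Rightarrow> (nat \<Rightarrow> complex) \<Rightarrow> (nat \<Rightarrow> complex) set" where
  "worbit a z = {(\<lambda>i. c ^ a i * z i) | c. c \<noteq> 0}"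

definition wproj_pts :: "nat \<Rightarrow> (nat \<Rightarrow> nat) \<Rightarrow> (nat \<Rightarrow> complex) set set" where
  "wproj_pts N a = {worbit a z | z. (\<forall>i>N. z i = 0) \<and> (\<exists>i\<le>N. z i \<noteq> 0)}"

definition rep :: "(nat \<Rightarrow> complex) set \<Rightarrow> nat \<Rightarrow> complex" where
  "rep p = (SOME z. z \<in> p)"

text \<open>Whether \<open>G\<close> vanishes at \<open>p\<close>, and the value of \<open>F / G\<close>, do not depend on the representative,
  as \<open>F\<close> and \<open>G\<close> are weighted homogeneous of the same degree.\<close>

definition wproj :: "nat \<Rightarrow> (nat \<Rightarrow> nat) \<Rightarrow> (nat \<Rightarrow> complex) set fspace" where
  "wproj N a = fspace_of
    {(D, g) | D g. \<exists>d F G. is_whomog N a d F \<and> is_whomog N a d G \<and>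
       D = {p \<in> wproj_pts N a. poly_eval G (rep p) \<noteq> 0} \<and>
       g = (\<lambda>p. poly_eval F (rep p) / poly_eval G (rep p))}"

abbreviation proj_plane :: "(nat \<Rightarrow> complex) set fspace" where
  "proj_plane \<equiv> wproj 2 (\<lambda>_. 1)"


section \<open>Structures of a \<open>G\<^sub>a\<^sup>2\<close>-surface\<close>

text \<open>To be used for a variety \<open>Y\<close>; generic means on a dense Zariski open subset.\<close>

definition ga2_action :: "'a fspace \<Rightarrow> ((complex \<times> complex) \<times> 'a \<Rightarrow> 'a) \<Rightarrow> bool" where
  "ga2_action Y \<sigma> \<longleftrightarrow> morphism (prod_fspace affine_plane Y) Y \<sigma> \<and>
    (\<forall>p\<in>pts Y. \<sigma> (0, p) = p) \<and>
    (\<forall>s t. \<forall>p\<in>pts Y. \<sigma> (s + t, p) = \<sigma> (s, \<sigma> (t, p)))"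

definition ga2_structure :: "'a fspace \<Rightarrow> ((complex \<times> complex) \<times> 'a \<Rightarrow> 'a) \<Rightarrow> bool" where
  "ga2_structure Y \<sigma> \<longleftrightarrow> ga2_action Y \<sigma> \<and>
    (\<exists>U. openin (zar Y) U \<and> zar Y closure_of U = pts Y \<and>
      (\<forall>p\<in>U. {t. \<sigma> (t, p) = p} = {0} \<and>
              zar Y closure_of (range (\<lambda>t. \<sigma> (t, p))) = pts Y))"


section \<open>Key sequences\<close>

text \<open>A sequence \<open>(\<omega>\<^sub>0, \<dots>, \<omega>\<^sub>n\<^sub>+\<^sub>1)\<close> is given by \<open>n\<close> and a function \<open>\<omega>\<close> on \<open>nat\<close>, of which only the
  values up to \<open>n + 1\<close> are used.\<close>

definition key_e :: "(nat \<Rightarrow> int) \<Rightarrow> nat \<Rightarrow> int" where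
  "key_e \<omega> k = Gcd ((\<lambda>j. \<bar>\<omega> j\<bar>) ` {..k})"

text \<open>The division is exact.\<close>

definition key_alpha :: "(nat \<Rightarrow> int) \<Rightarrow> nat \<Rightarrow> int" where
  "key_alpha \<omega> k = key_e \<omega> (k - 1) div key_e \<omega> k"

definition key_sequence :: "nat \<Rightarrow> (nat \<Rightarrow> int) \<Rightarrow> bool" where
  "key_sequence n \<omega> \<longleftrightarrow> \<omega> 0 \<ge> 1 \<and> key_e \<omega> (n + 1) = 1 \<and>
    (\<forall>k\<in>{1..n}. \<omega> (k + 1) < key_alpha \<omega> k * \<omega> k)"

definition key_primitive :: "nat \<Rightarrow> (nat \<Rightarrow> int) \<Rightarrow> bool" where
  "key_primitive n \<omega> \<longleftrightarrow> \<omega> (n + 1) > 0"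

definition key_algebraic :: "nat \<Rightarrow> (nat \<Rightarrow> int) \<Rightarrow> bool" where
  "key_algebraic n \<omega> \<longleftrightarrow>
    (\<forall>k\<in>{1..n}. \<exists>c :: nat \<Rightarrow> nat. key_alpha \<omega> k * \<omega> k = (\<Sum>j<k. int (c j) * \<omega> j))"

definition key_beta :: "(nat \<Rightarrow> int) \<Rightarrow> nat \<Rightarrow> nat \<Rightarrow> int" where
  "key_beta \<omega> k = (THE b. key_alpha \<omega> k * \<omega> k = (\<Sum>j<k. b j * \<omega> j) \<and>
     (\<forall>j\<in>{1..<k}. 0 \<le> b j \<and> b j < key_alpha \<omega> j) \<and> (\<forall>j\<ge>k. b j = 0))"


section \<open>The surface\<close>

text \<open>The homogeneous coordinates are ordered as \<open>[w : y\<^sub>0 : \<dots> : y\<^sub>n\<^sub>+\<^sub>1]\<close>, so \<open>w\<close> has index \<open>0\<close> and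
  \<open>y\<^sub>j\<close> has index \<open>j + 1\<close>. For primitive algebraic key sequences all exponents converted by \<open>nat\<close>
  are nonnegative.\<close>

definition xbar_weights :: "(nat \<Rightarrow> int) \<Rightarrow> nat \<Rightarrow> nat" where
  "xbar_weights \<omega> i = (case i of 0 \<Rightarrow> 1 | Suc j \<Rightarrow> nat (\<omega> j))"

definition xbar_pts ::
    "nat \<Rightarrow> (nat \<Rightarrow> int) \<Rightarrow> (nat \<Rightarrow> complex) \<Rightarrow> (nat \<Rightarrow> complex) set set" where
  "xbar_pts n \<omega> \<theta> = {p \<in> wproj_pts (n + 2) (xbar_weights \<omega>).
     \<forall>z\<in>p. \<forall>k\<in>{1..n}.
       z 0 ^ nat (key_alpha \<omega> k * \<omega> k - \<omega> (k + 1)) * z (k + 2)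
       - (z (k + 1) ^ nat (key_alpha \<omega> k)
          - \<theta> k * (\<Prod>j<k. z (j + 1) ^ nat (key_beta \<omega> k j))) = 0}"

definition xbar :: "nat \<Rightarrow> (nat \<Rightarrow> int) \<Rightarrow> (nat \<Rightarrow> complex) \<Rightarrow> (nat \<Rightarrow> complex) set fspace" where
  "xbar n \<omega> \<theta> = subspace_of (wproj (n + 2) (xbar_weights \<omega>)) (xbar_pts n \<omega> \<theta>)"

definition xbar_affine ::
    "nat \<Rightarrow> (nat \<Rightarrow> int) \<Rightarrow> (nat \<Rightarrow> complex) \<Rightarrow> (nat \<Rightarrow> complex) set set" where
  "xbar_affine n \<omega> \<theta> = {p \<in> xbar_pts n \<omega> \<theta>. \<forall>z\<in>p. z 0 \<noteq> 0}"

text \<open>The coordinates \<open>(x, y)\<close>, independent of the representative.\<close>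

definition xbar_coords :: "(nat \<Rightarrow> int) \<Rightarrow> (nat \<Rightarrow> complex) set \<Rightarrow> complex \<times> complex" where
  "xbar_coords \<omega> p =
    (rep p 1 / rep p 0 ^ nat (\<omega> 0), rep p 2 / rep p 0 ^ nat (\<omega> 1))"


section \<open>Normal form\<close>

definition ess_indices :: "nat \<Rightarrow> (nat \<Rightarrow> int) \<Rightarrow> nat list" where
  "ess_indices n \<omega> = 0 # sorted_list_of_set {k\<in>{1..n}. key_alpha \<omega> k \<ge> 2} @ [n + 1]"

definition ess_len :: "nat \<Rightarrow> (nat \<Rightarrow> int) \<Rightarrow> nat" where
  "ess_len n \<omega> = card {k\<in>{1..n}. key_alpha \<omega> k \<ge> 2}"

abbreviation ess_ix :: "nat \<Rightarrow> (nat \<Rightarrow> int) \<Rightarrow> nat \<Rightarrow> nat" where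
  "ess_ix n \<omega> j \<equiv> ess_indices n \<omega> ! j"

definition key_chi :: "nat \<Rightarrow> (nat \<Rightarrow> int) \<Rightarrow> nat \<Rightarrow> rat" where
  "key_chi n \<omega> j = 1 / of_int (\<omega> 0) * of_int (\<omega> (ess_ix n \<omega> j)
     - (\<Sum>k\<in>{1..<j}. (key_alpha \<omega> (ess_ix n \<omega> k) - 1) * \<omega> (ess_ix n \<omega> k)))"

definition key_E :: "nat \<Rightarrow> (nat \<Rightarrow> int) \<Rightarrow> rat set" where
  "key_E n \<omega> =
    {of_int k * (of_int (\<omega> 1) / of_int (\<omega> 0)) - 1 | k :: int.
       max 0 ((key_chi n \<omega> (ess_len n \<omega> + 1) + 1) * (of_int (\<omega> 0) / of_int (\<omega> 1))) < of_int k \<and>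
       of_int k < (of_int (\<omega> 0) / of_int (\<omega> 1) :: rat) + 1} \<union> {0}"

definition khat :: "nat \<Rightarrow> (nat \<Rightarrow> int) \<Rightarrow> rat \<Rightarrow> nat" where
  "khat n \<omega> \<beta> = (if \<beta> \<ge> key_chi n \<omega> 1 then 0
     else Max {k. 1 \<le> k \<and> k \<le> ess_len n \<omega> + 1 \<and> \<beta> < key_chi n \<omega> k})"

definition omega_hat :: "nat \<Rightarrow> (nat \<Rightarrow> int) \<Rightarrow> rat \<Rightarrow> rat" where
  "omega_hat n \<omega> \<beta> = of_int (\<omega> 0) * \<beta>
     + of_int (\<Sum>j\<in>{1..khat n \<omega> \<beta>}. (key_alpha \<omega> (ess_ix n \<omega> j) - 1) * \<omega> (ess_ix n \<omega> j))"

definition I_hat :: "nat \<Rightarrow> (nat \<Rightarrow> int) \<Rightarrow> rat \<Rightarrow> nat set" where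
  "I_hat n \<omega> \<beta> = (if khat n \<omega> \<beta> \<le> ess_len n \<omega>
     then {i. ess_ix n \<omega> (khat n \<omega> \<beta>) < i \<and> i < ess_ix n \<omega> (khat n \<omega> \<beta> + 1)} else {})"

definition normal_form :: "nat \<Rightarrow> (nat \<Rightarrow> int) \<Rightarrow> bool" where
  "normal_form n \<omega> \<longleftrightarrow>
     (n = 0 \<and> \<omega> 0 \<ge> \<omega> 1) \<or>
     (n \<ge> 1 \<and> \<omega> 0 > \<omega> 1 \<and>
      (of_int (\<omega> 1) / of_int (\<omega> 0) :: rat) \<notin> {1 / of_int k | k :: int. k \<ge> 1} \<union> {0} \<and>
      (\<forall>\<beta>\<in>key_E n \<omega>. \<not> (\<exists>i\<in>I_hat n \<omega> \<beta>. of_int (\<omega> i) = omega_hat n \<omega> \<beta>)))"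


section \<open>The standard actions\<close>

definition k_xbar :: "nat \<Rightarrow> (nat \<Rightarrow> int) \<Rightarrow> int" where
  "k_xbar n \<omega> = - (\<omega> 0 + \<omega> (n + 1) + 1 - (\<Sum>k=1..n. (key_alpha \<omega> k - 1) * \<omega> k))"

definition m_omega :: "nat \<Rightarrow> (nat \<Rightarrow> int) \<Rightarrow> int" where
  "m_omega n \<omega> = \<lfloor>of_int (- (k_xbar n \<omega> + \<omega> 1 + 1)) / (of_int (\<omega> 1) :: rat)\<rfloor>"

text \<open>Summation over \<open>i < nat (m + 1)\<close> is summation over the natural numbers \<open>i\<close> with
  \<open>0 \<le> i \<le> m\<close>, for an integer \<open>m\<close>.\<close>

definition g_fun :: "int \<Rightarrow> (nat \<Rightarrow> complex) \<Rightarrow> nat \<Rightarrow> complex \<Rightarrow> complex" where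
  "g_fun m lam i r = (\<Sum>j\<in>{i..<nat (m + 1)}.
     lam j / of_nat (j - i + 1) * of_nat (j choose (j - i)) * r ^ (j - i + 1))"

definition std_action ::
    "int \<Rightarrow> (nat \<Rightarrow> complex) \<Rightarrow> complex \<Rightarrow> complex \<Rightarrow> complex
      \<Rightarrow> complex \<times> complex \<Rightarrow> complex \<times> complex \<Rightarrow> complex \<times> complex" where
  "std_action m lam c1 c2 \<mu> = (\<lambda>(t1, t2) (x, y).
     (x + (\<Sum>i<nat (m + 1). g_fun m lam i (c1 * t1 + c2 * t2) * y ^ i)
        + \<mu> * (cnj c2 * t1 - cnj c1 * t2),
      y + c1 * t1 + c2 * t2))"

text \<open>The map \<open>\<tau>\<close> leaves \<open>X\<close> invariant and restricts there to the map \<open>A\<close> in the coordinates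
  \<open>(x, y)\<close>.\<close>

definition restricts_to ::
    "nat \<Rightarrow> (nat \<Rightarrow> int) \<Rightarrow> (nat \<Rightarrow> complex)
      \<Rightarrow> ((complex \<times> complex) \<times> (nat \<Rightarrow> complex) set \<Rightarrow> (nat \<Rightarrow> complex) set)
      \<Rightarrow> (complex \<times> complex \<Rightarrow> complex \<times> complex \<Rightarrow> complex \<times> complex) \<Rightarrow> bool" where
  "restricts_to n \<omega> \<theta> \<tau> A \<longleftrightarrow> (\<forall>t. \<forall>p\<in>xbar_affine n \<omega> \<theta>.
     \<tau> (t, p) \<in> xbar_affine n \<omega> \<theta> \<and> xbar_coords \<omega> (\<tau> (t, p)) = A t (xbar_coords \<omega> p))"

end

theory Submission
  imports Defs "HOL-Computational_Algebra.Computational_Algebra" "HOL-Computational_Algebra.Field_as_Ring"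
begin

text \<open>The functions on \<open>X\<close> are \<open>\<complex>[x, y]\<close>, filtered by the pole order along the curve at infinity; the
  piece of degree \<open>d\<close> is spanned by the monomials of weight at most \<open>d\<close> in the key polynomials \<open>y\<^sub>j\<close>
  (of weight \<open>\<omega>\<^sub>j\<close>). The infinitesimal generators of an action are commuting derivations of \<open>\<complex>[x, y]\<close>.
  Regularity at a general point at infinity forces such a derivation to preserve the filtration, or to
  raise it by 1 with an Euler field as leading part; the latter requires \<open>\<omega>\<^sub>n\<^sub>+\<^sub>1 = 1\<close>. A generator that
  preserves the filtration acts on finite-dimensional spaces, so its flow is a rational, hence
  polynomial, solution of a linear differential equation: \<open>X\<close> is invariant under it and the generator is
  locally nilpotent. Degeneration to top weights then makes it triangular, \<open>c \<partial>/\<partial>y + p(y) \<partial>/\<partial>x\<close>, and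
  the exact degree of its value at \<open>y\<^sub>n\<^sub>+\<^sub>1\<close> yields \<open>\<omega>\<^sub>0 + k < 0\<close>, the bound on \<open>deg p\<close>, and a contradiction
  if \<open>n \<ge> 1\<close> and \<open>\<omega>\<^sub>n\<^sub>+\<^sub>1 = 1\<close>. In the remaining case, the weights 1, q, 1, an automorphism moves an
  invariant curve to infinity.\<close>

section \<open>Spaces presented by graded functions\<close>

text \<open>Two facts carry the degree estimates. The leading form, a polynomial in the last
  coordinate \<open>V\<close> at infinity, is well defined and multiplicative, because expansions in
  the \<open>y_j\<close> with digits below \<open>\<alpha>\<^sub>j\<close> are unique. So regularity
  at one point at infinity with all \<open>y_j\<close> nonzero already bounds the degree of a
  generator. The obstacle is that for \<open>n >= 1\<close> the weighted degree in
  \<open>x, y\<close> is not the pole order: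
  \<open>y^\<alpha>\<^sub>1 - \<theta>\<^sub>1 x^\<beta>\<close> drops. A top part that is a single
  monomial cannot drop, and the degenerations aim at reaching one. The numerical conditions come
  from one count. For a field \<open>c d/dy + p(y) d/dx\<close> of weight \<open>e\<close>, the
  image of \<open>y_k\<close> has degree \<open>s_k + e\<close> for \<open>k >= 2\<close>, with
  \<open>s_k\<close> the sum of \<open>(\<alpha>\<^sub>j - 1) \<omega>\<^sub>j\<close> over
  \<open>1 <= j < k\<close>; preserving degrees at \<open>y_{n+1}\<close> means
  \<open>s_{n+1} + e <= \<omega>_{n+1}\<close>. If \<open>c\<close> is nonzero then
  \<open>e >= 0\<close>, and this is the condition in (1); a term \<open>y^i\<close> of
  \<open>p\<close> gives \<open>e >= (i + 1) \<omega>\<^sub>1 - \<omega>\<^sub>0\<close>, and this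
  is the origin of \<open>m_omega\<close>. The same count, as an upper bound for finite times, shows
  that the standard actions extend.\<close>

definition germ where
  "germ S H p C \<phi> \<longleftrightarrow> (\<exists>d F G. H d F \<and> H d G \<and> G p \<noteq> (0::complex) \<and>
     (\<forall>q\<in>S. G q \<noteq> 0 \<longrightarrow> C q \<and> \<phi> q = F q / G q))"
  for S :: "'a set" and H :: "nat \<Rightarrow> ('a \<Rightarrow> complex) \<Rightarrow> bool"

definition qopen where
  "qopen S H U \<longleftrightarrow> U \<subseteq> S \<and> (\<forall>p\<in>U. \<exists>d G. H d G \<and> G p \<noteq> (0::complex) \<and> (\<forall>q\<in>S. G q \<noteq> 0 \<longrightarrow> q \<in> U))"
  for S :: "'a set" and H :: "nat \<Rightarrow> ('a \<Rightarrow> complex) \<Rightarrow> bool"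

definition qreg where
  "qreg S H U f \<longleftrightarrow> U \<subseteq> S \<and> (\<forall>p\<in>U. germ S H p (\<lambda>q. q \<in> U) f)"

text \<open>\<open>H d\<close> plays the part of the forms of degree \<open>d\<close>. A form need
  not be a function of the point, only quotients of equal degree are; one value per point, taken at
  some chosen representative, is enough for that. Open sets and regular functions are handled
  through such presentations from here on.\<close>

definition presents :: "'a fspace \<Rightarrow> 'a set \<Rightarrow> (nat \<Rightarrow> ('a \<Rightarrow> complex) \<Rightarrow> bool) \<Rightarrow> bool" where
  "presents X S H \<longleftrightarrow> (\<forall>U. openin (zar X) U \<longleftrightarrow> qopen S H U) \<and>
     (\<forall>U f. f \<in> regf X U \<longleftrightarrow> qreg S H U f)"

definition graded :: "(nat \<Rightarrow> ('a \<Rightarrow> complex) \<Rightarrow> bool) \<Rightarrow> bool" where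
  "graded H \<longleftrightarrow> (\<forall>c. H 0 (\<lambda>_. c)) \<and>
     (\<forall>d f g. H d f \<longrightarrow> H d g \<longrightarrow> H d (\<lambda>p. f p + g p)) \<and>
     (\<forall>d e f g. H d f \<longrightarrow> H e g \<longrightarrow> H (d + e) (\<lambda>p. f p * g p))"

lemma gradedD:
  assumes "graded H"
  shows "H 0 (\<lambda>_. c)" "H d f \<Longrightarrow> H d g \<Longrightarrow> H d (\<lambda>p. f p + g p)"
    "H d f \<Longrightarrow> H e g \<Longrightarrow> H (d + e) (\<lambda>p. f p * g p)"
  using assms unfolding graded_def by blast+

lemma graded_diff:
  assumes "graded H" "H d f" "H d g" shows "H d (\<lambda>p. f p - g p)"
proof -
  have "H (0 + d) (\<lambda>p. -1 * g p)"
    using assms unfolding graded_def by blast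
  then have "H d (\<lambda>p. - g p)" by simp
  then have "H d (\<lambda>p. f p + - g p)" using assms unfolding graded_def by blast
  then show ?thesis by simp
qed

lemma germI:
  "H d F \<Longrightarrow> H d G \<Longrightarrow> G p \<noteq> 0 \<Longrightarrow> (\<And>q. q \<in> S \<Longrightarrow> G q \<noteq> 0 \<Longrightarrow> C q \<and> \<phi> q = F q / G q) \<Longrightarrow> germ S H p C \<phi>"
  unfolding germ_def by blast

lemma germE:
  assumes "germ S H p C \<phi>"
  obtains d F G where "H d F" "H d G" "G p \<noteq> 0" "\<forall>q\<in>S. G q \<noteq> 0 \<longrightarrow> C q \<and> \<phi> q = F q / G q"
  using assms unfolding germ_def by (elim exE conjE)

lemma qopenE:
  assumes "qopen S H U" "p \<in> U"
  obtains d G where "H d G" "G p \<noteq> 0" "\<forall>q\<in>S. G q \<noteq> 0 \<longrightarrow> q \<in> U"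
  using bspec[OF conjunct2[OF assms(1)[unfolded qopen_def]] assms(2)] by (elim exE conjE)

lemma qreg_qopen: "qreg S H U f \<Longrightarrow> qopen S H U"
  unfolding qreg_def qopen_def by (metis germE)

lemma germ_const: "graded H \<Longrightarrow> germ S H p (\<lambda>_. True) (\<lambda>_. c)"
  by (rule germI[of H 0 "\<lambda>_. c" "\<lambda>_. 1"]) (auto simp: graded_def)

lemma germ_add:
  assumes H: "graded H" and "germ S H p C f" "germ S H p C' g"
  shows "germ S H p (\<lambda>q. C q \<and> C' q) (\<lambda>q. f q + g q)"
proof -
  obtain d F G where 1: "H d F" "H d G" "G p \<noteq> 0" "\<forall>q\<in>S. G q \<noteq> 0 \<longrightarrow> C q \<and> f q = F q / G q"
    using germE[OF assms(2)] .
  obtain d' F' G' where 2: "H d' F'" "H d' G'" "G' p \<noteq> 0" "\<forall>q\<in>S. G' q \<noteq> 0 \<longrightarrow> C' q \<and> g q = F' q / G' q"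
    using germE[OF assms(3)] .
  have "H (d + d') (\<lambda>q. F q * G' q + G q * F' q)" "H (d + d') (\<lambda>q. G q * G' q)"
    by (intro gradedD(2,3)[OF H] 1 2)+
  then show ?thesis by (rule germI) (use 1 2 in \<open>auto simp: add_frac_eq mult.commute\<close>)
qed

lemma germ_mult:
  assumes H: "graded H" and "germ S H p C f" "germ S H p C' g"
  shows "germ S H p (\<lambda>q. C q \<and> C' q) (\<lambda>q. f q * g q)"
proof -
  obtain d F G where 1: "H d F" "H d G" "G p \<noteq> 0" "\<forall>q\<in>S. G q \<noteq> 0 \<longrightarrow> C q \<and> f q = F q / G q"
    using germE[OF assms(2)] .
  obtain d' F' G' where 2: "H d' F'" "H d' G'" "G' p \<noteq> 0" "\<forall>q\<in>S. G' q \<noteq> 0 \<longrightarrow> C' q \<and> g q = F' q / G' q"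
    using germE[OF assms(3)] .
  have "H (d + d') (\<lambda>q. F q * F' q)" "H (d + d') (\<lambda>q. G q * G' q)"
    by (intro gradedD(3)[OF H] 1 2)+
  then show ?thesis by (rule germI) (use 1 2 in \<open>auto simp: add_frac_eq mult.commute\<close>)
qed

lemma germ_divide:
  assumes H: "graded H" and p: "p \<in> S" and "germ S H p C f" "germ S H p C' g" "g p \<noteq> 0"
  shows "germ S H p (\<lambda>q. C q \<and> C' q \<and> g q \<noteq> 0) (\<lambda>q. f q / g q)"
proof -
  obtain d F G where 1: "H d F" "H d G" "G p \<noteq> 0" "\<forall>q\<in>S. G q \<noteq> 0 \<longrightarrow> C q \<and> f q = F q / G q"
    using germE[OF assms(3)] .
  obtain d' F' G' where 2: "H d' F'" "H d' G'" "G' p \<noteq> 0" "\<forall>q\<in>S. G' q \<noteq> 0 \<longrightarrow> C' q \<and> g q = F' q / G' q"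
    using germE[OF assms(4)] .
  have "F' p \<noteq> 0" using 2 assms p by auto
  moreover have "H (d + d' + d') (\<lambda>q. F q * G' q * G' q)" "H (d + d' + d') (\<lambda>q. G q * F' q * G' q)"
    by (intro gradedD(3)[OF H] 1 2)+
  ultimately show ?thesis
    by (intro germI[of H "d + d' + d'" "\<lambda>q. F q * G' q * G' q" "\<lambda>q. G q * F' q * G' q"]) (use 1 2 in auto)
qed

lemma germ_weaken:
  "germ S H p C f \<Longrightarrow> (\<And>q. q \<in> S \<Longrightarrow> C q \<Longrightarrow> C' q \<and> f' q = f q) \<Longrightarrow> germ S H p C' f'"
  unfolding germ_def by metis

lemma germ_sum:
  assumes "graded H" "\<And>i::nat. i < M \<Longrightarrow> germ S H p C (f i)"
  shows "germ S H p (\<lambda>q. \<forall>i<M. C q) (\<lambda>q. \<Sum>i<M. f i q)"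
  using assms(2)
proof (induction M)
  case 0
  show ?case using germ_const[OF assms(1), of S p 0] by simp
next
  case (Suc M)
  have "germ S H p (\<lambda>q. (\<forall>i<M. C q) \<and> C q) (\<lambda>q. (\<Sum>i<M. f i q) + f M q)"
    by (rule germ_add[OF assms(1)]) (use Suc in auto)
  then show ?case by (rule germ_weaken) auto
qed

section \<open>Topology and regular functions of a generated space\<close>

lemma openin_fspace_of:
  assumes "\<And>D D' p. D \<in> fst ` P \<Longrightarrow> D' \<in> fst ` P \<Longrightarrow> p \<in> D \<Longrightarrow> p \<in> D' \<Longrightarrow>
      \<exists>E\<in>fst ` P. p \<in> E \<and> E \<subseteq> D \<inter> D'"
  shows "openin (zar (fspace_of P)) U \<longleftrightarrow> (\<forall>p\<in>U. \<exists>D\<in>fst ` P. p \<in> D \<and> D \<subseteq> U)" (is "?L \<longleftrightarrow> ?R U")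
proof
  assume ?L
  then have "generate_topology_on (fst ` P) U"
    by (simp add: fspace_of_def Let_def openin_topology_generated_by_iff)
  then show "?R U"
  proof induction
    case (Int a b)
    show ?case
    proof
      fix p assume "p \<in> a \<inter> b"
      then obtain D D' where "D \<in> fst ` P" "D' \<in> fst ` P" "p \<in> D" "p \<in> D'" "D \<subseteq> a" "D' \<subseteq> b"
        using Int.IH by (metis IntD1 IntD2)
      moreover from this obtain E where "E \<in> fst ` P" "p \<in> E" "E \<subseteq> D \<inter> D'" using assms[of D D' p] by auto
      ultimately show "\<exists>D\<in>fst ` P. p \<in> D \<and> D \<subseteq> a \<inter> b" by (intro bexI[of _ E]) auto
    qed
  next
    case (UN K)
    show ?case
    proof
      fix p assume "p \<in> \<Union>K"
      then obtain k where "k \<in> K" "p \<in> k" by blast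
      then show "\<exists>D\<in>fst ` P. p \<in> D \<and> D \<subseteq> \<Union>K" using UN.IH[of k] by (meson Union_upper order_trans)
    qed
  next
    case (Basis s)
    then show ?case by (intro ballI bexI[of _ s]) auto
  qed simp
next
  assume R: "?R U"
  have "generate_topology_on (fst ` P) (\<Union>{D \<in> fst ` P. D \<subseteq> U})"
    by (rule generate_topology_on.UN) (auto intro: generate_topology_on.Basis)
  moreover have "\<Union>{D \<in> fst ` P. D \<subseteq> U} = U" using R by blast
  ultimately show ?L by (simp add: fspace_of_def Let_def openin_topology_generated_by_iff)
qed

lemma regf_fspace_of:
  "f \<in> regf (fspace_of P) U \<longleftrightarrow> openin (zar (fspace_of P)) U \<and>
     (\<forall>p\<in>U. \<exists>D g. (D, g) \<in> P \<and> p \<in> D \<and> D \<subseteq> U \<and> (\<forall>q\<in>D. f q = g q))"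
  unfolding fspace_of_def Let_def by (simp add: Bex_def case_prod_beta split_paired_Ex)

lemma presents_openD: "presents X S H \<Longrightarrow> openin (zar X) U \<Longrightarrow> qopen S H U"
  and presents_openI: "presents X S H \<Longrightarrow> qopen S H U \<Longrightarrow> openin (zar X) U"
  and presents_regD: "presents X S H \<Longrightarrow> f \<in> regf X U \<Longrightarrow> qreg S H U f"
  and presents_regI: "presents X S H \<Longrightarrow> qreg S H U f \<Longrightarrow> f \<in> regf X U"
  unfolding presents_def by simp_all

lemma qopen_sub: "qopen S H U \<Longrightarrow> U \<subseteq> S"
  and qreg_germ: "qreg S H U f \<Longrightarrow> p \<in> U \<Longrightarrow> germ S H p (\<lambda>q. q \<in> U) f"
  and qregI: "U \<subseteq> S \<Longrightarrow> (\<And>p. p \<in> U \<Longrightarrow> germ S H p (\<lambda>q. q \<in> U) f) \<Longrightarrow> qreg S H U f"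
  unfolding qopen_def qreg_def by simp_all

lemma qopen_basic: "H d G \<Longrightarrow> qopen S H {q \<in> S. G q \<noteq> 0}"
  unfolding qopen_def by auto

lemma qreg_basic: "H d F \<Longrightarrow> H d G \<Longrightarrow> qreg S H {q \<in> S. G q \<noteq> 0} (\<lambda>q. F q / G q)"
  by (rule qregI) (auto intro: germI)

text \<open>Two conditions on a generating family: its members are locally quotients of forms, and
  every quotient of forms is refined around each point by a member. Subspaces and products have very
  different families, and both are covered by this criterion.\<close>

lemma presentsI:
  assumes H: "graded H"
    and sub: "\<And>D g p. (D, g) \<in> P \<Longrightarrow> p \<in> D \<Longrightarrow> D \<subseteq> S \<and> germ S H p (\<lambda>q. q \<in> D) g"
    and sup: "\<And>d F G p. H d F \<Longrightarrow> H d G \<Longrightarrow> p \<in> S \<Longrightarrow> G p \<noteq> 0 \<Longrightarrow>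
      \<exists>D g. (D, g) \<in> P \<and> p \<in> D \<and> (\<forall>q\<in>D. q \<in> S \<and> G q \<noteq> 0 \<and> g q = F q / G q)"
  shows "presents (fspace_of P) S H"
proof -
  have base: "\<exists>E\<in>fst ` P. p \<in> E \<and> E \<subseteq> U" if U: "qopen S H U" "p \<in> U" for U p
  proof -
    obtain d G where G: "H d G" "G p \<noteq> 0" "\<forall>q\<in>S. G q \<noteq> 0 \<longrightarrow> q \<in> U"
      using qopenE[OF U] .
    have "p \<in> S" using that unfolding qopen_def by blast
    then obtain D g where "(D, g) \<in> P" "p \<in> D" "\<forall>q\<in>D. q \<in> S \<and> G q \<noteq> 0"
      using sup[OF G(1,1) _ G(2)] by blast
    then show ?thesis using G by (intro bexI[of _ D]) force+
  qed
  have qo: "qopen S H D" if DP: "D \<in> fst ` P" for D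
    unfolding qopen_def
  proof (intro conjI ballI subsetI)
    fix p assume p: "p \<in> D"
    obtain g where g: "(D, g) \<in> P" using DP by force
    note s = sub[OF g p]
    then show "p \<in> S" using p by blast
    obtain d F G where "H d F" "H d G" "G p \<noteq> 0" "\<forall>q\<in>S. G q \<noteq> 0 \<longrightarrow> q \<in> D \<and> g q = F q / G q"
      using germE[OF conjunct2[OF s]] .
    then show "\<exists>d G. H d G \<and> G p \<noteq> 0 \<and> (\<forall>q\<in>S. G q \<noteq> 0 \<longrightarrow> q \<in> D)" by metis
  qed
  have qi: "qopen S H (D \<inter> D')" if D: "qopen S H D" "qopen S H D'" for D D'
    unfolding qopen_def
  proof (intro conjI ballI)
    show "D \<inter> D' \<subseteq> S" using that unfolding qopen_def by blast
    fix p assume "p \<in> D \<inter> D'"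
    then obtain d G d' G' where "H d G" "G p \<noteq> 0" "\<forall>q\<in>S. G q \<noteq> 0 \<longrightarrow> q \<in> D"
      "H d' G'" "G' p \<noteq> 0" "\<forall>q\<in>S. G' q \<noteq> 0 \<longrightarrow> q \<in> D'"
      using qopenE[OF D(1)] qopenE[OF D(2)] by (metis IntD1 IntD2)
    then show "\<exists>d G. H d G \<and> G p \<noteq> 0 \<and> (\<forall>q\<in>S. G q \<noteq> 0 \<longrightarrow> q \<in> D \<inter> D')"
      using gradedD(3)[OF H, of d G d' G'] by (intro exI[of _ "d + d'"] exI[of _ "\<lambda>q. G q * G' q"]) auto
  qed
  have op: "openin (zar (fspace_of P)) U \<longleftrightarrow> (\<forall>p\<in>U. \<exists>D\<in>fst ` P. p \<in> D \<and> D \<subseteq> U)" for U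
  proof (rule openin_fspace_of)
    fix D D' p assume *: "D \<in> fst ` P" "D' \<in> fst ` P" "p \<in> D" "p \<in> D'"
    show "\<exists>E\<in>fst ` P. p \<in> E \<and> E \<subseteq> D \<inter> D'"
      by (rule base[OF qi[OF qo[OF *(1)] qo[OF *(2)]]]) (use * in simp)
  qed
  have oq: "openin (zar (fspace_of P)) U \<longleftrightarrow> qopen S H U" for U
  proof
    assume "openin (zar (fspace_of P)) U"
    then have *: "\<forall>p\<in>U. \<exists>D\<in>fst ` P. p \<in> D \<and> D \<subseteq> U" by (simp only: op)
    show "qopen S H U" unfolding qopen_def
    proof (intro conjI ballI subsetI)
      fix p assume "p \<in> U"
      then obtain D where D: "D \<in> fst ` P" "p \<in> D" "D \<subseteq> U" using * by blast
      note q = qo[OF D(1)]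
      then show "p \<in> S" using D unfolding qopen_def by blast
      show "\<exists>d G. H d G \<and> G p \<noteq> 0 \<and> (\<forall>q\<in>S. G q \<noteq> 0 \<longrightarrow> q \<in> U)"
        using qopenE[OF q D(2)] D(3) by (metis subsetD)
    qed
  next
    assume q: "qopen S H U"
    show "openin (zar (fspace_of P)) U" unfolding op using base[OF q] by simp
  qed
  have "f \<in> regf (fspace_of P) U \<longleftrightarrow> qreg S H U f" for U f
  proof
    assume L: "f \<in> regf (fspace_of P) U"
    show "qreg S H U f" unfolding qreg_def
    proof (intro conjI ballI)
      show "U \<subseteq> S" using L oq unfolding regf_fspace_of qopen_def by blast
      fix p assume "p \<in> U"
      then obtain D g where D: "(D, g) \<in> P" "p \<in> D" "D \<subseteq> U" "\<forall>q\<in>D. f q = g q"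
        using L unfolding regf_fspace_of by blast
      show "germ S H p (\<lambda>q. q \<in> U) f"
        by (rule germ_weaken[OF conjunct2[OF sub[OF D(1,2)]]]) (use D in auto)
    qed
  next
    assume R: "qreg S H U f"
    then have "qopen S H U" by (rule qreg_qopen)
    moreover have "\<exists>D g. (D, g) \<in> P \<and> p \<in> D \<and> D \<subseteq> U \<and> (\<forall>q\<in>D. f q = g q)" if p: "p \<in> U" for p
    proof -
      obtain d F G where 1: "H d F" "H d G" "G p \<noteq> 0" "\<forall>q\<in>S. G q \<noteq> 0 \<longrightarrow> q \<in> U \<and> f q = F q / G q"
        using germE[OF bspec[OF conjunct2[OF R[unfolded qreg_def]] p]] .
      have "p \<in> S" using R p unfolding qreg_def by blast
      then obtain D g where "(D, g) \<in> P" "p \<in> D" "\<forall>q\<in>D. q \<in> S \<and> G q \<noteq> 0 \<and> g q = F q / G q"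
        using sup[OF 1(1,2) _ 1(3)] by blast
      then show ?thesis using 1(4) by (intro exI[of _ D] exI[of _ g]) auto
    qed
    ultimately show "f \<in> regf (fspace_of P) U" unfolding regf_fspace_of oq by blast
  qed
  then show ?thesis using oq unfolding presents_def by blast
qed

lemma presents_basic:
  assumes "graded H"
  shows "presents (fspace_of {(D, g) | D g. \<exists>d F G. H d F \<and> H d G \<and> D = {p \<in> S. G p \<noteq> 0} \<and>
     g = (\<lambda>p. F p / G p)}) S H"
proof (rule presentsI[OF assms])
  fix d F G p assume "H d F" "H d G" "p \<in> S" "G p \<noteq> 0"
  then show "\<exists>D g. (D, g) \<in> {(D, g) | D g. \<exists>d F G. H d F \<and> H d G \<and> D = {p \<in> S. G p \<noteq> 0} \<and>
     g = (\<lambda>p. F p / G p)} \<and> p \<in> D \<and> (\<forall>q\<in>D. q \<in> S \<and> G q \<noteq> 0 \<and> g q = F q / G q)"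
    by (intro exI[of _ "{p \<in> S. G p \<noteq> 0}"] exI[of _ "\<lambda>p. F p / G p"]) blast
qed (auto intro: germI)

lemma presents_subspace:
  assumes H: "graded H" and X: "presents X W H" and S: "S \<subseteq> W"
  shows "presents (subspace_of X S) S H"
  unfolding subspace_of_def
proof (rule presentsI[OF H])
  fix D g p assume "(D, g) \<in> {(D \<inter> S, g) |D g. openin (zar X) D \<and> g \<in> regf X D}" "p \<in> D"
  then obtain D' where D: "D = D' \<inter> S" "g \<in> regf X D'" by blast
  have "germ W H p (\<lambda>q. q \<in> D') g" by (rule qreg_germ[OF presents_regD[OF X D(2)]]) (use \<open>p \<in> D\<close> D in simp)
  then have "germ S H p (\<lambda>q. q \<in> D) g" by (elim germE, intro germI) (use S D in auto)
  then show "D \<subseteq> S \<and> germ S H p (\<lambda>q. q \<in> D) g" using D by blast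
next
  fix d F G p assume *: "H d F" "H d G" "p \<in> S" "G p \<noteq> 0"
  have q: "qreg W H {q \<in> W. G q \<noteq> 0} (\<lambda>q. F q / G q)"
    by (rule qreg_basic[of H d F G, OF *(1,2)])
  then have "qopen W H {q \<in> W. G q \<noteq> 0}" by (rule qreg_qopen)
  then show "\<exists>D g. (D, g) \<in> {(D \<inter> S, g) |D g. openin (zar X) D \<and> g \<in> regf X D} \<and> p \<in> D \<and>
      (\<forall>q\<in>D. q \<in> S \<and> G q \<noteq> 0 \<and> g q = F q / G q)"
    using * S presents_openI[OF X, of "{q \<in> W. G q \<noteq> 0}"] presents_regI[OF X q]
    by (intro exI[of _ "{q \<in> W. G q \<noteq> 0} \<inter> S"] exI[of _ "\<lambda>q. F q / G q"]) auto
qed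

section \<open>Products\<close>

inductive bigraded :: "(('a \<Rightarrow> complex) \<Rightarrow> bool) \<Rightarrow> (nat \<Rightarrow> ('b \<Rightarrow> complex) \<Rightarrow> bool) \<Rightarrow>
    nat \<Rightarrow> ('a \<times> 'b \<Rightarrow> complex) \<Rightarrow> bool" for A H d where
  bigraded_zero: "bigraded A H d (\<lambda>_. 0)"
| bigraded_step: "bigraded A H d f \<Longrightarrow> A a \<Longrightarrow> H d b \<Longrightarrow> bigraded A H d (\<lambda>z. a (fst z) * b (snd z) + f z)"

lemma bigraded_add:
  assumes "bigraded A H d f" "bigraded A H d g" shows "bigraded A H d (\<lambda>z. f z + g z)"
  using assms(1)
proof induction
  case bigraded_zero
  then show ?case using assms(2) by simp
next
  case (bigraded_step f a b)
  then show ?case using bigraded.bigraded_step[OF bigraded_step.IH bigraded_step.hyps(2,3)] by (simp add: add.assoc)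
qed

lemma bigraded_prod: "A a \<Longrightarrow> H d b \<Longrightarrow> bigraded A H d (\<lambda>z. a (fst z) * b (snd z))"
  using bigraded_step[OF bigraded_zero, of A a H d b] by simp

lemma bigraded_mult:
  assumes A: "graded (\<lambda>_::nat. A)" and H: "graded H"
    and f: "bigraded A H d f" and g: "bigraded A H e g"
  shows "bigraded A H (d + e) (\<lambda>z. f z * g z)"
proof -
  have mA: "A f \<Longrightarrow> A g \<Longrightarrow> A (\<lambda>p. f p * g p)" for f g using A unfolding graded_def by blast
  have mH: "H d f \<Longrightarrow> H e g \<Longrightarrow> H (d + e) (\<lambda>p. f p * g p)" for d e f g using H unfolding graded_def by blast
  have 1: "bigraded A H (d + e) (\<lambda>z. (a (fst z) * b (snd z)) * g z)" if "A a" "H d b" for a b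
    using g
  proof induction
    case bigraded_zero
    then show ?case by (simp add: bigraded.bigraded_zero)
  next
    case (bigraded_step f a' b')
    have "bigraded A H (d + e) (\<lambda>z. (a (fst z) * a' (fst z)) * (b (snd z) * b' (snd z)) +
        (a (fst z) * b (snd z)) * f z)"
      using bigraded.bigraded_step[OF bigraded_step.IH, of "\<lambda>z. a z * a' z" "\<lambda>z. b z * b' z"]
        mA[OF that(1) bigraded_step.hyps(2)] mH[OF that(2) bigraded_step.hyps(3)] by simp
    then show ?case by (simp add: algebra_simps)
  qed
  show ?thesis using f
  proof induction
    case bigraded_zero
    then show ?case by (simp add: bigraded.bigraded_zero)
  next
    case (bigraded_step f a b)
    then show ?case using bigraded_add[OF 1[OF bigraded_step.hyps(2,3)] bigraded_step.IH]
      by (simp add: algebra_simps)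
  qed
qed

lemma graded_bigraded:
  assumes A: "graded (\<lambda>_::nat. A)" and H: "graded H"
  shows "graded (bigraded A H)"
  unfolding graded_def
proof (intro conjI allI impI)
  fix c
  have "bigraded A H 0 (\<lambda>z. (\<lambda>_. c) (fst z) * (\<lambda>_. 1) (snd z))"
    by (rule bigraded_prod) (use A H in \<open>auto simp: graded_def\<close>)
  then show "bigraded A H 0 (\<lambda>_. c)" by simp
next
  fix d f g assume "bigraded A H d f" "bigraded A H d g"
  then show "bigraded A H d (\<lambda>p. f p + g p)" by (rule bigraded_add)
next
  fix d e f g assume "bigraded A H d f" "bigraded A H e g"
  then show "bigraded A H (d + e) (\<lambda>p. f p * g p)" by (rule bigraded_mult[OF A H])
qed

text \<open>Supplies the denominator in \<open>presents_prod\<close>: a form of degree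
  \<open>d\<close> on the second factor alone that does not vanish at the given point.\<close>

lemma bigraded_nonzero:
  assumes "bigraded A H d f" "f z \<noteq> 0" shows "\<exists>b. H d b \<and> b (snd z) \<noteq> 0"
  using assms
proof induction
  case (bigraded_step f a b)
  then show ?case by (cases "b (snd z) = 0") auto
qed simp

lemma bigraded_sum_form:
  assumes "bigraded A H d f"
  shows "\<exists>(M::nat) a b. (\<forall>i<M. A (a i) \<and> H d (b i)) \<and> f = (\<lambda>z. \<Sum>i<M. a i (fst z) * b i (snd z))"
  using assms
proof induction
  case bigraded_zero
  then show ?case by (intro exI[of _ 0]) simp
next
  case (bigraded_step f a' b')
  obtain M :: nat and a b where *: "\<forall>i<M. A (a i) \<and> H d (b i)" "f = (\<lambda>z. \<Sum>i<M. a i (fst z) * b i (snd z))"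
    using bigraded_step.IH by (elim exE conjE)
  show ?case
    by (rule exI[of _ "Suc M"], rule exI[of _ "a(M := a')"], rule exI[of _ "b(M := b')"])
      (use * bigraded_step in \<open>auto simp: less_Suc_eq\<close>)
qed

text \<open>The degree lives on the second factor, since the first one is presented by functions
  without degree. Quotients of sums of products of regular functions become quotients of bigraded
  forms after clearing denominators; conversely, numerator and denominator are divided by one form
  \<open>c\<close> of degree \<open>d\<close> on the second factor, which turns all second factors
  into regular functions.\<close>

lemma presents_prod:
  assumes A: "graded (\<lambda>_::nat. A)" and H: "graded H"
    and X: "presents X R (\<lambda>_. A)" and Y: "presents Y S H"
  shows "presents (prod_fspace X Y) (R \<times> S) (bigraded A H)"
proof -
  note B = graded_bigraded[OF A H]
  define Q where "Q D g \<longleftrightarrow> (\<exists>U V.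
       openin (zar X) U \<and> openin (zar Y) V \<and>
       (\<exists>(M :: nat) (N :: nat) a b f h.
          (\<forall>i<M. a i \<in> regf X U \<and> b i \<in> regf Y V) \<and>
          (\<forall>i<N. f i \<in> regf X U \<and> h i \<in> regf Y V) \<and>
          D = {(p, q). p \<in> U \<and> q \<in> V \<and> (\<Sum>i<N. f i p * h i q) \<noteq> 0} \<and>
          g = (\<lambda>(p, q). (\<Sum>i<M. a i p * b i q) / (\<Sum>i<N. f i p * h i q))))" for D g
  let ?P = "{(D, g) | D g. Q D g}"
  {
    fix D g z assume "(D, g) \<in> ?P" "z \<in> D"
    then have Q: "Q D g" by simp
    have "D \<subseteq> R \<times> S \<and> germ (R \<times> S) (bigraded A H) z (\<lambda>q. q \<in> D) g"
      using Q unfolding Q_def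
    proof (elim exE conjE)
    fix U V and M N :: nat and a b f h
    assume UV: "openin (zar X) U" "openin (zar Y) V" and
      ab: "\<forall>i<M. a i \<in> regf X U \<and> b i \<in> regf Y V" and
      fh: "\<forall>i<N. f i \<in> regf X U \<and> h i \<in> regf Y V" and
      D: "D = {(p, q). p \<in> U \<and> q \<in> V \<and> (\<Sum>i<N. f i p * h i q) \<noteq> 0}" and
      g: "g = (\<lambda>(p, q). (\<Sum>i<M. a i p * b i q) / (\<Sum>i<N. f i p * h i q))"
    have sub: "U \<subseteq> R" "V \<subseteq> S"
      using qopen_sub[OF presents_openD[OF X UV(1)]] qopen_sub[OF presents_openD[OF Y UV(2)]] by simp_all
    have zU: "fst z \<in> U" "snd z \<in> V" using \<open>z \<in> D\<close> D by auto
    have l1: "germ (R \<times> S) (bigraded A H) z (\<lambda>q. fst q \<in> U) (\<lambda>q. a (fst q))" if r: "a \<in> regf X U" for a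
    proof -
      have g: "germ R (\<lambda>_. A) (fst z) (\<lambda>q. q \<in> U) a" by (rule qreg_germ[OF presents_regD[OF X r] zU(1)])
      obtain F G where 1: "A F" "A G" "G (fst z) \<noteq> 0" "\<forall>q\<in>R. G q \<noteq> 0 \<longrightarrow> q \<in> U \<and> a q = F q / G q"
        by (rule germE[OF g]) (rule that)
      have "bigraded A H 0 (\<lambda>z. F (fst z) * (\<lambda>_. 1) (snd z))" "bigraded A H 0 (\<lambda>z. G (fst z) * (\<lambda>_. 1) (snd z))"
        by (intro bigraded_prod 1 gradedD(1)[OF H])+
      then show ?thesis by (rule germI) (use 1 in auto)
    qed
    have l2: "germ (R \<times> S) (bigraded A H) z (\<lambda>q. snd q \<in> V) (\<lambda>q. b (snd q))" if r: "b \<in> regf Y V" for b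
    proof -
      have g: "germ S H (snd z) (\<lambda>q. q \<in> V) b" by (rule qreg_germ[OF presents_regD[OF Y r] zU(2)])
      obtain d F G where 1: "H d F" "H d G" "G (snd z) \<noteq> 0" "\<forall>q\<in>S. G q \<noteq> 0 \<longrightarrow> q \<in> V \<and> b q = F q / G q"
        using germE[OF g] .
      have "bigraded A H d (\<lambda>z. (\<lambda>_. 1) (fst z) * F (snd z))" "bigraded A H d (\<lambda>z. (\<lambda>_. 1) (fst z) * G (snd z))"
        by (intro bigraded_prod 1 gradedD(1)[OF A])+
      then show ?thesis by (rule germI) (use 1 in auto)
    qed
    have l3: "germ (R \<times> S) (bigraded A H) z (\<lambda>q. \<forall>i<M. fst q \<in> U \<and> snd q \<in> V) (\<lambda>q. \<Sum>i<M. a i (fst q) * b i (snd q))"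
      if "\<forall>i<M. a i \<in> regf X U \<and> b i \<in> regf Y V" for M :: nat and a b
      by (rule germ_sum[OF B], rule germ_mult[OF B]) (use that l1 l2 in blast)+
    have "(\<Sum>i<N. f i (fst z) * h i (snd z)) \<noteq> 0" using \<open>z \<in> D\<close> D by auto
    moreover from this have "N \<noteq> 0" by (intro notI) simp
    moreover have "z \<in> R \<times> S" using zU sub by (cases z) auto
    ultimately have "germ (R \<times> S) (bigraded A H) z (\<lambda>q. q \<in> D) g"
      by (intro germ_weaken[OF germ_divide[OF B _ l3[OF ab] l3[OF fh]]]) (auto simp: D g case_prod_beta)
    then show "D \<subseteq> R \<times> S \<and> germ (R \<times> S) (bigraded A H) z (\<lambda>q. q \<in> D) g" using sub D by auto
    qed
  }
  note 1 = this
  show ?thesis unfolding prod_fspace_def Q_def[symmetric]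
  proof (rule presentsI[OF B 1])
  fix d F G z assume F: "bigraded A H d F" and G: "bigraded A H d G" and z: "z \<in> R \<times> S" "G z \<noteq> 0"
  obtain c where c: "H d c" "c (snd z) \<noteq> 0" using bigraded_nonzero[OF G z(2)] by blast
  obtain M a b where F': "\<forall>i<M. A (a i) \<and> H d (b i)" "F = (\<lambda>z. \<Sum>i<(M::nat). a i (fst z) * b i (snd z))"
    using bigraded_sum_form[OF F] by blast
  obtain N f h where G': "\<forall>i<N. A (f i) \<and> H d (h i)" "G = (\<lambda>z. \<Sum>i<(N::nat). f i (fst z) * h i (snd z))"
    using bigraded_sum_form[OF G] by blast
  let ?V = "{q \<in> S. c q \<noteq> 0}"
  have rV: "(\<lambda>q. b q / c q) \<in> regf Y ?V" if "H d b" for b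
    by (rule presents_regI[OF Y qreg_basic[of H d b c, OF that c(1)]])
  have rR: "a \<in> regf X R" if "A a" for a
  proof -
    have "germ R (\<lambda>_. A) p (\<lambda>q. q \<in> R) a" for p
      by (rule germI[of _ 0 a "\<lambda>_. 1"]) (use that gradedD(1)[OF A] in auto)
    then show ?thesis using presents_regI[OF X qregI] by blast
  qed
  have "openin (zar X) R" "openin (zar Y) ?V"
    using presents_openI[OF X qopen_basic[of "\<lambda>_. A" 0 "\<lambda>_. 1"]] gradedD(1)[OF A, of 1]
      presents_openI[OF Y qopen_basic[of H d c, OF c(1)]] by simp_all
  moreover have "\<forall>i<M. a i \<in> regf X R \<and> (\<lambda>q. b i q / c q) \<in> regf Y ?V"
    "\<forall>i<N. f i \<in> regf X R \<and> (\<lambda>q. h i q / c q) \<in> regf Y ?V" using F' G' rV rR by blast+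
  ultimately have "Q {(p, q). p \<in> R \<and> q \<in> ?V \<and> (\<Sum>i<N. f i p * (h i q / c q)) \<noteq> 0}
      (\<lambda>(p, q). (\<Sum>i<M. a i p * (b i q / c q)) / (\<Sum>i<N. f i p * (h i q / c q)))"
    unfolding Q_def
    apply -
    apply (rule exI[of _ R], rule exI[of _ ?V], intro conjI; assumption?)
    apply (rule exI[of _ M], rule exI[of _ N], rule exI[of _ a], rule exI[of _ "\<lambda>i q. b i q / c q"],
      rule exI[of _ f], rule exI[of _ "\<lambda>i q. h i q / c q"])
    by (intro conjI; assumption?) (rule refl)+
  then show "\<exists>D g. (D, g) \<in> ?P \<and> z \<in> D \<and> (\<forall>q\<in>D. q \<in> R \<times> S \<and> G q \<noteq> 0 \<and> g q = F q / G q)"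
    apply (intro exI conjI)
      apply (rule CollectI, intro exI conjI, rule refl, assumption)
    using z c by (auto simp: F' G' simp flip: sum_divide_distrib)
  qed
qed

section \<open>Points and morphisms of presented spaces\<close>

lemma pts_presents: "presents X S H \<Longrightarrow> graded H \<Longrightarrow> pts X = S"
proof -
  assume X: "presents X S H" and H: "graded H"
  have "openin (zar X) S" using presents_openI[OF X qopen_basic[of H 0 "\<lambda>_. 1"]] gradedD(1)[OF H, of 1] by simp
  moreover have "U \<subseteq> S" if "openin (zar X) U" for U by (rule qopen_sub[OF presents_openD[OF X that]])
  ultimately show ?thesis using openin_subset by (metis openin_topspace subset_antisym)
qed

text \<open>Homogeneous coordinates of an image point are known only up to the scalar
  \<open>c p\<close>. The factor \<open>c p ^ d\<close> is common to numerator and denominator of a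
  quotient of forms of degree \<open>d\<close> and cancels, so \<open>c\<close> may come from an
  arbitrary choice of representatives.\<close>

lemma morphismI:
  assumes X: "presents X S H" "graded H" and Y: "presents Y R K" "graded K"
    and im: "\<And>p. p \<in> S \<Longrightarrow> \<phi> p \<in> R" and c: "\<And>p. p \<in> S \<Longrightarrow> c p \<noteq> (0::complex)"
    and pull: "\<And>d G. K d G \<Longrightarrow> \<exists>G'. H d G' \<and> (\<forall>p\<in>S. G (\<phi> p) = c p ^ d * G' p)"
  shows "morphism X Y \<phi>"
proof -
  have pts: "pts X = S" "pts Y = R" using pts_presents X Y by blast+
  have 1: "germ S H p (\<lambda>q. C (\<phi> q)) (f \<circ> \<phi>)" if g: "germ R K (\<phi> p) C f" and "p \<in> S" for p C f
  proof -
    obtain d F G where *: "K d F" "K d G" "G (\<phi> p) \<noteq> 0" "\<forall>q\<in>R. G q \<noteq> 0 \<longrightarrow> C q \<and> f q = F q / G q"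
      using germE[OF g] .
    obtain F' G' where "H d F'" "\<forall>p\<in>S. F (\<phi> p) = c p ^ d * F' p" "H d G'" "\<forall>p\<in>S. G (\<phi> p) = c p ^ d * G' p"
      using pull[OF *(1)] pull[OF *(2)] by (elim exE conjE)
    then show ?thesis
    proof (intro germI[of H d F' G'])
      fix q assume q: "q \<in> S" "G' q \<noteq> 0"
      then have "G (\<phi> q) = c q ^ d * G' q" "F (\<phi> q) = c q ^ d * F' q" "c q \<noteq> 0"
        using \<open>\<forall>p\<in>S. F (\<phi> p) = c p ^ d * F' p\<close> \<open>\<forall>p\<in>S. G (\<phi> p) = c p ^ d * G' p\<close> c by auto
      then show "C (\<phi> q) \<and> (f \<circ> \<phi>) q = F' q / G' q" using *(4) im[OF q(1)] q(2) by simp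
    qed (use * \<open>p \<in> S\<close> c in auto)
  qed
  show ?thesis unfolding morphism_def
  proof (intro conjI allI impI)
    show "continuous_map (zar X) (zar Y) \<phi>"
      unfolding continuous_map_def pts
    proof (intro conjI allI impI)
      show "\<phi> \<in> S \<rightarrow> R" using im by blast
      fix U assume "openin (zar Y) U"
      then have U: "qopen R K U" by (rule presents_openD[OF Y(1)])
      have "qopen S H {x \<in> S. \<phi> x \<in> U}"
        unfolding qopen_def
      proof (intro conjI ballI)
        fix p assume "p \<in> {x \<in> S. \<phi> x \<in> U}"
        then have p: "p \<in> S" "\<phi> p \<in> U" by auto
        obtain d G where "K d G" "G (\<phi> p) \<noteq> 0" "\<forall>q\<in>R. G q \<noteq> 0 \<longrightarrow> q \<in> U"
          using qopenE[OF U p(2)] .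
        moreover obtain G' where "H d G'" "\<forall>p\<in>S. G (\<phi> p) = c p ^ d * G' p" using pull[OF calculation(1)] by (elim exE conjE)
        ultimately show "\<exists>d G. H d G \<and> G p \<noteq> 0 \<and> (\<forall>q\<in>S. G q \<noteq> 0 \<longrightarrow> q \<in> {x \<in> S. \<phi> x \<in> U})"
          using p im c by (intro exI[of _ d] exI[of _ G']) auto
      qed auto
      then show "openin (zar X) {x \<in> S. \<phi> x \<in> U}" by (rule presents_openI[OF X(1)])
    qed
    fix V f assume "openin (zar Y) V \<and> f \<in> regf Y V"
    then have f: "qreg R K V f" using presents_regD[OF Y(1)] by simp
    have "qreg S H {p \<in> S. \<phi> p \<in> V} (f \<circ> \<phi>)"
    proof (rule qregI)
      fix p assume p: "p \<in> {p \<in> S. \<phi> p \<in> V}"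
      show "germ S H p (\<lambda>q. q \<in> {p \<in> S. \<phi> p \<in> V}) (f \<circ> \<phi>)"
        by (rule germ_weaken[OF 1[OF qreg_germ[OF f]]]) (use p in auto)
    qed blast
    then show "f \<circ> \<phi> \<in> regf X {p \<in> pts X. \<phi> p \<in> V}" using presents_regI[OF X(1)] pts by simp
  qed
qed

lemma morphism_id: "morphism X X (\<lambda>x. x)" if X: "presents X S H" "graded H"
  by (rule morphismI[OF X X, of _ "\<lambda>_. 1"]) auto

lemma morphism_comp: "morphism X Y f \<Longrightarrow> morphism Y Z g \<Longrightarrow> morphism X Z (\<lambda>p. g (f p))"
  unfolding morphism_def
proof (intro conjI allI impI; (elim conjE)?)
  assume "continuous_map (zar X) (zar Y) f" "continuous_map (zar Y) (zar Z) g"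
  then show "continuous_map (zar X) (zar Z) (\<lambda>p. g (f p))" using continuous_map_compose by (force simp: o_def)
next
  fix V h assume *: "continuous_map (zar X) (zar Y) f" "continuous_map (zar Y) (zar Z) g"
    "\<forall>V h. openin (zar Y) V \<and> h \<in> regf Y V \<longrightarrow> h \<circ> f \<in> regf X {p \<in> pts X. f p \<in> V}"
    "\<forall>V f. openin (zar Z) V \<and> f \<in> regf Z V \<longrightarrow> f \<circ> g \<in> regf Y {p \<in> pts Y. g p \<in> V}"
    "openin (zar Z) V" "h \<in> regf Z V"
  have o: "openin (zar Y) {p \<in> pts Y. g p \<in> V}"
    by (rule openin_continuous_map_preimage[OF *(2,5)])
  have r: "h \<circ> g \<in> regf Y {p \<in> pts Y. g p \<in> V}"
    using *(4)[rule_format, OF conjI, OF *(5,6)] .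
  have "(h \<circ> g) \<circ> f \<in> regf X {p \<in> pts X. f p \<in> {p \<in> pts Y. g p \<in> V}}"
    using *(3)[rule_format, OF conjI, OF o r] .
  moreover have "{p \<in> pts X. f p \<in> {p \<in> pts Y. g p \<in> V}} = {p \<in> pts X. g (f p) \<in> V}"
    using *(1) by (auto simp: continuous_map_def Pi_iff)
  ultimately show "h \<circ> (\<lambda>p. g (f p)) \<in> regf X {p \<in> pts X. g (f p) \<in> V}" by (simp add: o_def)
qed

section \<open>Polynomial functions\<close>

definition monom_val :: "(nat \<Rightarrow>\<^sub>0 nat) \<Rightarrow> (nat \<Rightarrow> complex) \<Rightarrow> complex" where
  "monom_val m z = (\<Prod>i\<in>Poly_Mapping.keys m. z i ^ Poly_Mapping.lookup m i)"

text \<open>Weighted homogeneous polynomials as functions, so that substitution, scaling and the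
  comparison with the filtration become inductions on the terms; \<open>whom_iff\<close> is the link
  to \<open>is_whomog\<close>.\<close>

inductive whom :: "nat \<Rightarrow> (nat \<Rightarrow> nat) \<Rightarrow> nat \<Rightarrow> ((nat \<Rightarrow> complex) \<Rightarrow> complex) \<Rightarrow> bool" for N a d where
  whom_zero: "whom N a d (\<lambda>_. 0)"
| whom_step: "whom N a d f \<Longrightarrow> Poly_Mapping.keys m \<subseteq> {..N} \<Longrightarrow>
    (\<Sum>i\<in>Poly_Mapping.keys m. a i * Poly_Mapping.lookup m i) = d \<Longrightarrow>
    whom N a d (\<lambda>z. c * monom_val m z + f z)"

lemma monom_val_superset:
  "finite K \<Longrightarrow> Poly_Mapping.keys m \<subseteq> K \<Longrightarrow> monom_val m z = (\<Prod>i\<in>K. z i ^ Poly_Mapping.lookup m i)"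
  unfolding monom_val_def by (rule prod.mono_neutral_left) (auto simp: in_keys_iff)

lemma weight_superset:
  fixes a :: "nat \<Rightarrow> nat"
  shows "finite K \<Longrightarrow> Poly_Mapping.keys m \<subseteq> K \<Longrightarrow>
    (\<Sum>i\<in>Poly_Mapping.keys m. a i * Poly_Mapping.lookup m i) = (\<Sum>i\<in>K. a i * Poly_Mapping.lookup m i)"
  by (rule sum.mono_neutral_left) (auto simp: in_keys_iff)

lemma monom_val_add: "monom_val (m + m') z = monom_val m z * monom_val m' z"
proof -
  let ?K = "Poly_Mapping.keys m \<union> Poly_Mapping.keys m'"
  have s: "Poly_Mapping.keys (m + m') \<subseteq> ?K" by (rule Poly_Mapping.keys_add)
  have "monom_val (m + m') z = (\<Prod>i\<in>?K. z i ^ Poly_Mapping.lookup (m + m') i)"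
    by (rule monom_val_superset) (use s in auto)
  then show ?thesis
    by (simp add: monom_val_superset[of ?K m] monom_val_superset[of ?K m'] lookup_add power_add prod.distrib)
qed

lemma weight_add:
  fixes a :: "nat \<Rightarrow> nat"
  shows "(\<Sum>i\<in>Poly_Mapping.keys (m + m'). a i * Poly_Mapping.lookup (m + m') i) =
    (\<Sum>i\<in>Poly_Mapping.keys m. a i * Poly_Mapping.lookup m i) + (\<Sum>i\<in>Poly_Mapping.keys m'. a i * Poly_Mapping.lookup m' i)"
proof -
  let ?K = "Poly_Mapping.keys m \<union> Poly_Mapping.keys m'"
  have s: "Poly_Mapping.keys (m + m') \<subseteq> ?K" by (rule Poly_Mapping.keys_add)
  have "(\<Sum>i\<in>Poly_Mapping.keys (m + m'). a i * Poly_Mapping.lookup (m + m') i) =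
     (\<Sum>i\<in>?K. a i * Poly_Mapping.lookup (m + m') i)"
    by (rule weight_superset) (use s in auto)
  then show ?thesis
    by (simp add: weight_superset[of ?K m] weight_superset[of ?K m'] lookup_add algebra_simps sum.distrib)
qed

lemma whom_add: "whom N a d f \<Longrightarrow> whom N a d g \<Longrightarrow> whom N a d (\<lambda>z. f z + g z)"
proof (induction rule: whom.induct)
  case (whom_step f m c)
  then show ?case using whom.whom_step[of N a d "\<lambda>z. f z + g z" m c] by (simp add: add.assoc)
qed simp

lemma whom_monom:
  "Poly_Mapping.keys m \<subseteq> {..N} \<Longrightarrow> (\<Sum>i\<in>Poly_Mapping.keys m. a i * Poly_Mapping.lookup m i) = d \<Longrightarrow>
    whom N a d (\<lambda>z. c * monom_val m z)"
  using whom_step[OF whom_zero, of m N a d c] by simp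

lemma whom_mult:
  assumes f: "whom N a d f" and g: "whom N a e g" shows "whom N a (d + e) (\<lambda>z. f z * g z)"
proof -
  have 1: "whom N a (d + e) (\<lambda>z. (c * monom_val m z) * g z)"
    if m: "Poly_Mapping.keys m \<subseteq> {..N}" "(\<Sum>i\<in>Poly_Mapping.keys m. a i * Poly_Mapping.lookup m i) = d" for c m
    using g
  proof (induction rule: whom.induct)
    case whom_zero
    then show ?case by (simp add: whom.whom_zero)
  next
    case (whom_step f m' c')
    have "whom N a (d + e) (\<lambda>z. (c * c') * monom_val (m + m') z + (c * monom_val m z) * f z)"
      by (rule whom.whom_step[OF whom_step.IH])
        (use m whom_step.hyps Poly_Mapping.keys_add[of m m'] in \<open>auto simp: weight_add\<close>)
    then show ?case by (simp add: algebra_simps monom_val_add)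
  qed
  show ?thesis using f
  proof (induction rule: whom.induct)
    case whom_zero
    then show ?case by (simp add: whom.whom_zero)
  next
    case (whom_step f m c)
    show ?case using whom_add[OF 1[OF whom_step.hyps(2,3), of c] whom_step.IH] by (simp add: algebra_simps)
  qed
qed

lemma graded_whom: "graded (whom N a)"
  unfolding graded_def
proof (intro conjI allI impI)
  fix c show "whom N a 0 (\<lambda>_. c)" using whom_monom[of 0 N a 0 c] by (simp add: monom_val_def)
next
  fix d f g assume "whom N a d f" "whom N a d g"
  then show "whom N a d (\<lambda>p. f p + g p)" by (rule whom_add)
next
  fix d e f g assume "whom N a d f" "whom N a e g"
  then show "whom N a (d + e) (\<lambda>p. f p * g p)" by (rule whom_mult)
qed

lemma whom_var: "i \<le> N \<Longrightarrow> whom N a (a i) (\<lambda>z. z i)"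
  using whom_monom[of "Poly_Mapping.single i 1" N a "a i" 1] by (simp add: monom_val_def)

lemma poly_eval_superset:
  "finite K \<Longrightarrow> Poly_Mapping.keys p \<subseteq> K \<Longrightarrow>
    poly_eval p z = (\<Sum>m\<in>K. Poly_Mapping.lookup p m * monom_val m z)"
  unfolding poly_eval_def monom_val_def by (rule sum.mono_neutral_left) (auto simp: in_keys_iff)

lemma poly_eval_add: "poly_eval (p + q) z = poly_eval p z + poly_eval q z"
proof -
  let ?K = "Poly_Mapping.keys p \<union> Poly_Mapping.keys q"
  have s: "Poly_Mapping.keys (p + q) \<subseteq> ?K" by (rule Poly_Mapping.keys_add)
  have "poly_eval (p + q) z = (\<Sum>m\<in>?K. Poly_Mapping.lookup (p + q) m * monom_val m z)"
    by (rule poly_eval_superset) (use s in auto)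
  then show ?thesis
    by (simp add: poly_eval_superset[of ?K p] poly_eval_superset[of ?K q] lookup_add algebra_simps sum.distrib)
qed

lemma poly_eval_single: "poly_eval (Poly_Mapping.single m c) z = c * monom_val m z"
  by (cases "c = 0") (simp_all add: poly_eval_def monom_val_def)

lemma is_whomog_add: "is_whomog N a d p \<Longrightarrow> is_whomog N a d q \<Longrightarrow> is_whomog N a d (p + q)"
  using Poly_Mapping.keys_add[of p q] unfolding is_whomog_def by blast

lemma whom_iff: "whom N a d f \<longleftrightarrow> (\<exists>G. is_whomog N a d G \<and> f = poly_eval G)"
proof
  assume "whom N a d f"
  then show "\<exists>G. is_whomog N a d G \<and> f = poly_eval G"
  proof (induction rule: whom.induct)
    case whom_zero
    show ?case by (rule exI[of _ 0]) (auto simp: is_whomog_def poly_eval_def)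
  next
    case (whom_step f m c)
    then obtain G where "is_whomog N a d G" "f = poly_eval G" by blast
    moreover have "is_whomog N a d (Poly_Mapping.single m c)"
      using whom_step.hyps unfolding is_whomog_def by (auto split: if_splits)
    ultimately show ?case
      by (intro exI[of _ "Poly_Mapping.single m c + G"])
        (auto simp: is_whomog_add poly_eval_add poly_eval_single fun_eq_iff)
  qed
next
  assume "\<exists>G. is_whomog N a d G \<and> f = poly_eval G"
  then obtain G where G: "is_whomog N a d G" and f: "f = poly_eval G" by blast
  have "whom N a d (\<lambda>z. \<Sum>m\<in>K. Poly_Mapping.lookup G m * monom_val m z)"
    if "K \<subseteq> Poly_Mapping.keys G" for K
    using finite_subset[OF that finite_keys] that
  proof induction
    case empty
    then show ?case by (simp add: whom_zero)
  next
    case (insert m K)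
    then have "Poly_Mapping.keys m \<subseteq> {..N}" "(\<Sum>i\<in>Poly_Mapping.keys m. a i * Poly_Mapping.lookup m i) = d"
      using G unfolding is_whomog_def by blast+
    then show ?case using insert whom_step[of N a d _ m "Poly_Mapping.lookup G m"] by simp
  qed
  from this[of "Poly_Mapping.keys G"] show "whom N a d f"
    unfolding f by (simp add: poly_eval_superset[OF finite_keys subset_refl, symmetric])
qed

lemma whom_scale:
  assumes "whom N a d f" shows "f (\<lambda>i. c ^ a i * z i) = c ^ d * f z"
  using assms
proof (induction rule: whom.induct)
  case (whom_step f m k)
  have "monom_val m (\<lambda>i. c ^ a i * z i) = (\<Prod>i\<in>Poly_Mapping.keys m. c ^ (a i * Poly_Mapping.lookup m i)) * monom_val m z"
    by (simp add: monom_val_def power_mult_distrib prod.distrib power_mult)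
  also have "(\<Prod>i\<in>Poly_Mapping.keys m. c ^ (a i * Poly_Mapping.lookup m i)) = c ^ d"
    using whom_step.hyps(3) by (simp flip: power_sum)
  finally show ?case using whom_step.IH by (simp add: algebra_simps)
qed simp

lemma whom_power: "whom N a d f \<Longrightarrow> whom N a (k * d) (\<lambda>z. f z ^ k)"
proof (induction k)
  case 0
  then show ?case using gradedD(1)[OF graded_whom, of N a 1] by simp
next
  case (Suc k)
  show ?case using whom_mult[OF Suc.prems Suc.IH[OF Suc.prems]] by simp
qed

lemma whom_prod:
  "(\<And>i. i \<in> I \<Longrightarrow> whom N a (d i) (f i)) \<Longrightarrow> whom N a (\<Sum>i\<in>I. d i) (\<lambda>z. \<Prod>i\<in>I. f i z)"
proof (induction I rule: infinite_finite_induct)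
  case (infinite A)
  then show ?case using gradedD(1)[OF graded_whom, of N a 1] by simp
next
  case empty
  then show ?case using gradedD(1)[OF graded_whom, of N a 1] by simp
next
  case (insert x F)
  then show ?case using whom_mult[of N a "d x" "f x" "sum d F" "\<lambda>z. \<Prod>i\<in>F. f i z"] by simp
qed

lemma whom_cmult: "whom N a d f \<Longrightarrow> whom N a d (\<lambda>z. c * f z)"
  using whom_mult[OF gradedD(1)[OF graded_whom, of N a c]] by force

lemma whom_diff: "whom N a d f \<Longrightarrow> whom N a d g \<Longrightarrow> whom N a d (\<lambda>z. f z - g z)"
  by (rule graded_diff[OF graded_whom])

section \<open>Polynomial functions on the affine plane\<close>

inductive pfun :: "(complex \<times> complex \<Rightarrow> complex) \<Rightarrow> bool" where
  pfun_const: "pfun (\<lambda>_. c)"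
| pfun_fst: "pfun fst"
| pfun_snd: "pfun snd"
| pfun_add: "pfun f \<Longrightarrow> pfun g \<Longrightarrow> pfun (\<lambda>t. f t + g t)"
| pfun_mult: "pfun f \<Longrightarrow> pfun g \<Longrightarrow> pfun (\<lambda>t. f t * g t)"

lemma graded_pfun: "graded (\<lambda>_::nat. pfun)"
  unfolding graded_def by (intro conjI allI impI pfun_const pfun_add pfun_mult; assumption)

lemma pfun_sum: "(\<And>i. i \<in> I \<Longrightarrow> pfun (f i)) \<Longrightarrow> pfun (\<lambda>t. \<Sum>i\<in>I. f i t)"
  by (induction I rule: infinite_finite_induct) (auto intro: pfun_const pfun_add)

lemma pfun_prod: "(\<And>i. i \<in> I \<Longrightarrow> pfun (f i)) \<Longrightarrow> pfun (\<lambda>t. \<Prod>i\<in>I. f i t)"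
  by (induction I rule: infinite_finite_induct) (auto intro: pfun_const pfun_mult)

lemma pfun_power: "pfun f \<Longrightarrow> pfun (\<lambda>t. f t ^ k)"
  by (induction k) (auto intro: pfun_const pfun_mult)

lemma pfun_iff: "pfun f \<longleftrightarrow> (\<exists>G. f = (\<lambda>t. poly_eval G (\<lambda>i. if i = 0 then fst t else snd t)))"
proof
  let ?e = "\<lambda>t i. if i = (0::nat) then fst t else snd t"
  assume "pfun f"
  then have "\<exists>g. whom 1 (\<lambda>_. 0) 0 g \<and> f = (\<lambda>t. g (?e t))"
  proof induction
    case (pfun_const c)
    show ?case using gradedD(1)[OF graded_whom, of 1 "\<lambda>_. 0" c] by blast
  next
    case pfun_fst
    show ?case using whom_var[of 0 1 "\<lambda>_. 0"] by (intro exI[of _ "\<lambda>z. z 0"]) auto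
  next
    case pfun_snd
    show ?case using whom_var[of 1 1 "\<lambda>_. 0"] by (intro exI[of _ "\<lambda>z. z 1"]) auto
  next
    case (pfun_add f g)
    then obtain f' g' where "whom 1 (\<lambda>_. 0) 0 f'" "f = (\<lambda>t. f' (?e t))" "whom 1 (\<lambda>_. 0) 0 g'" "g = (\<lambda>t. g' (?e t))"
      by blast
    then show ?case using whom_add[of 1 "\<lambda>_. 0" 0 f' g'] by (intro exI[of _ "\<lambda>z. f' z + g' z"]) auto
  next
    case (pfun_mult f g)
    then obtain f' g' where "whom 1 (\<lambda>_. 0) 0 f'" "f = (\<lambda>t. f' (?e t))" "whom 1 (\<lambda>_. 0) 0 g'" "g = (\<lambda>t. g' (?e t))"
      by blast
    then show ?case using whom_mult[of 1 "\<lambda>_. 0" 0 f' 0 g'] by (intro exI[of _ "\<lambda>z. f' z * g' z"]) auto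
  qed
  then show "\<exists>G. f = (\<lambda>t. poly_eval G (\<lambda>i. if i = 0 then fst t else snd t))"
    unfolding whom_iff by blast
next
  assume "\<exists>G. f = (\<lambda>t. poly_eval G (\<lambda>i. if i = 0 then fst t else snd t))"
  then obtain G where f: "f = (\<lambda>t. poly_eval G (\<lambda>i. if i = 0 then fst t else snd t))" by blast
  have "pfun (\<lambda>t. if i = 0 then fst t else snd t)" for i :: nat
    by (cases "i = 0") (simp_all add: pfun_fst[simplified] pfun_snd[simplified])
  then show "pfun f" unfolding f poly_eval_def
    by (intro pfun_sum pfun_mult pfun_prod pfun_power pfun_const)
qed

lemma presents_affine: "presents affine_plane UNIV (\<lambda>_. pfun)"
proof -
  have "affine_plane = fspace_of {(D, g) | D g. \<exists>(d::nat) F G. pfun F \<and> pfun G \<and> D = {p \<in> UNIV. G p \<noteq> 0} \<and>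
     g = (\<lambda>p. F p / G p)}"
    unfolding affine_plane_def pfun_iff case_prod_unfold
  proof (intro arg_cong[where f = fspace_of] Collect_cong iffI, goal_cases)
    case (1 u)
    then obtain F G where u: "u = ({p. poly_eval G (\<lambda>i. if i = 0 then fst p else snd p) \<noteq> 0},
        \<lambda>p. poly_eval F (\<lambda>i. if i = 0 then fst p else snd p) / poly_eval G (\<lambda>i. if i = 0 then fst p else snd p))"
      by auto
    let ?f = "\<lambda>F p. poly_eval F (\<lambda>i. if i = 0 then fst p else snd p)"
    show ?case unfolding u
      by (rule exI[of _ "{p. ?f G p \<noteq> 0}"], rule exI[of _ "\<lambda>p. ?f F p / ?f G p"], rule conjI, rule refl,
          rule exI[of _ 0], rule exI[of _ "?f F"], rule exI[of _ "?f G"]) auto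
  qed auto
  then show ?thesis using presents_basic[OF graded_pfun, of UNIV] by simp
qed

section \<open>Weighted projective space\<close>

text \<open>The value depends on the representative chosen by \<open>rep\<close>. The zero set and
  the quotients of equal degree are intrinsic, as recorded by \<open>hfun_worbit\<close> and
  \<open>hfun_quotient\<close>.\<close>

definition hfun :: "nat \<Rightarrow> (nat \<Rightarrow> nat) \<Rightarrow> nat \<Rightarrow> ((nat \<Rightarrow> complex) set \<Rightarrow> complex) \<Rightarrow> bool" where
  "hfun N a d F \<longleftrightarrow> (\<exists>f. whom N a d f \<and> F = (\<lambda>p. f (rep p)))"

lemma hfunI: "whom N a d f \<Longrightarrow> hfun N a d (\<lambda>p. f (rep p))"
  unfolding hfun_def by blast

lemma graded_hfun: "graded (hfun N a)"
  unfolding graded_def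
proof (intro conjI allI impI)
  fix c show "hfun N a 0 (\<lambda>_. c)" using hfunI[OF gradedD(1)[OF graded_whom, of N a c]] by simp
next
  fix d f g assume "hfun N a d f" "hfun N a d g"
  then obtain f' g' where "whom N a d f'" "f = (\<lambda>p. f' (rep p))" "whom N a d g'" "g = (\<lambda>p. g' (rep p))"
    unfolding hfun_def by blast
  then show "hfun N a d (\<lambda>p. f p + g p)" using hfunI[OF whom_add[of N a d f' g']] by simp
next
  fix d e f g assume "hfun N a d f" "hfun N a e g"
  then obtain f' g' where "whom N a d f'" "f = (\<lambda>p. f' (rep p))" "whom N a e g'" "g = (\<lambda>p. g' (rep p))"
    unfolding hfun_def by blast
  then show "hfun N a (d + e) (\<lambda>p. f p * g p)" using hfunI[OF whom_mult[of N a d f' e g']] by simp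
qed

lemma presents_wproj: "presents (wproj N a) (wproj_pts N a) (hfun N a)"
proof -
  have "wproj N a = fspace_of {(D, g) | D g. \<exists>d F G. hfun N a d F \<and> hfun N a d G \<and>
      D = {p \<in> wproj_pts N a. G p \<noteq> 0} \<and> g = (\<lambda>p. F p / G p)}"
    unfolding wproj_def hfun_def whom_iff
    by (intro arg_cong[where f = fspace_of] Collect_cong) (auto, force+)
  then show ?thesis using presents_basic[OF graded_hfun, of N a "wproj_pts N a"] by simp
qed

lemma worbit_self: "z \<in> worbit a z"
  unfolding worbit_def by (rule CollectI, rule exI[of _ 1]) auto

lemma rep_worbit: "\<exists>c. c \<noteq> 0 \<and> rep (worbit a z) = (\<lambda>i. c ^ a i * z i)"
proof -
  have "rep (worbit a z) \<in> worbit a z" unfolding rep_def by (rule someI[of _ z]) (rule worbit_self)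
  then show ?thesis unfolding worbit_def by blast
qed

lemma worbit_scale: "c \<noteq> 0 \<Longrightarrow> worbit a (\<lambda>i. c ^ a i * z i) = worbit a z"
proof (intro set_eqI iffI)
  fix u assume c: "c \<noteq> 0" and "u \<in> worbit a (\<lambda>i. c ^ a i * z i)"
  then obtain e where "e \<noteq> 0" "u = (\<lambda>i. e ^ a i * (c ^ a i * z i))" unfolding worbit_def by blast
  then show "u \<in> worbit a z" using c unfolding worbit_def
    by (intro CollectI exI[of _ "e * c"]) (auto simp: power_mult_distrib mult.assoc)
next
  fix u assume c: "c \<noteq> 0" and "u \<in> worbit a z"
  then obtain e where "e \<noteq> 0" "u = (\<lambda>i. e ^ a i * z i)" unfolding worbit_def by blast
  then show "u \<in> worbit a (\<lambda>i. c ^ a i * z i)" using c unfolding worbit_def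
    by (intro CollectI exI[of _ "e / c"]) (auto simp: power_divide)
qed

lemma worbit_rep: "worbit a (rep (worbit a z)) = worbit a z"
  using rep_worbit[of a z] worbit_scale by metis

lemma hfun_worbit:
  assumes "whom N a d f"
  shows "f (rep (worbit a z)) = 0 \<longleftrightarrow> f z = 0"
  using rep_worbit[of a z] whom_scale[OF assms] by auto

lemma hfun_quotient:
  assumes "whom N a d f" "whom N a d g"
  shows "f (rep (worbit a z)) / g (rep (worbit a z)) = f z / g z"
proof -
  obtain c where "c \<noteq> 0" "rep (worbit a z) = (\<lambda>i. c ^ a i * z i)" using rep_worbit by blast
  then show ?thesis using whom_scale[OF assms(1)] whom_scale[OF assms(2)] by simp
qed

section \<open>Key polynomials and the filtration of the polynomial ring\<close>

text \<open>\<open>\<complex>[x, y]\<close> is the type \<open>complex poly poly\<close>, with \<open>y\<close> as the outer variable.\<close>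

abbreviation cst :: "complex \<Rightarrow> complex poly poly" where "cst c \<equiv> [:[:c:]:]"
abbreviation PX :: "complex poly poly" where "PX \<equiv> [:[:0, 1:]:]"
abbreviation PY :: "complex poly poly" where "PY \<equiv> [:0, 1:]"

definition ev :: "complex poly poly \<Rightarrow> complex \<times> complex \<Rightarrow> complex" where
  "ev f p = poly (poly f [:snd p:]) (fst p)"

lemma ev_simps [simp]:
  "ev 0 p = 0" "ev 1 p = 1" "ev (f + g) p = ev f p + ev g p" "ev (f - g) p = ev f p - ev g p" "ev (- f) p = - ev f p"
  "ev (f * g) p = ev f p * ev g p" "ev (f ^ k) p = ev f p ^ k" "ev (cst c) p = c"
  "ev PX p = fst p" "ev PY p = snd p" "ev (smult a f) p = poly a (fst p) * ev f p" "ev [:a:] p = poly a (fst p)"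
  by (simp_all add: ev_def)

lemma ev_sum [simp]: "ev (\<Sum>i\<in>I. f i) p = (\<Sum>i\<in>I. ev (f i) p)"
  by (induction I rule: infinite_finite_induct) simp_all

lemma ev_prod [simp]: "ev (\<Prod>i\<in>I. f i) p = (\<Prod>i\<in>I. ev (f i) p)"
  by (induction I rule: infinite_finite_induct) simp_all

lemma coeff_mult_top:
  assumes "degree f \<le> d" "degree g \<le> e"
  shows "coeff (f * g) (d + e) = coeff f d * coeff g e"
proof -
  have "coeff (f * g) (d + e) = (\<Sum>i\<le>d + e. coeff f i * coeff g (d + e - i))" by (simp add: coeff_mult)
  also have "\<dots> = (\<Sum>i\<in>{d}. coeff f i * coeff g (d + e - i))"
  proof (rule sum.mono_neutral_right)
    show "\<forall>i\<in>{..d + e} - {d}. coeff f i * coeff g (d + e - i) = 0"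
    proof
      fix i assume "i \<in> {..d + e} - {d}"
      then have "i > d \<or> d + e - i > e" by auto
      then show "coeff f i * coeff g (d + e - i) = 0" using assms by (auto simp: coeff_eq_0)
    qed
  qed auto
  finally show ?thesis by simp
qed

text \<open>The arithmetic of a primitive algebraic key sequence in natural numbers. In
  \<open>uniq\<close>, the digits with \<open>1 <= j\<close> are bounded by \<open>al j\<close> and
  the digit at 0 is free; the weight determines all of them. This is what makes leading forms of
  normal monomials independent.\<close>

locale keydata =
  fixes n :: nat and om al :: "nat \<Rightarrow> nat" and be :: "nat \<Rightarrow> nat \<Rightarrow> nat" and th :: "nat \<Rightarrow> complex"
  assumes om_pos: "k \<le> Suc n \<Longrightarrow> 0 < om k"
    and al_pos: "1 \<le> k \<Longrightarrow> k \<le> n \<Longrightarrow> 0 < al k"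
    and om_less: "1 \<le> k \<Longrightarrow> k \<le> n \<Longrightarrow> om (Suc k) < al k * om k"
    and be_sum: "1 \<le> k \<Longrightarrow> k \<le> n \<Longrightarrow> (\<Sum>j<k. be k j * om j) = al k * om k"
    and be_less: "1 \<le> j \<Longrightarrow> j < k \<Longrightarrow> k \<le> n \<Longrightarrow> be k j < al j"
    and th_nz: "1 \<le> k \<Longrightarrow> k \<le> n \<Longrightarrow> th k \<noteq> 0"
    and uniq: "\<lbrakk>\<And>j. 1 \<le> j \<Longrightarrow> j \<le> n \<Longrightarrow> a j < al j; \<And>j. 1 \<le> j \<Longrightarrow> j \<le> n \<Longrightarrow> b j < al j;
      (\<Sum>j\<le>n. a j * om j) = (\<Sum>j\<le>n. b j * om j); j \<le> n\<rbrakk> \<Longrightarrow> a j = (b j :: nat)"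
begin

fun yy :: "nat \<Rightarrow> complex poly poly" where
  "yy 0 = PX"
| "yy (Suc 0) = PY"
| "yy (Suc (Suc k)) = yy (Suc k) ^ al (Suc k) - cst (th (Suc k)) * (\<Prod>j<Suc k. yy j ^ be (Suc k) j)"

lemma yy_Suc: "1 \<le> k \<Longrightarrow> yy (Suc k) = yy k ^ al k - cst (th k) * (\<Prod>j<k. yy j ^ be k j)"
  by (cases k) auto

definition Mo :: "(nat \<Rightarrow> nat) \<Rightarrow> complex poly poly" where "Mo a = (\<Prod>j\<le>Suc n. yy j ^ a j)"
definition wt :: "(nat \<Rightarrow> nat) \<Rightarrow> nat" where "wt a = (\<Sum>j\<le>Suc n. a j * om j)"

text \<open>The degree of \<open>yy j\<close> in \<open>y\<close>, and at the same time the place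
  value of the \<open>j\<close>-th digit in the mixed radix system with radices \<open>al i\<close>.
  Accordingly \<open>ydeg a\<close> is the degree of \<open>Mo a\<close> in
  \<open>y\<close>.\<close>

definition dd :: "nat \<Rightarrow> nat" where "dd j = (\<Prod>i\<in>{1..<j}. al i)"
definition ydeg :: "(nat \<Rightarrow> nat) \<Rightarrow> nat" where "ydeg a = (\<Sum>j\<in>{1..Suc n}. a j * dd j)"

text \<open>The points at infinity with \<open>y\<^sub>0 \<noteq> 0\<close> are the points \<open>[0 : c\<^sub>0 : \<dots> : c\<^sub>n : V]\<close> for the
  sequences \<open>c\<close> below. The weighted homogeneous part of degree \<open>d\<close> is evaluated along the line
  of all \<open>V\<close>.\<close>

definition curve :: "(nat \<Rightarrow> complex) \<Rightarrow> bool" where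
  "curve c \<longleftrightarrow> c 0 = 1 \<and> (\<forall>k\<in>{1..n}. c k ^ al k = th k * (\<Prod>j<k. c j ^ be k j))"

definition cc :: "(nat \<Rightarrow> complex) \<Rightarrow> nat \<Rightarrow> complex poly" where
  "cc c j = (if j \<le> n then [:c j:] else [:0, 1:])"

definition In :: "(nat \<Rightarrow> complex) \<Rightarrow> (nat \<Rightarrow> nat) \<Rightarrow> complex poly" where
  "In c a = (\<Prod>j\<le>Suc n. cc c j ^ a j)"

text \<open>A polynomial has many expressions in the \<open>yy j\<close>, so the leading form
  \<open>P\<close> of \<open>f\<close> in degree \<open>d\<close> enters as a relation; that it
  depends on \<open>c\<close>, \<open>d\<close> and \<open>f\<close> alone is
  \<open>Fil_unique\<close>. A zero leading form means that the degree is smaller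
  (\<open>Fil_drop\<close>). Degrees are integers because they get shifted by the possibly negative
  weight of a field.\<close>

inductive Fil :: "(nat \<Rightarrow> complex) \<Rightarrow> int \<Rightarrow> complex poly poly \<Rightarrow> complex poly \<Rightarrow> bool" for c d where
  Fil_zero: "Fil c d 0 0"
| Fil_step: "Fil c d f P \<Longrightarrow> int (wt a) \<le> d \<Longrightarrow>
    Fil c d (cst k * Mo a + f) ((if int (wt a) = d then smult k (In c a) else 0) + P)"

text \<open>The exponents of \<open>y_0\<close> and \<open>y_{n+1}\<close> are free, those in
  between are digits. Exponents beyond \<open>Suc n\<close> are 0, so that a monomial determines its
  exponent function. These monomials are a basis adapted to the filtration.\<close>

definition nf :: "(nat \<Rightarrow> nat) \<Rightarrow> bool" where
  "nf a \<longleftrightarrow> (\<forall>j\<in>{1..n}. a j < al j) \<and> (\<forall>j>Suc n. a j = 0)"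

definition Nrm :: "(nat \<Rightarrow> complex) \<Rightarrow> int \<Rightarrow> complex poly poly \<Rightarrow> complex poly \<Rightarrow> bool" where
  "Nrm c d f P \<longleftrightarrow> (\<exists>A \<kappa>. finite A \<and> (\<forall>a\<in>A. nf a \<and> int (wt a) \<le> d) \<and>
     f = (\<Sum>a\<in>A. cst (\<kappa> a) * Mo a) \<and> P = (\<Sum>a\<in>A. if int (wt a) = d then smult (\<kappa> a) (In c a) else 0))"

lemma Mo_add: "Mo (\<lambda>i. a i + b i) = Mo a * Mo b"
  by (simp add: Mo_def power_add prod.distrib)
lemma wt_add: "wt (\<lambda>i. a i + b i) = wt a + wt b"
  by (simp add: wt_def sum.distrib algebra_simps)
lemma In_add: "In c (\<lambda>i. a i + b i) = In c a * In c b"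
  by (simp add: In_def power_add prod.distrib)
lemma ydeg_add: "ydeg (\<lambda>i. a i + b i) = ydeg a + ydeg b"
  by (simp add: ydeg_def sum.distrib algebra_simps)

lemma Mo_zero: "Mo (\<lambda>_. 0) = 1" and wt_zero: "wt (\<lambda>_. 0) = 0" and In_zero: "In c (\<lambda>_. 0) = 1"
  by (simp_all add: Mo_def wt_def In_def)

definition ex1 :: "nat \<Rightarrow> nat \<Rightarrow> nat \<Rightarrow> nat" where "ex1 j m = (\<lambda>i. if i = j then m else 0)"

lemma if_pow: "(x :: 'a :: comm_semiring_1) ^ (if b then m else 0) = (if b then x ^ m else 1)" by simp
lemma if_mul: "(if b then m else 0) * (x :: nat) = (if b then m * x else 0)" by simp

lemma Mo_ex1: "j \<le> Suc n \<Longrightarrow> Mo (ex1 j m) = yy j ^ m"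
  unfolding Mo_def ex1_def if_pow by (subst prod.delta) auto
lemma In_ex1: "j \<le> Suc n \<Longrightarrow> In c (ex1 j m) = cc c j ^ m"
  unfolding In_def ex1_def if_pow by (subst prod.delta) auto
lemma wt_ex1: "j \<le> Suc n \<Longrightarrow> wt (ex1 j m) = m * om j"
  unfolding wt_def ex1_def if_mul by (subst sum.delta) auto
lemma ydeg_ex1: "1 \<le> j \<Longrightarrow> j \<le> Suc n \<Longrightarrow> ydeg (ex1 j m) = m * dd j"
  unfolding ydeg_def ex1_def if_mul by (subst sum.delta) auto

text \<open>Exponents of the monomial that is subtracted in the recursion for
  \<open>yy (Suc j)\<close>.\<close>

definition exl :: "nat \<Rightarrow> nat \<Rightarrow> nat" where "exl j = (\<lambda>i. if i < j then be j i else 0)"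

lemma Mo_exl: "j \<le> n \<Longrightarrow> Mo (exl j) = (\<Prod>i<j. yy i ^ be j i)"
  unfolding Mo_def exl_def if_pow by (rule prod.mono_neutral_cong_right) auto
lemma In_exl: "j \<le> n \<Longrightarrow> In c (exl j) = (\<Prod>i<j. cc c i ^ be j i)"
  unfolding In_def exl_def if_pow by (rule prod.mono_neutral_cong_right) auto
lemma wt_exl: "1 \<le> j \<Longrightarrow> j \<le> n \<Longrightarrow> wt (exl j) = al j * om j"
proof -
  assume j: "1 \<le> j" "j \<le> n"
  have "wt (exl j) = (\<Sum>i<j. be j i * om i)"
    unfolding wt_def exl_def if_mul by (rule sum.mono_neutral_cong_right) (use j in auto)
  then show ?thesis using be_sum[OF j] by simp
qed

lemma dd_pos: "j \<le> Suc n \<Longrightarrow> dd j > 0"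
  unfolding dd_def by (rule prod_pos) (use al_pos in auto)

lemma dd_Suc: "1 \<le> j \<Longrightarrow> dd (Suc j) = al j * dd j"
  unfolding dd_def by (simp add: prod.atLeastLessThan_Suc mult.commute)

lemma radix_less:
  assumes "k \<le> Suc n" "\<And>i. 1 \<le> i \<Longrightarrow> i < k \<Longrightarrow> a i < al i"
  shows "(\<Sum>i\<in>{1..<k}. a i * dd i) < dd k"
  using assms
proof (induction k)
  case (Suc k)
  show ?case
  proof (cases "k = 0")
    case False
    have "(\<Sum>i\<in>{1..<Suc k}. a i * dd i) = (\<Sum>i\<in>{1..<k}. a i * dd i) + a k * dd k"
      using False by (simp add: sum.atLeastLessThan_Suc)
    also have "\<dots> < dd k + a k * dd k" using Suc by simp
    also have "\<dots> \<le> al k * dd k" using Suc.prems(2)[of k] False mult_le_mono1[of "Suc (a k)" "al k" "dd k"] by simp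
    finally show ?thesis using dd_Suc[of k] False by simp
  qed (simp add: dd_def)
qed (simp add: dd_def)

text \<open>Digits are read off from the top: the leading digit is unbounded, and all lower ones
  together stay below its place value by \<open>radix_less\<close>.\<close>

lemma radix_unique:
  assumes "k \<le> Suc n" "\<And>i. 1 \<le> i \<Longrightarrow> i < k \<Longrightarrow> a i < al i" "\<And>i. 1 \<le> i \<Longrightarrow> i < k \<Longrightarrow> b i < al i"
    and "(\<Sum>i\<in>{1..k}. a i * dd i) = (\<Sum>i\<in>{1..k}. b i * dd i)" "1 \<le> j" "j \<le> k"
  shows "a j = b j"
  using assms
proof (induction k arbitrary: j)
  case (Suc k)
  have s: "(\<Sum>i\<in>{1..Suc k}. c i * dd i) = (\<Sum>i\<in>{1..<Suc k}. c i * dd i) + c (Suc k) * dd (Suc k)" for c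
    by (subst sum.cl_ivl_Suc) (auto simp: atLeastLessThanSuc_atLeastAtMost)
  have la: "(\<Sum>i\<in>{1..<Suc k}. a i * dd i) < dd (Suc k)" and lb: "(\<Sum>i\<in>{1..<Suc k}. b i * dd i) < dd (Suc k)"
    using radix_less[of "Suc k"] Suc.prems by auto
  have e: "(\<Sum>i\<in>{1..<Suc k}. a i * dd i) + a (Suc k) * dd (Suc k) = (\<Sum>i\<in>{1..<Suc k}. b i * dd i) + b (Suc k) * dd (Suc k)"
    using Suc.prems(4) unfolding s .
  have 1: "a (Suc k) = b (Suc k)"
    using arg_cong[OF e, of "\<lambda>t. t div dd (Suc k)"] la lb by simp
  then have "(\<Sum>i\<in>{1..k}. a i * dd i) = (\<Sum>i\<in>{1..k}. b i * dd i)"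
    using e by (simp add: atLeastLessThanSuc_atLeastAtMost)
  then show ?case using Suc.IH[of j] Suc.prems 1 by (cases "j = Suc k") auto
qed simp

lemma ydeg_exl:
  assumes "1 \<le> j" "j \<le> n" shows "ydeg (exl j) < al j * dd j"
proof -
  have "ydeg (exl j) = (\<Sum>i\<in>{1..<j}. be j i * dd i)"
    unfolding ydeg_def exl_def if_mul by (rule sum.mono_neutral_cong_right) (use assms in auto)
  also have "\<dots> < dd j" by (rule radix_less) (use assms be_less in auto)
  also have "\<dots> \<le> al j * dd j" using al_pos[OF assms] by simp
  finally show ?thesis .
qed

subsection \<open>Normal forms\<close>

lemma cst_add_mult: "cst (k + m) * f = cst k * f + cst m * f"
proof -
  have "cst (k + m) = cst k + cst m" by simp
  then show ?thesis by (simp only: distrib_right)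
qed

lemma Nrm_zero: "Nrm c d 0 0"
  unfolding Nrm_def by (rule exI[of _ "{}"]) auto

lemma Nrm_add:
  assumes "Nrm c d f P" "Nrm c d g Q" shows "Nrm c d (f + g) (P + Q)"
proof -
  obtain A \<kappa> where A: "finite A" "\<forall>a\<in>A. nf a \<and> int (wt a) \<le> d" "f = (\<Sum>a\<in>A. cst (\<kappa> a) * Mo a)"
    "P = (\<Sum>a\<in>A. if int (wt a) = d then smult (\<kappa> a) (In c a) else 0)" using assms(1) unfolding Nrm_def by blast
  obtain B \<mu> where B: "finite B" "\<forall>a\<in>B. nf a \<and> int (wt a) \<le> d" "g = (\<Sum>a\<in>B. cst (\<mu> a) * Mo a)"
    "Q = (\<Sum>a\<in>B. if int (wt a) = d then smult (\<mu> a) (In c a) else 0)" using assms(2) unfolding Nrm_def by blast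
  let ?k = "\<lambda>a. if a \<in> A then \<kappa> a else 0" and ?m = "\<lambda>a. if a \<in> B then \<mu> a else 0"
  have "f = (\<Sum>a\<in>A \<union> B. cst (?k a) * Mo a)" "P = (\<Sum>a\<in>A \<union> B. if int (wt a) = d then smult (?k a) (In c a) else 0)"
    unfolding A(3,4) by (rule sum.mono_neutral_cong_left; use A B in auto)+
  moreover have "g = (\<Sum>a\<in>A \<union> B. cst (?m a) * Mo a)" "Q = (\<Sum>a\<in>A \<union> B. if int (wt a) = d then smult (?m a) (In c a) else 0)"
    unfolding B(3,4) by (rule sum.mono_neutral_cong_left; use A B in auto)+
  ultimately have "f + g = (\<Sum>a\<in>A \<union> B. cst (?k a + ?m a) * Mo a)"
    "P + Q = (\<Sum>a\<in>A \<union> B. if int (wt a) = d then smult (?k a + ?m a) (In c a) else 0)"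
    by (simp_all only: cst_add_mult sum.distrib[symmetric], auto intro!: sum.cong simp: smult_add_left)
  then show ?thesis unfolding Nrm_def
    by (intro exI[of _ "A \<union> B"] exI[of _ "\<lambda>a. ?k a + ?m a"]) (use A(1,2) B(1,2) in blast)
qed

lemma Nrm_mult_const:
  assumes "Nrm c d f P" shows "Nrm c d (cst k * f) (smult k P)"
proof -
  obtain A \<kappa> where A: "finite A" "\<forall>a\<in>A. nf a \<and> int (wt a) \<le> d" "f = (\<Sum>a\<in>A. cst (\<kappa> a) * Mo a)"
    "P = (\<Sum>a\<in>A. if int (wt a) = d then smult (\<kappa> a) (In c a) else 0)" using assms(1) unfolding Nrm_def by blast
  have "smult k P = (\<Sum>a\<in>A. if int (wt a) = d then smult (k * \<kappa> a) (In c a) else 0)"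
    unfolding A(4) using A(1) by (induction A rule: finite_induct) (auto simp: smult_add_right)
  moreover have "cst k * f = (\<Sum>a\<in>A. cst (k * \<kappa> a) * Mo a)"
    unfolding A(3) sum_distrib_left by (simp add: mult.assoc)
  ultimately show ?thesis unfolding Nrm_def
    by (intro exI[of _ A] exI[of _ "\<lambda>a. k * \<kappa> a"]) (use A in auto)
qed

lemma Nrm_mono:
  assumes "Nrm c d f P" "d \<le> e" shows "Nrm c e f (if d = e then P else 0)"
proof (cases "d = e")
  case False
  obtain A \<kappa> where A: "finite A" "\<forall>a\<in>A. nf a \<and> int (wt a) \<le> d" "f = (\<Sum>a\<in>A. cst (\<kappa> a) * Mo a)"
     using assms(1) unfolding Nrm_def by blast
  have "int (wt a) \<le> e \<and> int (wt a) \<noteq> e" if "a \<in> A" for a using A(2) that False assms(2) by force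
  then have "(\<Sum>a\<in>A. if int (wt a) = e then smult (\<kappa> a) (In c a) else 0) = 0" "\<forall>a\<in>A. nf a \<and> int (wt a) \<le> e"
    using A(2) by (auto intro!: sum.neutral)
  then show ?thesis using False A(1,3) unfolding Nrm_def by auto
qed (use assms in simp)

lemma curve_exl: "curve c \<Longrightarrow> 1 \<le> j \<Longrightarrow> j \<le> n \<Longrightarrow> smult (th j) (In c (exl j)) = cc c j ^ al j"
proof -
  assume c: "curve c" and j: "1 \<le> j" "j \<le> n"
  have "(\<Prod>i<j. cc c i ^ be j i) = [:\<Prod>i<j. c i ^ be j i:]"
  proof -
    have "(\<Prod>i\<in>I. cc c i ^ be j i) = [:\<Prod>i\<in>I. c i ^ be j i:]" if "I \<subseteq> {..<j}" for I
      using finite_subset[OF that finite_lessThan] that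
      by induction (use j in \<open>auto simp: cc_def one_pCons poly_const_pow\<close>)
    then show ?thesis by simp
  qed
  then show ?thesis using c j unfolding curve_def by (simp add: In_exl cc_def poly_const_pow)
qed

text \<open>The rewriting rule is \<open>y_j^{al j} = y_{j+1} + th j * Mo (exl j)\<close>. The first
  summand has smaller weight and the same degree in \<open>y\<close>, the second has the same weight
  and smaller degree in \<open>y\<close>; hence the induction on \<open>wt a + ydeg a\<close>. The
  leading form survives: the first summand contributes nothing in weight \<open>wt a\<close>, and
  the second one matches by the equation of the curve.\<close>

lemma Nrm_monomial:
  assumes c: "curve c" shows "Nrm c (int (wt a)) (Mo a) (In c a)"
proof (induction "wt a + ydeg a" arbitrary: a rule: less_induct)
  case less
  show ?case
  proof (cases "\<forall>j\<in>{1..n}. a j < al j")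
    case True
    define b where "b = (\<lambda>j. if j \<le> Suc n then a j else 0)"
    have "nf b" "Mo b = Mo a" "wt b = wt a" "In c b = In c a"
      using True by (auto simp: b_def nf_def Mo_def wt_def In_def intro!: prod.cong sum.cong)
    then show ?thesis unfolding Nrm_def by (intro exI[of _ "{b}"] exI[of _ "\<lambda>_. 1"]) (simp flip: one_pCons)
  next
    case False
    then obtain j where j: "1 \<le> j" "j \<le> n" "al j \<le> a j" by (auto simp: not_less)
    define a' where "a' = (\<lambda>i. if i = j then a j - al j else a i)"
    have a: "a = (\<lambda>i. a' i + ex1 j (al j) i)" using j by (auto simp: a'_def ex1_def)
    let ?a1 = "\<lambda>i. a' i + ex1 (Suc j) 1 i" and ?a2 = "\<lambda>i. a' i + exl j i"
    have w: "wt ?a1 < wt a" "wt ?a2 = wt a"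
      unfolding a wt_add using j om_less[of j] by (simp_all add: wt_ex1 wt_exl)
    have y: "ydeg ?a1 = ydeg a" "ydeg ?a2 < ydeg a"
      unfolding a ydeg_add using j ydeg_exl[of j] by (simp_all add: ydeg_ex1 dd_Suc)
    have M: "Mo a = Mo ?a1 + cst (th j) * Mo ?a2"
      unfolding a Mo_add using j by (simp add: Mo_ex1 Mo_exl yy_Suc algebra_simps)
    have I: "In c a = smult (th j) (In c ?a2)"
      unfolding a In_add using j curve_exl[OF c j(1,2)] by (simp add: In_ex1 flip: mult_smult_right)
    have "Nrm c (int (wt ?a1)) (Mo ?a1) (In c ?a1)" by (rule less) (use w y in linarith)
    moreover have "Nrm c (int (wt ?a2)) (Mo ?a2) (In c ?a2)" by (rule less) (use w y in linarith)
    ultimately have 1: "Nrm c (int (wt a)) (Mo ?a1) 0" and 2: "Nrm c (int (wt a)) (Mo ?a2) (In c ?a2)"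
      using Nrm_mono[of c "int (wt ?a1)" "Mo ?a1" _ "int (wt a)"] w by auto
    show ?thesis using Nrm_add[OF 1 Nrm_mult_const[OF 2, of "th j"]] M I by simp
  qed
qed

lemma Fil_Nrm: assumes c: "curve c" and "Fil c d f P" shows "Nrm c d f P"
  using assms(2)
proof induction
  case Fil_zero
  show ?case by (rule Nrm_zero)
next
  case (Fil_step f P a k)
  have "Nrm c d (Mo a) (if int (wt a) = d then In c a else 0)"
    by (rule Nrm_mono[OF Nrm_monomial[OF c] Fil_step.hyps(2)])
  from Nrm_add[OF Nrm_mult_const[OF this, of k] Fil_step.IH] show ?case by (simp split: if_splits)
qed

text \<open>Since the exponents \<open>be j i\<close> with \<open>1 <= i\<close> are digits below
  \<open>al i\<close>, the subtracted monomial stays below \<open>dd (Suc j)\<close> in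
  \<open>y\<close>-degree, and \<open>yy (Suc j)\<close> is monic in \<open>y\<close>.\<close>

lemma degree_yy:
  assumes "1 \<le> k" "k \<le> Suc n" shows "degree (yy k) \<le> dd k \<and> coeff (yy k) (dd k) = 1"
  using assms
proof (induction k rule: less_induct)
  case (less k)
  have pw: "degree (yy j ^ m) \<le> m * dd j \<and> coeff (yy j ^ m) (m * dd j) = 1" if "1 \<le> j" "j < k" for j m
  proof (induction m)
    case (Suc m)
    have "degree (yy j) \<le> dd j" "coeff (yy j) (dd j) = 1" using less.IH[of j] that less.prems by auto
    then show ?case using Suc coeff_mult_top[of "yy j" "dd j" "yy j ^ m" "m * dd j"]
      degree_mult_le[of "yy j" "yy j ^ m"] by auto
  qed simp
  show ?case
  proof (cases "k = 1")
    case True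
    then show ?thesis by (simp add: dd_def)
  next
    case False
    then obtain j where j: "k = Suc j" "1 \<le> j" "j \<le> n" using less.prems by (cases k) auto
    have "degree (\<Prod>i<j. yy i ^ be j i) \<le> (\<Sum>i<j. exl j i * (if i = 0 then 0 else dd i))"
      using degree_prod_sum_le[of "{..<j}" "\<lambda>i. yy i ^ be j i"]
      apply (rule order_trans)
       apply simp
      apply (rule sum_mono)
      using pw j by (auto simp: exl_def degree_power_eq)
    also have "\<dots> = ydeg (exl j)"
      unfolding ydeg_def exl_def if_mul
      by (rule sum.mono_neutral_cong) (use j in auto)
    finally have "degree (\<Prod>i<j. yy i ^ be j i) < al j * dd j" using ydeg_exl[of j] j by simp
    then have lt: "degree (cst (th j) * (\<Prod>i<j. yy i ^ be j i)) < al j * dd j"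
      using al_pos[of j] dd_pos[of j] j by simp
    then show ?thesis using pw[of j "al j"] j dd_Suc[of j] coeff_eq_0[OF lt]
      by (auto simp: yy_Suc intro!: degree_diff_le)
  qed
qed

lemma degree_Mo: "degree (Mo a) \<le> ydeg a \<and> coeff (Mo a) (ydeg a) = monom 1 (a 0)"
proof -
  have pw: "degree (yy j ^ m) \<le> m * dd j \<and> coeff (yy j ^ m) (m * dd j) = 1" if "1 \<le> j" "j \<le> Suc n" for j m
  proof (induction m)
    case (Suc m)
    then show ?case using degree_yy[OF that] coeff_mult_top[of "yy j" "dd j" "yy j ^ m" "m * dd j"]
      degree_mult_le[of "yy j" "yy j ^ m"] by auto
  qed simp
  have 1: "degree (\<Prod>j\<in>{1..<Suc k}. yy j ^ a j) \<le> (\<Sum>j\<in>{1..<Suc k}. a j * dd j) \<and>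
    coeff (\<Prod>j\<in>{1..<Suc k}. yy j ^ a j) (\<Sum>j\<in>{1..<Suc k}. a j * dd j) = 1" if "k \<le> Suc n" for k
    using that
  proof (induction k)
    case (Suc k)
    have d: "degree (\<Prod>j\<in>{1..<Suc k}. yy j ^ a j) \<le> (\<Sum>j\<in>{1..<Suc k}. a j * dd j)"
      "coeff (\<Prod>j\<in>{1..<Suc k}. yy j ^ a j) (\<Sum>j\<in>{1..<Suc k}. a j * dd j) = 1" using Suc by auto
    have p: "degree (yy (Suc k) ^ a (Suc k)) \<le> a (Suc k) * dd (Suc k)" "coeff (yy (Suc k) ^ a (Suc k)) (a (Suc k) * dd (Suc k)) = 1"
      using pw[of "Suc k"] Suc.prems by auto
    have "(\<Prod>j\<in>{1..<Suc (Suc k)}. yy j ^ a j) = (\<Prod>j\<in>{1..<Suc k}. yy j ^ a j) * yy (Suc k) ^ a (Suc k)"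
      "(\<Sum>j\<in>{1..<Suc (Suc k)}. a j * dd j) = (\<Sum>j\<in>{1..<Suc k}. a j * dd j) + a (Suc k) * dd (Suc k)"
      by simp_all
    then show ?case using coeff_mult_top[OF d(1) p(1)] d p
      degree_mult_le[of "(\<Prod>j\<in>{1..<Suc k}. yy j ^ a j)" "yy (Suc k) ^ a (Suc k)"] by auto
  qed simp
  have M: "Mo a = [:[:0, 1:] ^ a 0:] * (\<Prod>j\<in>{1..<Suc (Suc n)}. yy j ^ a j)"
  proof -
    have "{..Suc n} = insert 0 {1..<Suc (Suc n)}" by auto
    then show ?thesis unfolding Mo_def by (simp add: poly_const_pow)
  qed
  have y: "ydeg a = (\<Sum>j\<in>{1..<Suc (Suc n)}. a j * dd j)"
    unfolding ydeg_def by (simp add: atLeastLessThanSuc_atLeastAtMost)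
  have "coeff (Mo a) (ydeg a) = [:0, 1:] ^ a 0" "degree (Mo a) \<le> ydeg a"
    unfolding M y using 1[of "Suc n"] degree_smult_le[of "[:0, 1:] ^ a 0" "\<Prod>j\<in>{1..<Suc (Suc n)}. yy j ^ a j"]
    by (simp_all del: prod.op_ivl_Suc sum.op_ivl_Suc)
  then show ?thesis by (simp add: monom_altdef)
qed

text \<open>For the largest degree in \<open>y\<close> that occurs, the exponents of
  \<open>y_1, ..., y_{n+1}\<close> are the mixed radix digits of this degree, and the exponent of
  \<open>x\<close> is seen in the leading coefficient. So one coefficient of the sum detects exactly
  one normal monomial.\<close>

lemma normal_independent:
  assumes A: "finite A" "\<forall>a\<in>A. nf a" and 0: "(\<Sum>a\<in>A. cst (\<kappa> a) * Mo a) = 0" and a: "a \<in> A"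
  shows "\<kappa> a = 0"
proof (rule ccontr)
  assume "\<kappa> a \<noteq> 0"
  define B where "B = {a\<in>A. \<kappa> a \<noteq> 0}"
  have B: "finite B" "B \<noteq> {}" "B \<subseteq> A" using A a \<open>\<kappa> a \<noteq> 0\<close> by (auto simp: B_def)
  define m where "m = Max (ydeg ` B)"
  have "m \<in> ydeg ` B" unfolding m_def by (rule Max_in) (use B in auto)
  then obtain s where s: "s \<in> B" "ydeg s = m" by blast
  have le: "ydeg b \<le> m" if "b \<in> B" for b unfolding m_def by (rule Max_ge) (use B that in auto)
  have "(\<Sum>a\<in>B. cst (\<kappa> a) * Mo a) = 0"
    using 0 sum.mono_neutral_left[OF A(1) B(3), of "\<lambda>a. cst (\<kappa> a) * Mo a"] by (auto simp: B_def)
  then have "coeff (coeff (\<Sum>a\<in>B. cst (\<kappa> a) * Mo a) m) (s 0) = 0" by simp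
  then have "(\<Sum>b\<in>B. \<kappa> b * coeff (coeff (Mo b) m) (s 0)) = 0" by (simp add: coeff_sum)
  moreover have "\<kappa> b * coeff (coeff (Mo b) m) (s 0) = (if b = s then \<kappa> s else 0)" if b: "b \<in> B" for b
  proof (cases "ydeg b = m")
    case True
    have nb: "nf b" "nf s" using b s A B by auto
    have "b j = s j" if "b 0 = s 0" for j
    proof (cases "j = 0 \<or> j > Suc n")
      case False
      show ?thesis
        by (rule radix_unique[of "Suc n"]) (use nb s True False in \<open>auto simp: nf_def ydeg_def\<close>)
    qed (use that nb in \<open>auto simp: nf_def\<close>)
    then have "b 0 = s 0 \<longleftrightarrow> b = s" by auto
    then show ?thesis using degree_Mo[of b] True by auto
  next
    case False
    then have "degree (Mo b) < m" using degree_Mo[of b] le[OF b] by linarith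
    then show ?thesis using False s by (auto simp: coeff_eq_0)
  qed
  ultimately have "\<kappa> s = 0" using B(1) s(1) by (simp add: sum.delta)
  then show False using s by (simp add: B_def)
qed

lemma curve_nz: "curve c \<Longrightarrow> j \<le> n \<Longrightarrow> c j \<noteq> 0"
proof (induction j rule: less_induct)
  case (less j)
  show ?case
  proof (cases "j = 0")
    case False
    have "(\<Prod>i<j. c i ^ be j i) \<noteq> 0" using less by (auto simp: prod_zero_iff)
    moreover have "c j ^ al j = th j * (\<Prod>i<j. c i ^ be j i)" using less False by (auto simp: curve_def)
    ultimately show ?thesis using th_nz[of j] al_pos[of j] False less.prems by (auto simp: zero_power)
  qed (use less in \<open>simp add: curve_def\<close>)
qed

lemma In_eq: "In c a = monom (\<Prod>j\<le>n. c j ^ a j) (a (Suc n))"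
proof -
  have "(\<Prod>j\<in>I. cc c j ^ a j) = [:\<Prod>j\<in>I. c j ^ a j:]" if "I \<subseteq> {..n}" for I
    using finite_subset[OF that finite_atMost] that
    by induction (auto simp: cc_def one_pCons poly_const_pow)
  from this[of "{..n}"] show ?thesis
    by (simp add: In_def cc_def monom_altdef)
qed

text \<open>The leading form of a monomial is a nonzero constant times the power of \<open>V\<close>
  given by its last exponent. Normal monomials with equal weight and equal last exponent coincide by
  \<open>uniq\<close>, so the powers of \<open>V\<close> separate them.\<close>

lemma Nrm_leading:
  assumes c: "curve c" and "finite A" "\<forall>a\<in>A. nf a"
    and 0: "(\<Sum>a\<in>A. if int (wt a) = d then smult (\<kappa> a) (In c a) else 0) = 0"
    and s: "s \<in> A" "int (wt s) = d"
  shows "\<kappa> s = 0"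
proof -
  have "(\<Sum>a\<in>A. coeff (if int (wt a) = d then smult (\<kappa> a) (In c a) else 0) (s (Suc n))) = 0"
    using arg_cong[OF 0, of "\<lambda>P. coeff P (s (Suc n))"] by (simp add: coeff_sum)
  moreover have "coeff (if int (wt a) = d then smult (\<kappa> a) (In c a) else 0) (s (Suc n)) =
      (if a = s then \<kappa> s * (\<Prod>j\<le>n. c j ^ s j) else 0)" if a: "a \<in> A" for a
  proof (cases "int (wt a) = d \<and> a (Suc n) = s (Suc n)")
    case True
    have na: "nf a" "nf s" using a s assms by auto
    have "wt a = wt s" using True s by simp
    then have "(\<Sum>j\<le>n. a j * om j) = (\<Sum>j\<le>n. s j * om j)" using True by (simp add: wt_def)
    then have e: "a j = s j" if "j \<le> n" for j
      by (intro uniq[where a = a and b = s, OF _ _ _ that]) (use na in \<open>auto simp: nf_def\<close>)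
    have "a j = s j" for j
    proof -
      consider "j \<le> n" | "j = Suc n" | "j > Suc n" by linarith
      then show ?thesis by cases (use e True na in \<open>auto simp: nf_def\<close>)
    qed
    then have "a = s" by blast
    then show ?thesis using s by (simp add: In_eq)
  qed (use s in \<open>auto simp: In_eq\<close>)
  ultimately have "\<kappa> s * (\<Prod>j\<le>n. c j ^ s j) = 0" using assms(2) s(1) by (simp add: sum.delta)
  then show ?thesis using curve_nz[OF c] by (auto simp: prod_zero_iff)
qed

subsection \<open>The filtration\<close>

lemma Fil_well_defined: assumes "curve c" "Fil c d 0 P" shows "P = 0"
proof -
  obtain A \<kappa> where A: "finite A" "\<forall>a\<in>A. nf a \<and> int (wt a) \<le> d" "0 = (\<Sum>a\<in>A. cst (\<kappa> a) * Mo a)"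
    "P = (\<Sum>a\<in>A. if int (wt a) = d then smult (\<kappa> a) (In c a) else 0)"
    using Fil_Nrm[OF assms] unfolding Nrm_def by blast
  have "\<kappa> a = 0" if "a \<in> A" for a by (rule normal_independent[OF A(1) _ A(3)[symmetric] that]) (use A(2) in auto)
  then show ?thesis unfolding A(4) by (intro sum.neutral) auto
qed

lemma Fil_monom: "int (wt a) \<le> d \<Longrightarrow> Fil c d (cst k * Mo a) (if int (wt a) = d then smult k (In c a) else 0)"
  using Fil_step[OF Fil_zero, of a d c k] by simp

lemma Fil_add: "Fil c d f P \<Longrightarrow> Fil c d g Q \<Longrightarrow> Fil c d (f + g) (P + Q)"
proof (induction rule: Fil.induct)
  case (Fil_step f P a k)
  show ?case using Fil.Fil_step[OF Fil_step.IH[OF Fil_step.prems] Fil_step.hyps(2), of k] by (simp only: add.assoc)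
qed simp

lemma Fil_sum: "(\<And>i. i \<in> I \<Longrightarrow> Fil c d (f i) (P i)) \<Longrightarrow> Fil c d (\<Sum>i\<in>I. f i) (\<Sum>i\<in>I. P i)"
  by (induction I rule: infinite_finite_induct) (auto intro: Fil_zero Fil_add)

lemma Fil_mult: "Fil c d f P \<Longrightarrow> Fil c e g Q \<Longrightarrow> Fil c (d + e) (f * g) (P * Q)"
proof (induction rule: Fil.induct)
  case Fil_zero
  then show ?case by (simp add: Fil.Fil_zero)
next
  case (Fil_step f P a k)
  have "Fil c (d + e) (cst k * Mo a * g) ((if int (wt a) = d then smult k (In c a) else 0) * Q)"
    using Fil_step.prems
  proof (induction rule: Fil.induct)
    case Fil_zero
    then show ?case by (simp add: Fil.Fil_zero)
  next
    case (Fil_step f' P' a' k')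
    let ?b = "\<lambda>i. a i + a' i"
    have "int (wt ?b) \<le> d + e" using \<open>int (wt a) \<le> d\<close> Fil_step.hyps by (simp add: wt_add)
    from Fil.Fil_step[OF Fil_step.IH this, of "k * k'"]
    have "Fil c (d + e) (cst (k * k') * Mo ?b + cst k * Mo a * f')
       ((if int (wt ?b) = d + e then smult (k * k') (In c ?b) else 0) + (if int (wt a) = d then smult k (In c a) else 0) * P')" .
    moreover have "cst (k * k') * Mo ?b + cst k * Mo a * f' = cst k * Mo a * (cst k' * Mo a' + f')"
    proof -
      have "cst (k * k') = cst k * cst k'" by simp
      then show ?thesis unfolding Mo_add by (simp only: algebra_simps)
    qed
    moreover have "(if int (wt ?b) = d + e then smult (k * k') (In c ?b) else 0) =
      (if int (wt a) = d then smult k (In c a) else 0) * (if int (wt a') = e then smult k' (In c a') else 0)"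
      using \<open>int (wt a) \<le> d\<close> Fil_step.hyps by (auto simp: wt_add In_add mult.commute)
    ultimately show ?case by (simp only: distrib_left)
  qed
  from Fil_add[OF this Fil_step.IH[OF Fil_step.prems]] show ?case by (simp only: distrib_right)
qed

lemma Fil_const: "Fil c 0 (cst k) [:k:]"
  using Fil_monom[of "\<lambda>_. 0" 0 c k] by (simp add: wt_zero Mo_zero In_zero)

lemma Fil_cmult: "Fil c d f P \<Longrightarrow> Fil c d (cst k * f) (smult k P)"
  using Fil_mult[OF Fil_const, of c d f P k] by simp

lemma Fil_diff: "Fil c d f P \<Longrightarrow> Fil c d g Q \<Longrightarrow> Fil c d (f - g) (P - Q)"
proof -
  assume "Fil c d f P" "Fil c d g Q"
  then have "Fil c d (f + cst (-1) * g) (P + smult (-1) Q)" by (intro Fil_add Fil_cmult)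
  moreover have "cst (-1) = -1" by (simp add: one_pCons)
  then have "cst (-1) * g = - g" by (simp only: mult_minus1)
  ultimately show ?thesis by simp
qed

lemma Fil_mono: "Fil c d f P \<Longrightarrow> d \<le> e \<Longrightarrow> Fil c e f (if d = e then P else 0)"
proof (induction rule: Fil.induct)
  case Fil_zero
  then show ?case by (simp add: Fil.Fil_zero)
next
  case (Fil_step f P a k)
  have "int (wt a) \<le> e" using Fil_step by simp
  then show ?case using Fil.Fil_step[OF Fil_step.IH[OF Fil_step.prems] \<open>int (wt a) \<le> e\<close>, of k] Fil_step.prems Fil_step.hyps
    by (auto split: if_splits)
qed

lemma Fil_less: "Fil c d f P \<Longrightarrow> d < e \<Longrightarrow> Fil c e f 0"
  using Fil_mono[of c d f P e] by simp

lemma Fil_le: "Fil c d f P \<Longrightarrow> d \<le> e \<Longrightarrow> \<exists>Q. Fil c e f Q"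
  using Fil_mono[of c d f P e] by blast

lemma Fil_yy: "j \<le> Suc n \<Longrightarrow> Fil c (int (om j)) (yy j) (cc c j)"
  using Fil_monom[of "ex1 j 1" "int (om j)" c 1] by (simp add: wt_ex1 Mo_ex1 In_ex1 flip: one_pCons)

lemma Fil_power: "Fil c d f P \<Longrightarrow> Fil c (int k * d) (f ^ k) (P ^ k)"
proof (induction k)
  case 0
  then show ?case using Fil_const[of c 1] by (simp flip: one_pCons)
next
  case (Suc k)
  show ?case using Fil_mult[OF Suc.prems Suc.IH[OF Suc.prems]] by (simp add: algebra_simps)
qed

lemma Fil_unique: "curve c \<Longrightarrow> Fil c d f P \<Longrightarrow> Fil c d f Q \<Longrightarrow> P = Q"
  using Fil_well_defined[of c d "P - Q"] Fil_diff[of c d f P f Q] by simp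

text \<open>Makes the filtration strict: in the expansion into normal monomials a vanishing leading
  form kills every coefficient of weight \<open>d\<close>. With multiplicativity of leading forms,
  the degree becomes a pole order.\<close>

lemma Fil_drop:
  assumes c: "curve c" and "Fil c d f 0" shows "\<exists>P. Fil c (d - 1) f P"
proof -
  obtain A \<kappa> where A: "finite A" "\<forall>a\<in>A. nf a \<and> int (wt a) \<le> d" "f = (\<Sum>a\<in>A. cst (\<kappa> a) * Mo a)"
    "0 = (\<Sum>a\<in>A. if int (wt a) = d then smult (\<kappa> a) (In c a) else 0)"
    using Fil_Nrm[OF assms] unfolding Nrm_def by blast
  have "\<kappa> a = 0" if "a \<in> A" "int (wt a) = d" for a
    by (rule Nrm_leading[OF c A(1) _ A(4)[symmetric] that]) (use A(2) in auto)
  then have "\<exists>P. Fil c (d - 1) (cst (\<kappa> a) * Mo a) P" if "a \<in> A" for a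
    using that Fil_monom[of a "d - 1" c "\<kappa> a"] Fil_zero[of c "d - 1"] A(2) by (cases "int (wt a) = d") force+
  then obtain P where P: "\<forall>a\<in>A. Fil c (d - 1) (cst (\<kappa> a) * Mo a) (P a)" by metis
  have "Fil c (d - 1) (\<Sum>a\<in>A. cst (\<kappa> a) * Mo a) (\<Sum>a\<in>A. P a)" by (rule Fil_sum) (use P in blast)
  then show ?thesis unfolding A(3) by blast
qed

lemma Fil_neg: "Fil c d f P \<Longrightarrow> d < 0 \<Longrightarrow> f = 0"
  by (induction rule: Fil.induct) auto

lemma Fil_exhaust: "\<exists>d P. d \<ge> 0 \<and> Fil c d f P"
proof (induction f)
  case 0
  show ?case using Fil_zero[of c 0] by blast
next
  case (pCons p f)
  have "\<exists>d P. d \<ge> 0 \<and> Fil c d [:p:] P"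
  proof (induction p)
    case 0
    show ?case using Fil_zero[of c 0] by auto
  next
    case (pCons k p)
    then obtain d P where d: "d \<ge> 0" "Fil c d [:p:] P" by blast
    have e: "[:pCons k p:] = cst k + PX * [:p:]" by simp
    have 1: "Fil c (int (om 0) + d) (PX * [:p:]) (cc c 0 * P)" using Fil_mult[OF Fil_yy[of 0 c] d(2)] by simp
    obtain Q where Q: "Fil c (int (om 0) + d) (cst k) Q" using Fil_le[OF Fil_const, of "int (om 0) + d"] d by auto
    show ?case unfolding e using Fil_add[OF Q 1] d by (intro exI[of _ "int (om 0) + d"]) auto
  qed
  then obtain d P where d: "d \<ge> 0" "Fil c d [:p:] P" by blast
  obtain e Q where e: "e \<ge> 0" "Fil c e f Q" using pCons by blast
  have eq: "pCons p f = [:p:] + PY * f" by simp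
  have 1: "Fil c (int (om 1) + e) (PY * f) (cc c 1 * Q)" using Fil_mult[OF Fil_yy[of 1 c] e(2)] by simp
  obtain R S where "Fil c (d + (int (om 1) + e)) (PY * f) R" "Fil c (d + (int (om 1) + e)) [:p:] S"
    using Fil_le[OF 1, of "d + (int (om 1) + e)"] Fil_le[OF d(2), of "d + (int (om 1) + e)"] d e by auto
  then have "Fil c (d + (int (om 1) + e)) ([:p:] + PY * f) (S + R)" by (intro Fil_add)
  then show ?case unfolding eq using d e by (intro exI[of _ "d + (int (om 1) + e)"] exI[of _ "S + R"]) simp
qed

text \<open>Descent by \<open>Fil_drop\<close>, which ends because negative degrees contain only
  0.\<close>

lemma Fil_degree:
  assumes c: "curve c" and "f \<noteq> 0" shows "\<exists>d P. d \<ge> 0 \<and> P \<noteq> 0 \<and> Fil c d f P"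
proof -
  have "\<exists>d P. P \<noteq> 0 \<and> Fil c d f P \<and> d \<ge> 0" if "Fil c (int k) f Q" for k Q
    using that
  proof (induction k arbitrary: Q)
    case 0
    show ?case
    proof (cases "Q = 0")
      case True
      then have "\<exists>P. Fil c (0 - 1) f P" using Fil_drop[OF c, of 0 f] 0 by simp
      then show ?thesis using Fil_neg assms(2) by force
    qed (use 0 in force)
  next
    case (Suc k)
    show ?case
    proof (cases "Q = 0")
      case True
      then obtain P where "Fil c (int (Suc k) - 1) f P" using Fil_drop[OF c, of "int (Suc k)" f] Suc.prems by blast
      then show ?thesis using Suc.IH[of P] by simp
    qed (use Suc in force)
  qed
  moreover obtain d P where "d \<ge> 0" "Fil c d f P" using Fil_exhaust by blast
  ultimately show ?thesis by (metis nonneg_int_cases)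
qed

lemma Fil_degree_le:
  assumes c: "curve c" and "Fil c d f P" "P \<noteq> 0" "Fil c e f Q" shows "d \<le> e"
proof (rule ccontr)
  assume "\<not> d \<le> e"
  then have "Fil c d f 0" using Fil_less[OF assms(4)] by simp
  then show False using Fil_unique[OF c assms(2)] assms(3) by blast
qed

text \<open>Degrees add, since leading forms multiply in the domain of polynomials in
  \<open>V\<close>.\<close>

lemma Fil_cancel:
  assumes c: "curve c" and G: "Fil c g G \<Gamma>" "\<Gamma> \<noteq> 0" and K: "Fil c (e + g) (K * G) \<Phi>"
  shows "\<exists>P. Fil c e K P"
proof (cases "K = 0")
  case True
  then show ?thesis using Fil_zero by blast
next
  case False
  then obtain d P where d: "P \<noteq> 0" "Fil c d K P" using Fil_degree[OF c] by blast
  have "d + g \<le> e + g" by (rule Fil_degree_le[OF c Fil_mult[OF d(2) G(1)] _ K]) (use d G in simp)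
  then show ?thesis using Fil_le[OF d(2)] by simp
qed

text \<open>Restricts the powers of \<open>V\<close> in a leading form: the remaining degree must
  lie in the semigroup generated by \<open>om 0, ..., om n\<close>.\<close>

lemma Fil_support:
  "Fil c d f P \<Longrightarrow> coeff P b \<noteq> 0 \<Longrightarrow> \<exists>h. int (\<Sum>j\<le>n. h j * om j) + int b * int (om (Suc n)) = d"
proof (induction rule: Fil.induct)
  case (Fil_step f P a k)
  show ?case
  proof (cases "coeff P b = 0")
    case True
    then have "int (wt a) = d" "a (Suc n) = b" using Fil_step.prems by (auto simp: In_eq split: if_splits)
    then show ?thesis by (intro exI[of _ a]) (auto simp: wt_def)
  qed (use Fil_step in blast)
qed simp

end

section \<open>The surface and its cone\<close>

lemma graded_power:
  assumes "graded H" "H d f" shows "H (k * d) (\<lambda>p. f p ^ k)"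
proof (induction k)
  case 0
  show ?case using gradedD(1)[OF assms(1), of 1] by simp
next
  case (Suc k)
  show ?case using gradedD(3)[OF assms(1), OF assms(2) Suc] by simp
qed

lemma graded_prod:
  assumes "graded H" "\<And>i. i \<in> I \<Longrightarrow> H (d i) (f i)" shows "H (\<Sum>i\<in>I. d i) (\<lambda>p. \<Prod>i\<in>I. f i p)"
  using assms(2)
proof (induction I rule: infinite_finite_induct)
  case (insert x F)
  have "H (d x + sum d F) (\<lambda>p. f x p * (\<Prod>i\<in>F. f i p))"
    by (rule gradedD(3)[OF assms(1)]) (use insert in auto)
  then show ?case using insert by simp
qed (use gradedD(1)[OF assms(1), of 1] in simp_all)

text \<open>Stated for an arbitrary graded family, to cover forms on the surface, bigraded forms on
  the product and polynomials in one variable.\<close>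

lemma whom_subst:
  assumes H: "graded H" and Z: "\<And>d. H d (\<lambda>_. 0)" and \<phi>: "\<And>i. i \<le> N \<Longrightarrow> H (a i) (\<phi> i)"
    and G: "whom N a d G"
  shows "H d (\<lambda>p. G (\<lambda>i. \<phi> i p))"
  using G
proof induction
  case whom_zero
  show ?case by (rule Z)
next
  case (whom_step f m c)
  have "H (\<Sum>i\<in>Poly_Mapping.keys m. Poly_Mapping.lookup m i * a i)
      (\<lambda>p. \<Prod>i\<in>Poly_Mapping.keys m. \<phi> i p ^ Poly_Mapping.lookup m i)"
  proof (rule graded_prod[OF H])
    fix i assume "i \<in> Poly_Mapping.keys m"
    then have "i \<le> N" using whom_step.hyps by auto
    show "H (Poly_Mapping.lookup m i * a i) (\<lambda>p. \<phi> i p ^ Poly_Mapping.lookup m i)"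
      by (rule graded_power[OF H \<phi>[OF \<open>i \<le> N\<close>]])
  qed
  then have "H d (\<lambda>p. \<Prod>i\<in>Poly_Mapping.keys m. \<phi> i p ^ Poly_Mapping.lookup m i)"
    using whom_step.hyps(3) by (simp add: mult.commute)
  from gradedD(3)[OF H, OF gradedD(1)[OF H, of c] this]
  have "H d (\<lambda>p. c * monom_val m (\<lambda>i. \<phi> i p))" by (simp add: monom_val_def)
  from gradedD(2)[OF H, OF this whom_step.IH] show ?case .
qed

lemma whom_poly:
  assumes "\<And>i. i \<le> N \<Longrightarrow> \<exists>p. \<forall>s. z s i = poly p s" "whom N a d G"
  shows "\<exists>p. \<forall>s. G (z s) = poly p (s::complex)"
proof -
  have "graded (\<lambda>(_::nat) f. \<exists>p. \<forall>s. f s = poly p (s::complex))"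
    unfolding graded_def
    apply (intro conjI allI impI)
      apply (rule exI[of _ "[:_:]"]) apply simp
     apply (elim exE)
     apply (rule_tac x = "p + pa" in exI) apply simp
    apply (elim exE)
    apply (rule_tac x = "p * pa" in exI) apply simp
    done
  moreover have "\<exists>p. \<forall>s. (0::complex) = poly p s" by (rule exI[of _ 0]) simp
  ultimately show ?thesis
    using whom_subst[of "\<lambda>(_::nat) f. \<exists>p. \<forall>s. f s = poly p (s::complex)" N a "\<lambda>i s. z s i" d G] assms by simp
qed

lemma ev_zero_iff: "(\<forall>p. ev f p = 0) \<longleftrightarrow> f = 0"
proof
  assume *: "\<forall>p. ev f p = 0"
  have 1: "\<And>x. poly f [:x:] = 0"
  proof -
    fix y show "poly f [:y:] = 0"
      using poly_all_0_iff_0[of "poly f [:y:]"] * by (auto simp: ev_def)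
  qed
  show "f = 0"
  proof (rule ccontr)
    assume "f \<noteq> 0"
    then have "finite {x. poly f x = 0}" by (rule poly_roots_finite)
    then have "finite ((\<lambda>x. [:x:]) ` (UNIV :: complex set))" by (rule finite_subset[rotated]) (use 1 in auto)
    then have "finite (UNIV :: complex set)" by (rule finite_imageD) (auto intro: inj_onI)
    then show False using infinite_UNIV_char_0 by blast
  qed
qed simp

lemma ev_eq_iff: "(\<forall>p. ev f p = ev g p) \<longleftrightarrow> f = g"
  using ev_zero_iff[of "f - g"] by simp

context keydata
begin

definition wts :: "nat \<Rightarrow> nat" where "wts i = (case i of 0 \<Rightarrow> 1 | Suc j \<Rightarrow> om j)"

lemma wts_simps [simp]: "wts 0 = 1" "wts (Suc j) = om j" by (simp_all add: wts_def)

definition eqn :: "nat \<Rightarrow> (nat \<Rightarrow> complex) \<Rightarrow> complex" where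
  "eqn k z = z 0 ^ (al k * om k - om (k + 1)) * z (k + 2)
       - (z (k + 1) ^ al k - th k * (\<Prod>j<k. z (j + 1) ^ be k j))"

definition ycone :: "(nat \<Rightarrow> complex) \<Rightarrow> bool" where
  "ycone z \<longleftrightarrow> (\<forall>i>n + 2. z i = 0) \<and> (\<exists>i\<le>n + 2. z i \<noteq> 0) \<and> (\<forall>k\<in>{1..n}. eqn k z = 0)"

definition Ypts :: "(nat \<Rightarrow> complex) set set" where
  "Ypts = {p \<in> wproj_pts (n + 2) wts. \<forall>z\<in>p. \<forall>k\<in>{1..n}. eqn k z = 0}"

definition Y :: "(nat \<Rightarrow> complex) set fspace" where
  "Y = subspace_of (wproj (n + 2) wts) Ypts"

abbreviation YH :: "nat \<Rightarrow> ((nat \<Rightarrow> complex) set \<Rightarrow> complex) \<Rightarrow> bool" where "YH \<equiv> hfun (n + 2) wts"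
abbreviation Hom :: "nat \<Rightarrow> ((nat \<Rightarrow> complex) \<Rightarrow> complex) \<Rightarrow> bool" where "Hom \<equiv> whom (n + 2) wts"

lemma presents_Y: "presents Y Ypts YH"
  unfolding Y_def by (rule presents_subspace[OF graded_hfun presents_wproj]) (auto simp: Ypts_def)

lemma pts_Y: "pts Y = Ypts" by (rule pts_presents[OF presents_Y graded_hfun])

lemma Hom_var: "i \<le> n + 2 \<Longrightarrow> Hom (wts i) (\<lambda>z. z i)"
  by (rule whom_var)

lemma Hom_eqn: assumes k: "k \<in> {1..n}" shows "Hom (al k * om k) (eqn k)"
proof -
  have 1: "Hom ((al k * om k - om (Suc k)) * 1 + om (Suc k)) (\<lambda>z. z 0 ^ (al k * om k - om (Suc k)) * z (Suc (Suc k)))"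
    by (intro whom_mult whom_power) (use Hom_var[of 0] Hom_var[of "Suc (Suc k)"] k in auto)
  have 2: "Hom (al k * om k) (\<lambda>z. z (Suc k) ^ al k)"
    by (intro whom_power) (use Hom_var[of "Suc k"] k in auto)
  have 3: "Hom (\<Sum>j<k. be k j * om j) (\<lambda>z. \<Prod>j<k. z (Suc j) ^ be k j)"
    by (intro whom_prod whom_power) (use Hom_var[of "Suc _"] k in auto)
  have e: "(al k * om k - om (Suc k)) * 1 + om (Suc k) = al k * om k" "(\<Sum>j<k. be k j * om j) = al k * om k"
    using om_less[of k] be_sum[of k] k by auto
  from whom_diff[OF 1[unfolded e] whom_diff[OF 2 whom_cmult[OF 3[unfolded e]]], of "th k"]
  show ?thesis by (simp add: eqn_def[abs_def])
qed

lemma cone_scale: assumes "ycone z" "c \<noteq> 0" shows "ycone (\<lambda>i. c ^ wts i * z i)"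
  using assms whom_scale[OF Hom_eqn] unfolding ycone_def by auto

lemma Ypts_eq: "Ypts = {worbit wts z | z. ycone z}"
proof (intro set_eqI iffI)
  fix p assume "p \<in> Ypts"
  then obtain z where "p = worbit wts z" "\<forall>i>n+2. z i = 0" "\<exists>i\<le>n+2. z i \<noteq> 0" "\<forall>z\<in>p. \<forall>k\<in>{1..n}. eqn k z = 0"
    unfolding Ypts_def wproj_pts_def by blast
  then show "p \<in> {worbit wts z | z. ycone z}" using worbit_self[of z wts] unfolding ycone_def by blast
next
  fix p assume "p \<in> {worbit wts z | z. ycone z}"
  then obtain z where z: "p = worbit wts z" "ycone z" by blast
  have "ycone u" if "u \<in> p" for u using that z cone_scale unfolding z worbit_def by blast
  then show "p \<in> Ypts" using z unfolding Ypts_def wproj_pts_def ycone_def by blast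
qed

lemma rep_cone: assumes "p \<in> Ypts" shows "ycone (rep p)" "worbit wts (rep p) = p"
proof -
  obtain z where z: "p = worbit wts z" "ycone z" using assms unfolding Ypts_eq by blast
  then show "worbit wts (rep p) = p" using worbit_rep by simp
  show "ycone (rep p)" using rep_worbit[of wts z] cone_scale z by metis
qed

section \<open>Affine points and points at infinity\<close>

definition zc :: "complex \<times> complex \<Rightarrow> nat \<Rightarrow> complex" where
  "zc xy i = (case i of 0 \<Rightarrow> 1 | Suc j \<Rightarrow> if j \<le> Suc n then ev (yy j) xy else 0)"

lemma zc_0 [simp]: "zc xy 0 = 1" and zc_Suc [simp]: "j \<le> Suc n \<Longrightarrow> zc xy (Suc j) = ev (yy j) xy"
  by (simp_all add: zc_def)

definition zi :: "(nat \<Rightarrow> complex) \<Rightarrow> complex \<Rightarrow> nat \<Rightarrow> complex" where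
  "zi c V i = (case i of 0 \<Rightarrow> 0 | Suc j \<Rightarrow> if j \<le> n then c j else if j = Suc n then V else 0)"

definition pt :: "complex \<times> complex \<Rightarrow> (nat \<Rightarrow> complex) set" where "pt xy = worbit wts (zc xy)"

lemma cone_zc: "ycone (zc xy)"
  unfolding ycone_def
proof (intro conjI ballI allI impI)
  show "\<exists>i\<le>n + 2. zc xy i \<noteq> 0" by (rule exI[of _ 0]) simp
  fix i assume "i > n + 2" then show "zc xy i = 0" by (cases i) (auto simp: zc_def)
next
  fix k assume "k \<in> {1..n}"
  then show "eqn k (zc xy) = 0" using arg_cong[OF yy_Suc[of k], of "\<lambda>f. ev f xy"] by (simp add: eqn_def)
qed

text \<open>Where \<open>w\<close> is nonzero, the equations can be solved for
  \<open>y_2, ..., y_{n+1}\<close> one after the other; so this part of the surface is a plane with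
  coordinates \<open>x, y\<close>.\<close>

lemma cone_affine:
  assumes "ycone z" "z 0 \<noteq> 0"
  shows "z = (\<lambda>i. z 0 ^ wts i * zc (z 1 / z 0 ^ om 0, z 2 / z 0 ^ om 1) i)"
proof -
  let ?xy = "(z 1 / z 0 ^ om 0, z 2 / z 0 ^ om 1)"
  have 1: "z (Suc k) = z 0 ^ om k * ev (yy k) ?xy" if "k \<le> Suc n" for k
    using that
  proof (induction k rule: less_induct)
    case (less k)
    consider "k = 0" | "k = 1" | j where "k = Suc j" "1 \<le> j" "j \<le> n" using less.prems by (cases k; force)
    then show ?case
    proof cases
      case 3
      have "eqn j z = 0" using assms 3 unfolding ycone_def by auto
      then have e: "z 0 ^ (al j * om j - om (Suc j)) * z (Suc (Suc j)) = z (Suc j) ^ al j - th j * (\<Prod>i<j. z (Suc i) ^ be j i)"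
        by (simp add: eqn_def)
      have e1: "z (Suc j) = z 0 ^ om j * ev (yy j) ?xy" by (rule less.IH) (use 3 in simp_all)
      have "(\<Prod>i<j. z (Suc i) ^ be j i) = (\<Prod>i<j. z 0 ^ (be j i * om i) * ev (yy i) ?xy ^ be j i)"
      proof (rule prod.cong)
        fix i assume "i \<in> {..<j}"
        then have "z (Suc i) = z 0 ^ om i * ev (yy i) ?xy" by (intro less.IH) (use 3 in simp_all)
        then show "z (Suc i) ^ be j i = z 0 ^ (be j i * om i) * ev (yy i) ?xy ^ be j i"
          by (simp only: power_mult_distrib power_mult[symmetric] mult.commute)
      qed simp
      also have "\<dots> = z 0 ^ (al j * om j) * (\<Prod>i<j. ev (yy i) ?xy ^ be j i)"
        using be_sum[of j] 3 by (simp add: prod.distrib flip: power_sum)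
      finally have e2: "(\<Prod>i<j. z (Suc i) ^ be j i) = z 0 ^ (al j * om j) * (\<Prod>i<j. ev (yy i) ?xy ^ be j i)" .
      have e3: "(z 0 ^ om j) ^ al j = z 0 ^ (al j * om j)" by (simp add: mult.commute flip: power_mult)
      have e4: "z 0 ^ (al j * om j) = z 0 ^ (al j * om j - om (Suc j)) * z 0 ^ om (Suc j)"
        using om_less[of j] 3 by (simp flip: power_add)
      have e5: "ev (yy (Suc j)) ?xy = ev (yy j) ?xy ^ al j - th j * (\<Prod>i<j. ev (yy i) ?xy ^ be j i)"
        using yy_Suc[of j] 3 by simp
      have "z 0 ^ (al j * om j - om (Suc j)) * z (Suc (Suc j)) =
        (z 0 ^ om j * ev (yy j) ?xy) ^ al j - th j * (z 0 ^ (al j * om j) * (\<Prod>i<j. ev (yy i) ?xy ^ be j i))"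
        using e unfolding e2 by (simp only: e1)
      also have "\<dots> = z 0 ^ (al j * om j) * ev (yy (Suc j)) ?xy"
        unfolding e5 power_mult_distrib e3 by (simp add: algebra_simps)
      also have "\<dots> = z 0 ^ (al j * om j - om (Suc j)) * (z 0 ^ om (Suc j) * ev (yy (Suc j)) ?xy)"
        by (simp only: e4 mult.assoc)
      finally show ?thesis using assms(2) unfolding 3(1) by (simp only: mult_cancel_left power_not_zero simp_thms)
    qed (use assms(2) in \<open>auto simp: numeral_2_eq_2\<close>)
  qed
  show ?thesis
  proof
    fix i show "z i = z 0 ^ wts i * zc ?xy i"
    proof (cases i)
      case (Suc j)
      then show ?thesis using 1[of j] assms by (cases "j \<le> Suc n") (auto simp: zc_def ycone_def)
    qed simp
  qed
qed

lemma pt_Y: "pt xy \<in> Ypts"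
  unfolding Ypts_eq pt_def using cone_zc by blast

lemma affine_pt: assumes "p \<in> Ypts" "rep p 0 \<noteq> 0"
  shows "p = pt (rep p 1 / rep p 0 ^ om 0, rep p 2 / rep p 0 ^ om 1)"
proof -
  have "worbit wts (rep p) = pt (rep p 1 / rep p 0 ^ om 0, rep p 2 / rep p 0 ^ om 1)"
    unfolding pt_def by (subst cone_affine[OF rep_cone(1)[OF assms(1)] assms(2)]) (simp add: worbit_scale assms(2))
  then show ?thesis using rep_cone(2)[OF assms(1)] by simp
qed

lemma rep_pt: "\<exists>c. c \<noteq> 0 \<and> rep (pt xy) = (\<lambda>i. c ^ wts i * zc xy i)"
  unfolding pt_def by (rule rep_worbit)

lemma rep_pt_0: "rep (pt xy) 0 \<noteq> 0"
  using rep_pt[of xy] by auto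

lemma coords_pt: "(rep (pt xy) 1 / rep (pt xy) 0 ^ om 0, rep (pt xy) 2 / rep (pt xy) 0 ^ om 1) = xy"
proof -
  obtain c where "c \<noteq> 0" "rep (pt xy) = (\<lambda>i. c ^ wts i * zc xy i)" using rep_pt by blast
  then show ?thesis by (simp add: numeral_2_eq_2 zc_def)
qed

lemma pt_inj: "pt xy = pt uv \<Longrightarrow> xy = uv"
  using coords_pt[of xy] coords_pt[of uv] by simp

text \<open>Links forms with the filtration: on \<open>w = 1\<close> a form of degree
  \<open>d\<close> is a polynomial of degree at most \<open>d\<close>, and on the line at infinity
  above \<open>c\<close> it is the leading form. A term divisible by \<open>w\<close> has smaller
  weight on one side and vanishes on the other.\<close>

lemma Hom_Fil:
  assumes "Hom d h" and c: "curve c"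
  shows "\<exists>f P. Fil c (int d) f P \<and> (\<forall>xy. ev f xy = h (zc xy)) \<and> (\<forall>V. poly P V = h (zi c V))"
  using assms(1)
proof induction
  case whom_zero
  show ?case by (rule exI[of _ 0], rule exI[of _ 0]) (simp add: Fil_zero)
next
  case (whom_step h m k)
  then obtain f P where f: "Fil c (int d) f P" "\<forall>xy. ev f xy = h (zc xy)" "\<forall>V. poly P V = h (zi c V)" by blast
  define a where "a j = Poly_Mapping.lookup m (Suc j)" for j
  have m: "Poly_Mapping.keys m \<subseteq> {..Suc (Suc n)}" using whom_step.hyps(2) by simp
  have d: "d = Poly_Mapping.lookup m 0 + wt a"
  proof -
    have "d = (\<Sum>i\<le>Suc (Suc n). wts i * Poly_Mapping.lookup m i)"
      unfolding whom_step.hyps(3)[symmetric] by (rule weight_superset) (use m in auto)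
    also have "\<dots> = Poly_Mapping.lookup m 0 + (\<Sum>j\<le>Suc n. om j * Poly_Mapping.lookup m (Suc j))"
      by (subst sum.atMost_Suc_shift) simp
    finally show ?thesis by (simp add: wt_def a_def mult.commute)
  qed
  have e1: "monom_val m (zc xy) = ev (Mo a) xy" for xy
  proof -
    have "monom_val m (zc xy) = (\<Prod>i\<le>Suc (Suc n). zc xy i ^ Poly_Mapping.lookup m i)"
      by (rule monom_val_superset) (use m in auto)
    also have "\<dots> = (\<Prod>j\<le>Suc n. zc xy (Suc j) ^ a j)" by (subst prod.atMost_Suc_shift) (simp add: a_def)
    also have "\<dots> = ev (Mo a) xy" by (simp add: Mo_def)
    finally show ?thesis .
  qed
  have e2: "monom_val m (zi c V) = (if int (wt a) = int d then poly (In c a) V else 0)" for V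
  proof -
    have "monom_val m (zi c V) = (\<Prod>i\<le>Suc (Suc n). zi c V i ^ Poly_Mapping.lookup m i)"
      by (rule monom_val_superset) (use m in auto)
    also have "\<dots> = 0 ^ Poly_Mapping.lookup m 0 * (\<Prod>j\<le>Suc n. zi c V (Suc j) ^ a j)"
      by (subst prod.atMost_Suc_shift) (simp add: a_def zi_def)
    also have "(\<Prod>j\<le>Suc n. zi c V (Suc j) ^ a j) = poly (In c a) V"
      unfolding In_def poly_prod by (rule prod.cong) (auto simp: zi_def cc_def)
    finally show ?thesis using d by (simp add: zero_power)
  qed
  have "Fil c (int d) (cst k * Mo a + f) ((if int (wt a) = int d then smult k (In c a) else 0) + P)"
    by (rule Fil_step[OF f(1)]) (use d in simp)
  then show ?case using f e1 e2
    by (intro exI[of _ "cst k * Mo a + f"] exI[of _ "(if int (wt a) = int d then smult k (In c a) else 0) + P"])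
      (simp split: if_splits)
qed

lemma curve_exists: "\<exists>c. curve c"
proof -
  have "\<exists>c. c 0 = 1 \<and> (\<forall>k\<in>{1..m}. c k ^ al k = th k * (\<Prod>j<k. c j ^ be k j))" if "m \<le> n" for m
    using that
  proof (induction m)
    case 0
    show ?case by (rule exI[of _ "\<lambda>_. 1"]) simp
  next
    case (Suc m)
    then obtain c where c: "c 0 = 1" "\<forall>k\<in>{1..m}. c k ^ al k = th k * (\<Prod>j<k. c j ^ be k j)" by auto
    obtain w where w: "th (Suc m) * (\<Prod>j<Suc m. c j ^ be (Suc m) j) = w ^ al (Suc m)"
      using exists_complex_root[of "al (Suc m)"] al_pos[of "Suc m"] Suc.prems by (metis One_nat_def Suc_le_mono bot_nat_0.extremum not_less_zero)
    let ?c = "c(Suc m := w)"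
    have p: "(\<Prod>j<k. ?c j ^ be k j) = (\<Prod>j<k. c j ^ be k j)" if "k \<le> Suc m" for k
      by (rule prod.cong) (use that in auto)
    show ?case
    proof (intro exI[of _ ?c] conjI ballI)
      fix k assume k: "k \<in> {1..Suc m}"
      show "?c k ^ al k = th k * (\<Prod>j<k. ?c j ^ be k j)"
        using p[of k] k c w by (cases "k = Suc m") (auto simp del: prod.lessThan_Suc)
    qed (use c in simp)
  qed
  from this[of n] show ?thesis unfolding curve_def by blast
qed

lemma cone_curve:
  assumes z: "ycone z" "z 0 = 0" "z 1 = 1" shows "curve (\<lambda>j. z (Suc j))"
  unfolding curve_def
proof (intro conjI ballI)
  fix k assume k: "k \<in> {1..n}"
  then have "eqn k z = 0" using z unfolding ycone_def by blast
  moreover have "(0::complex) ^ (al k * om k - om (Suc k)) = 0" using om_less[of k] k by (simp add: zero_power)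
  ultimately show "z (Suc k) ^ al k = th k * (\<Prod>j<k. z (Suc j) ^ be k j)" using z by (simp add: eqn_def)
qed (use z in simp)

text \<open>Describes the point at infinity that lies on no line above a curve \<open>c\<close>:
  once \<open>y_0 = 0\<close>, each equation makes a power of \<open>y_k\<close> a multiple of some
  earlier coordinate.\<close>

lemma cone_vertex:
  assumes z: "ycone z" "z 0 = 0" "z 1 = 0" "k \<le> n" shows "z (Suc k) = 0"
  using z(4)
proof (induction k rule: less_induct)
  case (less k)
  show ?case
  proof (cases "k = 0")
    case False
    then have k: "k \<in> {1..n}" using less.prems by auto
    then have "eqn k z = 0" using z unfolding ycone_def by blast
    moreover have "(0::complex) ^ (al k * om k - om (Suc k)) = 0" using om_less[of k] k by (simp add: zero_power)
    ultimately have e: "z (Suc k) ^ al k = th k * (\<Prod>j<k. z (Suc j) ^ be k j)" using z by (simp add: eqn_def)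
    have "(\<Sum>j<k. be k j * om j) \<noteq> 0" using be_sum[of k] al_pos[of k] om_pos[of k] k by auto
    then obtain j where "j < k" "be k j \<noteq> 0" by auto
    then have "(\<Prod>j<k. z (Suc j) ^ be k j) = 0" using less by (auto simp: prod_zero_iff intro!: bexI[of _ j])
    then have "z (Suc k) ^ al k = 0" using e by (simp only: mult_zero_right)
    then show ?thesis by simp
  qed (use z in simp)
qed

text \<open>Density of the affine part, on the level of the cone. At infinity with
  \<open>y_0\<close> nonzero the point is rescaled to \<open>y_0 = 1\<close>, where the form takes
  values of the leading form of the zero polynomial. The vertex is a limit of such points.\<close>

lemma Hom_vanish:
  assumes h: "Hom d h" "\<And>xy. h (zc xy) = 0" and z: "ycone z"
  shows "h z = 0"
proof -
  have inf: "h (zi c V) = 0" if "curve c" for c V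
  proof -
    obtain f P where f: "Fil c (int d) f P" "\<forall>xy. ev f xy = h (zc xy)" "\<forall>V. poly P V = h (zi c V)"
      using Hom_Fil[OF h(1) \<open>curve c\<close>] by blast
    then have "f = 0" using h(2) ev_zero_iff[of f] by simp
    then have "P = 0" using Fil_well_defined[OF \<open>curve c\<close>] f(1) by blast
    then show ?thesis using f(3)[rule_format, of V] by simp
  qed
  show ?thesis
  proof (cases "z 0 = 0")
    case False
    then show ?thesis using cone_affine[OF z] whom_scale[OF h(1)] h(2) by (metis mult_zero_right)
  next
    case z0: True
    show ?thesis
    proof (cases "z 1 = 0")
      case False
      obtain s where s: "1 / z 1 = s ^ om 0" using exists_complex_root[of "om 0" "1 / z 1"] om_pos[of 0] by auto
      have "s \<noteq> 0" using s False om_pos[of 0] by (auto simp: zero_power)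
      let ?u = "\<lambda>i. s ^ wts i * z i"
      have u: "ycone ?u" by (rule cone_scale[OF z \<open>s \<noteq> 0\<close>])
      have "curve (\<lambda>j. ?u (Suc j))" by (rule cone_curve[OF u]) (use z0 s False in \<open>auto simp flip: s\<close>)
      from inf[OF this, of "?u (Suc (Suc n))"] have "h ?u = 0"
      proof -
        have "zi (\<lambda>j. ?u (Suc j)) (?u (Suc (Suc n))) = ?u"
          using z z0 by (auto simp: zi_def fun_eq_iff ycone_def split: nat.split)
        then show ?thesis using inf[OF \<open>curve (\<lambda>j. ?u (Suc j))\<close>, of "?u (Suc (Suc n))"] by simp
      qed
      then show ?thesis using whom_scale[OF h(1), of s z] \<open>s \<noteq> 0\<close> by simp
    next
      case True
      obtain c where c: "curve c" using curve_exists by blast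
      define V where "V = z (Suc (Suc n))"
      \<comment> \<open>A curve through the vertex at \<open>s = 0\<close>; for every other
        \<open>s\<close> its point is, up to scaling, on the line at infinity above
        \<open>c\<close>. The form is polynomial in \<open>s\<close> along it.\<close>
      define u where "u s i = (if i = 0 then 0 else if i \<le> Suc n then s ^ wts i * c (i - 1) else if i = Suc (Suc n) then V else 0)" for s i
      have "u 0 = z"
      proof
        fix i show "u 0 i = z i"
        proof (cases "i \<le> Suc n")
          case i: True
          show ?thesis
          proof (cases i)
            case (Suc j)
            then show ?thesis using cone_vertex[OF z z0 True, of j] i om_pos[of j] by (simp add: u_def zero_power)
          qed (use z0 in \<open>simp add: u_def\<close>)
        next
          case False
          then show ?thesis using z by (auto simp: u_def V_def ycone_def)
        qed
      qed
      have "\<exists>p. \<forall>s. u s i = poly p s" for i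
        by (rule exI[of _ "if i = 0 then 0 else if i \<le> Suc n then monom (c (i - 1)) (wts i) else if i = Suc (Suc n) then [:V:] else 0"])
          (auto simp: u_def poly_monom)
      then obtain p where p: "\<forall>s. h (u s) = poly p s" using whom_poly[OF _ h(1), of u] by blast
      have "poly p s = 0" if "s \<noteq> 0" for s
      proof -
        have "u s = (\<lambda>i. s ^ wts i * zi c (V / s ^ om (Suc n)) i)"
          using that by (auto simp: u_def zi_def fun_eq_iff split: nat.split)
        then show ?thesis using p whom_scale[OF h(1)] inf[OF c] by (metis mult_zero_right)
      qed
      then have "UNIV - {0} \<subseteq> {s. poly p s = 0}" by auto
      moreover have "infinite (UNIV - {0 :: complex})" by (simp add: infinite_UNIV_char_0)
      ultimately have "p = 0" using poly_roots_finite[of p] finite_subset by blast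
      then show ?thesis using p \<open>u 0 = z\<close> by (metis poly_0)
    qed
  qed
qed

lemma Hom_eq: "Hom d h \<Longrightarrow> Hom d g \<Longrightarrow> (\<And>xy. h (zc xy) = g (zc xy)) \<Longrightarrow> ycone z \<Longrightarrow> h z = g z"
  using Hom_vanish[OF whom_diff[of _ _ d h g], of z] by simp

subsection \<open>Maps given by weighted homogeneous coordinates\<close>

definition hmap :: "(nat \<Rightarrow> (nat \<Rightarrow> complex) \<Rightarrow> complex) \<Rightarrow> (nat \<Rightarrow> complex) set \<Rightarrow> (nat \<Rightarrow> complex) set" where
  "hmap \<Phi> p = worbit wts (\<lambda>i. if i \<le> n + 2 then \<Phi> i (rep p) else 0)"

lemma hmap_worbit:
  assumes "\<And>i. i \<le> n + 2 \<Longrightarrow> Hom (wts i) (\<Phi> i)"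
  shows "hmap \<Phi> (worbit wts z) = worbit wts (\<lambda>i. if i \<le> n + 2 then \<Phi> i z else 0)"
proof -
  obtain c where c: "c \<noteq> 0" "rep (worbit wts z) = (\<lambda>i. c ^ wts i * z i)" using rep_worbit by blast
  have "(\<lambda>i. if i \<le> n + 2 then \<Phi> i (rep (worbit wts z)) else 0) = (\<lambda>i. c ^ wts i * (if i \<le> n + 2 then \<Phi> i z else 0))"
    using whom_scale[OF assms] c by auto
  then show ?thesis unfolding hmap_def using worbit_scale[OF c(1)] by simp
qed

text \<open>The source is any presented space, so that this serves for automorphisms of the surface
  as well as for actions of the group on it.\<close>

lemma Ypts_pullback:
  assumes H: "graded H" "\<And>d. H d (\<lambda>_. 0)" and \<Phi>: "\<And>i. i \<le> n + 2 \<Longrightarrow> H (wts i) (\<Phi> i)"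
    and Yf: "presents Z S H"
    and im: "\<And>p. p \<in> S \<Longrightarrow> ycone (\<lambda>i. if i \<le> n + 2 then \<Phi> i p else 0)"
  shows "morphism Z Y (\<lambda>p. worbit wts (\<lambda>i. if i \<le> n + 2 then \<Phi> i p else 0))"
proof -
  let ?z = "\<lambda>p i. if i \<le> n + 2 then \<Phi> i p else 0"
  have "\<exists>c. c \<noteq> 0 \<and> rep (worbit wts (?z p)) = (\<lambda>i. c ^ wts i * ?z p i)" for p by (rule rep_worbit)
  then obtain c where c: "\<And>p. c p \<noteq> 0" "\<And>p. rep (worbit wts (?z p)) = (\<lambda>i. c p ^ wts i * ?z p i)" by metis
  show ?thesis
  proof (rule morphismI[OF Yf H(1) presents_Y graded_hfun, where c = c])
    fix p assume "p \<in> S" then show "worbit wts (?z p) \<in> Ypts" using im unfolding Ypts_eq by blast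
  next
    fix d G assume "YH d G"
    then obtain g where g: "Hom d g" "G = (\<lambda>p. g (rep p))" unfolding hfun_def by blast
    have "H d (\<lambda>p. g (\<lambda>i. ?z p i))" by (rule whom_subst[OF H _ g(1)]) (use \<Phi> in auto)
    then show "\<exists>G'. H d G' \<and> (\<forall>p\<in>S. G (worbit wts (?z p)) = c p ^ d * G' p)"
      by (intro exI[of _ "\<lambda>p. g (?z p)"] conjI ballI) (simp_all only: g(2) c(2) whom_scale[OF g(1)])
  qed (use c in auto)
qed

lemma YH_zero: "YH d (\<lambda>_. 0)" using hfunI[OF whom_zero] .

lemma hmap_morphism:
  assumes \<Phi>: "\<And>i. i \<le> n + 2 \<Longrightarrow> Hom (wts i) (\<Phi> i)"
    and im: "\<And>z. ycone z \<Longrightarrow> ycone (\<lambda>i. if i \<le> n + 2 then \<Phi> i z else 0)"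
  shows "morphism Y Y (hmap \<Phi>)"
  unfolding hmap_def[abs_def]
  by (rule Ypts_pullback[OF graded_hfun YH_zero, of "\<lambda>i p. \<Phi> i (rep p)", OF hfunI[OF \<Phi>] presents_Y])
    (use im rep_cone in auto)

end

section \<open>Actions induced by triangular actions on the plane\<close>

context keydata
begin

text \<open>\<open>e + sI k\<close> bounds the degree of the change of \<open>yy k\<close> under a
  triangular map of weight \<open>e\<close>: passing from \<open>k\<close> to \<open>Suc k\<close>
  multiplies by \<open>yy k ^ (al k - 1)\<close>. The value at 0 is set so that a change of
  \<open>x\<close> by \<open>y^i\<close> has weight \<open>e = (i + 1) * om 1 - om 0\<close> and a
  change of \<open>y\<close> by a constant has weight 0.\<close>

definition sI :: "nat \<Rightarrow> int" where
  "sI k = (if k = 0 then int (om 0) - int (om 1) else (\<Sum>j\<in>{1..<k}. (int (al j) - 1) * int (om j)))"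

lemma sI_0: "sI 0 = int (om 0) - int (om 1)" and sI_1: "sI (Suc 0) = 0"
  and sI_Suc: "1 \<le> k \<Longrightarrow> sI (Suc k) = sI k + (int (al k) - 1) * int (om k)"
  by (simp_all add: sI_def)

text \<open>The inequality \<open>om (Suc k) < al k * om k\<close> says exactly that
  \<open>sI k - om k\<close> grows with \<open>k\<close>. Therefore the degree condition at
  \<open>y_{n+1}\<close> implies the conditions at all other coordinates.\<close>

lemma sI_step: "1 \<le> k \<Longrightarrow> k \<le> n \<Longrightarrow> sI k - int (om k) < sI (Suc k) - int (om (Suc k))"
proof -
  assume k: "1 \<le> k" "k \<le> n"
  have "int (om (Suc k)) < int (al k) * int (om k)" using om_less[OF k] by (simp flip: of_nat_mult)
  then show ?thesis using sI_Suc[OF k(1)] by (simp add: algebra_simps)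
qed

lemma sI_less: "1 \<le> j \<Longrightarrow> j < k \<Longrightarrow> k \<le> Suc n \<Longrightarrow> sI j - int (om j) < sI k - int (om k)"
proof (induction k)
  case (Suc k)
  then show ?case using sI_step[of k] by (cases "j = k") auto
qed simp

lemma sI_less0: "j < k \<Longrightarrow> 2 \<le> k \<Longrightarrow> k \<le> Suc n \<Longrightarrow> sI j - int (om j) < sI k - int (om k)"
  using sI_less[of j k] sI_less[of 1 k] by (cases "j = 0") (auto simp: sI_0 sI_1)

lemma sI_le: "j \<le> k \<Longrightarrow> k \<le> Suc n \<Longrightarrow> sI j - int (om j) \<le> sI k - int (om k)"
proof -
  assume *: "j \<le> k" "k \<le> Suc n"
  consider "j = k" | "j < k" "2 \<le> k" | "j = 0" "k = 1" using * by linarith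
  then show ?thesis using sI_less0[of j k] * by cases (auto simp: sI_0 sI_1)
qed

text \<open>Polynomial in the time \<open>t\<close> and of degree at most \<open>d\<close> in the
  point. The witness is a bigraded form because these forms become the homogeneous coordinates of
  the extended action.\<close>

definition TF :: "int \<Rightarrow> (complex \<times> complex \<Rightarrow> complex \<times> complex \<Rightarrow> complex) \<Rightarrow> bool" where
  "TF d \<phi> \<longleftrightarrow> (if d < 0 then (\<forall>t xy. \<phi> t xy = 0)
     else \<exists>\<Phi>. bigraded pfun Hom (nat d) \<Phi> \<and> (\<forall>t xy. \<phi> t xy = \<Phi> (t, zc xy)))"

lemma TF_zero: "TF d (\<lambda>_ _. 0)"
  unfolding TF_def using bigraded_zero[of pfun Hom "nat d"] by auto

lemma TF_add: "TF d \<phi> \<Longrightarrow> TF d \<psi> \<Longrightarrow> TF d (\<lambda>t xy. \<phi> t xy + \<psi> t xy)"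
proof (cases "d < 0")
  case False
  assume "TF d \<phi>" "TF d \<psi>"
  then obtain \<Phi> \<Psi> where *: "bigraded pfun Hom (nat d) \<Phi>" "\<forall>t xy. \<phi> t xy = \<Phi> (t, zc xy)"
    "bigraded pfun Hom (nat d) \<Psi>" "\<forall>t xy. \<psi> t xy = \<Psi> (t, zc xy)" unfolding TF_def using False by auto
  show ?thesis using bigraded_add[OF *(1,3)] *(2,4) False unfolding TF_def by auto
qed (auto simp: TF_def)

lemma TF_mult: "TF d \<phi> \<Longrightarrow> TF e \<psi> \<Longrightarrow> TF (d + e) (\<lambda>t xy. \<phi> t xy * \<psi> t xy)"
proof (cases "d < 0 \<or> e < 0")
  case True
  assume "TF d \<phi>" "TF e \<psi>"
  then have "(\<lambda>t xy. \<phi> t xy * \<psi> t xy) = (\<lambda>_ _. 0)" using True unfolding TF_def by (auto simp: fun_eq_iff)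
  then show ?thesis using TF_zero by simp
next
  case False
  assume "TF d \<phi>" "TF e \<psi>"
  then obtain \<Phi> \<Psi> where *: "bigraded pfun Hom (nat d) \<Phi>" "\<forall>t xy. \<phi> t xy = \<Phi> (t, zc xy)"
    "bigraded pfun Hom (nat e) \<Psi>" "\<forall>t xy. \<psi> t xy = \<Psi> (t, zc xy)" unfolding TF_def using False by auto
  have "bigraded pfun Hom (nat (d + e)) (\<lambda>z. \<Phi> z * \<Psi> z)"
    using bigraded_mult[OF graded_pfun graded_whom *(1,3)] False by (simp add: nat_add_distrib)
  then show ?thesis using *(2,4) False unfolding TF_def by auto
qed

lemma TF_Hom: assumes "pfun a" "Hom d h" shows "TF (int d) (\<lambda>t xy. a t * h (zc xy))"
  using bigraded_prod[of pfun a Hom d h, OF assms] unfolding TF_def by auto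

lemma TF_pfun: "pfun a \<Longrightarrow> TF 0 (\<lambda>t xy. a t)"
  using TF_Hom[of a 0 "\<lambda>_. 1"] gradedD(1)[OF graded_whom, of "n + 2" wts 1] by simp

lemma TF_yy: "j \<le> Suc n \<Longrightarrow> TF (int (om j)) (\<lambda>t xy. ev (yy j) xy)"
  using TF_Hom[of "\<lambda>_. 1" "om j" "\<lambda>z. z (Suc j)"] Hom_var[of "Suc j"] pfun_const[of 1] by simp

lemma TF_mono: assumes "TF d \<phi>" "d \<le> e" shows "TF e \<phi>"
proof -
  have "TF (int (nat (e - d) * 1)) (\<lambda>t xy. 1 * (zc xy 0) ^ nat (e - d))"
    using TF_Hom[of "\<lambda>_. 1" "nat (e - d) * 1" "\<lambda>z. z 0 ^ nat (e - d)"] whom_power[of "n + 2" wts 1 "\<lambda>z. z 0" "nat (e - d)"] Hom_var[of 0] pfun_const[of 1]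
    by simp
  from TF_mult[OF assms(1) this] show ?thesis using assms(2) by simp
qed

lemma TF_cmult: "TF d \<phi> \<Longrightarrow> TF d (\<lambda>t xy. k * \<phi> t xy)"
  using TF_mult[OF TF_pfun[OF pfun_const[of k]]] by force

lemma TF_diff: "TF d \<phi> \<Longrightarrow> TF d \<psi> \<Longrightarrow> TF d (\<lambda>t xy. \<phi> t xy - \<psi> t xy)"
  using TF_add[of d \<phi> "\<lambda>t xy. (-1) * \<psi> t xy"] TF_cmult[of d \<psi> "-1"] by simp

text \<open>\<open>f\<close> and \<open>g\<close> have degree \<open>d\<close> and agree up to
  relative order \<rho>. Under products the degrees add while \<rho> stays the same.\<close>

definition pert :: "int \<Rightarrow> int \<Rightarrow> (complex \<times> complex \<Rightarrow> complex \<times> complex \<Rightarrow> complex) \<Rightarrow>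
    (complex \<times> complex \<Rightarrow> complex \<times> complex \<Rightarrow> complex) \<Rightarrow> bool" where
  "pert \<rho> d f g \<longleftrightarrow> TF d f \<and> TF d g \<and> TF (d + \<rho>) (\<lambda>t xy. g t xy - f t xy)"

lemma pert_mult:
  assumes "pert \<rho> d f g" "pert \<rho> e f' g'"
  shows "pert \<rho> (d + e) (\<lambda>t xy. f t xy * f' t xy) (\<lambda>t xy. g t xy * g' t xy)"
proof -
  have 1: "TF (d + (e + \<rho>)) (\<lambda>t xy. g t xy * (g' t xy - f' t xy))" "TF ((d + \<rho>) + e) (\<lambda>t xy. (g t xy - f t xy) * f' t xy)"
    by (rule TF_mult; use assms in \<open>simp add: pert_def\<close>)+
  have "TF (d + e + \<rho>) (\<lambda>t xy. g t xy * (g' t xy - f' t xy) + (g t xy - f t xy) * f' t xy)"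
    by (rule TF_add) (use 1 in \<open>simp_all add: algebra_simps\<close>)
  then show ?thesis using assms TF_mult[of d f e f'] TF_mult[of d g e g']
    by (simp add: pert_def algebra_simps)
qed

lemma pert_one: "pert \<rho> 0 (\<lambda>_ _. 1) (\<lambda>_ _. 1)"
  using TF_zero[of \<rho>] TF_pfun[OF pfun_const[of 1]] by (simp add: pert_def)

lemma pert_power:
  "pert \<rho> d f g \<Longrightarrow> pert \<rho> (int k * d) (\<lambda>t xy. f t xy ^ k) (\<lambda>t xy. g t xy ^ k)"
proof (induction k)
  case (Suc k)
  show ?case using pert_mult[OF Suc.prems Suc.IH[OF Suc.prems]] by (simp add: algebra_simps)
qed (simp add: pert_one)

lemma pert_prod:
  "(\<And>i. i \<in> I \<Longrightarrow> pert \<rho> (d i) (f i) (g i)) \<Longrightarrow>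
    pert \<rho> (\<Sum>i\<in>I. d i) (\<lambda>t xy. \<Prod>i\<in>I. f i t xy) (\<lambda>t xy. \<Prod>i\<in>I. g i t xy)"
proof (induction I rule: infinite_finite_induct)
  case (insert x F)
  then show ?case using pert_mult[of \<rho> "d x" "f x" "g x" "sum d F" "\<lambda>t xy. \<Prod>i\<in>F. f i t xy" "\<lambda>t xy. \<Prod>i\<in>F. g i t xy"] by simp
qed (simp_all add: pert_one)

text \<open>By induction the change of \<open>y_k\<close> has degree at most
  \<open>e + sI k\<close>, which does not exceed \<open>om k\<close>. In the recursion both
  monomials have degree \<open>al j * om j\<close> and all their factors change by relative order at
  most \<open>e + sI j - om j\<close>; these two numbers add up to
  \<open>e + sI (Suc j)\<close>.\<close>

lemma TF_action:
  assumes A: "\<And>t xy. A t xy = (fst xy + E t xy, snd xy + r t)"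
    and E: "TF (e + sI 0) E" and r: "pfun r" and e: "e \<ge> 0" and le: "e + sI (Suc n) \<le> int (om (Suc n))"
    and k: "k \<le> Suc n"
  shows "TF (int (om k)) (\<lambda>t xy. ev (yy k) (A t xy))"
proof -
  have le': "e + sI j \<le> int (om j)" if "j \<le> Suc n" for j using sI_le[OF that order_refl] le by simp
  have tot: "TF (int (om j)) (\<lambda>t xy. ev (yy j) (A t xy))"
    if j: "j \<le> Suc n" and T: "TF (e + sI j) (\<lambda>t xy. ev (yy j) (A t xy) - ev (yy j) xy)" for j
    using TF_add[OF TF_yy[OF j] TF_mono[OF T le'[OF j]]] by simp
  have "TF (e + sI k) (\<lambda>t xy. ev (yy k) (A t xy) - ev (yy k) xy)"
    using k
  proof (induction k rule: less_induct)
    case (less k)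
    consider "k = 0" | "k = 1" | j where "k = Suc j" "1 \<le> j" "j \<le> n" using less.prems by (cases k; force)
    then show ?case
    proof cases
      case 1
      then show ?thesis using E A by simp
    next
      case 2
      then show ?thesis using TF_mono[OF TF_pfun[OF r] e] A by (simp add: sI_1)
    next
      case 3
      let ?\<rho> = "e + sI j - int (om j)"
      let ?f = "\<lambda>i (t::complex\<times>complex) xy. ev (yy i) xy" and ?g = "\<lambda>i t xy. ev (yy i) (A t xy)"
      have p: "pert ?\<rho> (int (om i)) (?f i) (?g i)" if i: "i \<le> j" for i
      proof -
        have T: "TF (e + sI i) (\<lambda>t xy. ev (yy i) (A t xy) - ev (yy i) xy)" by (rule less.IH) (use i 3 in auto)
        have i': "i \<le> Suc n" using i 3 by simp
        have "e + sI i \<le> int (om i) + ?\<rho>" using sI_le[OF i] 3 by simp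
        from TF_mono[OF T this] tot[OF i' T] TF_yy[OF i'] show ?thesis unfolding pert_def by blast
      qed
      have P1: "pert ?\<rho> (int (al j) * int (om j)) (\<lambda>t xy. ?f j t xy ^ al j) (\<lambda>t xy. ?g j t xy ^ al j)"
        by (rule pert_power[OF p]) simp
      have "pert ?\<rho> (\<Sum>i<j. int (be j i) * int (om i)) (\<lambda>t xy. \<Prod>i<j. ?f i t xy ^ be j i) (\<lambda>t xy. \<Prod>i<j. ?g i t xy ^ be j i)"
        by (rule pert_prod, rule pert_power, rule p) simp
      moreover have "(\<Sum>i<j. int (be j i) * int (om i)) = int (al j) * int (om j)"
        using arg_cong[OF be_sum[OF 3(2,3)], of int] by simp
      ultimately have P2: "pert ?\<rho> (int (al j) * int (om j)) (\<lambda>t xy. \<Prod>i<j. ?f i t xy ^ be j i) (\<lambda>t xy. \<Prod>i<j. ?g i t xy ^ be j i)"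
        by (simp only:)
      have d: "int (al j) * int (om j) + ?\<rho> = e + sI k" using sI_Suc[of j] 3 by (simp add: algebra_simps)
      have T1: "TF (e + sI k) (\<lambda>t xy. ?g j t xy ^ al j - ?f j t xy ^ al j)"
        using P1 unfolding pert_def d by blast
      have T2: "TF (e + sI k) (\<lambda>t xy. (\<Prod>i<j. ?g i t xy ^ be j i) - (\<Prod>i<j. ?f i t xy ^ be j i))"
        using P2 unfolding pert_def d by blast
      have ek: "ev (yy k) uv = ev (yy j) uv ^ al j - th j * (\<Prod>i<j. ev (yy i) uv ^ be j i)" for uv
        unfolding 3(1) yy_Suc[OF 3(2)] by simp
      from TF_diff[OF T1 TF_cmult[OF T2, of "th j"]] show ?thesis
        unfolding ek by (simp add: algebra_simps)
    qed
  qed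
  then show ?thesis by (rule tot[OF k])
qed

lemma bigraded_fix: "bigraded A Hom d \<Phi> \<Longrightarrow> Hom d (\<lambda>z. \<Phi> (t, z))"
  by (induction rule: bigraded.induct) (auto intro: whom_zero whom_add whom_cmult)

lemma bigraded_rep: "bigraded A Hom d \<Phi> \<Longrightarrow> bigraded A YH d (\<lambda>z. \<Phi> (fst z, rep (snd z)))"
proof (induction rule: bigraded.induct)
  case (bigraded_step f a b)
  show ?case using bigraded.bigraded_step[OF bigraded_step.IH bigraded_step.hyps(2), of "\<lambda>p. b (rep p)"]
    hfunI[OF bigraded_step.hyps(3)] by simp
qed (simp add: bigraded_zero)

lemma range_pt: "range pt = {p \<in> Ypts. rep p 0 \<noteq> 0}"
  using pt_Y rep_pt_0 affine_pt by blast

lemma YH_rep0: "YH 1 (\<lambda>p. rep p 0)"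
  using hfunI[OF Hom_var[of 0]] by simp

lemma open_affine: "openin (zar Y) (range pt)"
  unfolding range_pt by (rule presents_openI[OF presents_Y qopen_basic[of YH 1 "\<lambda>p. rep p 0", OF YH_rep0]])

lemma Hom_nonzero_pt: assumes "Hom d h" shows "h (rep (pt xy)) \<noteq> 0 \<longleftrightarrow> h (zc xy) \<noteq> 0"
  unfolding pt_def using hfun_worbit[OF assms] by simp

lemma open_meets: assumes "openin (zar Y) T" "p \<in> T" shows "\<exists>xy. pt xy \<in> T"
proof -
  have q: "qopen Ypts YH T" by (rule presents_openD[OF presents_Y assms(1)])
  obtain d G where G: "YH d G" "G p \<noteq> 0" "\<forall>q\<in>Ypts. G q \<noteq> 0 \<longrightarrow> q \<in> T" using qopenE[OF q assms(2)] .
  then obtain g where g: "Hom d g" "G = (\<lambda>p. g (rep p))" unfolding hfun_def by blast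
  have "p \<in> Ypts" using qopen_sub[OF q] assms(2) by blast
  then obtain xy where "g (zc xy) \<noteq> 0" using Hom_vanish[OF g(1)] rep_cone(1) G(2) g(2) by metis
  then have "pt xy \<in> T" using G(3) g(2) pt_Y Hom_nonzero_pt[OF g(1)] by simp
  then show ?thesis by blast
qed

lemma affine_dense: "zar Y closure_of (range pt) = pts Y"
proof
  show "pts Y \<subseteq> zar Y closure_of (range pt)"
  proof
    fix p assume "p \<in> pts Y"
    then show "p \<in> zar Y closure_of (range pt)" unfolding in_closure_of
      by (auto dest!: open_meets)
  qed
qed (rule closure_of_subset_topspace)

text \<open>The homogeneous coordinates of the image are bigraded forms and hence define maps
  \<open>M t\<close> on the whole cone. The group law, the equations of the surface and
  \<open>M 0 z = z\<close> hold over the affine part and spread to the cone by \<open>Hom_eq\<close>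
  and \<open>Hom_vanish\<close>.\<close>

lemma action_extends:
  assumes A: "\<And>t xy. A t xy = (fst xy + E t xy, snd xy + r t)"
    and E: "TF (e + sI 0) E" and r: "pfun r" and e: "e \<ge> 0" and le: "e + sI (Suc n) \<le> int (om (Suc n))"
    and A0: "\<And>xy. A 0 xy = xy" and Aadd: "\<And>s t xy. A (s + t) xy = A s (A t xy)"
  shows "\<exists>\<sigma>. ga2_action Y \<sigma> \<and> (\<forall>t xy. \<sigma> (t, pt xy) = pt (A t xy))"
proof -
  have "\<exists>\<Phi>. bigraded pfun Hom (wts i) \<Phi> \<and> (\<forall>t xy. \<Phi> (t, zc xy) = zc (A t xy) i)" if "i \<le> n + 2" for i
  proof (cases i)
    case 0
    have "bigraded pfun Hom (wts 0) (\<lambda>z. (\<lambda>_. 1) (fst z) * (\<lambda>z. z 0) (snd z))"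
      using bigraded_prod[of pfun "\<lambda>_. 1" Hom "wts 0" "\<lambda>z. z 0", OF pfun_const Hom_var[of 0]] by simp
    then show ?thesis using 0 by (intro exI[of _ "\<lambda>z. (\<lambda>_. 1) (fst z) * (\<lambda>z. z 0) (snd z)"]) simp
  next
    case (Suc k)
    then have "TF (int (om k)) (\<lambda>t xy. ev (yy k) (A t xy))"
      using TF_action[OF A E r e le, of k] that by simp
    then show ?thesis using Suc that unfolding TF_def by auto
  qed
  then obtain \<Phi> where \<Phi>: "\<And>i. i \<le> n + 2 \<Longrightarrow> bigraded pfun Hom (wts i) (\<Phi> i)"
    "\<And>i t xy. i \<le> n + 2 \<Longrightarrow> \<Phi> i (t, zc xy) = zc (A t xy) i" by metis
  define M where "M t z i = (if i \<le> n + 2 then \<Phi> i (t, z) else 0)" for t z i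
  have HM: "Hom (wts i) (\<lambda>z. \<Phi> i (t, z))" if "i \<le> n + 2" for i t by (rule bigraded_fix[OF \<Phi>(1)[OF that]])
  have HM': "Hom (wts i) (\<lambda>z. M t z i)" if "i \<le> n + 2" for i t using HM[OF that] that by (simp add: M_def)
  have Mzc: "M t (zc xy) = zc (A t xy)" for t xy
    using \<Phi>(2) by (auto simp: M_def fun_eq_iff zc_def split: nat.split)
  have sub: "Hom d (\<lambda>z. h (M t z))" if "Hom d h" for d h t
    by (rule whom_subst[where N = "n + 2" and a = wts and \<phi> = "\<lambda>i z. M t z i", OF graded_whom whom_zero])
      (use HM' that in auto)
  have comp: "M s (M t z) = M (s + t) z" if z: "ycone z" for s t z
  proof
    fix i show "M s (M t z) i = M (s + t) z i"
    proof (cases "i \<le> n + 2")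
      case True
      show ?thesis by (rule Hom_eq[OF sub[OF HM'[OF True]] HM'[OF True] _ z]) (simp add: Mzc Aadd)
    qed (simp add: M_def)
  qed
  have M0: "M 0 z = z" if z: "ycone z" for z
  proof
    fix i show "M 0 z i = z i"
    proof (cases "i \<le> n + 2")
      case True
      show ?thesis by (rule Hom_eq[OF HM'[OF True] Hom_var[OF True] _ z]) (simp add: Mzc A0)
    qed (use z in \<open>auto simp: M_def ycone_def\<close>)
  qed
  have Mc: "ycone (M t z)" if z: "ycone z" for t z
    unfolding ycone_def
  proof (intro conjI ballI allI impI)
    fix k assume k: "k \<in> {1..n}"
    show "eqn k (M t z) = 0"
    proof (rule Hom_vanish[OF sub[OF Hom_eqn[OF k]] _ z])
      show "eqn k (M t (zc xy)) = 0" for xy using cone_zc k unfolding Mzc ycone_def by blast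
    qed
  next
    \<comment> \<open>If all coordinates of \<open>M t z\<close> were 0, then
      \<open>M (- t)\<close>, whose components have positive weight, would send it to 0 and back to
      \<open>z\<close>.\<close>
    show "\<exists>i\<le>n + 2. M t z i \<noteq> 0"
    proof (rule ccontr)
      assume "\<not> ?thesis"
      then have M: "M t z = (\<lambda>_. 0)" by (auto simp: M_def fun_eq_iff)
      have "z i = 0" if i: "i \<le> n + 2" for i
      proof -
        have "wts i > 0" using i om_pos by (cases i) auto
        then have "M (- t) (\<lambda>_. 0) i = 0" using whom_scale[OF HM'[OF i, of "- t"], of 0 "\<lambda>_. 0"] by (auto simp: zero_power)
        then show ?thesis using comp[OF z, of "- t" t] M0[OF z] M by simp
      qed
      then show False using z unfolding ycone_def by blast
    qed
  qed (simp add: M_def)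
  define \<sigma> where "\<sigma> = (\<lambda>z. worbit wts (\<lambda>i. if i \<le> n + 2 then \<Phi> i (fst z, rep (snd z)) else 0))"
  have \<sigma>: "\<sigma> (t, worbit wts z) = worbit wts (M t z)" for t z
    using hmap_worbit[of "\<lambda>i z. \<Phi> i (t, z)" z, OF HM] by (simp only: \<sigma>_def hmap_def M_def[abs_def] fst_conv snd_conv)
  have mor: "morphism (prod_fspace affine_plane Y) Y \<sigma>"
    unfolding \<sigma>_def
  proof (rule Ypts_pullback[OF graded_bigraded[OF graded_pfun graded_hfun] bigraded_zero
      _ presents_prod[OF graded_pfun graded_hfun presents_affine presents_Y]])
    show "bigraded pfun YH (wts i) (\<lambda>z. \<Phi> i (fst z, rep (snd z)))" if "i \<le> n + 2" for i
      by (rule bigraded_rep[OF \<Phi>(1)[OF that]])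
    fix z :: "(complex \<times> complex) \<times> (nat \<Rightarrow> complex) set" assume "z \<in> UNIV \<times> Ypts"
    then have "ycone (M (fst z) (rep (snd z)))" using Mc rep_cone(1) by auto
    then show "ycone (\<lambda>i. if i \<le> n + 2 then \<Phi> i (fst z, rep (snd z)) else 0)" by (simp add: M_def[abs_def])
  qed
  have "ga2_action Y \<sigma>" unfolding ga2_action_def pts_Y
  proof (intro conjI ballI allI mor)
    fix p assume "p \<in> Ypts"
    then obtain z where z: "p = worbit wts z" "ycone z" unfolding Ypts_eq by blast
    show "\<sigma> (0, p) = p" unfolding z \<sigma> using M0[OF z(2)] by simp
    fix s t show "\<sigma> (s + t, p) = \<sigma> (s, \<sigma> (t, p))" unfolding z \<sigma> using comp[OF z(2)] by simp
  qed
  moreover have "\<sigma> (t, pt xy) = pt (A t xy)" for t xy unfolding pt_def \<sigma> Mzc ..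
  ultimately show ?thesis by blast
qed

lemma structure_extends:
  assumes "ga2_action Y \<sigma>" and \<sigma>: "\<And>t xy. \<sigma> (t, pt xy) = pt (A t xy)"
    and free: "\<And>t xy. A t xy = xy \<Longrightarrow> t = 0" and A0: "\<And>xy. A 0 xy = xy"
    and trans: "\<And>xy uv. \<exists>t. A t xy = uv"
  shows "ga2_structure Y \<sigma>"
  unfolding ga2_structure_def
proof (intro conjI exI[of _ "range pt"] ballI assms(1) open_affine affine_dense)
  fix p assume "p \<in> range pt"
  then obtain xy where p: "p = pt xy" by blast
  show "{t. \<sigma> (t, p) = p} = {0}" unfolding p \<sigma> by (auto dest!: pt_inj free simp: A0)
  have "range (\<lambda>t. \<sigma> (t, p)) = range pt"
  proof (intro set_eqI iffI)
    fix q assume "q \<in> range pt"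
    then obtain uv where q: "q = pt uv" by (rule rangeE)
    obtain t where "A t xy = uv" using trans[of xy uv] by (rule exE)
    then have "q = \<sigma> (t, p)" by (simp add: p \<sigma> q)
    then show "q \<in> range (\<lambda>t. \<sigma> (t, p))" by simp
  qed (auto simp: p \<sigma>)
  then show "zar Y closure_of range (\<lambda>t. \<sigma> (t, p)) = pts Y" using affine_dense by simp
qed

end

subsection \<open>The standard actions\<close>

text \<open>The antiderivative, vanishing at 0, of the polynomial with coefficients
  \<open>lam j\<close>.\<close>

definition Qf :: "int \<Rightarrow> (nat \<Rightarrow> complex) \<Rightarrow> complex \<Rightarrow> complex" where
  "Qf m lam y = (\<Sum>j<nat (m + 1). lam j / of_nat (j + 1) * y ^ (j + 1))"

text \<open>The binomial theorem for \<open>(y + r)^(j+1)\<close>. It shows where the coefficients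
  of \<open>g_fun\<close> come from: \<open>x\<close> moves by the increment of one fixed polynomial
  in \<open>y\<close>, so that the group law is a telescoping identity.\<close>

lemma g_fun_sum:
  "(\<Sum>i<nat (m + 1). g_fun m lam i r * y ^ i) = Qf m lam (y + r) - Qf m lam y"
proof -
  let ?M = "nat (m + 1)"
  have c: "of_nat (j choose (j - i)) / of_nat (Suc j - i) = (of_nat (Suc j choose i) / of_nat (Suc j) :: complex)"
    if "i \<le> j" for i j
  proof -
    have "Suc j * (j choose i) = (Suc j choose i) * (Suc j - i)"
      using binomial_absorb_comp[of "Suc j" i] that by (simp add: mult.commute)
    then have "(of_nat (Suc j) * of_nat (j choose i) :: complex) = of_nat (Suc j choose i) * of_nat (Suc j - i)"
      by (metis of_nat_mult)
    moreover have "j choose (j - i) = j choose i" by (rule binomial_symmetric[OF that, symmetric])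
    moreover have nz: "(of_nat (Suc j) :: complex) \<noteq> 0" "(of_nat (Suc j - i) :: complex) \<noteq> 0"
      using that by (simp_all only: of_nat_eq_0_iff)
    ultimately show ?thesis by (simp only: frac_eq_eq[OF nz(2,1)] mult.commute[of _ "of_nat (Suc j)"])
  qed
  have "(\<Sum>i<?M. g_fun m lam i r * y ^ i) = (\<Sum>i<?M. \<Sum>j\<in>{i..<?M}. lam j / of_nat (Suc j) * (of_nat (Suc j choose i) * y ^ i * r ^ (Suc j - i)))"
    unfolding g_fun_def sum_distrib_right
  proof (intro sum.cong refl)
    fix i j assume "j \<in> {i..<?M}"
    then have ij: "i \<le> j" "j - i + 1 = Suc j - i" by auto
    have "lam j / of_nat (j - i + 1) * of_nat (j choose (j - i)) * r ^ (j - i + 1) * y ^ i =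
       lam j * (of_nat (j choose (j - i)) / of_nat (j - i + 1)) * r ^ (j - i + 1) * y ^ i" by simp
    also have "\<dots> = lam j * (of_nat (Suc j choose i) / of_nat (Suc j)) * r ^ (Suc j - i) * y ^ i"
      by (simp only: c[OF ij(1)] ij(2))
    also have "\<dots> = lam j / of_nat (Suc j) * (of_nat (Suc j choose i) * y ^ i * r ^ (Suc j - i))"
      by (simp only: times_divide_eq_left times_divide_eq_right mult_ac)
    finally show "lam j / of_nat (j - i + 1) * of_nat (j choose (j - i)) * r ^ (j - i + 1) * y ^ i =
       lam j / of_nat (Suc j) * (of_nat (Suc j choose i) * y ^ i * r ^ (Suc j - i))" .
  qed
  also have "\<dots> = (\<Sum>j<?M. \<Sum>i\<in>{..j}. lam j / of_nat (Suc j) * (of_nat (Suc j choose i) * y ^ i * r ^ (Suc j - i)))"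
    (is "(\<Sum>i<?M. \<Sum>j\<in>{i..<?M}. ?f i j) = _")
  proof -
    have "(\<Sum>i<?M. \<Sum>j\<in>{i..<?M}. ?f i j) = (\<Sum>i<?M. \<Sum>j<?M. if i \<le> j then ?f i j else 0)"
      by (rule sum.cong[OF refl], rule sum.mono_neutral_cong_left) auto
    also have "\<dots> = (\<Sum>j<?M. \<Sum>i<?M. if i \<le> j then ?f i j else 0)" by (rule sum.swap)
    also have "\<dots> = (\<Sum>j<?M. \<Sum>i\<in>{..j}. ?f i j)"
      by (rule sum.cong[OF refl], rule sum.mono_neutral_cong_right) auto
    finally show ?thesis .
  qed
  also have "\<dots> = (\<Sum>j<?M. lam j / of_nat (Suc j) * ((y + r) ^ Suc j - y ^ Suc j))"
  proof (rule sum.cong[OF refl])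
    fix j
    have "(y + r) ^ Suc j = (\<Sum>i\<le>j. of_nat (Suc j choose i) * y ^ i * r ^ (Suc j - i)) + y ^ Suc j"
      unfolding binomial_ring[of y r "Suc j"] by simp
    then show "(\<Sum>i\<in>{..j}. lam j / of_nat (Suc j) * (of_nat (Suc j choose i) * y ^ i * r ^ (Suc j - i))) =
       lam j / of_nat (Suc j) * ((y + r) ^ Suc j - y ^ Suc j)"
      by (simp only: sum_distrib_left[symmetric]) simp
  qed
  also have "\<dots> = Qf m lam (y + r) - Qf m lam y"
    unfolding Qf_def by (simp add: algebra_simps sum_subtractf)
  finally show ?thesis .
qed

lemma std_action_eq:
  "std_action m lam c1 c2 \<mu> t xy =
    (fst xy + (Qf m lam (snd xy + (c1 * fst t + c2 * snd t)) - Qf m lam (snd xy) + \<mu> * (cnj c2 * fst t - cnj c1 * snd t)),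
     snd xy + (c1 * fst t + c2 * snd t))"
  unfolding std_action_def case_prod_beta g_fun_sum by simp

context keydata
begin

lemma standard_structure:
  fixes m :: int
  assumes s: "sI (Suc n) \<le> int (om (Suc n))" and o: "om 1 \<le> om 0"
    and m: "m * int (om 1) \<le> int (om 0) + int (om (Suc n)) - sI (Suc n) - int (om 1)"
    and c: "(c1, c2) \<noteq> (0, 0)" and \<mu>: "\<mu> \<noteq> 0"
  shows "\<exists>\<sigma>. ga2_structure Y \<sigma> \<and> (\<forall>t xy. \<sigma> (t, pt xy) = pt (std_action m lam c1 c2 \<mu> t xy))"
proof -
  let ?A = "std_action m lam c1 c2 \<mu>"
  let ?r = "\<lambda>t :: complex \<times> complex. c1 * fst t + c2 * snd t"
  let ?w = "\<lambda>t :: complex \<times> complex. cnj c2 * fst t - cnj c1 * snd t"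
  define E where "E t xy = (\<Sum>i<nat (m + 1). g_fun m lam i (?r t) * snd xy ^ i) + \<mu> * ?w t" for t and xy :: "complex \<times> complex"
  \<comment> \<open>The weight of the action: translation of \<open>y\<close> has weight 0, and the
    top power \<open>y^m\<close> in the shift of \<open>x\<close> has weight
    \<open>(m + 1) * om 1 - om 0\<close>. The constant part of the shift of \<open>x\<close> is
    covered because \<open>om 1 <= om 0\<close>.\<close>
  define e where "e = max 0 ((m + 1) * int (om 1) - int (om 0))"
  have r: "pfun ?r" by (intro pfun_add pfun_mult pfun_const pfun_fst pfun_snd)
  have "pfun (\<lambda>t. \<mu> * (cnj c2 * fst t + (- cnj c1) * snd t))"
    by (intro pfun_add pfun_mult pfun_const pfun_fst pfun_snd)
  then have w: "pfun (\<lambda>t. \<mu> * ?w t)" by simp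
  have A: "?A t xy = (fst xy + E t xy, snd xy + ?r t)" for t xy
    unfolding std_action_eq E_def g_fun_sum by simp
  have pos: "int (om 1) > 0" using om_pos[of 1] by simp
  have TE: "TF (e + sI 0) E"
  proof -
    have d0: "0 \<le> e + sI 0" using o by (simp add: e_def sI_0)
    have 1: "TF (e + sI 0) (\<lambda>t xy. g_fun m lam i (?r t) * snd xy ^ i)" if i: "i < nat (m + 1)" for i
    proof -
      have "pfun (\<lambda>t. g_fun m lam i (?r t))"
        unfolding g_fun_def by (intro pfun_sum pfun_mult pfun_power pfun_const r)
      from TF_Hom[OF this whom_power[OF Hom_var[of 2]], of i]
      have "TF (int (i * om 1)) (\<lambda>t xy. g_fun m lam i (?r t) * snd xy ^ i)"
        by (simp add: numeral_2_eq_2)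
      moreover have "int (i * om 1) \<le> e + sI 0"
      proof -
        have "int i * int (om 1) \<le> m * int (om 1)" using i pos by (intro mult_right_mono) auto
        also have "\<dots> \<le> e + sI 0" by (auto simp: e_def sI_0 algebra_simps)
        finally show ?thesis by simp
      qed
      ultimately show ?thesis by (rule TF_mono)
    qed
    have 2: "TF (e + sI 0) (\<lambda>t xy. \<Sum>i\<in>I. g_fun m lam i (?r t) * snd xy ^ i)" if "I \<subseteq> {..<nat (m + 1)}" for I
      using finite_subset[OF that finite_lessThan] that
    proof induction
      case empty
      show ?case using TF_zero by simp
    next
      case (insert i I)
      have "TF (e + sI 0) (\<lambda>t xy. g_fun m lam i (?r t) * snd xy ^ i + (\<Sum>i\<in>I. g_fun m lam i (?r t) * snd xy ^ i))"
        by (rule TF_add) (use insert 1 in auto)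
      then show ?case using insert by simp
    qed
    show ?thesis unfolding E_def[abs_def]
      by (rule TF_add[OF 2[OF subset_refl] TF_mono[OF TF_pfun[OF w] d0]])
  qed
  have e0: "e \<ge> 0" by (simp add: e_def)
  have le: "e + sI (Suc n) \<le> int (om (Suc n))" using s m by (auto simp: e_def algebra_simps)
  have A0: "?A 0 xy = xy" for xy unfolding std_action_eq by simp
  have Aadd: "?A (s + t) xy = ?A s (?A t xy)" for s t xy
    unfolding std_action_eq by (simp add: algebra_simps)
  obtain \<sigma> where \<sigma>: "ga2_action Y \<sigma>" "\<forall>t xy. \<sigma> (t, pt xy) = pt (?A t xy)"
    using action_extends[OF A TE r e0 le A0 Aadd] by (elim exE conjE)
  \<comment> \<open>The linear map from \<open>t\<close> to \<open>?r t\<close> and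
    \<open>?w t\<close> has determinant \<open>- N\<close>, nonzero as \<open>N\<close> is the
    square norm of \<open>(c1, c2)\<close>; \<open>sol\<close> inverts it. Both trivial stabilizers
    and transitivity on the plane follow.\<close>
  define N where "N = c1 * cnj c1 + c2 * cnj c2"
  have "N = of_real ((cmod c1)\<^sup>2 + (cmod c2)\<^sup>2)"
    unfolding N_def by (simp only: complex_norm_square[symmetric] of_real_add of_real_power[symmetric])
  moreover have "(cmod c1)\<^sup>2 + (cmod c2)\<^sup>2 \<noteq> 0" using c by (simp add: sum_power2_eq_zero_iff)
  ultimately have N: "N \<noteq> 0" using of_real_eq_0_iff by metis
  have sol: "N * fst t = cnj c1 * ?r t + c2 * ?w t" "N * snd t = cnj c2 * ?r t - c1 * ?w t" for t
    by (simp_all add: N_def algebra_simps)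
  have "ga2_structure Y \<sigma>"
  proof (rule structure_extends[OF \<sigma>(1) \<sigma>(2)[rule_format] _ A0])
    fix t xy assume "?A t xy = xy"
    then have "fst (?A t xy) = fst xy" "snd (?A t xy) = snd xy" by simp_all
    then have "?r t = 0" "?w t = 0" unfolding std_action_eq using \<mu> by auto
    then have "N * fst t = 0" "N * snd t = 0" unfolding sol[of t] by simp_all
    then show "t = 0" using N by (simp add: prod_eq_iff)
  next
    fix xy uv :: "complex \<times> complex"
    define r w where "r = snd uv - snd xy" and "w = (fst uv - fst xy - Qf m lam (snd uv) + Qf m lam (snd xy)) / \<mu>"
    let ?t = "((cnj c1 * r + c2 * w) / N, (cnj c2 * r - c1 * w) / N)"
    have "?r ?t = (c1 * (cnj c1 * r + c2 * w) + c2 * (cnj c2 * r - c1 * w)) / N"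
      by (simp only: fst_conv snd_conv times_divide_eq_right add_divide_distrib[symmetric])
    also have "c1 * (cnj c1 * r + c2 * w) + c2 * (cnj c2 * r - c1 * w) = r * N" by (simp add: N_def algebra_simps)
    finally have t1: "?r ?t = r" using N by simp
    have "?w ?t = (cnj c2 * (cnj c1 * r + c2 * w) - cnj c1 * (cnj c2 * r - c1 * w)) / N"
      by (simp only: fst_conv snd_conv times_divide_eq_right diff_divide_distrib[symmetric])
    also have "cnj c2 * (cnj c1 * r + c2 * w) - cnj c1 * (cnj c2 * r - c1 * w) = w * N" by (simp add: N_def algebra_simps)
    finally have t2: "?w ?t = w" using N by simp
    note t = t1 t2
    have "?A ?t xy = (fst xy + (Qf m lam (snd xy + r) - Qf m lam (snd xy) + \<mu> * w), snd xy + r)"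
      unfolding std_action_eq t ..
    also have "\<dots> = uv" using \<mu> by (simp add: r_def w_def prod_eq_iff)
    finally show "\<exists>t. ?A t xy = uv" by (rule exI)
  qed
  then show ?thesis using \<sigma>(2) by (intro exI[of _ \<sigma>] conjI)
qed

end

section \<open>Locally nilpotent derivations\<close>

locale derivation =
  fixes D :: "'a :: {idom, ring_char_0} \<Rightarrow> 'a"
  assumes D_add: "D (f + g) = D f + D g" and D_mult: "D (f * g) = D f * g + f * D g"
begin

lemma D_0 [simp]: "D 0 = 0" using D_add[of 0 0] by simp
lemma D_minus: "D (- f) = - D f" using D_add[of f "- f"] by (simp add: eq_neg_iff_add_eq_0 add.commute)
lemma D_diff: "D (f - g) = D f - D g" using D_add[of f "- g"] by (simp add: D_minus)

lemma pow_0 [simp]: "(D ^^ k) 0 = 0" by (induction k) simp_all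
lemma pow_add: "(D ^^ k) (f + g) = (D ^^ k) f + (D ^^ k) g" by (induction k) (simp_all add: D_add)
lemma pow_D: "(D ^^ k) (D f) = (D ^^ Suc k) f" by (simp add: funpow_swap1)

definition nilp :: "'a \<Rightarrow> bool" where "nilp f \<longleftrightarrow> (\<exists>k. (D ^^ k) f = 0)"

lemma pow_ge: "(D ^^ k) f = 0 \<Longrightarrow> k \<le> l \<Longrightarrow> (D ^^ l) f = 0"
  using funpow_add[of "l - k" k D] by (simp add: o_def)

text \<open>In the iterated product rule only the term with \<open>k\<close> derivatives on
  \<open>f\<close> and \<open>l\<close> on \<open>g\<close> survives. Hence the order of nilpotency
  is additive on products (\<open>leibniz_nz\<close>): it is the degree function of a locally
  nilpotent derivation.\<close>

lemma leibniz_top: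
  "(D ^^ Suc k) f = 0 \<Longrightarrow> (D ^^ Suc l) g = 0 \<Longrightarrow>
    (D ^^ (k + l)) (f * g) = of_nat ((k + l) choose k) * ((D ^^ k) f * (D ^^ l) g)"
proof (induction "k + l" arbitrary: k l f g)
  case (Suc N)
  have split: "(D ^^ (k + l)) (f * g) = (D ^^ N) (D f * g) + (D ^^ N) (f * D g)"
    unfolding Suc.hyps(2)[symmetric] pow_D[symmetric] D_mult pow_add ..
  have z: "(D ^^ N) (f * D g) = 0" if "l = 0" using Suc.prems(2) that by simp
  have z': "(D ^^ N) (D f * g) = 0" if "k = 0" using Suc.prems(1) that by simp
  have 1: "(D ^^ N) (D f * g) = of_nat (N choose k') * ((D ^^ k) f * (D ^^ l) g)" if "k = Suc k'" for k'
  proof -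
    have e: "N = k' + l" using Suc.hyps(2) that by simp
    have p: "(D ^^ Suc k') (D f) = 0" using Suc.prems(1) unfolding pow_D that .
    show ?thesis using Suc.hyps(1)[OF e p Suc.prems(2)] unfolding e pow_D that .
  qed
  have 2: "(D ^^ N) (f * D g) = of_nat (N choose k) * ((D ^^ k) f * (D ^^ l) g)" if "l = Suc l'" for l'
  proof -
    have e: "N = k + l'" using Suc.hyps(2) that by simp
    have p: "(D ^^ Suc l') (D g) = 0" using Suc.prems(2) unfolding pow_D that .
    show ?thesis using Suc.hyps(1)[OF e Suc.prems(1) p] unfolding e pow_D that .
  qed
  show ?case
  proof (cases k)
    case 0
    then obtain l' where l: "l = Suc l'" using Suc.hyps(2) by (cases l) auto
    show ?thesis using split z'[OF 0] 2[OF l] 0 by simp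
  next
    case k: (Suc k')
    show ?thesis
    proof (cases l)
      case 0
      then have "N = k'" using Suc.hyps(2) k by simp
      then show ?thesis using split z[OF 0] 1[OF k] 0 by simp
    next
      case l: (Suc l')
      have "(k + l) choose k = (N choose k') + (N choose k)" unfolding Suc.hyps(2)[symmetric] unfolding k by (simp only: binomial_Suc_Suc)
      then show ?thesis using split 1[OF k] 2[OF l] by (simp add: algebra_simps)
    qed
  qed
qed simp

lemma nilp_add: "nilp f \<Longrightarrow> nilp g \<Longrightarrow> nilp (f + g)"
proof -
  assume "nilp f" "nilp g"
  then obtain k l where "(D ^^ k) f = 0" "(D ^^ l) g = 0" unfolding nilp_def by (elim exE)
  then have "(D ^^ (k + l)) (f + g) = 0" unfolding pow_add using pow_ge[of k f "k + l"] pow_ge[of l g "k + l"] by simp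
  then show ?thesis unfolding nilp_def by (rule exI)
qed

lemma nilp_mult: "nilp f \<Longrightarrow> nilp g \<Longrightarrow> nilp (f * g)"
proof -
  assume "nilp f" "nilp g"
  then obtain k l where "(D ^^ k) f = 0" "(D ^^ l) g = 0" unfolding nilp_def by (elim exE)
  then have kl: "(D ^^ Suc k) f = 0" "(D ^^ Suc l) g = 0" using pow_ge[of k f "Suc k"] pow_ge[of l g "Suc l"] by simp_all
  have z: "(D ^^ k) f = 0" by fact
  have "(D ^^ (k + l)) (f * g) = 0" unfolding leibniz_top[OF kl] z by simp
  then show ?thesis unfolding nilp_def by (rule exI)
qed

lemma nu_exists: "nilp f \<Longrightarrow> f \<noteq> 0 \<Longrightarrow> \<exists>k. (D ^^ k) f \<noteq> 0 \<and> (D ^^ Suc k) f = 0"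
proof -
  assume f: "nilp f" "f \<noteq> 0"
  define N where "N = (LEAST k. (D ^^ k) f = 0)"
  have N: "(D ^^ N) f = 0" unfolding N_def using f(1) unfolding nilp_def by (rule LeastI_ex)
  then obtain k where k: "N = Suc k" using f(2) by (cases N) auto
  have "(D ^^ k) f \<noteq> 0" using not_less_Least[of k "\<lambda>k. (D ^^ k) f = 0"] k unfolding N_def[symmetric] by simp
  then show ?thesis using N k by auto
qed

lemma leibniz_nz:
  assumes "(D ^^ k) f \<noteq> 0" "(D ^^ Suc k) f = 0" "(D ^^ l) g \<noteq> 0" "(D ^^ Suc l) g = 0"
  shows "(D ^^ (k + l)) (f * g) \<noteq> 0"
proof -
  have "(of_nat ((k + l) choose k) :: 'a) \<noteq> 0" by simp
  then show ?thesis unfolding leibniz_top[OF assms(2,4)] using assms(1,3) by simp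
qed

text \<open>Applying \<open>D\<close> lowers the order of nilpotency by one, multiplying by a
  nonzero \<open>g\<close> does not lower it.\<close>

lemma nilp_eigen:
  assumes "D f = f * g" "nilp f" "nilp g" shows "D f = 0"
proof (rule ccontr)
  assume "D f \<noteq> 0"
  then have "f \<noteq> 0" "g \<noteq> 0" using assms(1) by auto
  obtain k where k: "(D ^^ k) f \<noteq> 0" "(D ^^ Suc k) f = 0" using nu_exists[OF assms(2) \<open>f \<noteq> 0\<close>] by (elim exE conjE)
  obtain l where l: "(D ^^ l) g \<noteq> 0" "(D ^^ Suc l) g = 0" using nu_exists[OF assms(3) \<open>g \<noteq> 0\<close>] by (elim exE conjE)
  have "(D ^^ (k + l)) (D f) \<noteq> 0" unfolding assms(1) by (rule leibniz_nz[OF k l])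
  then show False unfolding pow_D using pow_ge[OF k(2), of "Suc (k + l)"] by simp
qed

text \<open>If both derivatives were nonzero, the order of nilpotency of \<open>x\<close> would
  exceed that of \<open>y\<close>, and conversely.\<close>

lemma nilp_cross:
  assumes x: "D x = y * g" and y: "D y = x * h" and n: "nilp x" "nilp y" "nilp g" "nilp h"
  shows "D x = 0 \<or> D y = 0"
proof (rule ccontr)
  assume "\<not> ?thesis"
  then have nz: "x \<noteq> 0" "y \<noteq> 0" "g \<noteq> 0" "h \<noteq> 0" using x y by auto
  obtain k where k: "(D ^^ k) x \<noteq> 0" "(D ^^ Suc k) x = 0" using nu_exists[OF n(1) nz(1)] by (elim exE conjE)
  obtain l where l: "(D ^^ l) y \<noteq> 0" "(D ^^ Suc l) y = 0" using nu_exists[OF n(2) nz(2)] by (elim exE conjE)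
  obtain i where i: "(D ^^ i) g \<noteq> 0" "(D ^^ Suc i) g = 0" using nu_exists[OF n(3) nz(3)] by (elim exE conjE)
  obtain j where j: "(D ^^ j) h \<noteq> 0" "(D ^^ Suc j) h = 0" using nu_exists[OF n(4) nz(4)] by (elim exE conjE)
  have "(D ^^ (l + i)) (D x) \<noteq> 0" unfolding x by (rule leibniz_nz[OF l i])
  then have "\<not> Suc k \<le> Suc (l + i)" unfolding pow_D using pow_ge[OF k(2), of "Suc (l + i)"] by (intro notI) simp
  moreover have "(D ^^ (k + j)) (D y) \<noteq> 0" unfolding y by (rule leibniz_nz[OF k j])
  then have "\<not> Suc l \<le> Suc (k + j)" unfolding pow_D using pow_ge[OF l(2), of "Suc (k + j)"] by (intro notI) simp
  ultimately show False by simp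
qed

end

subsection \<open>Derivations of the polynomial ring in two variables\<close>

definition pdx :: "complex poly poly \<Rightarrow> complex poly poly" where "pdx f = map_poly pderiv f"

lemma coeff_pdx: "coeff (pdx f) b = pderiv (coeff f b)" unfolding pdx_def by (simp add: coeff_map_poly)

lemma pdx_add: "pdx (f + g) = pdx f + pdx g" by (rule poly_eqI) (simp add: coeff_pdx pderiv_add)

lemma pdx_pCons: "pdx (pCons a f) = pCons (pderiv a) (pdx f)"
  by (rule poly_eqI) (simp add: coeff_pdx coeff_pCons split: nat.split)

lemma pdx_smult: "pdx (smult a f) = smult (pderiv a) f + smult a (pdx f)"
  by (rule poly_eqI) (simp add: coeff_pdx pderiv_mult algebra_simps)

lemma pdx_mult: "pdx (f * g) = pdx f * g + f * pdx g"
proof (induction f)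
  case 0
  show ?case by (simp add: pdx_def)
next
  case (pCons a f)
  show ?case by (simp add: pdx_pCons pdx_add pdx_smult pCons.IH algebra_simps)
qed

lemma pdx_pderiv: "pdx (pderiv f) = pderiv (pdx f)"
  by (rule poly_eqI) (simp add: coeff_pdx coeff_pderiv pderiv_mult pderiv_of_nat del: of_nat_Suc)

definition der :: "complex poly poly \<Rightarrow> complex poly poly \<Rightarrow> complex poly poly \<Rightarrow> complex poly poly" where
  "der A B f = A * pdx f + B * pderiv f"

lemma derivation_der: "derivation (der A B)"
  by standard (simp_all add: der_def pdx_add pdx_mult pderiv_add pderiv_mult algebra_simps)

lemma der_simps [simp]: "der A B PX = A" "der A B PY = B" "der A B (cst c) = 0"
proof -
  have 0: "pdx 0 = 0" by (simp add: pdx_def)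
  have "pdx PX = 1" "pdx PY = 0" "pdx (cst c) = 0" "pderiv PX = 0" "pderiv PY = 1"
    by (simp_all add: pdx_pCons pderiv_pCons 0 one_pCons)
  then show "der A B PX = A" "der A B PY = B" "der A B (cst c) = 0"
    unfolding der_def by simp_all
qed

lemma B2_induct:
  assumes "\<And>c. P (cst c)" "P PX" "P PY" "\<And>f g. P f \<Longrightarrow> P g \<Longrightarrow> P (f + g)" "\<And>f g. P f \<Longrightarrow> P g \<Longrightarrow> P (f * g)"
  shows "P f"
proof (induction f)
  case 0
  show ?case using assms(1)[of 0] by simp
next
  case (pCons p f)
  have "P [:p:]"
  proof (induction p)
    case 0
    show ?case using assms(1)[of 0] by simp
  next
    case (pCons k p)
    have "[:pCons k p:] = cst k + PX * [:p:]" by simp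
    then show ?case using assms(4)[OF assms(1) assms(5)[OF assms(2) pCons(2)]] by simp
  qed
  from assms(4)[OF this assms(5)[OF assms(3) pCons(2)]] have "P ([:p:] + PY * f)" .
  moreover have "[:p:] + PY * f = pCons p f" by simp
  ultimately show ?case by (simp only:)
qed

section \<open>Coefficients and monomial expansions\<close>

definition cf :: "complex poly poly \<Rightarrow> nat \<Rightarrow> nat \<Rightarrow> complex" where "cf f a b = coeff (coeff f b) a"

lemma cf_eqI: "(\<And>a b. cf f a b = cf g a b) \<Longrightarrow> f = g" unfolding cf_def by (intro poly_eqI)

lemma cf_add: "cf (f + g) a b = cf f a b + cf g a b" and cf_diff: "cf (f - g) a b = cf f a b - cf g a b"
  and cf_0: "cf 0 a b = 0"
  by (simp_all add: cf_def)

lemma cf_mult: "cf (f * g) a b = (\<Sum>i\<le>b. \<Sum>j\<le>a. cf f j i * cf g (a - j) (b - i))"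
  by (simp add: cf_def coeff_mult coeff_sum)

lemma cf_pdx: "cf (pdx f) a b = of_nat (Suc a) * cf f (Suc a) b"
  by (simp add: cf_def coeff_pdx coeff_pderiv del: of_nat_Suc)

lemma cf_pderiv: "cf (pderiv f) a b = of_nat (Suc b) * cf f a (Suc b)"
proof -
  have "coeff (of_nat k * p) a = of_nat k * coeff p a" for k and p :: "complex poly"
    by (simp add: of_nat_poly)
  then show ?thesis by (simp add: cf_def coeff_pderiv del: of_nat_Suc)
qed

lemma finite_cf: "finite {(a, b). cf f a b \<noteq> 0}"
proof -
  have "{(a, b). cf f a b \<noteq> 0} \<subseteq> (\<Union>b\<in>{..degree f}. (\<lambda>a. (a, b)) ` {..degree (coeff f b)})"
  proof
    fix z assume "z \<in> {(a, b). cf f a b \<noteq> 0}"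
    then obtain a b where z: "z = (a, b)" "cf f a b \<noteq> 0" by auto
    then have "a \<le> degree (coeff f b)" "coeff f b \<noteq> 0" unfolding cf_def by (auto intro: le_degree)
    then show "z \<in> (\<Union>b\<in>{..degree f}. (\<lambda>a. (a, b)) ` {..degree (coeff f b)})"
      using le_degree[of f b] z by auto
  qed
  then show ?thesis by (rule finite_subset) auto
qed

lemma cf_monomial: "cf (cst k * PX ^ i * PY ^ j) a b = (if a = i \<and> b = j then k else 0)"
proof -
  have "cst k * PX ^ i * PY ^ j = monom (monom k i) j"
    unfolding monom_altdef by (simp add: poly_const_pow mult.assoc smult_smult[symmetric] del: smult_smult)
  then show ?thesis by (simp add: cf_def)
qed

lemma B2_expand: "f = (\<Sum>(a, b)\<in>{(a, b). cf f a b \<noteq> 0}. cst (cf f a b) * PX ^ a * PY ^ b)"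
proof (rule cf_eqI)
  fix i j
  let ?S = "{(a, b). cf f a b \<noteq> 0}"
  have "cf (\<Sum>(a, b)\<in>?S. cst (cf f a b) * PX ^ a * PY ^ b) i j = (\<Sum>(a, b)\<in>?S. cf (cst (cf f a b) * PX ^ a * PY ^ b) i j)"
    by (simp add: cf_def coeff_sum case_prod_beta)
  also have "\<dots> = (\<Sum>z\<in>?S. if z = (i, j) then cf f i j else 0)"
    by (rule sum.cong[OF refl]) (auto simp only: cf_monomial split: if_splits)
  also have "\<dots> = cf f i j" using finite_cf[of f] by (simp add: sum.delta)
  finally show "cf f i j = cf (\<Sum>(a, b)\<in>?S. cst (cf f a b) * PX ^ a * PY ^ b) i j" by simp
qed

subsection \<open>Weight degenerations\<close>

locale weighting = fixes p q :: int
begin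

definition W :: "int \<Rightarrow> complex poly poly \<Rightarrow> bool" where
  "W d f \<longleftrightarrow> (\<forall>a b. cf f a b \<noteq> 0 \<longrightarrow> p * int a + q * int b \<le> d)"
definition Hm :: "int \<Rightarrow> complex poly poly \<Rightarrow> bool" where
  "Hm d f \<longleftrightarrow> (\<forall>a b. cf f a b \<noteq> 0 \<longrightarrow> p * int a + q * int b = d)"
definition top :: "int \<Rightarrow> complex poly poly \<Rightarrow> complex poly poly" where
  "top d f = (\<Sum>(a, b)\<in>{(a, b). cf f a b \<noteq> 0}. cst (if p * int a + q * int b = d then cf f a b else 0) * PX ^ a * PY ^ b)"

lemma cf_top: "cf (top d f) i j = (if p * int i + q * int j = d then cf f i j else 0)"
proof -
  let ?S = "{(a, b). cf f a b \<noteq> 0}"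
  let ?k = "\<lambda>a b. if p * int a + q * int b = d then cf f a b else 0"
  have "cf (top d f) i j = (\<Sum>(a, b)\<in>?S. cf (cst (?k a b) * PX ^ a * PY ^ b) i j)"
    unfolding top_def by (simp add: cf_def coeff_sum case_prod_beta)
  also have "\<dots> = (\<Sum>z\<in>?S. if z = (i, j) then ?k i j else 0)"
    by (rule sum.cong[OF refl]) (auto simp only: cf_monomial split: if_splits)
  also have "\<dots> = ?k i j" using finite_cf[of f] by (simp add: sum.delta)
  finally show ?thesis .
qed

lemma W_add: "W d f \<Longrightarrow> W d g \<Longrightarrow> W d (f + g)"
  unfolding W_def cf_add by (metis add.right_neutral add_cancel_left_left)
lemma Hm_add: "Hm d f \<Longrightarrow> Hm d g \<Longrightarrow> Hm d (f + g)"
  unfolding Hm_def cf_add by (metis add.right_neutral add_cancel_left_left)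

lemma mult_support:
  assumes "cf (f * g) a b \<noteq> 0"
  shows "\<exists>i j. i \<le> b \<and> j \<le> a \<and> cf f j i \<noteq> 0 \<and> cf g (a - j) (b - i) \<noteq> 0"
proof (rule ccontr)
  assume *: "\<not> ?thesis"
  have "cf (f * g) a b = 0" unfolding cf_mult by (intro sum.neutral ballI) (use * in auto)
  then show False using assms by simp
qed

lemma W_mult: assumes "W d f" "W e g" shows "W (d + e) (f * g)"
  unfolding W_def
proof (intro allI impI)
  fix a b assume "cf (f * g) a b \<noteq> 0"
  then obtain i j where ij: "i \<le> b" "j \<le> a" "cf f j i \<noteq> 0" "cf g (a - j) (b - i) \<noteq> 0"
    using mult_support[of f g a b] by auto
  have "p * int j + q * int i \<le> d" using assms(1) ij(3) unfolding W_def by blast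
  moreover have "p * int (a - j) + q * int (b - i) \<le> e" using assms(2) ij(4) unfolding W_def by blast
  ultimately have "p * int j + q * int i \<le> d" "p * int (a - j) + q * int (b - i) \<le> e" .
  then show "p * int a + q * int b \<le> d + e" using ij(1,2) by (simp add: of_nat_diff algebra_simps)
qed

lemma Hm_mult: assumes "Hm d f" "Hm e g" shows "Hm (d + e) (f * g)"
  unfolding Hm_def
proof (intro allI impI)
  fix a b assume "cf (f * g) a b \<noteq> 0"
  then obtain i j where ij: "i \<le> b" "j \<le> a" "cf f j i \<noteq> 0" "cf g (a - j) (b - i) \<noteq> 0"
    using mult_support[of f g a b] by auto
  have "p * int j + q * int i = d" using assms(1) ij(3) unfolding Hm_def by blast
  moreover have "p * int (a - j) + q * int (b - i) = e" using assms(2) ij(4) unfolding Hm_def by blast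
  ultimately have "p * int j + q * int i = d" "p * int (a - j) + q * int (b - i) = e" .
  then show "p * int a + q * int b = d + e" using ij(1,2) by (simp add: of_nat_diff algebra_simps)
qed

lemma W_pdx: "W d f \<Longrightarrow> W (d - p) (pdx f)" and W_pderiv: "W d f \<Longrightarrow> W (d - q) (pderiv f)"
  and Hm_pdx: "Hm d f \<Longrightarrow> Hm (d - p) (pdx f)" and Hm_pderiv: "Hm d f \<Longrightarrow> Hm (d - q) (pderiv f)"
proof -
  have d: "p * int (Suc a) + q * int b = p * int a + q * int b + p" "p * int a + q * int (Suc b) = p * int a + q * int b + q" for a b
    by (simp_all add: algebra_simps)
  {
    assume *: "W d f"
    show "W (d - p) (pdx f)" unfolding W_def cf_pdx
    proof (intro allI impI)
      fix a b assume "of_nat (Suc a) * cf f (Suc a) b \<noteq> 0"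
      then have "cf f (Suc a) b \<noteq> 0" by simp
      then have "p * int (Suc a) + q * int b \<le> d" using * unfolding W_def by blast
      then show "p * int a + q * int b \<le> d - p" unfolding d by simp
    qed
    show "W (d - q) (pderiv f)" unfolding W_def cf_pderiv
    proof (intro allI impI)
      fix a b assume "of_nat (Suc b) * cf f a (Suc b) \<noteq> 0"
      then have "cf f a (Suc b) \<noteq> 0" by simp
      then have "p * int a + q * int (Suc b) \<le> d" using * unfolding W_def by blast
      then show "p * int a + q * int b \<le> d - q" unfolding d by simp
    qed
  }
  assume *: "Hm d f"
  show "Hm (d - p) (pdx f)" unfolding Hm_def cf_pdx
  proof (intro allI impI)
    fix a b assume "of_nat (Suc a) * cf f (Suc a) b \<noteq> 0"
    then have "cf f (Suc a) b \<noteq> 0" by simp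
    then have "p * int (Suc a) + q * int b = d" using * unfolding Hm_def by blast
    then show "p * int a + q * int b = d - p" unfolding d by simp
  qed
  show "Hm (d - q) (pderiv f)" unfolding Hm_def cf_pderiv
  proof (intro allI impI)
    fix a b assume "of_nat (Suc b) * cf f a (Suc b) \<noteq> 0"
    then have "cf f a (Suc b) \<noteq> 0" by simp
    then have "p * int a + q * int (Suc b) = d" using * unfolding Hm_def by blast
    then show "p * int a + q * int b = d - q" unfolding d by simp
  qed
qed

lemma W_der: assumes "W (e + p) A" "W (e + q) B" "W d f" shows "W (d + e) (der A B f)"
  unfolding der_def
  using W_add[of "d + e" "A * pdx f" "B * pderiv f"] W_mult[OF assms(1) W_pdx[OF assms(3)]]
    W_mult[OF assms(2) W_pderiv[OF assms(3)]] by (simp add: add.commute)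

lemma Hm_der: assumes "Hm (e + p) A" "Hm (e + q) B" "Hm d f" shows "Hm (d + e) (der A B f)"
  unfolding der_def
  using Hm_add[of "d + e" "A * pdx f" "B * pderiv f"] Hm_mult[OF assms(1) Hm_pdx[OF assms(3)]]
    Hm_mult[OF assms(2) Hm_pderiv[OF assms(3)]] by (simp add: add.commute)

lemma Hm_W: "Hm d f \<Longrightarrow> W d f" unfolding Hm_def W_def by auto
lemma Hm_top: "Hm d (top d f)" unfolding Hm_def cf_top by auto
lemma W_low: "W d f \<Longrightarrow> W (d - 1) (f - top d f)" unfolding W_def cf_diff cf_top
proof (intro allI impI)
  fix a b assume *: "\<forall>a b. cf f a b \<noteq> 0 \<longrightarrow> p * int a + q * int b \<le> d"
    and "cf f a b - (if p * int a + q * int b = d then cf f a b else 0) \<noteq> 0"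
  then have "cf f a b \<noteq> 0" "p * int a + q * int b \<noteq> d" by (auto split: if_splits)
  then show "p * int a + q * int b \<le> d - 1" using *[rule_format, of a b] by simp
qed

text \<open>With \<open>E\<close> the top part of the derivation \<open>D\<close>, the polynomial
  \<open>E^k f\<close> is homogeneous of weight \<open>d + k e\<close>, and \<open>D^k f\<close>
  differs from it in smaller weights only. If \<open>D^N f = 0\<close>, then \<open>E^N f\<close> is
  homogeneous and at the same time of smaller weight, so it is 0.\<close>

lemma degenerate_nilpotent:
  assumes A: "W (e + p) A" and B: "W (e + q) B" and f: "Hm d f" and N: "(der A B ^^ N) f = 0"
  shows "(der (top (e + p) A) (top (e + q) B) ^^ N) f = 0"
proof -
  let ?D = "der A B" and ?E = "der (top (e + p) A) (top (e + q) B)"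
  have H: "Hm (d + int k * e) ((?E ^^ k) f)" for k
  proof (induction k)
    case (Suc k)
    show ?case using Hm_der[OF Hm_top[of "e + p" A] Hm_top[of "e + q" B] Suc] by (simp add: algebra_simps)
  qed (use f in simp)
  have L: "W (d + int k * e - 1) ((?D ^^ k) f - (?E ^^ k) f)" for k
  proof (induction k)
    case 0
    show ?case by (simp add: W_def cf_0)
  next
    case (Suc k)
    have 1: "W (d + int k * e - 1 + e) (?D ((?D ^^ k) f - (?E ^^ k) f))" by (rule W_der[OF A B Suc])
    have "W (e - 1 + p) (A - top (e + p) A)" "W (e - 1 + q) (B - top (e + q) B)"
      using W_low[OF A] W_low[OF B] by (simp_all add: algebra_simps)
    from W_der[OF this Hm_W[OF H]] have 2: "W (d + int k * e + (e - 1)) (der (A - top (e + p) A) (B - top (e + q) B) ((?E ^^ k) f))" .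
    have "(?D ^^ Suc k) f - (?E ^^ Suc k) f = ?D ((?D ^^ k) f - (?E ^^ k) f) + der (A - top (e + p) A) (B - top (e + q) B) ((?E ^^ k) f)"
      unfolding derivation.D_diff[OF derivation_der] by (simp add: der_def algebra_simps)
    then show ?case using W_add[of "d + int (Suc k) * e - 1"] 1 2 by (simp add: algebra_simps)
  qed
  show ?thesis
  proof (rule cf_eqI)
    fix a b
    show "cf ((?E ^^ N) f) a b = cf 0 a b"
    proof (rule ccontr)
      assume "cf ((?E ^^ N) f) a b \<noteq> cf 0 a b"
      then have nz: "cf ((?E ^^ N) f) a b \<noteq> 0" by (simp add: cf_0)
      then have "p * int a + q * int b = d + int N * e" using H[of N] unfolding Hm_def by auto
      moreover have "cf ((?D ^^ N) f - (?E ^^ N) f) a b \<noteq> 0" using nz unfolding N cf_diff cf_0 by simp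
      then have "p * int a + q * int b \<le> d + int N * e - 1" using L[of N] unfolding W_def by auto
      ultimately show False by simp
    qed
  qed
qed

lemma Hm_gens: "Hm 0 (cst c)" "Hm p PX" "Hm q PY"
  by (auto simp: Hm_def cf_def coeff_pCons split: nat.splits)

text \<open>Constants, \<open>x\<close> and \<open>y\<close> are homogeneous, and the elements
  killed by a power of a derivation form a subring.\<close>

lemma degenerate_LND:
  assumes A: "W (e + p) A" and B: "W (e + q) B" and n: "\<And>f. derivation.nilp (der A B) f"
  shows "derivation.nilp (der (top (e + p) A) (top (e + q) B)) f"
proof -
  interpret E: derivation "der (top (e + p) A) (top (e + q) B)" by (rule derivation_der)
  have "E.nilp f" if f: "Hm d f" for d f
  proof -
    obtain N where "(der A B ^^ N) f = 0" using n[of f] unfolding derivation.nilp_def[OF derivation_der] by (elim exE)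
    then show ?thesis unfolding E.nilp_def using degenerate_nilpotent[OF A B f] by (intro exI)
  qed
  then show ?thesis by (induction f rule: B2_induct) (auto intro: Hm_gens E.nilp_add E.nilp_mult)
qed

end

section \<open>Triangular form of degree preserving nilpotent fields\<close>

lemma PY_dvd: assumes "\<And>a. cf f a 0 = 0" obtains g where "f = PY * g"
proof -
  have "coeff f 0 = 0" by (rule poly_eqI) (use assms in \<open>simp add: cf_def\<close>)
  then obtain g where "f = pCons 0 g" by (cases f) auto
  then show ?thesis by (intro that[of g]) simp
qed

lemma PX_dvd: assumes "\<And>b. cf f 0 b = 0" obtains g where "f = PX * g"
proof
  show "f = PX * map_poly (poly_shift 1) f"
  proof (rule cf_eqI)
    fix a b show "cf f a b = cf (PX * map_poly (poly_shift 1) f) a b"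
      using assms[of b] by (cases a) (simp_all add: cf_def coeff_map_poly coeff_poly_shift)
  qed
qed

context keydata
begin

definition pw :: int where "pw = int (om 0)"
definition qw :: int where "qw = int (om 1)"

lemma Fil_monomial: "Fil c (int a * pw + int b * qw) (cst k * PX ^ a * PY ^ b) (smult k (cc c 0 ^ a * cc c 1 ^ b))"
proof -
  have x: "Fil c pw PX (cc c 0)" using Fil_yy[of 0 c] by (simp add: pw_def)
  have y: "Fil c qw PY (cc c 1)" using Fil_yy[of 1 c] by (simp add: qw_def)
  from Fil_mult[OF Fil_mult[OF Fil_const[of c k] Fil_power[OF x, of a]] Fil_power[OF y, of b]]
  show ?thesis by (simp add: mult.assoc)
qed

sublocale w: weighting pw qw .

lemma Fil_W: assumes "w.W d g" shows "\<exists>P. Fil c d g P"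
proof -
  let ?S = "{(a, b). cf g a b \<noteq> 0}"
  have "\<exists>P. Fil c d (cst (cf g (fst z) (snd z)) * PX ^ fst z * PY ^ snd z) P" if "z \<in> ?S" for z
  proof (rule Fil_le[OF Fil_monomial])
    show "int (fst z) * pw + int (snd z) * qw \<le> d" using assms that unfolding w.W_def by (auto simp: mult.commute)
  qed
  then obtain P where P: "\<And>z. z \<in> ?S \<Longrightarrow> Fil c d (cst (cf g (fst z) (snd z)) * PX ^ fst z * PY ^ snd z) (P z)" by metis
  have "Fil c d (\<Sum>z\<in>?S. cst (cf g (fst z) (snd z)) * PX ^ fst z * PY ^ snd z) (\<Sum>z\<in>?S. P z)"
    by (rule Fil_sum[OF P])
  moreover have "(\<Sum>z\<in>?S. cst (cf g (fst z) (snd z)) * PX ^ fst z * PY ^ snd z) = g"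
    using B2_expand[of g] by (simp add: case_prod_beta)
  ultimately show ?thesis by (intro exI) (simp only:)
qed

lemma cc1_nz: "curve c \<Longrightarrow> cc c j \<noteq> 0"
  using curve_nz[of c j] by (simp add: cc_def)

text \<open>In general the weight in \<open>x, y\<close> only bounds the degree: a top part such as
  \<open>y^{al 1} - th 1 * x^{be 1 0}\<close> loses degree at infinity. A single monomial cannot,
  because its leading form is nonzero.\<close>

lemma Fil_top:
  assumes c: "curve c" and k: "k \<noteq> 0"
    and low: "w.W (int i * pw + int j * qw - 1) (f - cst k * PX ^ i * PY ^ j)"
  shows "Fil c (int i * pw + int j * qw) f (smult k (cc c 0 ^ i * cc c 1 ^ j))"
proof -
  obtain P where "Fil c (int i * pw + int j * qw - 1) (f - cst k * PX ^ i * PY ^ j) P" using Fil_W[OF low, of c] by (elim exE)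
  then have "Fil c (int i * pw + int j * qw) (f - cst k * PX ^ i * PY ^ j) 0" by (rule Fil_less) simp
  from Fil_add[OF this Fil_monomial[of c i j k]] show ?thesis by simp
qed

lemma Fil_top_le:
  assumes c: "curve c" and k: "k \<noteq> 0"
    and low: "w.W (int i * pw + int j * qw - 1) (f - cst k * PX ^ i * PY ^ j)" and f: "Fil c e f Q"
  shows "int i * pw + int j * qw \<le> e"
  by (rule Fil_degree_le[OF c Fil_top[OF c k low] _ f]) (use k cc1_nz[OF c] in simp)

text \<open>The top part \<open>A' d/dx + B' d/dy\<close> for the weights \<open>om 0, om 1\<close>
  is locally nilpotent. If \<open>y\<close> divides \<open>B'\<close> then \<open>B' = 0\<close>,
  and if \<open>x\<close> divides \<open>A'\<close> then \<open>A' = 0\<close>, by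
  \<open>nilp_eigen\<close>. If both were nonzero, \<open>B'\<close> would contain a power of
  \<open>x\<close> and \<open>A'\<close> a power of \<open>y\<close>; neither of
  \<open>om 0, om 1\<close> divides the other, so by homogeneity \<open>A'\<close> would be
  divisible by \<open>y\<close> and \<open>B'\<close> by \<open>x\<close>, against
  \<open>nilp_cross\<close>. The component that survives is a single monomial, and
  \<open>Fil_top_le\<close> turns the given degree into a bound for its weight.\<close>

lemma triangular:
  assumes c: "curve c" and lt: "om 1 < om 0" and nd: "\<not> om 1 dvd om 0"
    and nil: "\<And>f. derivation.nilp (der A B) f"
    and FA: "Fil c (int (om 0)) A PA" and FB: "Fil c (int (om 1)) B PB"
  shows "(\<exists>k. B = cst k) \<and> (\<forall>a b. cf A a b \<noteq> 0 \<longrightarrow> a = 0 \<and> b * om 1 \<le> om 0)"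
proof (cases "A = 0 \<and> B = 0")
  case True
  then show ?thesis by (auto simp: cf_def intro: exI[of _ 0])
next
  case False
  have pq: "0 < qw" "qw < pw" using lt om_pos[of 1] by (simp_all add: pw_def qw_def)
  have nd': "\<not> qw dvd pw" using nd by (simp add: pw_def qw_def)
  define SA where "SA = (\<lambda>(a, b). pw * int a + qw * int b - pw) ` {(a, b). cf A a b \<noteq> 0}"
  define SB where "SB = (\<lambda>(a, b). pw * int a + qw * int b - qw) ` {(a, b). cf B a b \<noteq> 0}"
  have fin: "finite (SA \<union> SB)" unfolding SA_def SB_def using finite_cf by blast
  have ne: "SA \<union> SB \<noteq> {}"
  proof
    assume "SA \<union> SB = {}"
    then have "A = 0" "B = 0" unfolding SA_def SB_def by (auto intro!: cf_eqI simp: cf_0)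
    then show False using False by simp
  qed
  define e where "e = Max (SA \<union> SB)"
  have e_in: "e \<in> SA \<union> SB" unfolding e_def by (rule Max_in[OF fin ne])
  have WA: "w.W (e + pw) A" unfolding w.W_def
  proof (intro allI impI)
    fix a b assume "cf A a b \<noteq> 0"
    then have "pw * int a + qw * int b - pw \<in> SA \<union> SB" unfolding SA_def by force
    then show "pw * int a + qw * int b \<le> e + pw" using Max_ge[OF fin] unfolding e_def by fastforce
  qed
  have WB: "w.W (e + qw) B" unfolding w.W_def
  proof (intro allI impI)
    fix a b assume "cf B a b \<noteq> 0"
    then have "pw * int a + qw * int b - qw \<in> SA \<union> SB" unfolding SB_def by force
    then show "pw * int a + qw * int b \<le> e + qw" using Max_ge[OF fin] unfolding e_def by fastforce
  qed
  define A' B' where "A' = w.top (e + pw) A" and "B' = w.top (e + qw) B"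
  have nz: "A' \<noteq> 0 \<or> B' \<noteq> 0"
  proof -
    have "\<exists>a b. cf A' a b \<noteq> 0 \<or> cf B' a b \<noteq> 0"
      using e_in unfolding SA_def SB_def A'_def B'_def w.cf_top by force
    then show ?thesis by (auto simp: cf_0)
  qed
  interpret E: derivation "der A' B'" by (rule derivation_der)
  have nilE: "E.nilp f" for f unfolding A'_def B'_def by (rule w.degenerate_LND[OF WA WB nil])
  have hA: "pw * int a + qw * int b = e + pw" if "cf A' a b \<noteq> 0" for a b
    using that unfolding A'_def w.cf_top by (auto split: if_splits)
  have hB: "pw * int a + qw * int b = e + qw" if "cf B' a b \<noteq> 0" for a b
    using that unfolding B'_def w.cf_top by (auto split: if_splits)
  have yB: "B' = 0" if z: "\<And>a. cf B' a 0 = 0"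
  proof -
    obtain g where g: "B' = PY * g" using PY_dvd[OF z] .
    have "der A' B' PY = PY * g" using g by simp
    from E.nilp_eigen[OF this nilE nilE] show ?thesis by simp
  qed
  have xA: "A' = 0" if z: "\<And>b. cf A' 0 b = 0"
  proof -
    obtain g where g: "A' = PX * g" using PX_dvd[OF z] .
    have "der A' B' PX = PX * g" using g by simp
    from E.nilp_eigen[OF this nilE nilE] show ?thesis by simp
  qed
  have one: "A' = 0 \<or> B' = 0"
  proof (rule ccontr)
    assume no: "\<not> ?thesis"
    obtain i where i: "cf B' i 0 \<noteq> 0" using yB no by blast
    obtain j where j: "cf A' 0 j \<noteq> 0" using xA no by blast
    have a0: "cf A' a 0 = 0" for a
    proof (rule ccontr)
      assume "cf A' a 0 \<noteq> 0"
      then have "qw = pw * (int i - int a + 1)" using hA[of a 0] hB[OF i] by (simp add: algebra_simps)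
      then have "pw dvd qw" by simp
      then show False using pq zdvd_imp_le[of pw qw] by simp
    qed
    have b0: "cf B' 0 b = 0" for b
    proof (rule ccontr)
      assume "cf B' 0 b \<noteq> 0"
      then have "pw = qw * (int j - int b + 1)" using hB[of 0 b] hA[OF j] by (simp add: algebra_simps)
      then show False using nd' by simp
    qed
    obtain g where g: "A' = PY * g" using PY_dvd[OF a0] .
    obtain h where h: "B' = PX * h" using PX_dvd[OF b0] .
    have "der A' B' PX = PY * g" "der A' B' PY = PX * h" using g h by simp_all
    from E.nilp_cross[OF this nilE nilE nilE nilE] no show False by simp
  qed
  show ?thesis
  proof (cases "A' = 0")
    case A0: True
    then have B0: "B' \<noteq> 0" using nz by simp
    obtain i where i: "cf B' i 0 \<noteq> 0" using yB B0 by blast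
    have pure: "b = 0" if nzb: "cf B' a b \<noteq> 0" for a b
    proof (rule ccontr)
      assume "b \<noteq> 0"
      \<comment> \<open>A second degeneration, by the degree in \<open>y\<close> alone. If
        \<open>y\<close> occurred in \<open>B'\<close>, the part of top degree would be divisible by
        \<open>y\<close> and hence be 0.\<close>
      interpret v: weighting 0 1 .
      define k where "k = degree B'"
      have k: "k > 0"
      proof -
        have "coeff B' b \<noteq> 0" using nzb by (auto simp: cf_def)
        then show ?thesis using le_degree[of B' b] \<open>b \<noteq> 0\<close> by (simp add: k_def)
      qed
      have WB': "v.W ((int k - 1) + 1) B'" unfolding v.W_def
      proof (intro allI impI)
        fix a b assume "cf B' a b \<noteq> 0"
        then have "coeff B' b \<noteq> 0" by (auto simp: cf_def)
        then show "0 * int a + 1 * int b \<le> int k - 1 + 1" using le_degree[of B' b] by (simp add: k_def)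
      qed
      have WA': "v.W ((int k - 1) + 0) A'" unfolding A0 v.W_def by (simp add: cf_0)
      let ?A = "v.top ((int k - 1) + 0) A'" and ?B = "v.top ((int k - 1) + 1) B'"
      interpret F: derivation "der ?A ?B" by (rule derivation_der)
      have nilF: "F.nilp f" for f by (rule v.degenerate_LND[OF WA' WB' nilE])
      obtain g where g: "?B = PY * g" by (rule PY_dvd[of ?B]) (use k in \<open>auto simp: v.cf_top\<close>)
      have "der ?A ?B PY = PY * g" using g by simp
      from F.nilp_eigen[OF this nilF nilF] have B: "?B = 0" by simp
      have "coeff B' k \<noteq> 0" unfolding k_def using B0 by simp
      then obtain a where "cf B' a k \<noteq> 0" unfolding cf_def by (metis leading_coeff_neq_0)
      then have "cf ?B a k \<noteq> 0" by (simp add: v.cf_top)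
      then show False unfolding B by (simp add: cf_0)
    qed
    have ei: "e + qw = int i * pw" using hB[OF i] by (simp add: mult.commute)
    have B'_eq: "B' = cst (cf B' i 0) * PX ^ i * PY ^ 0"
    proof (rule cf_eqI)
      fix a b
      show "cf B' a b = cf (cst (cf B' i 0) * PX ^ i * PY ^ 0) a b"
      proof (cases "cf B' a b = 0")
        case True
        then show ?thesis unfolding cf_monomial by auto
      next
        case False
        then have b: "b = 0" by (rule pure)
        then have "pw * int a = pw * int i" using hB[OF False] ei by (simp add: mult.commute)
        then have "a = i" using pq by simp
        then show ?thesis using b unfolding cf_monomial by simp
      qed
    qed
    have "w.W (int i * pw + int 0 * qw - 1) (B - cst (cf B' i 0) * PX ^ i * PY ^ 0)"
      unfolding B'_eq[symmetric] unfolding B'_def using w.W_low[OF WB] ei by simp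
    \<comment> \<open>A power of \<open>x\<close> of degree at most \<open>om 1 < om 0\<close> is
      constant. Then the field has weight \<open>- qw\<close>, which leaves only a constant in all
      of \<open>B\<close> and no \<open>x\<close> in \<open>A\<close>.\<close>
    from Fil_top_le[OF c i this FB] have "int i * pw \<le> qw" by (simp add: qw_def)
    moreover have "pw \<le> int i * pw" if "i \<noteq> 0" using that pq by simp
    ultimately have "i = 0" using pq by fastforce
    then have e: "e = - qw" using ei by simp
    have "B = cst (cf B 0 0) * PX ^ 0 * PY ^ 0"
    proof (rule cf_eqI)
      fix a b
      show "cf B a b = cf (cst (cf B 0 0) * PX ^ 0 * PY ^ 0) a b"
      proof (cases "cf B a b = 0")
        case True
        then show ?thesis unfolding cf_monomial by auto
      next
        case False
        then have l: "pw * int a + qw * int b \<le> 0" using WB e unfolding w.W_def by force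
        have "pw * int a \<ge> 0" "qw * int b \<ge> 0" using pq by simp_all
        then have "pw * int a = 0" "qw * int b = 0" using l by linarith+
        then show ?thesis using pq unfolding cf_monomial by simp
      qed
    qed
    then have "B = cst (cf B 0 0)" by simp
    moreover have "a = 0 \<and> b * om 1 \<le> om 0" if "cf A a b \<noteq> 0" for a b
    proof -
      have l: "pw * int a + qw * int b \<le> pw - qw" using WA e that unfolding w.W_def by force
      have "qw * int b \<ge> 0" using pq by simp
      then have "pw * int a < pw * 1" using l pq by linarith
      then have a: "a = 0" using pq by simp
      then have "int b * qw \<le> pw" using l pq by (simp add: mult.commute)
      then have "int (b * om 1) \<le> int (om 0)" by (simp add: pw_def qw_def)
      then show ?thesis using a by (simp only: of_nat_le_iff simp_thms)
    qed
    ultimately show ?thesis by blast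
  next
    case A0: False
    then have B0: "B' = 0" using one by simp
    obtain j where j: "cf A' 0 j \<noteq> 0" using xA A0 by blast
    have pure: "a = 0" if nza: "cf A' a b \<noteq> 0" for a b
    proof (rule ccontr)
      assume "a \<noteq> 0"
      interpret v: weighting 1 0 .
      define k where "k = Max (fst ` {(a, b). cf A' a b \<noteq> 0})"
      have fk: "finite (fst ` {(a, b). cf A' a b \<noteq> 0})" using finite_cf by blast
      have le: "a \<le> k" if "cf A' a b \<noteq> 0" for a b unfolding k_def by (rule Max_ge[OF fk]) (use that in force)
      have k: "k > 0" using le[OF nza] \<open>a \<noteq> 0\<close> by simp
      have WA': "v.W ((int k - 1) + 1) A'" unfolding v.W_def using le by force
      have WB': "v.W ((int k - 1) + 0) B'" unfolding B0 v.W_def by (simp add: cf_0)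
      let ?A = "v.top ((int k - 1) + 1) A'" and ?B = "v.top ((int k - 1) + 0) B'"
      interpret F: derivation "der ?A ?B" by (rule derivation_der)
      have nilF: "F.nilp f" for f by (rule v.degenerate_LND[OF WA' WB' nilE])
      obtain g where g: "?A = PX * g" by (rule PX_dvd[of ?A]) (use k in \<open>auto simp: v.cf_top\<close>)
      have "der ?A ?B PX = PX * g" using g by simp
      from F.nilp_eigen[OF this nilF nilF] have A: "?A = 0" by simp
      have "k \<in> fst ` {(a, b). cf A' a b \<noteq> 0}" unfolding k_def by (rule Max_in[OF fk]) (use j in force)
      then obtain b where "cf A' k b \<noteq> 0" by auto
      then have "cf ?A k b \<noteq> 0" by (simp add: v.cf_top)
      then show False unfolding A by (simp add: cf_0)
    qed
    have ej: "e + pw = int j * qw" using hA[OF j] by (simp add: mult.commute)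
    have A'_eq: "A' = cst (cf A' 0 j) * PX ^ 0 * PY ^ j"
    proof (rule cf_eqI)
      fix a b
      show "cf A' a b = cf (cst (cf A' 0 j) * PX ^ 0 * PY ^ j) a b"
      proof (cases "cf A' a b = 0")
        case True
        then show ?thesis unfolding cf_monomial by auto
      next
        case False
        then have a: "a = 0" by (rule pure)
        then have "qw * int b = qw * int j" using hA[OF False] ej by (simp add: mult.commute)
        then have "b = j" using pq by simp
        then show ?thesis using a unfolding cf_monomial by simp
      qed
    qed
    have "w.W (int 0 * pw + int j * qw - 1) (A - cst (cf A' 0 j) * PX ^ 0 * PY ^ j)"
      unfolding A'_eq[symmetric] unfolding A'_def using w.W_low[OF WA] ej by simp
    from Fil_top_le[OF c j this FA] have "int j * qw \<le> pw" by (simp add: pw_def)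
    \<comment> \<open>Non-divisibility makes the weight \<open>e\<close> strictly negative, so
      \<open>B\<close> has weight below \<open>qw\<close> and is constant, and \<open>A\<close> has
      weight below \<open>pw\<close> and contains no \<open>x\<close>.\<close>
    moreover have "int j * qw \<noteq> pw" using nd' by (metis dvd_triv_right)
    ultimately have e: "e < 0" "int j * qw < pw" using ej by simp_all
    have "B = cst (cf B 0 0) * PX ^ 0 * PY ^ 0"
    proof (rule cf_eqI)
      fix a b
      show "cf B a b = cf (cst (cf B 0 0) * PX ^ 0 * PY ^ 0) a b"
      proof (cases "cf B a b = 0")
        case True
        then show ?thesis unfolding cf_monomial by auto
      next
        case False
        then have l: "pw * int a + qw * int b < qw" using WB e unfolding w.W_def by force
        have "pw * int a \<ge> 0" "qw * int b \<ge> 0" using pq by simp_all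
        then have "pw * int a < pw * 1" "qw * int b < qw * 1" using l pq by linarith+
        then show ?thesis using pq unfolding cf_monomial by simp
      qed
    qed
    then have "B = cst (cf B 0 0)" by simp
    moreover have "a = 0 \<and> b * om 1 \<le> om 0" if "cf A a b \<noteq> 0" for a b
    proof -
      have l: "pw * int a + qw * int b \<le> int j * qw" using WA ej that unfolding w.W_def by force
      have "qw * int b \<ge> 0" using pq by simp
      then have "pw * int a < pw * 1" using l e by linarith
      then have a: "a = 0" using pq by simp
      then have "int b * qw \<le> pw" using l e by (simp add: mult.commute)
      then have "int (b * om 1) \<le> int (om 0)" by (simp add: pw_def qw_def)
      then show ?thesis using a by (simp only: of_nat_le_iff simp_thms)
    qed
    ultimately show ?thesis by blast
  qed
qed

subsection \<open>The exact degree of the last key polynomial under a triangular derivation\<close>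

lemma der_power: "der A B (f ^ k) = of_nat k * f ^ (k - 1) * der A B f"
proof (induction k)
  case 0
  then show ?case using der_simps(3)[of A B 1] by (simp flip: one_pCons)
next
  case (Suc k)
  have "der A B (f ^ Suc k) = der A B f * f ^ k + f * (of_nat k * f ^ (k - 1) * der A B f)"
    by (simp add: derivation.D_mult[OF derivation_der] Suc)
  then show ?case by (cases k) (simp_all add: algebra_simps)
qed

text \<open>The infinitesimal counterpart of \<open>pert\<close>: by the product rule the shift
  \<rho> stays fixed while degrees add.\<close>

definition los :: "(nat \<Rightarrow> complex) \<Rightarrow> complex poly poly \<Rightarrow> complex poly poly \<Rightarrow> int \<Rightarrow> int \<Rightarrow> complex poly poly \<Rightarrow> bool" where
  "los c A B \<rho> d f \<longleftrightarrow> (\<exists>P. Fil c d f P) \<and> (\<exists>P. Fil c (d + \<rho>) (der A B f) P)"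

lemma los_mult: assumes "los c A B \<rho> d f" "los c A B \<rho> e g" shows "los c A B \<rho> (d + e) (f * g)"
proof -
  obtain P Q P' Q' where *: "Fil c d f P" "Fil c (d + \<rho>) (der A B f) P'" "Fil c e g Q" "Fil c (e + \<rho>) (der A B g) Q'"
    using assms unfolding los_def by auto
  have "Fil c (d + e + \<rho>) (der A B f * g) (P' * Q)" "Fil c (d + e + \<rho>) (f * der A B g) (P * Q')"
    using Fil_mult[OF *(2,3)] Fil_mult[OF *(1,4)] by (simp_all add: algebra_simps)
  from Fil_add[OF this] Fil_mult[OF *(1,3)] show ?thesis
    unfolding los_def derivation.D_mult[OF derivation_der] by (intro conjI exI)
qed

lemma los_one: "los c A B \<rho> 0 1"
  using Fil_const[of c 1] Fil_zero[of c "0 + \<rho>"] der_simps(3)[of A B 1] unfolding los_def by (auto simp flip: one_pCons)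

lemma los_power: "los c A B \<rho> d f \<Longrightarrow> los c A B \<rho> (int k * d) (f ^ k)"
proof (induction k)
  case (Suc k)
  show ?case using los_mult[OF Suc.prems Suc.IH[OF Suc.prems]] by (simp add: algebra_simps)
qed (simp add: los_one)

lemma los_prod: "(\<And>i. i \<in> I \<Longrightarrow> los c A B \<rho> (d i) (f i)) \<Longrightarrow> los c A B \<rho> (\<Sum>i\<in>I. d i) (\<Prod>i\<in>I. f i)"
  by (induction I rule: infinite_finite_induct) (auto intro: los_one los_mult)

lemma int_be_sum: "1 \<le> j \<Longrightarrow> j \<le> n \<Longrightarrow> (\<Sum>i<j. int (be j i) * int (om i)) = int (al j) * int (om j)"
  using arg_cong[OF be_sum[of j], of int] by simp

text \<open>The degree of the image of \<open>yy j\<close> is exactly \<open>sI j + e\<close> for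
  \<open>2 <= j\<close>. At \<open>yy 2\<close> the contributions of \<open>d/dy\<close> and of
  \<open>A d/dx\<close> have degrees that differ by \<epsilon>, which is nonzero since
  \<open>om 1\<close> does not divide \<open>om 0\<close>; so no cancellation occurs. From there on
  the term with \<open>yy m ^ (al m - 1)\<close> times the image of \<open>yy m\<close>
  dominates.\<close>

lemma exact_degree:
  assumes c: "curve c" and n: "n \<ge> 1" and lt: "om 1 < om 0" and nd: "\<not> om 1 dvd om 0"
    and A: "\<And>a b. cf A a b \<noteq> 0 \<Longrightarrow> a = 0" and nz: "A \<noteq> 0 \<or> k \<noteq> 0"
  obtains e where "k \<noteq> 0 \<Longrightarrow> 0 \<le> e" "\<And>b. cf A 0 b \<noteq> 0 \<Longrightarrow> (int b + 1) * int (om 1) - int (om 0) \<le> e"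
    "int (om 1) \<le> sI (Suc n) + e" "\<And>d Q. Fil c d (der A (cst k) (yy (Suc n))) Q \<Longrightarrow> sI (Suc n) + e \<le> d"
proof -
  let ?D = "der A (cst k)"
  have om1: "om 1 > 0" using om_pos[of 1] by simp
  define i where "i = Max {b. cf A 0 b \<noteq> 0}"
  have fin: "finite {b. cf A 0 b \<noteq> 0}"
    by (rule finite_subset[OF _ finite_imageI[OF finite_cf[of A], of snd]]) force
  have ile: "b \<le> i" if "cf A 0 b \<noteq> 0" for b unfolding i_def by (rule Max_ge[OF fin]) (use that in simp)
  have i: "cf A 0 i \<noteq> 0" if "A \<noteq> 0"
  proof -
    have "\<exists>b. cf A 0 b \<noteq> 0"
    proof (rule ccontr)
      assume "\<nexists>b. cf A 0 b \<noteq> 0"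
      then have "A = 0" using A by (intro cf_eqI) (metis cf_0)
      then show False using that by simp
    qed
    then have "i \<in> {b. cf A 0 b \<noteq> 0}" unfolding i_def by (intro Max_in[OF fin]) auto
    then show ?thesis by simp
  qed
  define \<epsilon> where "\<epsilon> = (int i + 1) * int (om 1) - int (om 0)"
  have \<epsilon>0: "\<epsilon> \<noteq> 0"
  proof
    assume "\<epsilon> = 0"
    then have "int (om 0) = int (om 1 * (i + 1))" by (simp add: \<epsilon>_def algebra_simps)
    then have "om 0 = om 1 * (i + 1)" by (simp only: of_nat_eq_iff)
    then show False using nd by simp
  qed
  \<comment> \<open>The weight of the field: a nonzero constant in front of \<open>d/dy\<close>
    contributes 0, the top power \<open>y^i\<close> in \<open>A\<close> contributes
    \<epsilon>.\<close>
  define e where "e = (if A = 0 then 0 else if k = 0 then \<epsilon> else max 0 \<epsilon>)"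
  have e1: "0 \<le> e" if "k \<noteq> 0" using that by (simp add: e_def)
  have e2: "\<epsilon> \<le> e" if "A \<noteq> 0" using that by (simp add: e_def)
  have e3: "(int b + 1) * int (om 1) - int (om 0) \<le> e" if "cf A 0 b \<noteq> 0" for b
  proof -
    have "A \<noteq> 0" using that by (auto simp: cf_0)
    moreover have "(int b + 1) * int (om 1) \<le> (int i + 1) * int (om 1)" using ile[OF that] by (intro mult_right_mono) auto
    ultimately show ?thesis using e2 unfolding \<epsilon>_def by linarith
  qed
  define \<kappa> where "\<kappa> = cf A 0 i"
  have FA: "Fil c (int i * qw) A (smult \<kappa> (cc c 1 ^ i))" if "A \<noteq> 0"
  proof -
    have "w.W (int 0 * pw + int i * qw - 1) (A - cst \<kappa> * PX ^ 0 * PY ^ i)"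
      unfolding w.W_def
    proof (intro allI impI)
      fix a b assume nzab: "cf (A - cst \<kappa> * PX ^ 0 * PY ^ i) a b \<noteq> 0"
      then have ab: "cf A a b \<noteq> 0" "\<not> (a = 0 \<and> b = i)" unfolding cf_diff cf_monomial \<kappa>_def by (auto split: if_splits)
      then have "a = 0" "b < i" using A[of a b] ile[of b] by (auto simp: le_less)
      then have "int b * qw \<le> (int i - 1) * qw" using om1 by (intro mult_right_mono) (auto simp: qw_def)
      then show "pw * int a + qw * int b \<le> int 0 * pw + int i * qw - 1" using \<open>a = 0\<close> om1 by (simp add: algebra_simps qw_def)
    qed
    from Fil_top[OF c _ this] i[OF that] show ?thesis by (simp add: \<kappa>_def)
  qed
  have D0: "\<exists>P. Fil c (sI 0 + e) (?D (yy 0)) P"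
  proof (cases "A = 0")
    case True
    then show ?thesis using Fil_zero[of c "sI 0 + e"] by (intro exI[of _ 0]) simp
  next
    case False
    have "int i * qw \<le> sI 0 + e" using e2[OF False] by (simp add: \<epsilon>_def sI_0 qw_def algebra_simps)
    then show ?thesis using Fil_le[OF FA[OF False]] by simp
  qed
  have D1: "\<exists>P. Fil c (sI 1 + e) (?D (yy 1)) P"
  proof (cases "k = 0")
    case True
    then show ?thesis using Fil_zero[of c "sI 1 + e"] by (intro exI[of _ 0]) simp
  next
    case False
    then show ?thesis using Fil_le[OF Fil_const[of c k], of "sI 1 + e"] e1 by (simp add: sI_1)
  qed
  have al1: "be 1 0 * om 0 = al 1 * om 1" using be_sum[of 1] n by simp
  \<comment> \<open>Exponent 0 contradicts positive weights, and exponent 1 would make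
    \<open>om 0\<close> a multiple of \<open>om 1\<close>.\<close>
  have be2: "be 1 0 \<ge> 2"
  proof (rule ccontr)
    assume "\<not> ?thesis"
    then have "be 1 0 = 0 \<or> be 1 0 = 1" by linarith
    then show False
    proof
      assume "be 1 0 = 0" then show False using al1 al_pos[of 1] n om1 by simp
    next
      assume "be 1 0 = 1" then have "om 1 dvd om 0" using al1 by simp
      then show False using nd by simp
    qed
  qed
  have al2: "al 1 \<ge> 2"
  proof (rule ccontr)
    assume "\<not> ?thesis"
    then have "al 1 * om 1 \<le> 1 * om 1" by (intro mult_le_mono1) simp
    also have "\<dots> < 2 * om 0" using lt by simp
    also have "\<dots> \<le> be 1 0 * om 0" using be2 by (rule mult_le_mono1)
    finally show False using al1 by simp
  qed
  have s2: "sI 2 = (int (al 1) - 1) * int (om 1)" using sI_Suc[of 1] by (simp add: sI_1 numeral_2_eq_2)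
  have al1': "int (be 1 0) * int (om 0) = int (al 1) * int (om 1)" using arg_cong[OF al1, of int] by simp
  have base_ge: "int (om 1) \<le> sI 2 + e"
  proof (cases "0 \<le> e")
    case True
    have "1 * int (om 1) \<le> (int (al 1) - 1) * int (om 1)" using al2 by (intro mult_right_mono) auto
    then show ?thesis using True s2 by simp
  next
    case False
    then have "A \<noteq> 0" by (auto simp: e_def)
    then have "\<epsilon> \<le> e" by (rule e2)
    moreover have "int (om 1) \<le> sI 2 + \<epsilon>"
    proof -
      have "sI 2 + \<epsilon> = (int (be 1 0) - 1) * int (om 0) + int i * int (om 1)"
        using al1' s2 by (simp add: \<epsilon>_def algebra_simps)
      moreover have "1 * int (om 0) \<le> (int (be 1 0) - 1) * int (om 0)" using be2 by (intro mult_right_mono) auto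
      moreover have "0 \<le> int i * int (om 1)" by simp
      ultimately show ?thesis using lt by linarith
    qed
    ultimately show ?thesis by linarith
  qed
  have base: "\<exists>P. P \<noteq> 0 \<and> Fil c (sI 2 + e) (?D (yy 2)) P"
  proof -
    let ?T1 = "of_nat (al 1) * PY ^ (al 1 - 1) * cst k" and ?T2 = "cst (th 1) * (of_nat (be 1 0) * PX ^ (be 1 0 - 1) * A)"
    have D2: "?D (yy 2) = ?T1 - ?T2"
    proof -
      have "yy 2 = PY ^ al 1 - cst (th 1) * PX ^ be 1 0" using yy_Suc[of 1] by (simp add: numeral_2_eq_2)
      then show ?thesis
        by (simp only: derivation.D_diff[OF derivation_der] derivation.D_mult[OF derivation_der, where f = "cst (th 1)"] der_power
          der_simps mult_zero_left add_0_left)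
    qed
    have nat_cst: "(of_nat m :: complex poly poly) = cst (of_nat m)" for m by (simp add: of_nat_poly)
    have T1: "Fil c (sI 2) ?T1 (smult (of_nat (al 1) * k) (cc c 1 ^ (al 1 - 1)))"
    proof -
      have "?T1 = cst (of_nat (al 1) * k) * PX ^ 0 * PY ^ (al 1 - 1)" unfolding nat_cst by (simp add: mult.commute)
      moreover have "sI 2 = int 0 * pw + int (al 1 - 1) * qw" using s2 al2 by (simp add: qw_def of_nat_diff)
      ultimately show ?thesis using Fil_monomial[of c 0 "al 1 - 1" "of_nat (al 1) * k"] by (simp only: power_0 mult_1_left)
    qed
    have T2: "Fil c (sI 2 + \<epsilon>) ?T2 (smult (th 1 * of_nat (be 1 0) * \<kappa>) (cc c 0 ^ (be 1 0 - 1) * cc c 1 ^ i))" if "A \<noteq> 0"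
    proof -
      have "?T2 = (cst (th 1 * of_nat (be 1 0)) * PX ^ (be 1 0 - 1) * PY ^ 0) * A" unfolding nat_cst by (simp add: mult.assoc)
      moreover have "sI 2 + \<epsilon> = (int (be 1 0 - 1) * pw + int 0 * qw) + int i * qw"
        using s2 be2 al1' by (simp add: \<epsilon>_def pw_def qw_def of_nat_diff algebra_simps)
      ultimately show ?thesis using Fil_mult[OF Fil_monomial[of c "be 1 0 - 1" 0 "th 1 * of_nat (be 1 0)"] FA[OF that]]
        by (simp add: mult_ac)
    qed
    have th1: "th 1 \<noteq> 0" using th_nz[of 1] n by simp
    consider "A = 0" "k \<noteq> 0" | "A \<noteq> 0" "k = 0" | "A \<noteq> 0" "k \<noteq> 0" "\<epsilon> < 0" | "A \<noteq> 0" "k \<noteq> 0" "\<epsilon> > 0"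
      using nz \<epsilon>0 by linarith
    then show ?thesis
    proof cases
      case 1
      then have "Fil c (sI 2 + e) (?D (yy 2)) (smult (of_nat (al 1) * k) (cc c 1 ^ (al 1 - 1)))"
        using T1 unfolding D2 by (simp add: e_def)
      then show ?thesis using 1 al2 cc1_nz[OF c, of 1] by (intro exI conjI) auto
    next
      case 2
      have e: "e = \<epsilon>" using 2 by (simp add: e_def)
      have z: "?T1 = 0" using 2 by simp
      have "Fil c (sI 2 + \<epsilon>) ?T1 0" unfolding z by (rule Fil_zero)
      from Fil_diff[OF this T2[OF 2(1)]] have "Fil c (sI 2 + e) (?T1 - ?T2) (0 - smult (th 1 * of_nat (be 1 0) * \<kappa>) (cc c 0 ^ (be 1 0 - 1) * cc c 1 ^ i))"
        unfolding e .
      then show ?thesis unfolding D2 using 2 be2 th1 i cc1_nz[OF c] by (intro exI conjI) (auto simp: \<kappa>_def)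
    next
      case 3
      have "Fil c (sI 2 + e) ?T2 0" by (rule Fil_less[OF T2[OF 3(1)]]) (use 3 in \<open>simp add: e_def\<close>)
      from Fil_diff[OF _ this] T1 3 have "Fil c (sI 2 + e) (?T1 - ?T2) (smult (of_nat (al 1) * k) (cc c 1 ^ (al 1 - 1)) - 0)"
        by (simp add: e_def max_def)
      then show ?thesis unfolding D2 using 3 al2 cc1_nz[OF c, of 1] by (intro exI conjI) auto
    next
      case 4
      have e: "e = \<epsilon>" using 4 by (simp add: e_def)
      have "Fil c (sI 2 + e) ?T1 0" by (rule Fil_less[OF T1]) (use 4 e in simp)
      from Fil_diff[OF this] T2[OF 4(1)] have "Fil c (sI 2 + e) (?T1 - ?T2) (0 - smult (th 1 * of_nat (be 1 0) * \<kappa>) (cc c 0 ^ (be 1 0 - 1) * cc c 1 ^ i))"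
        by (simp only: e)
      then show ?thesis unfolding D2 using 4 be2 th1 i cc1_nz[OF c] by (intro exI conjI) (auto simp: \<kappa>_def)
    qed
  qed
  have main: "\<exists>P. (2 \<le> j \<longrightarrow> P \<noteq> 0) \<and> Fil c (sI j + e) (?D (yy j)) P" if "j \<le> Suc n" for j
    using that
  proof (induction j rule: less_induct)
    case (less j)
    consider "j = 0" | "j = 1" | "j = 2" | m where "j = Suc m" "2 \<le> m" "m \<le> n" using less.prems by (cases j; force)
    then show ?case
    proof cases
      case 1 then show ?thesis using D0 by simp
    next
      case 2 then show ?thesis using D1 by simp
    next
      case 3 then show ?thesis using base by blast
    next
      case 4
      then have m: "1 \<le> m" by simp
      obtain P where P: "P \<noteq> 0" "Fil c (sI m + e) (?D (yy m)) P" using less.IH[of m] 4 less.prems by auto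
      \<comment> \<open>One less than the relative shift \<open>sI m - om m + e\<close> at
        \<open>yy m\<close>: this quantity is strictly larger at \<open>m\<close> than at any
        \<open>l < m\<close>. So the derivative of the subtracted product stays below the leading
        degree.\<close>
      let ?\<rho> = "sI m - int (om m) + e - 1"
      have los: "los c A (cst k) ?\<rho> (int (om l)) (yy l)" if l: "l < m" for l
      proof -
        obtain Q where Q: "Fil c (sI l + e) (?D (yy l)) Q" using less.IH[of l] 4 l by auto
        have "sI l + e \<le> int (om l) + ?\<rho>" using sI_less0[OF l] 4 by simp
        from Fil_le[OF Q this] Fil_yy[of l c] l 4 show ?thesis unfolding los_def by auto
      qed
      have "los c A (cst k) ?\<rho> (\<Sum>l<m. int (be m l) * int (om l)) (\<Prod>l<m. yy l ^ be m l)"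
        by (rule los_prod, rule los_power, rule los) simp
      then obtain R where R: "Fil c (int (al m) * int (om m) + ?\<rho>) (?D (\<Prod>l<m. yy l ^ be m l)) R"
        unfolding int_be_sum[OF m 4(3)] los_def by auto
      have deg: "int (al m) * int (om m) + ?\<rho> < sI j + e" "(int (al m - 1)) * int (om m) + (sI m + e) = sI j + e"
        using sI_Suc[OF m] al_pos[OF m 4(3)] by (simp_all add: 4(1) of_nat_diff algebra_simps)
      have R0: "Fil c (sI j + e) (?D (\<Prod>l<m. yy l ^ be m l)) 0" by (rule Fil_less[OF R deg(1)])
      have nat_cst: "(of_nat m :: complex poly poly) = cst (of_nat m)" for m by (simp add: of_nat_poly)
      have M: "Fil c (sI j + e) (cst (of_nat (al m)) * (yy m ^ (al m - 1) * ?D (yy m))) (smult (of_nat (al m)) (cc c m ^ (al m - 1) * P))"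
        using Fil_cmult[OF Fil_mult[OF Fil_power[OF Fil_yy[of m c], of "al m - 1"] P(2)]] 4 unfolding deg by simp
      have "?D (yy j) = cst (of_nat (al m)) * (yy m ^ (al m - 1) * ?D (yy m)) - cst (th m) * ?D (\<Prod>l<m. yy l ^ be m l)"
        unfolding 4(1) yy_Suc[OF m] derivation.D_diff[OF derivation_der] derivation.D_mult[OF derivation_der, where f = "cst (th m)"] der_power nat_cst der_simps
        by (simp only: mult_zero_left add_0_left mult.assoc)
      then have "Fil c (sI j + e) (?D (yy j)) (smult (of_nat (al m)) (cc c m ^ (al m - 1) * P) - smult (th m) 0)"
        using Fil_diff[OF M Fil_cmult[OF R0]] by simp
      moreover have "al m \<noteq> 0" using al_pos[OF m 4(3)] by simp
      ultimately show ?thesis using P(1) cc1_nz[OF c, of m] by (intro exI conjI) auto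
    qed
  qed
  show ?thesis
  proof (rule that[OF e1 e3])
    have "sI 2 \<le> sI (Suc n)"
    proof -
      have "sI 2 \<le> sI (2 + l)" if "2 + l \<le> Suc n" for l
        using that
      proof (induction l)
        case (Suc l)
        have "0 \<le> (int (al (2 + l)) - 1) * int (om (2 + l))" using al_pos[of "2 + l"] Suc.prems by simp
        then show ?case using Suc sI_Suc[of "2 + l"] by simp
      qed simp
      from this[of "n - 1"] show ?thesis using n by simp
    qed
    then show "int (om 1) \<le> sI (Suc n) + e" using base_ge by simp
    fix d Q assume Q: "Fil c d (?D (yy (Suc n))) Q"
    obtain P where P: "P \<noteq> 0" "Fil c (sI (Suc n) + e) (?D (yy (Suc n))) P" using main[of "Suc n"] n by auto
    show "sI (Suc n) + e \<le> d" by (rule Fil_degree_le[OF c P(2,1) Q])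
  qed simp_all
qed

end

section \<open>Infinitesimal generators\<close>

lemma pdx_0 [simp]: "pdx 0 = 0" by (simp add: pdx_def)

lemma pd_gens: "pdx (cst c) = 0" "pderiv (cst c) = 0" "pdx PX = 1" "pderiv PX = 0" "pdx PY = 0" "pderiv PY = 1"
  by (simp_all add: pdx_pCons pderiv_pCons one_pCons)

lemma pdx_diff: "pdx (f - g) = pdx f - pdx g"
  by (rule poly_eqI) (simp add: coeff_pdx pderiv_diff)

lemma ev_deriv:
  assumes "(u has_field_derivative u') (at s)" "(v has_field_derivative v') (at s)"
  shows "((\<lambda>s. ev f (u s, v s)) has_field_derivative ev (pdx f) (u s, v s) * u' + ev (pderiv f) (u s, v s) * v') (at s)"
proof (induction f rule: B2_induct)
  case (1 c)
  show ?case unfolding pd_gens by simp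
next
  case 2
  show ?case unfolding pd_gens using assms by simp
next
  case 3
  show ?case unfolding pd_gens using assms by simp
next
  case (4 f g)
  show ?case using DERIV_add[OF 4] by (simp add: pdx_add pderiv_add algebra_simps)
next
  case (5 f g)
  show ?case using DERIV_mult[OF 5] by (simp add: pdx_mult pderiv_mult algebra_simps)
qed

lemma ev_map_poly: "poly (map_poly (\<lambda>c. poly c x) g) y = ev g (x, y)"
proof (induction g)
  case (pCons a g)
  then show ?case by (simp add: map_poly_pCons ev_def)
qed (simp add: ev_def)

text \<open>For each fixed \<open>x\<close> the polynomial in \<open>y\<close> has no root and is
  constant; what remains is a polynomial in \<open>x\<close> without roots.\<close>

lemma nonvanishing_const:
  assumes "\<And>p. ev g p \<noteq> 0" shows "\<exists>k. k \<noteq> 0 \<and> g = cst k"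
proof -
  have "coeff g b = 0" if b: "b > 0" for b
  proof -
    have "poly (coeff g b) x = 0" for x
    proof -
      let ?p = "map_poly (\<lambda>c. poly c x) g"
      have "constant (poly ?p)"
        using fundamental_theorem_of_algebra[of ?p] assms unfolding ev_map_poly by blast
      then have "degree ?p = 0" by (simp add: constant_degree)
      then have "coeff ?p b = 0" using b by (simp add: coeff_eq_0)
      then show ?thesis by (simp add: coeff_map_poly)
    qed
    then show ?thesis using poly_all_0_iff_0 by blast
  qed
  then have "degree g = 0" by (metis gr0I leading_coeff_0_iff degree_0)
  then obtain r where r: "g = [:r:]" by (rule degree_eq_zeroE)
  have "constant (poly r)"
    using fundamental_theorem_of_algebra[of r] assms[of "(_, 0)"] unfolding r by auto
  then have "degree r = 0" by (simp add: constant_degree)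
  then obtain k where "r = [:k:]" by (rule degree_eq_zeroE)
  then show ?thesis using r assms[of 0] by auto
qed

text \<open>This uses unique factorization in \<open>\<complex>[x, y]\<close>: the reduced denominator has no zeros.\<close>

lemma local_quotient_poly:
  assumes "\<And>p. \<exists>f g. ev g p \<noteq> 0 \<and> (\<forall>q. ev g q \<noteq> 0 \<longrightarrow> F q = ev f q / ev g q)"
  shows "\<exists>h. \<forall>q. F q = ev h q"
proof -
  obtain f0 g0 where 0: "ev g0 0 \<noteq> 0" "\<forall>q. ev g0 q \<noteq> 0 \<longrightarrow> F q = ev f0 q / ev g0 q" using assms[of 0] by blast
  have "g0 \<noteq> 0" using 0 by auto
  define d where "d = gcd f0 g0"
  have d: "d \<noteq> 0" using \<open>g0 \<noteq> 0\<close> by (simp add: d_def)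
  obtain f1 g1 where fg: "f0 = d * f1" "g0 = d * g1" by (metis d_def dvdE gcd_dvd1 gcd_dvd2)
  have cop: "coprime f1 g1"
  proof -
    have "f1 = f0 div d" "g1 = g0 div d" using fg d by simp_all
    then show ?thesis using div_gcd_coprime[of f0 g0] \<open>g0 \<noteq> 0\<close> by (simp add: d_def)
  qed
  have key: "f1 * g = f * g1" if g: "ev g p \<noteq> 0" "\<forall>q. ev g q \<noteq> 0 \<longrightarrow> F q = ev f q / ev g q" for f g p
  proof -
    have "ev ((f0 * g - f * g0) * (g * g0)) q = 0" for q
    proof (cases "ev g q = 0 \<or> ev g0 q = 0")
      case False
      then have "ev f0 q / ev g0 q = ev f q / ev g q" using g(2) 0(2) by metis
      then show ?thesis using False by (simp add: frac_eq_eq)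
    qed auto
    then have "(f0 * g - f * g0) * (g * g0) = 0" using ev_zero_iff by blast
    moreover have "g \<noteq> 0" using g by auto
    ultimately have "f0 * g = f * g0" using \<open>g0 \<noteq> 0\<close> by simp
    then have "d * (f1 * g) = d * (f * g1)" unfolding fg by (simp only: mult_ac)
    then show ?thesis using d by (simp only: mult_cancel_left simp_thms)
  qed
  have "ev g1 p \<noteq> 0" for p
  proof
    assume z: "ev g1 p = 0"
    obtain f g where g: "ev g p \<noteq> 0" "\<forall>q. ev g q \<noteq> 0 \<longrightarrow> F q = ev f q / ev g q" using assms[of p] by blast
    have "g1 dvd f1 * g" unfolding key[OF g] by simp
    then have "g1 dvd g" using cop by (simp add: coprime_commute coprime_dvd_mult_right_iff)
    then obtain h where "g = g1 * h" by (rule dvdE)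
    then show False using g(1) z by simp
  qed
  then obtain k where k: "k \<noteq> 0" "g1 = cst k" using nonvanishing_const by blast
  have "F q = ev (cst (1 / k) * f1) q" for q
  proof -
    obtain f g where g: "ev g q \<noteq> 0" "\<forall>q. ev g q \<noteq> 0 \<longrightarrow> F q = ev f q / ev g q" using assms[of q] by blast
    have "ev f1 q * ev g q = ev f q * k" using arg_cong[OF key[OF g], of "\<lambda>f. ev f q"] k by simp
    moreover have "F q = ev f q / ev g q" using g by blast
    then have "ev f q = F q * ev g q" using g(1) by simp
    ultimately have "ev f1 q * ev g q = (F q * k) * ev g q" by (simp only: mult_ac)
    then have "ev f1 q = F q * k" using g(1) by (simp only: mult_cancel_right simp_thms)
    then show ?thesis using k by simp
  qed
  then show ?thesis by blast
qed

definition sm :: "complex \<times> complex \<Rightarrow> complex \<Rightarrow> complex \<times> complex" where "sm v s = (s * fst v, s * snd v)"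

lemma sm_0 [simp]: "sm v 0 = 0" and sm_add: "sm v (s + r) = sm v s + sm v r" and sm_1: "sm v 1 = v"
  by (simp_all add: sm_def zero_prod_def algebra_simps)

lemma pfun_deriv: "pfun a \<Longrightarrow> \<exists>a1 a2. \<forall>v. ((\<lambda>s. a (sm v s)) has_field_derivative fst v * a1 + snd v * a2) (at 0)"
proof (induction rule: pfun.induct)
  case (pfun_const c)
  show ?case by (intro exI[of _ 0]) simp
next
  case pfun_fst
  show ?case by (rule exI[of _ 1], rule exI[of _ 0], rule allI) (auto simp: sm_def intro!: derivative_eq_intros)
next
  case pfun_snd
  show ?case by (rule exI[of _ 0], rule exI[of _ 1], rule allI) (auto simp: sm_def intro!: derivative_eq_intros)
next
  case (pfun_add f g)
  then obtain f1 f2 g1 g2 where *: "\<forall>v. ((\<lambda>s. f (sm v s)) has_field_derivative fst v * f1 + snd v * f2) (at 0)"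
    "\<forall>v. ((\<lambda>s. g (sm v s)) has_field_derivative fst v * g1 + snd v * g2) (at 0)" by (elim exE)
  show ?case
    by (rule exI[of _ "f1 + g1"], rule exI[of _ "f2 + g2"], rule allI,
        rule DERIV_cong[OF DERIV_add[OF *(1)[rule_format] *(2)[rule_format]]]) (simp add: algebra_simps)
next
  case (pfun_mult f g)
  then obtain f1 f2 g1 g2 where *: "\<forall>v. ((\<lambda>s. f (sm v s)) has_field_derivative fst v * f1 + snd v * f2) (at 0)"
    "\<forall>v. ((\<lambda>s. g (sm v s)) has_field_derivative fst v * g1 + snd v * g2) (at 0)" by (elim exE)
  show ?case
    by (rule exI[of _ "f1 * g 0 + f 0 * g1"], rule exI[of _ "f2 * g 0 + f 0 * g2"], rule allI,
        rule DERIV_cong[OF DERIV_mult[OF *(1)[rule_format] *(2)[rule_format]]]) (simp add: algebra_simps)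
qed

lemma pfun_ev: "pfun a \<Longrightarrow> \<exists>P. \<forall>t. a t = ev P t"
proof (induction rule: pfun.induct)
  case (pfun_const c) show ?case by (rule exI[of _ "cst c"]) simp
next
  case pfun_fst show ?case by (rule exI[of _ PX]) simp
next
  case pfun_snd show ?case by (rule exI[of _ PY]) simp
next
  case (pfun_add f g)
  then obtain P Q where "\<forall>t. f t = ev P t" "\<forall>t. g t = ev Q t" by (elim exE)
  then show ?case by (intro exI[of _ "P + Q"]) simp
next
  case (pfun_mult f g)
  then obtain P Q where "\<forall>t. f t = ev P t" "\<forall>t. g t = ev Q t" by (elim exE)
  then show ?case by (intro exI[of _ "P * Q"]) simp
qed

lemma ev_line: "\<exists>p. \<forall>s. ev P (sm v s) = poly p s"
proof (induction P rule: B2_induct)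
  case (1 c) show ?case by (rule exI[of _ "[:c:]"]) simp
next
  case 2 show ?case by (rule exI[of _ "[:0, fst v:]"]) (simp add: sm_def)
next
  case 3 show ?case by (rule exI[of _ "[:0, snd v:]"]) (simp add: sm_def)
next
  case (4 f g)
  then obtain p q where "\<forall>s. ev f (sm v s) = poly p s" "\<forall>s. ev g (sm v s) = poly q s" by (elim exE)
  then show ?case by (intro exI[of _ "p + q"]) simp
next
  case (5 f g)
  then obtain p q where "\<forall>s. ev f (sm v s) = poly p s" "\<forall>s. ev g (sm v s) = poly q s" by (elim exE)
  then show ?case by (intro exI[of _ "p * q"]) simp
qed

lemma eventually_nonzero:
  assumes "(f has_field_derivative f') (at a)" "f a \<noteq> (0::complex)" shows "eventually (\<lambda>s. f s \<noteq> 0) (nhds a)"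
proof -
  have "isCont f a" by (rule DERIV_isCont[OF assms(1)])
  then have "(f \<longlongrightarrow> f a) (nhds a)" by (simp add: isCont_def tendsto_at_iff_tendsto_nhds)
  then show ?thesis using tendsto_imp_eventually_ne[OF _ assms(2)] by blast
qed

context keydata
begin

abbreviation BH :: "nat \<Rightarrow> ((complex \<times> complex) \<times> (nat \<Rightarrow> complex) set \<Rightarrow> complex) \<Rightarrow> bool" where
  "BH \<equiv> bigraded pfun YH"

lemma presents_PY: "presents (prod_fspace affine_plane Y) (UNIV \<times> Ypts) BH"
  by (rule presents_prod[OF graded_pfun graded_hfun presents_affine presents_Y])

text \<open>Differentiating at time 0 touches only the first factors, so the degree in the point is
  kept, and the result is linear in the direction \<open>v\<close>.\<close>

lemma bg_deriv:
  assumes "BH d N"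
  shows "YH d (\<lambda>p. N (0, p)) \<and> (\<exists>N1 N2. YH d N1 \<and> YH d N2 \<and>
    (\<forall>p v. ((\<lambda>s. N (sm v s, p)) has_field_derivative fst v * N1 p + snd v * N2 p) (at 0)))"
  using assms
proof induction
  case bigraded_zero
  show ?case by (intro conjI YH_zero exI[of _ "\<lambda>_. 0"]) simp
next
  case (bigraded_step f a b)
  have c: "YH d (\<lambda>p. k * b p)" for k
    using gradedD(3)[OF graded_hfun, OF gradedD(1)[OF graded_hfun, of "n + 2" wts k] bigraded_step.hyps(3)] by simp
  obtain a1 a2 where a: "\<forall>v. ((\<lambda>s. a (sm v s)) has_field_derivative fst v * a1 + snd v * a2) (at 0)"
    using pfun_deriv[OF bigraded_step.hyps(2)] by (elim exE)
  obtain f1 f2 where f: "YH d f1" "YH d f2" "\<forall>p v. ((\<lambda>s. f (sm v s, p)) has_field_derivative fst v * f1 p + snd v * f2 p) (at 0)"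
    using conjunct2[OF bigraded_step.IH] by (elim exE conjE)
  have r0: "YH d (\<lambda>p. a 0 * b p + f (0, p))"
    by (rule gradedD(2)[OF graded_hfun, OF c conjunct1[OF bigraded_step.IH]])
  have r1: "YH d (\<lambda>p. a1 * b p + f1 p)" and r2: "YH d (\<lambda>p. a2 * b p + f2 p)"
    using gradedD(2)[OF graded_hfun, OF c f(1)] gradedD(2)[OF graded_hfun, OF c f(2)] by blast+
  have r3: "((\<lambda>s. a (sm v s) * b p + f (sm v s, p)) has_field_derivative
      fst v * (a1 * b p + f1 p) + snd v * (a2 * b p + f2 p)) (at 0)" for p v
    by (rule DERIV_cong[OF DERIV_add[OF DERIV_cmult_right[OF a[rule_format]] f(3)[rule_format]]]) (simp add: algebra_simps)
  show ?case unfolding fst_conv snd_conv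
    by (rule conjI[OF r0], rule exI[of _ "\<lambda>p. a1 * b p + f1 p"], rule exI[of _ "\<lambda>p. a2 * b p + f2 p"],
        intro conjI allI r1 r2 r3)
qed

lemma bg_ev: assumes "BH d N" shows "\<exists>P. \<forall>t. N (t, p) = ev P t"
  using assms
proof induction
  case bigraded_zero show ?case by (rule exI[of _ 0]) simp
next
  case (bigraded_step f a b)
  obtain P Q where "\<forall>t. f (t, p) = ev P t" "\<forall>t. a t = ev Q t"
    using bigraded_step.IH pfun_ev[OF bigraded_step.hyps(2)] by (elim exE)
  then show ?case by (intro exI[of _ "Q * cst (b p) + P"]) simp
qed

definition cx :: "(nat \<Rightarrow> complex) set \<Rightarrow> complex" where "cx p = rep p 1 / rep p 0 ^ om 0"
definition cy :: "(nat \<Rightarrow> complex) set \<Rightarrow> complex" where "cy p = rep p 2 / rep p 0 ^ om 1"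
definition co :: "(nat \<Rightarrow> complex) set \<Rightarrow> complex \<times> complex" where "co p = (cx p, cy p)"

lemma co_pt [simp]: "co (pt xy) = xy" using coords_pt[of xy] by (simp add: co_def cx_def cy_def)
lemma cx_pt [simp]: "cx (pt xy) = fst xy" and cy_pt [simp]: "cy (pt xy) = snd xy"
  using co_pt[of xy] unfolding co_def by (auto simp: prod_eq_iff)

lemma pt_co: "p \<in> range pt \<Longrightarrow> pt (co p) = p" by auto

lemma coord_regular:
  assumes "0 < k" "i \<le> n + 2" "wts i = k" shows "(\<lambda>p. rep p i / rep p 0 ^ k) \<in> regf Y (range pt)"
proof -
  have "YH k (\<lambda>p. rep p i)" using hfunI[OF Hom_var[OF assms(2)]] assms(3) by simp
  moreover have "YH k (\<lambda>p. rep p 0 ^ k)" using hfunI[OF whom_power[OF Hom_var[of 0], of k]] by simp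
  ultimately have "(\<lambda>p. rep p i / rep p 0 ^ k) \<in> regf Y {q \<in> Ypts. rep q 0 ^ k \<noteq> 0}"
    by (intro presents_regI[OF presents_Y] qreg_basic)
  moreover have "{q \<in> Ypts. rep q 0 ^ k \<noteq> 0} = range pt" using assms(1) by (auto simp: range_pt)
  ultimately show ?thesis by simp
qed

lemma cx_regular: "cx \<in> regf Y (range pt)" and cy_regular: "cy \<in> regf Y (range pt)"
  using coord_regular[of "om 0" 1] coord_regular[of "om 1" 2] om_pos[of 0] om_pos[of 1]
  by (simp_all add: cx_def[abs_def] cy_def[abs_def] numeral_2_eq_2)

lemma YH_B2:
  assumes "YH d F" shows "\<exists>f h. Hom d h \<and> F = (\<lambda>p. h (rep p)) \<and> (\<forall>xy. ev f xy = h (zc xy))"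
proof -
  obtain h where h: "Hom d h" "F = (\<lambda>p. h (rep p))" using assms unfolding hfun_def by blast
  obtain c where "curve c" using curve_exists by blast
  then obtain f where "\<forall>xy. ev f xy = h (zc xy)" using Hom_Fil[OF h(1)] by blast
  then show ?thesis using h by blast
qed

end

section \<open>Regular functions along an action\<close>

locale gact = keydata +
  fixes \<sigma> :: "(complex \<times> complex) \<times> (nat \<Rightarrow> complex) set \<Rightarrow> (nat \<Rightarrow> complex) set"
  assumes act: "ga2_action Y \<sigma>"
begin

lemma mor: "morphism (prod_fspace affine_plane Y) Y \<sigma>" using act unfolding ga2_action_def by simp
lemma act_0 [simp]: "p \<in> Ypts \<Longrightarrow> \<sigma> (0, p) = p" using act unfolding ga2_action_def pts_Y by simp
lemma act_add: "p \<in> Ypts \<Longrightarrow> \<sigma> (s + t, p) = \<sigma> (s, \<sigma> (t, p))" using act unfolding ga2_action_def pts_Y by blast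

lemma pts_PY: "pts (prod_fspace affine_plane Y) = UNIV \<times> Ypts"
  by (rule pts_presents[OF presents_PY graded_bigraded[OF graded_pfun graded_hfun]])

lemma act_in: assumes "p \<in> Ypts" shows "\<sigma> (t, p) \<in> Ypts"
proof -
  have "\<sigma> \<in> pts (prod_fspace affine_plane Y) \<rightarrow> pts Y"
    using mor unfolding morphism_def continuous_map_def by simp
  then show ?thesis using assms unfolding pts_PY pts_Y by auto
qed

lemma act_germ:
  assumes h: "h \<in> regf Y V" and p0: "p0 \<in> Ypts" "\<sigma> (t0, p0) \<in> V"
  obtains d N Q where "BH d N" "BH d Q" "Q (t0, p0) \<noteq> 0"
    "\<And>t p. p \<in> Ypts \<Longrightarrow> Q (t, p) \<noteq> 0 \<Longrightarrow> \<sigma> (t, p) \<in> V \<and> h (\<sigma> (t, p)) = N (t, p) / Q (t, p)"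
proof -
  have V: "openin (zar Y) V" by (rule presents_openI[OF presents_Y qreg_qopen[OF presents_regD[OF presents_Y h]]])
  have m: "\<And>V f. openin (zar Y) V \<and> f \<in> regf Y V \<Longrightarrow>
      f \<circ> \<sigma> \<in> regf (prod_fspace affine_plane Y) {p \<in> pts (prod_fspace affine_plane Y). \<sigma> p \<in> V}"
    using mor unfolding morphism_def by simp
  have r: "h \<circ> \<sigma> \<in> regf (prod_fspace affine_plane Y) {z \<in> UNIV \<times> Ypts. \<sigma> z \<in> V}"
    using m[OF conjI[OF V h]] unfolding pts_PY .
  have g: "germ (UNIV \<times> Ypts) BH (t0, p0) (\<lambda>q. q \<in> {z \<in> UNIV \<times> Ypts. \<sigma> z \<in> V}) (h \<circ> \<sigma>)"
    by (rule qreg_germ[OF presents_regD[OF presents_PY r]]) (use p0 in simp)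
  obtain d N Q where *: "BH d N" "BH d Q" "Q (t0, p0) \<noteq> 0"
    "\<forall>q\<in>UNIV \<times> Ypts. Q q \<noteq> 0 \<longrightarrow> q \<in> {z \<in> UNIV \<times> Ypts. \<sigma> z \<in> V} \<and> (h \<circ> \<sigma>) q = N q / Q q"
    using germE[OF g] .
  show ?thesis by (rule that[OF *(1-3)]) (use *(4) in auto)
qed

text \<open>With the point and the direction fixed, bigraded forms are polynomials in
  \<open>s\<close>; a regular function of the moving point is therefore rational in the
  time.\<close>

lemma act_line:
  assumes h: "h \<in> regf Y V" and p0: "p \<in> Ypts" "\<sigma> (sm v s0, p) \<in> V"
  obtains A B where "poly B s0 \<noteq> 0"
    "\<And>s. poly B s \<noteq> 0 \<Longrightarrow> \<sigma> (sm v s, p) \<in> V \<and> h (\<sigma> (sm v s, p)) = poly A s / poly B s"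
proof -
  obtain d N Q where *: "BH d N" "BH d Q" "Q (sm v s0, p) \<noteq> 0"
    "\<And>t q. q \<in> Ypts \<Longrightarrow> Q (t, q) \<noteq> 0 \<Longrightarrow> \<sigma> (t, q) \<in> V \<and> h (\<sigma> (t, q)) = N (t, q) / Q (t, q)"
    by (rule act_germ[OF h p0]) (rule that)
  obtain P R where PR: "\<forall>t. N (t, p) = ev P t" "\<forall>t. Q (t, p) = ev R t" using bg_ev[OF *(1), of p] bg_ev[OF *(2), of p] by (elim exE)
  obtain A where A: "\<forall>s. ev P (sm v s) = poly A s" using ev_line by blast
  obtain B where B: "\<forall>s. ev R (sm v s) = poly B s" using ev_line by blast
  have Q: "Q (sm v s, p) = poly B s" and N: "N (sm v s, p) = poly A s" for s
    by (simp_all only: PR[rule_format] A[rule_format] B[rule_format])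
  show ?thesis
  proof (rule that[of B A])
    show "poly B s0 \<noteq> 0" using *(3) unfolding Q .
    show "\<sigma> (sm v s, p) \<in> V \<and> h (\<sigma> (sm v s, p)) = poly A s / poly B s" if "poly B s \<noteq> 0" for s
      using *(4)[OF p0(1), of "sm v s"] that unfolding Q N by blast
  qed
qed

text \<open>The quotient rule at time 0. The new denominator \<open>G\<close> is the square of the
  old one, so the forms have degree \<open>d + d\<close>.\<close>

lemma deriv_loc:
  assumes h: "h \<in> regf Y V" and p0: "p0 \<in> V" "p0 \<in> Ypts"
  obtains d F1 F2 G where "YH d F1" "YH d F2" "YH d G" "G p0 \<noteq> 0"
    "\<And>p. p \<in> Ypts \<Longrightarrow> G p \<noteq> 0 \<Longrightarrow> p \<in> V"
    "\<And>p v. p \<in> Ypts \<Longrightarrow> G p \<noteq> 0 \<Longrightarrow>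
      ((\<lambda>s. h (\<sigma> (sm v s, p))) has_field_derivative (fst v * F1 p + snd v * F2 p) / G p) (at 0)"
proof -
  obtain d N Q where *: "BH d N" "BH d Q" "Q (0, p0) \<noteq> 0"
    "\<And>t p. p \<in> Ypts \<Longrightarrow> Q (t, p) \<noteq> 0 \<Longrightarrow> \<sigma> (t, p) \<in> V \<and> h (\<sigma> (t, p)) = N (t, p) / Q (t, p)"
    by (rule act_germ[OF h p0(2), of 0]) (use p0 in auto)
  obtain N1 N2 where N: "YH d N1" "YH d N2" "\<forall>p v. ((\<lambda>s. N (sm v s, p)) has_field_derivative fst v * N1 p + snd v * N2 p) (at 0)"
    using conjunct2[OF bg_deriv[OF *(1)]] by (elim exE conjE)
  obtain Q1 Q2 where Q: "YH d Q1" "YH d Q2" "\<forall>p v. ((\<lambda>s. Q (sm v s, p)) has_field_derivative fst v * Q1 p + snd v * Q2 p) (at 0)"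
    using conjunct2[OF bg_deriv[OF *(2)]] by (elim exE conjE)
  note N0 = conjunct1[OF bg_deriv[OF *(1)]] and Q0 = conjunct1[OF bg_deriv[OF *(2)]]
  note mm = gradedD(3)[OF graded_hfun[of "n + 2" wts]]
  have F: "YH (d + d) (\<lambda>p. N1 p * Q (0, p) - N (0, p) * Q1 p)" "YH (d + d) (\<lambda>p. N2 p * Q (0, p) - N (0, p) * Q2 p)"
    "YH (d + d) (\<lambda>p. Q (0, p) * Q (0, p))"
    by (intro graded_diff[OF graded_hfun] mm N Q N0 Q0)+
  show ?thesis
  proof (rule that[OF F])
    show "Q (0, p0) * Q (0, p0) \<noteq> 0" using *(3) by simp
    fix p assume p: "p \<in> Ypts" "Q (0, p) * Q (0, p) \<noteq> 0"
    then have Qp: "Q (0, p) \<noteq> 0" by simp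
    show "p \<in> V" using *(4)[OF p(1) Qp] p(1) by simp
    fix v
    have dN: "((\<lambda>s. N (sm v s, p)) has_field_derivative fst v * N1 p + snd v * N2 p) (at 0)" using N(3) by blast
    have dQ: "((\<lambda>s. Q (sm v s, p)) has_field_derivative fst v * Q1 p + snd v * Q2 p) (at 0)" using Q(3) by blast
    have evn: "eventually (\<lambda>s. Q (sm v s, p) \<noteq> 0) (nhds 0)" by (rule eventually_nonzero[OF dQ]) (use Qp in simp)
    have e: "eventually (\<lambda>s. h (\<sigma> (sm v s, p)) = N (sm v s, p) / Q (sm v s, p)) (nhds 0)"
      by (rule eventually_mono[OF evn]) (use *(4)[OF p(1)] in blast)
    have "((\<lambda>s. N (sm v s, p) / Q (sm v s, p)) has_field_derivative
        ((fst v * N1 p + snd v * N2 p) * Q (0, p) - N (0, p) * (fst v * Q1 p + snd v * Q2 p)) / (Q (0, p) * Q (0, p))) (at 0)"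
      by (rule DERIV_cong[OF DERIV_divide[OF dN dQ]]) (use Qp in simp_all)
    then have "((\<lambda>s. h (\<sigma> (sm v s, p))) has_field_derivative
        ((fst v * N1 p + snd v * N2 p) * Q (0, p) - N (0, p) * (fst v * Q1 p + snd v * Q2 p)) / (Q (0, p) * Q (0, p))) (at 0)"
      unfolding DERIV_cong_ev[OF refl e refl] .
    then show "((\<lambda>s. h (\<sigma> (sm v s, p))) has_field_derivative (fst v * (N1 p * Q (0, p) - N (0, p) * Q1 p) +
        snd v * (N2 p * Q (0, p) - N (0, p) * Q2 p)) / (Q (0, p) * Q (0, p))) (at 0)"
      by (rule DERIV_cong) (simp add: algebra_simps)
  qed
qed

text \<open>On the affine part the derivative at time 0 is locally a quotient of polynomials, and
  \<open>local_quotient_poly\<close> glues these quotients to one polynomial. By linearity in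
  \<open>v\<close> the directions \<open>(1, 0)\<close> and \<open>(0, 1)\<close> determine the
  rest.\<close>

lemma generator_exists:
  assumes h: "h \<in> regf Y (range pt)"
  shows "\<exists>D1 D2. \<forall>xy v. ((\<lambda>s. h (\<sigma> (sm v s, pt xy))) has_field_derivative fst v * ev D1 xy + snd v * ev D2 xy) (at 0)"
proof -
  define Fv where "Fv v xy = deriv (\<lambda>s. h (\<sigma> (sm v s, pt xy))) 0" for v xy
  have loc: "\<exists>f1 f2 g. ev g xy \<noteq> 0 \<and> (\<forall>uv v. ev g uv \<noteq> 0 \<longrightarrow>
     ((\<lambda>s. h (\<sigma> (sm v s, pt uv))) has_field_derivative (fst v * ev f1 uv + snd v * ev f2 uv) / ev g uv) (at 0))" for xy
  proof -
    obtain d F1 F2 G where *: "YH d F1" "YH d F2" "YH d G" "G (pt xy) \<noteq> 0"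
      "\<And>p. p \<in> Ypts \<Longrightarrow> G p \<noteq> 0 \<Longrightarrow> p \<in> range pt"
      "\<And>p v. p \<in> Ypts \<Longrightarrow> G p \<noteq> 0 \<Longrightarrow>
      ((\<lambda>s. h (\<sigma> (sm v s, p))) has_field_derivative (fst v * F1 p + snd v * F2 p) / G p) (at 0)"
      by (rule deriv_loc[OF h _ pt_Y, of xy]) (simp, blast)
    obtain f1 h1 where 1: "Hom d h1" "F1 = (\<lambda>p. h1 (rep p))" "\<forall>xy. ev f1 xy = h1 (zc xy)" using YH_B2[OF *(1)] by blast
    obtain f2 h2 where 2: "Hom d h2" "F2 = (\<lambda>p. h2 (rep p))" "\<forall>xy. ev f2 xy = h2 (zc xy)" using YH_B2[OF *(2)] by blast
    obtain g h3 where 3: "Hom d h3" "G = (\<lambda>p. h3 (rep p))" "\<forall>xy. ev g xy = h3 (zc xy)" using YH_B2[OF *(3)] by blast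
    have nz: "G (pt uv) \<noteq> 0 \<longleftrightarrow> ev g uv \<noteq> 0" for uv by (simp only: 3(2) 3(3)[rule_format] Hom_nonzero_pt[OF 3(1)])
    have val: "(fst v * F1 (pt uv) + snd v * F2 (pt uv)) / G (pt uv) = (fst v * ev f1 uv + snd v * ev f2 uv) / ev g uv" for uv v
    proof -
      have "Hom d (\<lambda>z. fst v * h1 z + snd v * h2 z)" by (intro whom_add whom_cmult 1 2)
      from hfun_quotient[OF this 3(1), of "zc uv"] show ?thesis
        by (simp only: 1(2) 2(2) 3(2) 1(3)[rule_format] 2(3)[rule_format] 3(3)[rule_format] pt_def)
    qed
    show ?thesis
      by (rule exI[of _ f1], rule exI[of _ f2], rule exI[of _ g]) (use nz *(4) *(6)[OF pt_Y] val in auto)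
  qed
  have "\<exists>D. \<forall>xy. Fv v xy = ev D xy" for v
  proof (rule local_quotient_poly)
    fix xy
    obtain f1 f2 g where g: "ev g xy \<noteq> 0" "\<forall>uv v. ev g uv \<noteq> 0 \<longrightarrow>
     ((\<lambda>s. h (\<sigma> (sm v s, pt uv))) has_field_derivative (fst v * ev f1 uv + snd v * ev f2 uv) / ev g uv) (at 0)"
      using loc[of xy] by (elim exE conjE)
    show "\<exists>f g. ev g xy \<noteq> 0 \<and> (\<forall>q. ev g q \<noteq> 0 \<longrightarrow> Fv v q = ev f q / ev g q)"
      by (rule exI[of _ "cst (fst v) * f1 + cst (snd v) * f2"], rule exI[of _ g])
        (use g(1) DERIV_imp_deriv[OF g(2)[rule_format]] in \<open>simp add: Fv_def\<close>)
  qed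
  then obtain D1 D2 where D: "\<forall>xy. Fv (1, 0) xy = ev D1 xy" "\<forall>xy. Fv (0, 1) xy = ev D2 xy" by metis
  have "((\<lambda>s. h (\<sigma> (sm v s, pt xy))) has_field_derivative fst v * ev D1 xy + snd v * ev D2 xy) (at 0)" for v xy
  proof -
    obtain f1 f2 g where g0: "ev g xy \<noteq> 0" "\<forall>uv v. ev g uv \<noteq> 0 \<longrightarrow>
     ((\<lambda>s. h (\<sigma> (sm v s, pt uv))) has_field_derivative (fst v * ev f1 uv + snd v * ev f2 uv) / ev g uv) (at 0)"
      using loc[of xy] by (elim exE conjE)
    note g = g0(1) g0(2)[rule_format]
    have D1: "ev D1 xy = ev f1 xy / ev g xy"
      using DERIV_imp_deriv[OF g(2)[OF g(1), of "(1, 0)"]] D(1)[rule_format, of xy] unfolding Fv_def by simp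
    have D2: "ev D2 xy = ev f2 xy / ev g xy"
      using DERIV_imp_deriv[OF g(2)[OF g(1), of "(0, 1)"]] D(2)[rule_format, of xy] unfolding Fv_def by simp
    show ?thesis using g(2)[OF g(1), of v] unfolding D1 D2 by (simp add: add_divide_distrib)
  qed
  then show ?thesis by (rule_tac x = D1 in exI, rule_tac x = D2 in exI) blast
qed

end

section \<open>Generators as derivations of the polynomial ring\<close>

locale gder = gact +
  fixes X1 X2 Y1 Y2 :: "complex poly poly"
  assumes dX: "((\<lambda>s. cx (\<sigma> (sm v s, pt xy))) has_field_derivative fst v * ev X1 xy + snd v * ev X2 xy) (at 0)"
    and dY: "((\<lambda>s. cy (\<sigma> (sm v s, pt xy))) has_field_derivative fst v * ev Y1 xy + snd v * ev Y2 xy) (at 0)"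
begin

text \<open>The \<open>d/dx\<close> component of the generator in direction \<open>v\<close>;
  \<open>DB v\<close> is the \<open>d/dy\<close> component.\<close>

definition DA :: "complex \<times> complex \<Rightarrow> complex poly poly" where "DA v = cst (fst v) * X1 + cst (snd v) * X2"
definition DB :: "complex \<times> complex \<Rightarrow> complex poly poly" where "DB v = cst (fst v) * Y1 + cst (snd v) * Y2"
abbreviation DD :: "complex \<times> complex \<Rightarrow> complex poly poly \<Rightarrow> complex poly poly" where "DD v \<equiv> der (DA v) (DB v)"

lemma ev_DA [simp]: "ev (DA v) xy = fst v * ev X1 xy + snd v * ev X2 xy"
  and ev_DB [simp]: "ev (DB v) xy = fst v * ev Y1 xy + snd v * ev Y2 xy"
  by (simp_all add: DA_def DB_def)

lemma chain0: "((\<lambda>s. ev f (co (\<sigma> (sm v s, pt xy)))) has_field_derivative ev (DD v f) xy) (at 0)"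
proof -
  have "co (\<sigma> (sm v 0, pt xy)) = xy" using pt_Y by simp
  moreover have "cx p = fst (co p)" "cy p = snd (co p)" for p by (simp_all add: co_def)
  ultimately have "cx (\<sigma> (sm v 0, pt xy)) = fst xy" "cy (\<sigma> (sm v 0, pt xy)) = snd xy" by (simp_all only:)
  then show ?thesis unfolding co_def
    by (intro DERIV_cong[OF ev_deriv[OF dX dY]]) (simp add: der_def mult.commute)
qed

text \<open>The group law moves the derivative from time 0 to any time at which the orbit is in the
  affine part.\<close>

lemma flow_deriv:
  assumes p: "p \<in> Ypts" and q: "\<sigma> (sm v r, p) \<in> range pt"
  shows "((\<lambda>s. ev f (co (\<sigma> (sm v s, p)))) has_field_derivative ev (DD v f) (co (\<sigma> (sm v r, p)))) (at r)"
proof -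
  let ?xy = "co (\<sigma> (sm v r, p))"
  have "\<sigma> (sm v s, pt ?xy) = \<sigma> (sm v (s + r), p)" for s
    unfolding pt_co[OF q] sm_add by (rule act_add[OF p, symmetric])
  then have "((\<lambda>s. ev f (co (\<sigma> (sm v (s + r), p)))) has_field_derivative ev (DD v f) ?xy) (at 0)"
    using chain0[of f v ?xy] by simp
  then show ?thesis using DERIV_shift[of "\<lambda>s. ev f (co (\<sigma> (sm v s, p)))" "ev (DD v f) ?xy" 0 r] by simp
qed

lemma shift_deriv:
  assumes t: "\<sigma> (t, pt xy) \<in> range pt"
  shows "((\<lambda>s. ev f (co (\<sigma> (sm v s + t, pt xy)))) has_field_derivative ev (DD v f) (co (\<sigma> (t, pt xy)))) (at 0)"
  using chain0[of f v "co (\<sigma> (t, pt xy))"] unfolding pt_co[OF t] act_add[OF pt_Y] .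

text \<open>Near time 0 the value of \<open>f\<close> along the orbit is a quotient
  \<open>P / R\<close> of polynomials in \<open>t\<close>, and the generators act on it as the
  partial derivatives in \<open>t\<close>. Commutation is the symmetry of second derivatives, here
  an identity between numerators over the same denominator.\<close>

lemma mixed:
  fixes f :: "complex poly poly"
  assumes h: "(\<lambda>p. ev f (co p)) \<in> regf Y (range pt)"
  shows "DD (0, 1) (DD (1, 0) f) = DD (1, 0) (DD (0, 1) f)"
proof -
  let ?e1 = "(1, 0) :: complex \<times> complex" and ?e2 = "(0, 1) :: complex \<times> complex"
  have "ev (DD ?e2 (DD ?e1 f)) xy = ev (DD ?e1 (DD ?e2 f)) xy" for xy
  proof -
    obtain d N Q where *: "BH d N" "BH d Q" "Q (0, pt xy) \<noteq> 0"
      "\<And>t p. p \<in> Ypts \<Longrightarrow> Q (t, p) \<noteq> 0 \<Longrightarrow> \<sigma> (t, p) \<in> range pt \<and> ev f (co (\<sigma> (t, p))) = N (t, p) / Q (t, p)"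
      by (rule act_germ[OF h pt_Y, of 0 xy]) (use pt_Y in auto)
    obtain P R where PR: "\<forall>t. N (t, pt xy) = ev P t" "\<forall>t. Q (t, pt xy) = ev R t"
      using bg_ev[OF *(1)] bg_ev[OF *(2)] by metis
    have R0: "ev R 0 \<noteq> 0" using *(3) PR by simp
    have loc: "\<sigma> (t, pt xy) \<in> range pt" "ev f (co (\<sigma> (t, pt xy))) = ev P t / ev R t" if "ev R t \<noteq> 0" for t
      using *(4)[OF pt_Y, of t xy] PR that by auto
    have lin: "((\<lambda>s. ev g (sm v s + t)) has_field_derivative fst v * ev (pdx g) t + snd v * ev (pderiv g) t) (at 0)" for g t v
    proof -
      have 1: "((\<lambda>s. s * fst v + fst t) has_field_derivative fst v) (at 0)" "((\<lambda>s. s * snd v + snd t) has_field_derivative snd v) (at 0)"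
        by (auto intro!: derivative_eq_intros)
      have e: "sm v s + t = (s * fst v + fst t, s * snd v + snd t)" for s by (simp add: sm_def prod_eq_iff)
      show ?thesis unfolding e by (rule DERIV_cong[OF ev_deriv[OF 1]]) (simp add: mult.commute)
    qed
    have quo: "((\<lambda>s. ev g (sm v s + t) / ev k (sm v s + t)) has_field_derivative
        ev ((cst (fst v) * pdx g + cst (snd v) * pderiv g) * k - g * (cst (fst v) * pdx k + cst (snd v) * pderiv k)) t / ev (k * k) t) (at 0)"
      if "ev k t \<noteq> 0" for g k v t
      by (rule DERIV_cong[OF DERIV_divide[OF lin lin]]) (use that in simp_all)
    \<comment> \<open>Numerator of the derivative of \<open>g / k\<close> in direction
      \<open>v\<close>, over the denominator \<open>k * k\<close>.\<close>
    let ?K = "\<lambda>v g k. (cst (fst v) * pdx g + cst (snd v) * pderiv g) * k - g * (cst (fst v) * pdx k + cst (snd v) * pderiv k)"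
    have step: "ev (DD v g) (co (\<sigma> (t, pt xy))) = ev (?K v G K) t / ev (K * K) t"
      if G: "\<And>t. ev R t \<noteq> 0 \<Longrightarrow> ev K t \<noteq> 0 \<and> ev g (co (\<sigma> (t, pt xy))) = ev G t / ev K t" and t: "ev R t \<noteq> 0" for v g G K t
    proof -
      have evn: "eventually (\<lambda>s. ev R (sm v s + t) \<noteq> 0) (nhds 0)" by (rule eventually_nonzero[OF lin]) (use t in simp)
      have e: "eventually (\<lambda>s. ev g (co (\<sigma> (sm v s + t, pt xy))) = ev G (sm v s + t) / ev K (sm v s + t)) (nhds 0)"
        by (rule eventually_mono[OF evn]) (use G in blast)
      have "((\<lambda>s. ev g (co (\<sigma> (sm v s + t, pt xy)))) has_field_derivative ev (?K v G K) t / ev (K * K) t) (at 0)"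
        unfolding DERIV_cong_ev[OF refl e refl] by (rule quo) (use G[OF t] in blast)
      from DERIV_unique[OF shift_deriv[OF loc(1)[OF t]] this] show ?thesis .
    qed
    have s1: "ev (DD v f) (co (\<sigma> (t, pt xy))) = ev (?K v P R) t / ev (R * R) t" if "ev R t \<noteq> 0" for v t
      by (rule step) (use loc(2) that in auto)
    have s2: "ev (DD u (DD v f)) (co (\<sigma> (0, pt xy))) = ev (?K u (?K v P R) (R * R)) 0 / ev (R * R * (R * R)) 0" for u v
      by (rule step) (use s1 R0 in auto)
    have "?K ?e2 (?K ?e1 P R) (R * R) = ?K ?e1 (?K ?e2 P R) (R * R)"
    proof -
      have k: "?K ?e1 g k = pdx g * k - g * pdx k" "?K ?e2 g k = pderiv g * k - g * pderiv k" for g k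
        by (simp_all flip: one_pCons)
      show ?thesis unfolding k
        by (simp add: pdx_mult pdx_diff pderiv_mult pderiv_diff pdx_pderiv algebra_simps)
    qed
    then show ?thesis using s2[of ?e2 ?e1] s2[of ?e1 ?e2] pt_Y by simp
  qed
  then show ?thesis using ev_eq_iff by blast
qed

lemma commuting: "DD (0, 1) X1 = DD (1, 0) X2" "DD (0, 1) Y1 = DD (1, 0) Y2"
proof -
  have e: "DA (1, 0) = X1" "DA (0, 1) = X2" "DB (1, 0) = Y1" "DB (0, 1) = Y2"
    unfolding DA_def DB_def by (simp_all flip: one_pCons)
  have "(\<lambda>p. ev PX (co p)) \<in> regf Y (range pt)" "(\<lambda>p. ev PY (co p)) \<in> regf Y (range pt)"
    using cx_regular cy_regular by (simp_all add: co_def)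
  from mixed[OF this(1)] mixed[OF this(2)] show "DD (0, 1) X1 = DD (1, 0) X2" "DD (0, 1) Y1 = DD (1, 0) Y2"
    by (simp_all add: e)
qed

end

section \<open>Linear differential equations and rational flows\<close>

lemma poly_eq_on:
  fixes p q B :: "complex poly"
  assumes "B \<noteq> 0" "\<And>s. poly B s \<noteq> 0 \<Longrightarrow> poly p s = poly q s" shows "p = q"
proof -
  have "poly ((p - q) * B) s = 0" for s using assms(2)[of s] by (cases "poly B s = 0") auto
  then have "(p - q) * B = 0" using poly_all_0_iff_0 by blast
  then show ?thesis using assms(1) by simp
qed

lemma wronskian_scale:
  "pderiv (l * a) * (l * b) - l * a * pderiv (l * b) = (l * l) * (pderiv a * b - a * pderiv b)"
  for l a b :: "complex poly"
  by (simp add: pderiv_mult algebra_simps)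

text \<open>A rational solution of a linear system with constant coefficients is a polynomial, since
  differentiation raises the order of a pole.\<close>

lemma rational_solution:
  fixes B :: "complex poly"
  assumes "finite I" "B \<noteq> 0"
    "\<And>i. i \<in> I \<Longrightarrow> pderiv (A i) * B - A i * pderiv B = B * (\<Sum>j\<in>I. smult (m i j) (A j))"
    and "i \<in> I"
  shows "B dvd A i"
  using assms(2-4)
proof (induction "degree B" arbitrary: A B i rule: less_induct)
  case less
  show ?case
  proof (cases "degree B = 0")
    case True
    then show ?thesis using less.prems(1) by (metis degree_eq_zeroE dvd_trans is_unit_iff_degree one_dvd)
  next
    case False
    then have "\<not> constant (poly B)" by (simp add: constant_degree)
    then obtain z where z: "poly B z = 0" using fundamental_theorem_of_algebra by blast
    \<comment> \<open>Otherwise the order of \<open>B\<close> at \<open>z\<close> would be at most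
      that of its derivative, which is smaller by one. So \<open>B\<close> and all
      \<open>A j\<close> have the factor \<open>?l\<close> in common, and it can be
      cancelled.\<close>
    have Az: "poly (A j) z = 0" if j: "j \<in> I" for j
    proof (rule ccontr)
      assume nz: "poly (A j) z \<noteq> 0"
      have dB: "pderiv B \<noteq> 0" using False by (simp add: pderiv_eq_0_iff)
      have "A j * pderiv B = B * (pderiv (A j) - (\<Sum>k\<in>I. smult (m j k) (A k)))"
        using less.prems(2)[OF j] by (simp add: algebra_simps)
      then have "B dvd A j * pderiv B" by simp
      moreover have n: "A j * pderiv B \<noteq> 0" using nz dB by auto
      ultimately have "order z B \<le> order z (A j * pderiv B)" by (intro dvd_imp_order_le)
      also have "\<dots> = order z (pderiv B)" using order_mult[OF n] nz by (simp add: order_0I)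
      finally show False using order_pderiv[OF less.prems(1) z] by simp
    qed
    let ?l = "[:- z, 1:]"
    obtain B' where B': "B = ?l * B'" using z by (metis dvdE poly_eq_0_iff_dvd)
    have "\<forall>j\<in>I. \<exists>C. A j = ?l * C" using Az by (metis dvdE poly_eq_0_iff_dvd)
    then obtain A' where A': "\<And>j. j \<in> I \<Longrightarrow> A j = ?l * A' j" by metis
    have B0: "B' \<noteq> 0" using less.prems(1) B' by auto
    have deg: "degree B' < degree B" unfolding B' using B0 by (subst degree_mult_eq) auto
    have "B' dvd A' i"
    proof (rule less.hyps[OF deg B0 _ less.prems(3)])
      fix j assume j: "j \<in> I"
      have s: "(\<Sum>k\<in>I. smult (m j k) (A k)) = ?l * (\<Sum>k\<in>I. smult (m j k) (A' k))"
        unfolding sum_distrib_left by (rule sum.cong) (simp_all add: A')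
      have "pderiv (?l * A' j) * (?l * B') - ?l * A' j * pderiv (?l * B') = (?l * B') * (?l * (\<Sum>k\<in>I. smult (m j k) (A' k)))"
        using less.prems(2)[OF j] unfolding s unfolding B' A'[OF j] .
      then have "(?l * ?l) * (pderiv (A' j) * B' - A' j * pderiv B') = (?l * ?l) * (B' * (\<Sum>k\<in>I. smult (m j k) (A' k)))"
        unfolding wronskian_scale by (simp only: mult_ac)
      moreover have "?l * ?l \<noteq> 0" by simp
      ultimately show "pderiv (A' j) * B' - A' j * pderiv B' = B' * (\<Sum>k\<in>I. smult (m j k) (A' k))"
        by (simp only: mult_cancel_left simp_thms)
    qed
    then show ?thesis unfolding B' A'[OF less.prems(3)] by (rule mult_dvd_mono[OF dvd_refl])
  qed
qed

lemma choice2: "\<forall>x. \<exists>a b. P x a b \<Longrightarrow> \<exists>f g. \<forall>x. P x (f x) (g x)"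
  by metis

lemma pderiv_funpow_zero: "\<exists>N. (pderiv ^^ N) (p :: complex poly) = 0"
proof (induction "degree p" arbitrary: p rule: less_induct)
  case less
  show ?case
  proof (cases "degree p = 0")
    case True
    then have "pderiv p = 0" using pderiv_eq_0_iff by blast
    then have "(pderiv ^^ 1) p = 0" by simp
    then show ?thesis by blast
  next
    case False
    then have "degree (pderiv p) < degree p" by (simp add: degree_pderiv)
    then obtain N where "(pderiv ^^ N) (pderiv p) = 0" using less by blast
    then show ?thesis by (intro exI[of _ "Suc N"]) (simp add: funpow_swap1)
  qed
qed

text \<open>Countably many curves do not cover the plane: some \<open>x\<close> avoids the zeros of
  all leading coefficients, and then some \<open>y\<close> avoids the zeros of all specialised
  polynomials.\<close>

lemma common_nonzero:
  assumes "\<And>k::nat. g k \<noteq> 0" shows "\<exists>xy. \<forall>k. ev (g k) xy \<noteq> 0"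
proof -
  have avoid: "\<exists>x. \<forall>k. poly (p k) x \<noteq> 0" if p: "\<And>k::nat. p k \<noteq> 0" for p :: "nat \<Rightarrow> complex poly"
  proof -
    have "countable (\<Union>k. {x. poly (p k) x = 0})"
      using p by (intro countable_UN[OF countableI_type] countable_finite[OF poly_roots_finite]) simp
    then have "(\<Union>k. {x. poly (p k) x = 0}) \<noteq> UNIV" using uncountable_UNIV_complex by metis
    then show ?thesis by auto
  qed
  obtain x where x: "\<forall>k. poly (lead_coeff (g k)) x \<noteq> 0" using avoid[of "\<lambda>k. lead_coeff (g k)"] assms by auto
  have nz: "map_poly (\<lambda>c. poly c x) (g k) \<noteq> 0" for k
  proof
    assume "map_poly (\<lambda>c. poly c x) (g k) = 0"
    then have "coeff (map_poly (\<lambda>c. poly c x) (g k)) (degree (g k)) = 0" by simp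
    then show False using x by (simp add: coeff_map_poly)
  qed
  then obtain y where "\<forall>k. poly (map_poly (\<lambda>c. poly c x) (g k)) y \<noteq> 0" using avoid[of "\<lambda>k. map_poly (\<lambda>c. poly c x) (g k)", OF nz] by blast
  then show ?thesis unfolding ev_map_poly by blast
qed

section \<open>Regularity along the curve at infinity\<close>

context keydata
begin

definition mval :: "(nat \<Rightarrow> nat) \<Rightarrow> (nat \<Rightarrow> complex) \<Rightarrow> complex" where "mval a z = (\<Prod>j\<le>Suc n. z (Suc j) ^ a j)"

lemma Hom_mval: "Hom (wt a) (mval a)"
proof -
  have "Hom (\<Sum>j\<le>Suc n. a j * om j) (\<lambda>z. \<Prod>j\<le>Suc n. z (Suc j) ^ a j)"
    by (intro whom_prod whom_power) (use Hom_var[of "Suc _"] in auto)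
  then show ?thesis by (simp add: wt_def mval_def[abs_def])
qed

lemma mval_zc: "mval a (zc xy) = ev (Mo a) xy" unfolding mval_def Mo_def ev_prod by (intro prod.cong) auto

lemma cone_zi: assumes "curve c" "V \<noteq> 0" shows "ycone (zi c V)"
  unfolding ycone_def
proof (intro conjI ballI allI impI)
  show "\<exists>i\<le>n + 2. zi c V i \<noteq> 0" by (rule exI[of _ "Suc (Suc n)"]) (use assms in \<open>simp add: zi_def\<close>)
  fix i assume "i > n + 2" then show "zi c V i = 0" by (cases i) (auto simp: zi_def)
next
  fix k assume k: "k \<in> {1..n}"
  then have 1: "(0::complex) ^ (al k * om k - om (Suc k)) = 0" using om_less[of k] by (simp add: zero_power)
  have 2: "c k ^ al k = th k * (\<Prod>j<k. c j ^ be k j)" using assms(1) k unfolding curve_def by blast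
  have "(\<Prod>j<k. zi c V (Suc j) ^ be k j) = (\<Prod>j<k. c j ^ be k j)"
    by (rule prod.cong) (use k in \<open>auto simp: zi_def\<close>)
  moreover have "zi c V 0 = 0" "zi c V (Suc k) = c k" using k by (simp_all add: zi_def)
  ultimately show "eqn k (zi c V) = 0" unfolding eqn_def using 1 2 by simp
qed

lemma mval_zi_nz: assumes "curve c" "V \<noteq> 0" shows "mval a (zi c V) \<noteq> 0"
  using assms curve_nz[OF assms(1)] by (auto simp: mval_def zi_def prod_zero_iff)

end

context gder
begin

lemma near_affine: "eventually (\<lambda>s. \<sigma> (sm v s, pt xy) \<in> range pt) (nhds 0)"
proof -
  obtain A B where B: "poly B 0 \<noteq> 0"
    "\<And>s. poly B s \<noteq> 0 \<Longrightarrow> \<sigma> (sm v s, pt xy) \<in> range pt \<and> cx (\<sigma> (sm v s, pt xy)) = poly A s / poly B s"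
    by (rule act_line[OF cx_regular pt_Y, of v 0 xy]) (use pt_Y in auto)
  have "eventually (\<lambda>s. poly B s \<noteq> 0) (nhds 0)" by (rule eventually_nonzero[OF poly_DERIV B(1)])
  then show ?thesis by (rule eventually_mono) (use B(2) in blast)
qed

text \<open>The function \<open>w^{wt a - wt b} * Mo b / Mo a\<close> is regular near a point at
  infinity with all \<open>y_j\<close> nonzero, hence so is its derivative along the action. There
  this derivative is \<open>f / g\<close> with forms of the same degree and \<open>g\<close> nonzero
  at the point, so that \<open>g\<close> has a nonzero leading form. On the affine part the quotient
  rule gives \<open>?L * g = f * (Mo a * Mo a)\<close>, and cancelling \<open>g\<close> bounds the
  degree of \<open>?L\<close>.\<close>

lemma quot_bound:
  assumes c: "curve c" and ab: "wt b \<le> wt a"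
  shows "\<exists>P. Fil c (2 * int (wt a)) (DD v (Mo b) * Mo a - Mo b * DD v (Mo a)) P"
proof -
  let ?V = "{p \<in> Ypts. mval a (rep p) \<noteq> 0}"
  define h where "h p = rep p 0 ^ (wt a - wt b) * mval b (rep p) / mval a (rep p)" for p :: "(nat \<Rightarrow> complex) set"
  have Hnum: "Hom (wt a) (\<lambda>z. z 0 ^ (wt a - wt b) * mval b z)"
    using whom_mult[OF whom_power[OF Hom_var[of 0], of "wt a - wt b"] Hom_mval[of b]] ab by simp
  have "(\<lambda>p. (rep p 0 ^ (wt a - wt b) * mval b (rep p)) / mval a (rep p)) \<in> regf Y ?V"
    by (rule presents_regI[OF presents_Y qreg_basic[of YH "wt a" "\<lambda>p. rep p 0 ^ (wt a - wt b) * mval b (rep p)" "\<lambda>p. mval a (rep p)", OF hfunI[OF Hnum] hfunI[OF Hom_mval]]])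
  then have hreg: "h \<in> regf Y ?V" by (simp add: h_def[abs_def])
  define q0 where "q0 = worbit wts (zi c 1)"
  have q0: "q0 \<in> Ypts" unfolding q0_def Ypts_eq using cone_zi[OF c, of 1] by auto
  have q0V: "q0 \<in> ?V" using q0 mval_zi_nz[OF c, of 1 a] hfun_worbit[OF Hom_mval[of a], of "zi c 1"] by (simp add: q0_def)
  obtain d F1 F2 G where *: "YH d F1" "YH d F2" "YH d G" "G q0 \<noteq> 0"
    "\<And>p. p \<in> Ypts \<Longrightarrow> G p \<noteq> 0 \<Longrightarrow> p \<in> ?V"
    "\<And>p v. p \<in> Ypts \<Longrightarrow> G p \<noteq> 0 \<Longrightarrow>
      ((\<lambda>s. h (\<sigma> (sm v s, p))) has_field_derivative (fst v * F1 p + snd v * F2 p) / G p) (at 0)"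
    by (rule deriv_loc[OF hreg q0V q0]) (rule that)
  obtain h1 where h1: "Hom d h1" "F1 = (\<lambda>p. h1 (rep p))" using *(1) unfolding hfun_def by blast
  obtain h2 where h2: "Hom d h2" "F2 = (\<lambda>p. h2 (rep p))" using *(2) unfolding hfun_def by blast
  obtain h3 where h3: "Hom d h3" "G = (\<lambda>p. h3 (rep p))" using *(3) unfolding hfun_def by blast
  have Hv: "Hom d (\<lambda>z. fst v * h1 z + snd v * h2 z)" by (intro whom_add whom_cmult h1 h2)
  obtain g \<Gamma> where g: "Fil c (int d) g \<Gamma>" "\<forall>xy. ev g xy = h3 (zc xy)" "\<forall>V. poly \<Gamma> V = h3 (zi c V)"
    using Hom_Fil[OF h3(1) c] by blast
  obtain f \<Phi> where f: "Fil c (int d) f \<Phi>" "\<forall>xy. ev f xy = fst v * h1 (zc xy) + snd v * h2 (zc xy)"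
    using Hom_Fil[OF Hv c] by blast
  have "poly \<Gamma> 1 \<noteq> 0" using *(4) hfun_worbit[OF h3(1), of "zi c 1"] g(3) by (simp add: h3(2) q0_def)
  then have \<Gamma>: "\<Gamma> \<noteq> 0" by auto
  have hpt: "h (pt uv) = ev (Mo b) uv / ev (Mo a) uv" for uv
    using hfun_quotient[OF Hnum Hom_mval[of a], of "zc uv"] unfolding h_def pt_def by (simp add: mval_zc)
  let ?L = "DD v (Mo b) * Mo a - Mo b * DD v (Mo a)"
  have at: "ev (?L * g) xy = ev (f * (Mo a * Mo a)) xy" if gz: "ev g xy \<noteq> 0" for xy
  proof -
    have Gz: "G (pt xy) \<noteq> 0" using Hom_nonzero_pt[OF h3(1)] gz g(2)[rule_format, of xy] h3(2) by simp
    have "mval a (rep (pt xy)) \<noteq> 0" using *(5)[OF pt_Y Gz] by simp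
    then have az: "ev (Mo a) xy \<noteq> 0" using Hom_nonzero_pt[OF Hom_mval] by (simp add: mval_zc)
    have d1: "((\<lambda>s. h (\<sigma> (sm v s, pt xy))) has_field_derivative ev f xy / ev g xy) (at 0)"
    proof -
      have "(fst v * F1 (pt xy) + snd v * F2 (pt xy)) / G (pt xy) = ev f xy / ev g xy"
        using hfun_quotient[OF Hv h3(1), of "zc xy"] unfolding pt_def h1(2) h2(2) h3(2) f(2)[rule_format] g(2)[rule_format] .
      then show ?thesis using *(6)[OF pt_Y Gz, of v] by simp
    qed
    have e: "eventually (\<lambda>s. h (\<sigma> (sm v s, pt xy)) = ev (Mo b) (co (\<sigma> (sm v s, pt xy))) / ev (Mo a) (co (\<sigma> (sm v s, pt xy)))) (nhds 0)"
    proof (rule eventually_mono[OF near_affine])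
      fix s assume a: "\<sigma> (sm v s, pt xy) \<in> range pt"
      show "h (\<sigma> (sm v s, pt xy)) = ev (Mo b) (co (\<sigma> (sm v s, pt xy))) / ev (Mo a) (co (\<sigma> (sm v s, pt xy)))"
        using hpt[of "co (\<sigma> (sm v s, pt xy))"] unfolding pt_co[OF a] .
    qed
    have c0: "co (\<sigma> (sm v 0, pt xy)) = xy" using pt_Y by simp
    have "((\<lambda>s. h (\<sigma> (sm v s, pt xy))) has_field_derivative ev ?L xy / ev (Mo a * Mo a) xy) (at 0)"
      unfolding DERIV_cong_ev[OF refl e refl]
      by (rule DERIV_cong[OF DERIV_divide[OF chain0 chain0]]) (use az in \<open>simp_all only: c0 ev_simps not_False_eq_True\<close>)
    from DERIV_unique[OF d1 this] show ?thesis using gz az by (simp add: frac_eq_eq)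
  qed
  have "ev ((?L * g - f * (Mo a * Mo a)) * g) xy = 0" for xy
  proof (cases "ev g xy = 0")
    case True
    then show ?thesis by (simp only: ev_simps mult_zero_right)
  next
    case False
    then show ?thesis using at[OF False] by (simp only: ev_simps diff_self mult_zero_left)
  qed
  then have "(?L * g - f * (Mo a * Mo a)) * g = 0" using ev_zero_iff by blast
  moreover have "g \<noteq> 0" using g(1) \<Gamma> Fil_well_defined[OF c] by blast
  ultimately have e: "?L * g = f * (Mo a * Mo a)" by simp
  have Ma: "Fil c (int (wt a)) (Mo a) (In c a)" using Fil_monom[of a "int (wt a)" c 1] by (simp flip: one_pCons)
  have "Fil c (2 * int (wt a) + int d) (?L * g) (\<Phi> * (In c a * In c a))"
    using Fil_mult[OF f(1) Fil_mult[OF Ma Ma]] unfolding e by (simp add: algebra_simps)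
  then show ?thesis by (rule Fil_cancel[OF c g(1) \<Gamma>])
qed

text \<open>On leading forms the derivation acts as \<open>l\<close> times the Euler field: a form
  \<open>P\<close> of degree \<open>d\<close> goes to \<open>d * l * P\<close>, with degree shifted
  by \<open>r\<close>. The product rule preserves this shape.\<close>

definition Eul :: "(nat \<Rightarrow> complex) \<Rightarrow> complex \<times> complex \<Rightarrow> int \<Rightarrow> complex poly \<Rightarrow> nat \<Rightarrow> complex poly poly \<Rightarrow> complex poly \<Rightarrow> bool" where
  "Eul c v r l d f P \<longleftrightarrow> Fil c (int d) f P \<and> Fil c (int d + r) (DD v f) (smult (of_nat d) (l * P))"

lemma Eul_mult: assumes "Eul c v r l d f P" "Eul c v r l e g Q" shows "Eul c v r l (d + e) (f * g) (P * Q)"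
proof -
  note * = assms[unfolded Eul_def]
  have "Fil c (int (d + e) + r) (DD v f * g) (smult (of_nat d) (l * P) * Q)" "Fil c (int (d + e) + r) (f * DD v g) (P * smult (of_nat e) (l * Q))"
    using Fil_mult[OF conjunct2[OF *(1)] conjunct1[OF *(2)]] Fil_mult[OF conjunct1[OF *(1)] conjunct2[OF *(2)]]
    by (simp_all add: algebra_simps)
  from Fil_add[OF this]
  have "Fil c (int (d + e) + r) (DD v (f * g)) (smult (of_nat (d + e)) (l * (P * Q)))"
    unfolding derivation.D_mult[OF derivation_der] by (simp add: smult_add_left algebra_simps)
  then show ?thesis unfolding Eul_def using Fil_mult[OF conjunct1[OF *(1)] conjunct1[OF *(2)]] by simp
qed

lemma Eul_one: "Eul c v r l 0 1 1"
  using Fil_const[of c 1] Fil_zero[of c r] der_simps(3)[of "DA v" "DB v" 1] unfolding Eul_def by (simp flip: one_pCons)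

lemma Eul_power: "Eul c v r l d f P \<Longrightarrow> Eul c v r l (k * d) (f ^ k) (P ^ k)"
proof (induction k)
  case (Suc k)
  show ?case using Eul_mult[OF Suc.prems Suc.IH[OF Suc.prems]] by simp
qed (simp add: Eul_one)

lemma Eul_prod: "(\<And>i. i \<in> I \<Longrightarrow> Eul c v r l (d i) (f i) (P i)) \<Longrightarrow> Eul c v r l (\<Sum>i\<in>I. d i) (\<Prod>i\<in>I. f i) (\<Prod>i\<in>I. P i)"
  by (induction I rule: infinite_finite_induct) (auto intro: Eul_one Eul_mult)

text \<open>Let \<open>R\<close> be the least natural number by which the generator raises degrees.
  If \<open>R > 0\<close>, comparing \<open>y_j^{om 0}\<close> with \<open>y_0^{om j}\<close> by
  \<open>quot_bound\<close> shows that the leading part is \<open>l\<close> times the Euler field.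
  Two monomials with weights differing by 1 then give \<open>R = 1\<close>. Finally the leading form
  of the image of \<open>y_{n+1}\<close> has to respect the semigroup of weights, and as the earlier
  weights are at least 2, this leaves \<open>l = \<gamma> V\<close> together with
  \<open>om (Suc n) = 1\<close>.\<close>

lemma degree_drop:
  assumes c: "curve c" and om2: "\<And>j. j \<le> n \<Longrightarrow> 2 \<le> om j" and bez: "\<exists>a b. wt a = Suc (wt b)"
  shows "\<exists>\<gamma>. (\<forall>j\<le>Suc n. Fil c (int (om j) + 1) (DD v (yy j)) (smult (of_nat (om j)) (monom \<gamma> 1 * cc c j))) \<and>
    (2 \<le> om (Suc n) \<longrightarrow> \<gamma> = 0)"
proof -
  let ?D = "DD v"
  have ex: "\<exists>R. \<forall>j\<le>Suc n. \<exists>P. Fil c (int (om j) + int R) (?D (yy j)) P"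
  proof -
    have ex0: "\<forall>j. \<exists>d P. 0 \<le> d \<and> Fil c d (?D (yy j)) P" using Fil_exhaust by blast
    obtain d P where dP: "\<forall>j. 0 \<le> d j \<and> Fil c (d j) (?D (yy j)) (P j)" using choice2[OF ex0] by (elim exE)
    then have d: "\<And>j. 0 \<le> d j" "\<And>j. Fil c (d j) (?D (yy j)) (P j)" by blast+
    have "d j \<le> int (om j) + int (nat (\<Sum>i\<le>Suc n. d i))" if "j \<le> Suc n" for j
    proof -
      have "d j \<le> (\<Sum>i\<le>Suc n. d i)" by (rule member_le_sum) (use d that in auto)
      then show ?thesis by simp
    qed
    then show ?thesis using Fil_le[OF d(2)] by blast
  qed
  \<comment> \<open>A natural number, so a field that lowers all degrees is counted under
    \<open>R = 0\<close>, where \<gamma> = 0 will do.\<close>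
  define R where "R = (LEAST R. \<forall>j\<le>Suc n. \<exists>P. Fil c (int (om j) + int R) (?D (yy j)) P)"
  have R: "\<forall>j\<le>Suc n. \<exists>P. Fil c (int (om j) + int R) (?D (yy j)) P" unfolding R_def by (rule LeastI_ex[OF ex])
  have R_le: "R \<le> r" if "\<forall>j\<le>Suc n. \<exists>P. Fil c (int (om j) + int r) (?D (yy j)) P" for r
    unfolding R_def by (rule Least_le[where P = "\<lambda>r. \<forall>j\<le>Suc n. \<exists>P. Fil c (int (om j) + int r) (?D (yy j)) P", OF that])
  show ?thesis
  proof (cases "R = 0")
    case True
    have "Fil c (int (om j) + 1) (?D (yy j)) 0" if j: "j \<le> Suc n" for j
    proof -
      obtain P where "Fil c (int (om j) + int R) (?D (yy j)) P" using R j by blast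
      then show ?thesis by (rule Fil_less) (use True in simp)
    qed
    then show ?thesis by (intro exI[of _ 0]) simp
  next
    case False
    have "\<forall>j\<in>{..Suc n}. \<exists>P. Fil c (int (om j) + int R) (?D (yy j)) P" using R by simp
    then obtain P where "\<forall>j\<in>{..Suc n}. Fil c (int (om j) + int R) (?D (yy j)) (P j)" by (rule bchoice[THEN exE])
    then have P: "\<And>j. j \<le> Suc n \<Longrightarrow> Fil c (int (om j) + int R) (?D (yy j)) (P j)" by simp
    have nz: "\<exists>j\<le>Suc n. P j \<noteq> 0"
    proof (rule ccontr)
      assume "\<not> ?thesis"
      then have "\<forall>j\<le>Suc n. \<exists>Q. Fil c (int (om j) + int (R - 1)) (?D (yy j)) Q"
        using P Fil_drop[OF c, of "int (om _) + int R"] False by (auto simp: of_nat_diff algebra_simps)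
      then have "R \<le> R - 1" by (rule R_le)
      then show False using False by simp
    qed
    have o0: "om 0 > 0" using om_pos[of 0] by simp
    have cc0: "cc c 0 = 1" using c by (simp add: cc_def curve_def one_pCons)
    have pw: "Fil c (int (k * om j) + int R) (?D (yy j ^ k)) (smult (of_nat k) (cc c j ^ (k - 1) * P j))"
      if j: "j \<le> Suc n" and k: "0 < k" for j k
    proof -
      have nat_cst: "(of_nat m :: complex poly poly) = cst (of_nat m)" for m by (simp add: of_nat_poly)
      have e: "?D (yy j ^ k) = cst (of_nat k) * (yy j ^ (k - 1) * ?D (yy j))" unfolding der_power nat_cst by (simp only: mult.assoc)
      have d: "int (k - 1) * int (om j) + (int (om j) + int R) = int (k * om j) + int R"
        using k by (simp add: of_nat_diff algebra_simps)
      show ?thesis unfolding e using Fil_cmult[OF Fil_mult[OF Fil_power[OF Fil_yy[OF j, of c], of "k - 1"] P[OF j]], of "of_nat k"] unfolding d .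
    qed
    define l where "l = smult (1 / of_nat (om 0)) (P 0)"
    have Pl: "P j = smult (of_nat (om j)) (l * cc c j)" if j: "j \<le> Suc n" for j
    proof -
      have j0: "(0::nat) \<le> Suc n" by simp
      \<comment> \<open>Two monomials of equal weight: the bound of \<open>quot_bound\<close> lies
        \<open>R\<close> below the degree of either product, so the two leading forms must
        cancel.\<close>
      let ?a = "ex1 0 (om j)" and ?b = "ex1 j (om 0)"
      have oj: "om j > 0" using om_pos[OF j] .
      have w: "wt ?a = om j * om 0" "wt ?b = om j * om 0" using j by (simp_all add: wt_ex1 mult.commute)
      have M: "Mo ?a = yy 0 ^ om j" "Mo ?b = yy j ^ om 0" using j Mo_ex1 by simp_all
      obtain Q where Q: "Fil c (2 * int (om j * om 0)) (?D (yy j ^ om 0) * yy 0 ^ om j - yy j ^ om 0 * ?D (yy 0 ^ om j)) Q"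
        using quot_bound[OF c, of ?b ?a v] unfolding w M by auto
      have F1: "Fil c (2 * int (om j * om 0) + int R) (?D (yy j ^ om 0) * yy 0 ^ om j) (smult (of_nat (om 0)) (cc c j ^ (om 0 - 1) * P j) * cc c 0 ^ om j)"
        using Fil_mult[OF pw[OF j o0] Fil_power[OF Fil_yy[OF j0, of c], of "om j"]] by (simp add: algebra_simps)
      have F2: "Fil c (2 * int (om j * om 0) + int R) (yy j ^ om 0 * ?D (yy 0 ^ om j)) (cc c j ^ om 0 * smult (of_nat (om j)) (cc c 0 ^ (om j - 1) * P 0))"
        using Fil_mult[OF Fil_power[OF Fil_yy[OF j, of c], of "om 0"] pw[OF j0 oj]] by (simp add: algebra_simps)
      have "Fil c (2 * int (om j * om 0) + int R) (?D (yy j ^ om 0) * yy 0 ^ om j - yy j ^ om 0 * ?D (yy 0 ^ om j)) 0"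
        by (rule Fil_less[OF Q]) (use False in simp)
      from Fil_unique[OF c Fil_diff[OF F1 F2] this]
      have "smult (of_nat (om 0)) (cc c j ^ (om 0 - 1) * P j) = cc c j ^ om 0 * smult (of_nat (om j)) (P 0)"
        by (simp add: cc0)
      also have "\<dots> = cc c j ^ (om 0 - 1) * (cc c j * smult (of_nat (om j)) (P 0))"
        using o0 by (cases "om 0") (simp_all add: mult_ac)
      finally have "cc c j ^ (om 0 - 1) * smult (of_nat (om 0)) (P j) = cc c j ^ (om 0 - 1) * (cc c j * smult (of_nat (om j)) (P 0))"
        by simp
      then have "smult (of_nat (om 0)) (P j) = cc c j * smult (of_nat (om j)) (P 0)"
        using cc1_nz[OF c, of j] by (simp only: mult_cancel_left power_eq_0_iff simp_thms)
      then have "smult (1 / of_nat (om 0)) (smult (of_nat (om 0)) (P j)) = smult (1 / of_nat (om 0)) (cc c j * smult (of_nat (om j)) (P 0))"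
        by (simp only:)
      then show ?thesis using o0 by (simp add: l_def mult.commute)
    qed
    have l0: "l \<noteq> 0" using nz Pl by force
    have EM: "Eul c v (int R) l (wt a) (Mo a) (In c a)" for a
    proof -
      have "Eul c v (int R) l (om j) (yy j) (cc c j)" if j: "j \<le> Suc n" for j
        unfolding Eul_def using Fil_yy[OF j, of c] P[OF j] unfolding Pl[OF j] by blast
      then show ?thesis unfolding wt_def Mo_def In_def by (intro Eul_prod Eul_power) simp
    qed
    obtain a b where ab: "wt a = Suc (wt b)" using bez by blast
    have R1: "R = 1"
    proof -
      obtain Q where Q: "Fil c (2 * int (wt a)) (?D (Mo b) * Mo a - Mo b * ?D (Mo a)) Q"
        using quot_bound[OF c, of b a v] ab by auto
      note Ea = EM[of a, unfolded Eul_def] and Eb = EM[of b, unfolded Eul_def]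
      have "Fil c (int (wt a) + int (wt b) + int R) (?D (Mo b) * Mo a) (smult (of_nat (wt b)) (l * In c b) * In c a)"
        "Fil c (int (wt a) + int (wt b) + int R) (Mo b * ?D (Mo a)) (In c b * smult (of_nat (wt a)) (l * In c a))"
        using Fil_mult[OF conjunct2[OF Eb] conjunct1[OF Ea]] Fil_mult[OF conjunct1[OF Eb] conjunct2[OF Ea]]
        by (simp_all add: algebra_simps)
      from Fil_diff[OF this]
      have F: "Fil c (int (wt a) + int (wt b) + int R) (?D (Mo b) * Mo a - Mo b * ?D (Mo a)) (- (l * In c b * In c a))"
        unfolding ab by (simp add: smult_add_left algebra_simps)
      have "In c b \<noteq> 0" "In c a \<noteq> 0" using cc1_nz[OF c] by (simp_all add: In_def prod_zero_iff)
      then have "int (wt a) + int (wt b) + int R \<le> 2 * int (wt a)"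
        by (intro Fil_degree_le[OF c F _ Q]) (use l0 in simp)
      then show ?thesis using ab False by simp
    qed
    have supp: "b = 1 \<and> om (Suc n) = 1" if "coeff l b \<noteq> 0" for b
    proof -
      have "cc c (Suc n) = [:0, 1:]" by (simp add: cc_def)
      then have "P (Suc n) = smult (of_nat (om (Suc n))) (pCons 0 l)" using Pl[of "Suc n"] by simp
      then have "coeff (P (Suc n)) (Suc b) \<noteq> 0" using that om_pos[of "Suc n"] by simp
      \<comment> \<open>The leading form in question is a multiple of \<open>V * l\<close>. Taking
        away the weight of one factor \<open>V\<close>, a term \<open>V^b\<close> of
        \<open>l\<close> belongs to a monomial of total weight \<open>R = 1\<close>.\<close>
      then obtain h where h: "int (\<Sum>j\<le>n. h j * om j) + int (Suc b) * int (om (Suc n)) = int (om (Suc n)) + int R"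
        using Fil_support[OF P[of "Suc n"]] by blast
      then have "int ((\<Sum>j\<le>n. h j * om j) + b * om (Suc n)) = int 1" using R1 by (simp add: algebra_simps)
      then have s: "(\<Sum>j\<le>n. h j * om j) + b * om (Suc n) = 1" by (simp only: of_nat_eq_iff)
      have "h j = 0" if j: "j \<le> n" for j
      proof (rule ccontr)
        assume "h j \<noteq> 0"
        have "h j * om j \<le> (\<Sum>j\<le>n. h j * om j)" by (rule member_le_sum) (use j in auto)
        moreover have "1 * 2 \<le> h j * om j" using \<open>h j \<noteq> 0\<close> om2[OF j] by (intro mult_le_mono) auto
        ultimately show False using s by simp
      qed
      then have "b * om (Suc n) = 1" using s by simp
      then show ?thesis by simp
    qed
    obtain b0 where "coeff l b0 \<noteq> 0" using l0 by (metis leading_coeff_0_iff)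
    then have o1: "om (Suc n) = 1" using supp by blast
    have "l = monom (coeff l 1) 1" by (rule poly_eqI) (use supp in force)
    then have lm: "monom (coeff l 1) 1 = l" by simp
    have "\<forall>j\<le>Suc n. Fil c (int (om j) + 1) (?D (yy j)) (smult (of_nat (om j)) (monom (coeff l 1) 1 * cc c j))"
    proof (intro allI impI)
      fix j assume j: "j \<le> Suc n"
      show "Fil c (int (om j) + 1) (?D (yy j)) (smult (of_nat (om j)) (monom (coeff l 1) 1 * cc c j))"
        using P[OF j] unfolding R1 Pl[OF j] lm by simp
    qed
    then show ?thesis using o1 by (intro exI[of _ "coeff l 1"]) simp
  qed
qed

section \<open>Flows that preserve the affine part\<close>

lemma los0_Mo:
  assumes "\<And>j. j \<le> Suc n \<Longrightarrow> \<exists>P. Fil c (int (om j)) (der A B (yy j)) P"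
  shows "\<exists>P. Fil c (int (wt a)) (der A B (Mo a)) P"
proof -
  have "los c A B 0 (int (om j)) (yy j)" if "j \<le> Suc n" for j
    unfolding los_def using Fil_yy[OF that] assms[OF that] by auto
  then have "los c A B 0 (\<Sum>j\<le>Suc n. int (a j) * int (om j)) (\<Prod>j\<le>Suc n. yy j ^ a j)"
    by (intro los_prod los_power) simp
  moreover have "(\<Sum>j\<le>Suc n. int (a j) * int (om j)) = int (wt a)" by (simp add: wt_def)
  ultimately show ?thesis unfolding los_def Mo_def by simp
qed

text \<open>Finite because all weights are positive. It indexes a spanning set of a piece of the
  filtration rather than a basis, which is enough to write down a linear system.\<close>

definition Ex :: "nat \<Rightarrow> (nat \<Rightarrow> nat) set" where "Ex d = {a. wt a \<le> d \<and> (\<forall>j>Suc n. a j = 0)}"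

lemma finite_Ex: "finite (Ex d)"
proof (rule finite_subset)
  show "Ex d \<subseteq> {f. \<forall>x. (x \<in> {..Suc n} \<longrightarrow> f x \<in> {..d}) \<and> (x \<notin> {..Suc n} \<longrightarrow> f x = 0)}"
  proof
    fix a assume a: "a \<in> Ex d"
    have "a j \<le> d" if "j \<le> Suc n" for j
    proof -
      have "a j * 1 \<le> a j * om j" using om_pos[OF that] by (intro mult_le_mono2) simp
      also have "\<dots> \<le> wt a" unfolding wt_def by (rule member_le_sum) (use that in auto)
      finally show ?thesis using a by (simp add: Ex_def)
    qed
    then show "a \<in> {f. \<forall>x. (x \<in> {..Suc n} \<longrightarrow> f x \<in> {..d}) \<and> (x \<notin> {..Suc n} \<longrightarrow> f x = 0)}"
      using a by (auto simp: Ex_def)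
  qed
qed (rule finite_set_of_finite_funs; simp)

lemma Fil_span:
  assumes "Fil c (int d) f P" shows "\<exists>m. f = (\<Sum>a\<in>Ex d. cst (m a) * Mo a)"
  using assms
proof (induction rule: Fil.induct)
  case (Fil_zero)
  show ?case by (rule exI[of _ "\<lambda>_. 0"]) simp
next
  case (Fil_step f P a k)
  then obtain m where m: "f = (\<Sum>a\<in>Ex d. cst (m a) * Mo a)" by blast
  define b where "b j = (if j \<le> Suc n then a j else 0)" for j
  have wb: "wt b = wt a" by (simp add: b_def wt_def)
  have b: "b \<in> Ex d" using Fil_step.hyps wb by (simp add: Ex_def b_def)
  have Mb: "Mo b = Mo a" by (simp add: b_def Mo_def)
  have "(\<Sum>a\<in>Ex d. cst (m a + (if a = b then k else 0)) * Mo a) =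
      (\<Sum>a\<in>Ex d. cst (m a) * Mo a) + (\<Sum>a\<in>Ex d. if a = b then cst k * Mo b else 0)"
    unfolding cst_add_mult sum.distrib by (intro arg_cong2[where f = "(+)"] sum.cong refl) auto
  also have "\<dots> = f + cst k * Mo a" using finite_Ex b by (simp add: m Mb)
  finally show ?case by (intro exI[of _ "\<lambda>a. m a + (if a = b then k else 0)"]) (simp add: add.commute)
qed

text \<open>Meaningful as long as the orbit stays in the affine part; elsewhere \<open>co\<close>
  divides by zero and returns an arbitrary value.\<close>

definition fl :: "complex \<times> complex \<Rightarrow> complex \<times> complex \<Rightarrow> complex poly poly \<Rightarrow> complex \<Rightarrow> complex" where
  "fl v xy f s = ev f (co (\<sigma> (sm v s, pt xy)))"

text \<open>One denominator \<open>B\<close> clears both \<open>x\<close> and \<open>y\<close> along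
  the orbit; an arbitrary polynomial in them is cleared by some power of \<open>B\<close>.\<close>

lemma fl_rational:
  assumes "\<sigma> (sm v r, pt xy) \<in> range pt"
  obtains B where "poly B r \<noteq> 0" "\<And>s. poly B s \<noteq> 0 \<Longrightarrow> \<sigma> (sm v s, pt xy) \<in> range pt"
    "\<And>f. \<exists>k N. \<forall>s. poly B s \<noteq> 0 \<longrightarrow> fl v xy f s * poly B s ^ k = poly N s"
proof -
  obtain A1 B1 where 1: "poly B1 r \<noteq> 0" "\<And>s. poly B1 s \<noteq> 0 \<Longrightarrow> \<sigma> (sm v s, pt xy) \<in> range pt \<and> cx (\<sigma> (sm v s, pt xy)) = poly A1 s / poly B1 s"
    by (rule act_line[OF cx_regular pt_Y assms]) (rule that)
  obtain A2 B2 where 2: "poly B2 r \<noteq> 0" "\<And>s. poly B2 s \<noteq> 0 \<Longrightarrow> \<sigma> (sm v s, pt xy) \<in> range pt \<and> cy (\<sigma> (sm v s, pt xy)) = poly A2 s / poly B2 s"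
    by (rule act_line[OF cy_regular pt_Y assms]) (rule that)
  let ?B = "B1 * B2"
  have rat: "\<exists>k N. \<forall>s. poly ?B s \<noteq> 0 \<longrightarrow> fl v xy f s * poly ?B s ^ k = poly N s" for f
  proof (induction f rule: B2_induct)
    case (1 c)
    show ?case by (rule exI[of _ 0], rule exI[of _ "[:c:]"]) (simp add: fl_def)
  next
    case 2
    show ?case
    proof (rule exI[of _ 1], rule exI[of _ "A1 * B2"], intro allI impI)
      fix s assume "poly ?B s \<noteq> 0"
      then show "fl v xy PX s * poly ?B s ^ 1 = poly (A1 * B2) s" using 1(2)[of s] by (simp add: fl_def co_def)
    qed
  next
    case 3
    show ?case
    proof (rule exI[of _ 1], rule exI[of _ "A2 * B1"], intro allI impI)
      fix s assume "poly ?B s \<noteq> 0"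
      then show "fl v xy PY s * poly ?B s ^ 1 = poly (A2 * B1) s" using 2(2)[of s] by (simp add: fl_def co_def)
    qed
  next
    case (4 f g)
    then obtain k N k' N' where *: "\<forall>s. poly ?B s \<noteq> 0 \<longrightarrow> fl v xy f s * poly ?B s ^ k = poly N s"
      "\<forall>s. poly ?B s \<noteq> 0 \<longrightarrow> fl v xy g s * poly ?B s ^ k' = poly N' s" by (elim exE)
    show ?case
    proof (rule exI[of _ "k + k'"], rule exI[of _ "N * ?B ^ k' + N' * ?B ^ k"], intro allI impI)
      fix s assume s: "poly ?B s \<noteq> 0"
      have "fl v xy (f + g) s * poly ?B s ^ (k + k') =
        (fl v xy f s * poly ?B s ^ k) * poly ?B s ^ k' + (fl v xy g s * poly ?B s ^ k') * poly ?B s ^ k"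
        unfolding fl_def ev_simps power_add by (simp only: algebra_simps)
      then show "fl v xy (f + g) s * poly ?B s ^ (k + k') = poly (N * ?B ^ k' + N' * ?B ^ k) s"
        unfolding *(1)[rule_format, OF s] *(2)[rule_format, OF s] by simp
    qed
  next
    case (5 f g)
    then obtain k N k' N' where *: "\<forall>s. poly ?B s \<noteq> 0 \<longrightarrow> fl v xy f s * poly ?B s ^ k = poly N s"
      "\<forall>s. poly ?B s \<noteq> 0 \<longrightarrow> fl v xy g s * poly ?B s ^ k' = poly N' s" by (elim exE)
    show ?case
    proof (rule exI[of _ "k + k'"], rule exI[of _ "N * N'"], intro allI impI)
      fix s assume s: "poly ?B s \<noteq> 0"
      have "fl v xy (f * g) s * poly ?B s ^ (k + k') = (fl v xy f s * poly ?B s ^ k) * (fl v xy g s * poly ?B s ^ k')"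
        unfolding fl_def ev_simps power_add by (simp only: mult_ac)
      then show "fl v xy (f * g) s * poly ?B s ^ (k + k') = poly (N * N') s"
        unfolding *(1)[rule_format, OF s] *(2)[rule_format, OF s] by simp
    qed
  qed
  show ?thesis by (rule that[of ?B, OF _ _ rat]) (use 1 2 in auto)
qed

lemma start_affine: "\<sigma> (sm v 0, pt xy) \<in> range pt" using pt_Y by simp

context
  fixes c v
  assumes deg0: "\<And>j. j \<le> Suc n \<Longrightarrow> \<exists>P. Fil c (int (om j)) (DD v (yy j)) P"
begin

text \<open>The generator maps the span of the monomials in \<open>Ex d\<close> to itself, so along
  the orbit these monomials satisfy a linear system with constant coefficients. They are rational
  with a common denominator, which \<open>rational_solution\<close> removes. The equality is claimed
  off the zeros of \<open>B\<close> because at those times the orbit might still be at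
  infinity.\<close>

lemma fl_generic_poly:
  obtains B where "poly B 0 \<noteq> 0" "\<And>f. \<exists>G. \<forall>s. poly B s \<noteq> 0 \<longrightarrow> fl v xy f s = poly G s"
    "\<And>s. poly B s \<noteq> 0 \<Longrightarrow> \<sigma> (sm v s, pt xy) \<in> range pt"
proof -
  obtain B where B: "poly B 0 \<noteq> 0" "\<And>s. poly B s \<noteq> 0 \<Longrightarrow> \<sigma> (sm v s, pt xy) \<in> range pt"
    "\<And>f. \<exists>k N. \<forall>s. poly B s \<noteq> 0 \<longrightarrow> fl v xy f s * poly B s ^ k = poly N s"
    by (rule fl_rational[OF start_affine]) (rule that)
  have B0: "B \<noteq> 0" using B(1) by auto
  have "\<exists>G. \<forall>s. poly B s \<noteq> 0 \<longrightarrow> fl v xy f s = poly G s" for f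
  proof -
    obtain d0 P0 where "d0 \<ge> 0" "Fil c d0 f P0" using Fil_exhaust by blast
    then obtain d where d: "Fil c (int d) f P0" using nonneg_int_cases by blast
    obtain mf where mf: "f = (\<Sum>a\<in>Ex d. cst (mf a) * Mo a)" using Fil_span[OF d] by blast
    have "\<exists>m. DD v (Mo a) = (\<Sum>b\<in>Ex d. cst (m b) * Mo b)" if a: "a \<in> Ex d" for a
    proof -
      obtain P where P: "Fil c (int (wt a)) (DD v (Mo a)) P" using los0_Mo[OF deg0] by blast
      obtain Q where "Fil c (int d) (DD v (Mo a)) Q" using Fil_le[OF P, of "int d"] a by (auto simp: Ex_def)
      then show ?thesis by (rule Fil_span)
    qed
    then have "\<forall>a\<in>Ex d. \<exists>m. DD v (Mo a) = (\<Sum>b\<in>Ex d. cst (m b) * Mo b)" by blast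
    then obtain m where "\<forall>a\<in>Ex d. DD v (Mo a) = (\<Sum>b\<in>Ex d. cst (m a b) * Mo b)" by (rule bchoice[THEN exE])
    then have m: "\<And>a. a \<in> Ex d \<Longrightarrow> DD v (Mo a) = (\<Sum>b\<in>Ex d. cst (m a b) * Mo b)" by blast
    have exN: "\<forall>a. \<exists>k N. \<forall>s. poly B s \<noteq> 0 \<longrightarrow> fl v xy (Mo a) s * poly B s ^ k = poly N s" by (rule allI) (rule B(3))
    obtain k N where "\<forall>a s. poly B s \<noteq> 0 \<longrightarrow> fl v xy (Mo a) s * poly B s ^ k a = poly (N a) s" using choice2[OF exN] by (elim exE)
    then have kN: "\<And>a s. poly B s \<noteq> 0 \<Longrightarrow> fl v xy (Mo a) s * poly B s ^ k a = poly (N a) s" by blast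
    define K where "K = (\<Sum>a\<in>Ex d. k a)"
    define C where "C = B ^ K"
    define A where "A a = N a * B ^ (K - k a)" for a
    have C0: "C \<noteq> 0" using B0 by (simp add: C_def)
    have fA: "fl v xy (Mo a) s = poly (A a) s / poly C s" if a: "a \<in> Ex d" and s: "poly B s \<noteq> 0" for a s
    proof -
      have "k a \<le> K" unfolding K_def by (rule member_le_sum) (use a finite_Ex in auto)
      then have "poly B s ^ k a * poly B s ^ (K - k a) = poly C s" by (simp add: C_def flip: power_add)
      then have "fl v xy (Mo a) s * poly C s = poly (A a) s"
        using kN[OF s, of a] by (metis A_def mult.assoc poly_mult poly_power)
      moreover have "poly C s \<noteq> 0" using s by (simp add: C_def)
      ultimately show ?thesis by (simp add: field_simps)
    qed
    have ode: "pderiv (A a) * C - A a * pderiv C = C * (\<Sum>b\<in>Ex d. smult (m a b) (A b))" if a: "a \<in> Ex d" for a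
    proof (rule poly_eq_on[OF B0])
      fix s assume s: "poly B s \<noteq> 0"
      have Cs: "poly C s \<noteq> 0" using s by (simp add: C_def)
      have "eventually (\<lambda>r. poly B r \<noteq> 0) (nhds s)" by (rule eventually_nonzero[OF poly_DERIV s])
      then have e: "eventually (\<lambda>r. fl v xy (Mo a) r = poly (A a) r / poly C r) (nhds s)"
        by (rule eventually_mono) (use fA[OF a] in blast)
      have "(fl v xy (Mo a) has_field_derivative fl v xy (DD v (Mo a)) s) (at s)"
        using flow_deriv[OF pt_Y B(2)[OF s], of "Mo a"] unfolding fl_def[abs_def] .
      moreover have "(fl v xy (Mo a) has_field_derivative (poly (pderiv (A a)) s * poly C s - poly (A a) s * poly (pderiv C) s) / (poly C s * poly C s)) (at s)"
        unfolding DERIV_cong_ev[OF refl e refl] by (rule DERIV_divide[OF poly_DERIV poly_DERIV Cs])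
      ultimately have "fl v xy (DD v (Mo a)) s = (poly (pderiv (A a)) s * poly C s - poly (A a) s * poly (pderiv C) s) / (poly C s * poly C s)"
        by (rule DERIV_unique)
      moreover have "fl v xy (DD v (Mo a)) s = (\<Sum>b\<in>Ex d. m a b * poly (A b) s) / poly C s"
      proof -
        have "fl v xy (DD v (Mo a)) s = (\<Sum>b\<in>Ex d. m a b * fl v xy (Mo b) s)"
          by (simp add: m[OF a] fl_def)
        also have "\<dots> = (\<Sum>b\<in>Ex d. m a b * (poly (A b) s / poly C s))" by (rule sum.cong) (simp_all add: fA s)
        finally show ?thesis by (simp add: sum_divide_distrib)
      qed
      ultimately have "poly (pderiv (A a)) s * poly C s - poly (A a) s * poly (pderiv C) s = (\<Sum>b\<in>Ex d. m a b * poly (A b) s) * poly C s"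
        using Cs by (simp add: field_simps)
      then show "poly (pderiv (A a) * C - A a * pderiv C) s = poly (C * (\<Sum>b\<in>Ex d. smult (m a b) (A b))) s"
        by (simp add: poly_sum mult.commute)
    qed
    have "\<exists>G. A a = C * G" if a: "a \<in> Ex d" for a
    proof -
      have "C dvd A a" by (rule rational_solution[OF finite_Ex C0 _ a]) (rule ode)
      then show ?thesis unfolding dvd_def .
    qed
    then have "\<forall>a\<in>Ex d. \<exists>G. A a = C * G" by blast
    then obtain G where "\<forall>a\<in>Ex d. A a = C * G a" by (rule bchoice[THEN exE])
    then have G: "\<And>a. a \<in> Ex d \<Longrightarrow> A a = C * G a" by blast
    have "fl v xy f s = poly (\<Sum>a\<in>Ex d. smult (mf a) (G a)) s" if s: "poly B s \<noteq> 0" for s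
    proof -
      have Cs: "poly C s \<noteq> 0" using s by (simp add: C_def)
      have "fl v xy f s = (\<Sum>a\<in>Ex d. mf a * fl v xy (Mo a) s)"
        by (subst mf) (simp add: fl_def)
      also have "\<dots> = (\<Sum>a\<in>Ex d. mf a * poly (G a) s)"
        by (rule sum.cong) (use Cs in \<open>simp_all add: fA s G\<close>)
      finally show ?thesis by (simp add: poly_sum)
    qed
    then show ?thesis by blast
  qed
  then show ?thesis using that[OF B(1) _ B(2)] by blast
qed

text \<open>If the orbit is at infinity at time \<open>r\<close>, some \<open>y_k\<close> is nonzero
  there and \<open>w^{om k} / y_k\<close> is regular with value 0. At generic times this function is
  the inverse of a polynomial in \<open>s\<close>, which has no zero.\<close>

lemma flow_affine: "\<sigma> (sm v r, pt xy) \<in> range pt"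
proof (rule ccontr)
  assume no: "\<sigma> (sm v r, pt xy) \<notin> range pt"
  define q where "q = \<sigma> (sm v r, pt xy)"
  have q: "q \<in> Ypts" unfolding q_def by (rule act_in[OF pt_Y])
  then have q0: "rep q 0 = 0" using no unfolding q_def range_pt by simp
  obtain i where i: "i \<le> n + 2" "rep q i \<noteq> 0" using rep_cone(1)[OF q] unfolding ycone_def by blast
  then obtain k where k: "i = Suc k" "k \<le> Suc n" using q0 by (cases i) auto
  let ?V = "{p \<in> Ypts. rep p (Suc k) \<noteq> 0}"
  have hreg: "(\<lambda>p. rep p 0 ^ om k / rep p (Suc k)) \<in> regf Y ?V"
  proof (rule presents_regI[OF presents_Y qreg_basic])
    show "YH (om k) (\<lambda>p. rep p 0 ^ om k)" using hfunI[OF whom_power[OF Hom_var[of 0], of "om k"]] by simp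
    show "YH (om k) (\<lambda>p. rep p (Suc k))" using hfunI[OF Hom_var[of "Suc k"]] k by simp
  qed
  have qV: "\<sigma> (sm v r, pt xy) \<in> ?V" using q i k unfolding q_def by simp
  obtain A' B' where AB: "poly B' r \<noteq> 0" "\<And>s. poly B' s \<noteq> 0 \<Longrightarrow> \<sigma> (sm v s, pt xy) \<in> ?V \<and>
      rep (\<sigma> (sm v s, pt xy)) 0 ^ om k / rep (\<sigma> (sm v s, pt xy)) (Suc k) = poly A' s / poly B' s"
    by (rule act_line[OF hreg pt_Y qV]) (rule that)
  have "poly A' r / poly B' r = 0"
    using conjunct2[OF AB(2)[OF AB(1)]] q0 om_pos[OF k(2)] unfolding q_def by (simp add: zero_power)
  then have Ar: "poly A' r = 0" using AB(1) by simp
  obtain B where B: "poly B 0 \<noteq> 0" "\<And>f. \<exists>G. \<forall>s. poly B s \<noteq> 0 \<longrightarrow> fl v xy f s = poly G s"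
    "\<And>s. poly B s \<noteq> 0 \<Longrightarrow> \<sigma> (sm v s, pt xy) \<in> range pt"
    by (rule fl_generic_poly[of xy]) (rule that)
  obtain G where G: "\<forall>s. poly B s \<noteq> 0 \<longrightarrow> fl v xy (yy k) s = poly G s" using B(2) by blast
  have "A' * G = B'"
  proof (rule poly_eq_on[of "B * B'"])
    show "B * B' \<noteq> 0" using B(1) AB(1) by auto
    fix s assume "poly (B * B') s \<noteq> 0"
    then have s: "poly B s \<noteq> 0" "poly B' s \<noteq> 0" by auto
    obtain uv where uv: "\<sigma> (sm v s, pt xy) = pt uv" using B(3)[OF s(1)] by (rule rangeE)
    have "rep (pt uv) 0 ^ om k / rep (pt uv) (Suc k) = zc uv 0 ^ om k / zc uv (Suc k)"
    proof -
      have "Hom (om k) (\<lambda>z. z 0 ^ om k)" "Hom (om k) (\<lambda>z. z (Suc k))"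
        using whom_power[OF Hom_var[of 0], of "om k"] Hom_var[of "Suc k"] k by simp_all
      from hfun_quotient[OF this] show ?thesis unfolding pt_def .
    qed
    then have e: "1 / ev (yy k) uv = poly A' s / poly B' s" using AB(2)[OF s(2)] k unfolding uv by simp
    have nz: "ev (yy k) uv \<noteq> 0"
    proof -
      have "rep (pt uv) (Suc k) \<noteq> 0" using AB(2)[OF s(2)] unfolding uv by simp
      then show ?thesis using Hom_nonzero_pt[OF Hom_var[of "Suc k"]] k by simp
    qed
    have "poly G s = ev (yy k) uv" using G[rule_format, OF s(1)] unfolding fl_def uv co_pt by (rule sym)
    then show "poly (A' * G) s = poly B' s" using e nz s(2) by (simp add: field_simps)
  qed
  then have "poly (A' * G) r = poly B' r" by (rule arg_cong)
  then show False using Ar AB(1) by simp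
qed

text \<open>The polynomial valid at generic times is compared with the rational expression valid
  around a given time; both describe the flow off finitely many times.\<close>

lemma flow_poly: "\<exists>G. \<forall>s. fl v xy f s = poly G s"
proof -
  obtain B where B: "poly B 0 \<noteq> 0" "\<And>f. \<exists>G. \<forall>s. poly B s \<noteq> 0 \<longrightarrow> fl v xy f s = poly G s"
    "\<And>s. poly B s \<noteq> 0 \<Longrightarrow> \<sigma> (sm v s, pt xy) \<in> range pt"
    by (rule fl_generic_poly[of xy]) (rule that)
  obtain G where G: "\<forall>s. poly B s \<noteq> 0 \<longrightarrow> fl v xy f s = poly G s" using B(2) by blast
  have "fl v xy f r = poly G r" for r
  proof -
    obtain C where C: "poly C r \<noteq> 0" "\<And>s. poly C s \<noteq> 0 \<Longrightarrow> \<sigma> (sm v s, pt xy) \<in> range pt"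
      "\<And>f. \<exists>k N. \<forall>s. poly C s \<noteq> 0 \<longrightarrow> fl v xy f s * poly C s ^ k = poly N s"
      by (rule fl_rational[OF flow_affine]) (rule that)
    obtain k N where N: "\<forall>s. poly C s \<noteq> 0 \<longrightarrow> fl v xy f s * poly C s ^ k = poly N s" using C(3) by blast
    have "G * C ^ k = N"
      by (rule poly_eq_on[of "B * C"]) (use B(1) C(1) G N in auto)
    then have "poly G r * poly C r ^ k = poly N r" by auto
    then have "fl v xy f r * poly C r ^ k = poly G r * poly C r ^ k" using N C(1) by simp
    then show ?thesis using C(1) by (simp only: mult_cancel_right power_eq_0_iff simp_thms)
  qed
  then show ?thesis by blast
qed

lemma flow_poly_deriv:
  assumes "\<forall>s. fl v xy f s = poly G s" shows "\<forall>s. fl v xy (DD v f) s = poly (pderiv G) s"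
proof
  fix s
  have f: "fl v xy f = poly G" using assms by blast
  have "(fl v xy f has_field_derivative fl v xy (DD v f) s) (at s)"
    using flow_deriv[OF pt_Y flow_affine, of f] unfolding fl_def[abs_def] .
  then show "fl v xy (DD v f) s = poly (pderiv G) s" unfolding f by (rule DERIV_unique[OF _ poly_DERIV])
qed

text \<open>Along an orbit, the iterated images of \<open>f\<close> are the derivatives of a
  polynomial in time, so one of them vanishes on it. If all iterated images were nonzero, an orbit
  could be started where none of them vanishes.\<close>

lemma flow_nilpotent: "derivation.nilp (DD v) f"
proof (rule ccontr)
  assume "\<not> ?thesis"
  then have nz: "(DD v ^^ k) f \<noteq> 0" for k unfolding derivation.nilp_def[OF derivation_der] by blast
  obtain xy where xy: "\<And>k. ev ((DD v ^^ k) f) xy \<noteq> 0" using common_nonzero[of "\<lambda>k. (DD v ^^ k) f"] nz by blast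
  obtain G where G: "\<forall>s. fl v xy f s = poly G s" using flow_poly by blast
  have it: "\<forall>s. fl v xy ((DD v ^^ k) f) s = poly ((pderiv ^^ k) G) s" for k
  proof (induction k)
    case (Suc k)
    show ?case using flow_poly_deriv[OF Suc] by simp
  qed (use G in simp)
  obtain N where "(pderiv ^^ N) G = 0" using pderiv_funpow_zero by blast
  then have "fl v xy ((DD v ^^ N) f) 0 = 0" using it[of N] by simp
  then show False using xy[of N] pt_Y by (simp add: fl_def)
qed

end

end

section \<open>Actions that preserve the affine part\<close>

lemma pderiv_eq_imp:
  fixes p q :: "complex poly"
  assumes "pderiv p = pderiv q" shows "poly p a - poly p b = poly q a - poly q b"
proof -
  have "pderiv (p - q) = 0" using assms by (simp add: pderiv_diff)
  then obtain h where "p - q = [:h:]" using pderiv_iszero by blast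
  then have "poly (p - q) a = poly (p - q) b" by simp
  then show ?thesis by (simp add: algebra_simps)
qed

lemma pderiv_eigen:
  fixes d :: "complex poly"
  assumes "pderiv d = smult a d" "d \<noteq> 0" shows "a = 0"
proof (rule ccontr)
  assume a: "a \<noteq> 0"
  then have "degree d = degree d - 1" using assms(1) degree_pderiv[of d] by simp
  then have "degree d = 0" by simp
  then have "pderiv d = 0" using pderiv_eq_0_iff by blast
  then show False using a assms by simp
qed

lemma poly_eqI_all: "(\<And>s. poly p s = poly q s) \<Longrightarrow> p = q" for p q :: "complex poly"
  using poly_all_0_iff_0[of "p - q"] by simp

lemma only_y:
  assumes "\<And>a b. cf A a b \<noteq> 0 \<Longrightarrow> a = 0"
  obtains p where "\<And>xy. ev A xy = poly p (snd xy)" "\<And>b. coeff p b = cf A 0 b"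
    "\<And>xy. ev (pderiv A) xy = poly (pderiv p) (snd xy)" "pdx A = 0"
proof
  let ?p = "map_poly (\<lambda>q. coeff q 0) A"
  show c: "coeff ?p b = cf A 0 b" for b by (simp add: coeff_map_poly cf_def)
  have A: "coeff A b = [:cf A 0 b:]" for b
  proof (rule poly_eqI)
    fix a show "coeff (coeff A b) a = coeff [:cf A 0 b:] a"
      using assms[of a b] by (cases a) (auto simp: cf_def)
  qed
  show "pdx A = 0" by (rule poly_eqI) (simp add: coeff_pdx A pderiv_pCons)
  have "map_poly (\<lambda>q. poly q x) A = ?p" for x by (rule poly_eqI) (simp add: coeff_map_poly A)
  then have "poly ?p y = ev A (x, y)" for x y using ev_map_poly[of x A y] by simp
  then show "ev A xy = poly ?p (snd xy)" for xy by (cases xy) simp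
  have "map_poly (\<lambda>q. poly q x) (pderiv A) = pderiv ?p" for x
    by (rule poly_eqI) (simp add: coeff_map_poly coeff_pderiv A del: of_nat_Suc)
  then have "poly (pderiv ?p) y = ev (pderiv A) (x, y)" for x y using ev_map_poly[of x "pderiv A" y] by simp
  then show "ev (pderiv A) xy = poly (pderiv ?p) (snd xy)" for xy by (cases xy) simp
qed

lemma poly_eq_Qf_deriv:
  assumes "\<And>j. coeff g j \<noteq> 0 \<Longrightarrow> int j \<le> m"
  obtains Q where "pderiv Q = g" "\<And>y. poly Q y = Qf m (coeff g) y"
proof
  let ?Q = "\<Sum>j<nat (m + 1). monom (coeff g j / of_nat (j + 1)) (j + 1)"
  show "poly ?Q y = Qf m (coeff g) y" for y unfolding Qf_def by (simp add: poly_sum poly_monom)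
  have "pderiv ?Q = (\<Sum>j<nat (m + 1). pderiv (monom (coeff g j / of_nat (j + 1)) (j + 1)))"
    by (rule higher_pderiv_sum[of 1, simplified])
  also have "\<dots> = (\<Sum>j<nat (m + 1). monom (coeff g j) j)"
    by (rule sum.cong[OF refl]) (simp add: pderiv_monom del: of_nat_Suc)
  also have "\<dots> = g"
  proof (rule poly_eqI)
    fix k
    have "coeff (\<Sum>j<nat (m + 1). monom (coeff g j) j) k = (\<Sum>j<nat (m + 1). if j = k then coeff g k else 0)"
      unfolding coeff_sum by (rule sum.cong) auto
    also have "\<dots> = coeff g k" using assms[of k] by (cases "coeff g k = 0") (auto simp: sum.delta)
    finally show "coeff (\<Sum>j<nat (m + 1). monom (coeff g j) j) k = coeff g k" .
  qed
  finally show "pderiv ?Q = g" .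
qed

context gact
begin

lemma gder_exists: "\<exists>X1 X2 Y1 Y2. gder n om al be th \<sigma> X1 X2 Y1 Y2"
proof -
  obtain X1 X2 where X: "\<forall>xy v. ((\<lambda>s. cx (\<sigma> (sm v s, pt xy))) has_field_derivative fst v * ev X1 xy + snd v * ev X2 xy) (at 0)"
    using generator_exists[OF cx_regular] by (elim exE)
  obtain Y1 Y2 where Y: "\<forall>xy v. ((\<lambda>s. cy (\<sigma> (sm v s, pt xy))) has_field_derivative fst v * ev Y1 xy + snd v * ev Y2 xy) (at 0)"
    using generator_exists[OF cy_regular] by (elim exE)
  have "gder n om al be th \<sigma> X1 X2 Y1 Y2"
    by unfold_locales (use X Y in blast)+
  then show ?thesis by blast
qed

text \<open>Every nonempty open set meets the affine part, so the generic point can be chosen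
  there.\<close>

lemma generic_affine:
  assumes "ga2_structure Y \<sigma>"
  obtains xy where "\<And>t. \<sigma> (t, pt xy) = pt xy \<Longrightarrow> t = 0" "zar Y closure_of (range (\<lambda>t. \<sigma> (t, pt xy))) = pts Y"
proof -
  obtain U where U: "openin (zar Y) U" "zar Y closure_of U = pts Y"
    "\<forall>p\<in>U. {t. \<sigma> (t, p) = p} = {0} \<and> zar Y closure_of (range (\<lambda>t. \<sigma> (t, p))) = pts Y"
    using assms unfolding ga2_structure_def by blast
  have "pt (0, 0) \<in> zar Y closure_of U" unfolding U(2) pts_Y by (rule pt_Y)
  then obtain p where "p \<in> U" unfolding in_closure_of by auto
  then obtain xy where xy: "pt xy \<in> U" using open_meets[OF U(1)] by blast
  show ?thesis
  proof (rule that[of xy])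
    fix t assume "\<sigma> (t, pt xy) = pt xy"
    then have "t \<in> {t. \<sigma> (t, pt xy) = pt xy}" by blast
    then show "t = 0" using U(3) xy by blast
  qed (use U(3) xy in blast)
qed

end

context gder
begin

definition deg0 :: "(nat \<Rightarrow> complex) \<Rightarrow> complex \<times> complex \<Rightarrow> bool" where
  "deg0 c v \<longleftrightarrow> (\<forall>j\<le>Suc n. \<exists>P. Fil c (int (om j)) (DD v (yy j)) P)"

lemma deg0D: "deg0 c v \<Longrightarrow> j \<le> Suc n \<Longrightarrow> \<exists>P. Fil c (int (om j)) (DD v (yy j)) P"
  unfolding deg0_def by blast

lemma DD_linear: "DD v f = cst (fst v) * der X1 Y1 f + cst (snd v) * der X2 Y2 f"
  by (simp add: der_def DA_def DB_def algebra_simps)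

lemma flow_linear:
  assumes d: "deg0 c v" and f: "DD v f = cst k" shows "fl v xy f s = ev f xy + k * s"
proof -
  obtain G where G: "\<forall>s. fl v xy f s = poly G s" using flow_poly[OF deg0D[OF d]] by blast
  have "poly (pderiv G) s = k" for s
    using flow_poly_deriv[OF deg0D[OF d] G, rule_format, of s] by (simp add: f fl_def)
  then have "pderiv G = pderiv [:0, k:]" by (intro poly_eqI_all) (simp add: pderiv_pCons)
  from pderiv_eq_imp[OF this, of s 0] have "fl v xy f s - fl v xy f 0 = k * s" using G by simp
  then show ?thesis using pt_Y by (simp add: fl_def algebra_simps)
qed

lemma act_flow:
  assumes d: "deg0 c v" shows "\<sigma> (v, pt xy) = pt (fl v xy PX 1, fl v xy PY 1)"
proof -
  have a: "\<sigma> (v, pt xy) \<in> range pt" using flow_affine[OF deg0D[OF d], of 1 xy] unfolding sm_1 .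
  have "(fl v xy PX 1, fl v xy PY 1) = co (\<sigma> (v, pt xy))" by (simp add: fl_def sm_1)
  then show ?thesis using pt_co[OF a] by (simp only:)
qed

context
  fixes c
  assumes str: "ga2_structure Y \<sigma>" and c: "curve c"
begin

text \<open>A direction with zero generator would fix a generic point, against its trivial
  stabilizer.\<close>

lemma DD_nonzero: assumes "v \<noteq> 0" shows "DA v \<noteq> 0 \<or> DB v \<noteq> 0"
proof (rule ccontr)
  assume "\<not> ?thesis"
  then have z: "DA v = 0" "DB v = 0" by auto
  have "DD v f = 0" for f by (simp add: der_def z)
  then have d: "deg0 c v" unfolding deg0_def using Fil_zero by metis
  obtain xy where xy: "\<And>t. \<sigma> (t, pt xy) = pt xy \<Longrightarrow> t = 0" by (rule generic_affine[OF str]) (rule that)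
  have "fl v xy PX 1 = fst xy" "fl v xy PY 1 = snd xy"
    using flow_linear[OF d, of PX 0 xy 1] flow_linear[OF d, of PY 0 xy 1] by (simp_all add: z)
  then have "\<sigma> (v, pt xy) = pt xy" unfolding act_flow[OF d] by simp
  then show False using xy assms by blast
qed

text \<open>Otherwise \<open>y\<close> is constant along a generic orbit, which then misses a
  nonempty open set and is not dense.\<close>

lemma DB_nonzero: assumes d: "\<And>v. deg0 c v" shows "\<exists>v. DB v \<noteq> 0"
proof (rule ccontr)
  assume "\<not> ?thesis"
  then have z: "DB v = 0" for v by blast
  obtain xy where xy: "zar Y closure_of (range (\<lambda>t. \<sigma> (t, pt xy))) = pts Y" by (rule generic_affine[OF str]) (rule that)
  define h where "h z = z 2 - snd xy * z 0 ^ om 1" for z :: "nat \<Rightarrow> complex"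
  have h: "Hom (om 1) h"
  proof -
    have "Hom (om 1) (\<lambda>z. z (Suc (Suc 0)))" using Hom_var[of "Suc (Suc 0)"] by simp
    moreover have "Hom (om 1) (\<lambda>z. z 0 ^ om 1)" using whom_power[OF Hom_var[of 0], of "om 1"] by simp
    ultimately show ?thesis unfolding h_def[abs_def] numeral_2_eq_2 by (intro whom_diff whom_cmult)
  qed
  have hz: "h (zc uv) = snd uv - snd xy" for uv by (simp add: h_def zc_def numeral_2_eq_2)
  let ?T = "{p \<in> Ypts. h (rep p) \<noteq> 0}"
  have T: "openin (zar Y) ?T" by (rule presents_openI[OF presents_Y qopen_basic[of YH "om 1", OF hfunI[OF h]]])
  have mem: "pt uv \<in> ?T \<longleftrightarrow> snd uv \<noteq> snd xy" for uv using Hom_nonzero_pt[OF h, of uv] pt_Y[of uv] by (simp add: hz)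
  have "pt (0, snd xy + 1) \<in> zar Y closure_of (range (\<lambda>t. \<sigma> (t, pt xy)))" unfolding xy pts_Y by (rule pt_Y)
  then have cl: "\<forall>T. pt (0, snd xy + 1) \<in> T \<and> openin (zar Y) T \<longrightarrow> (\<exists>y. y \<in> range (\<lambda>t. \<sigma> (t, pt xy)) \<and> y \<in> T)"
    unfolding in_closure_of by (rule conjunct2)
  have "pt (0, snd xy + 1) \<in> ?T" unfolding mem by simp
  from cl[rule_format, OF conjI[OF this T]] obtain t where "\<sigma> (t, pt xy) \<in> ?T" by (elim exE conjE rangeE) (simp only:)
  moreover have "fl t xy PY 1 = snd xy" using flow_linear[OF d, of t PY 0 xy 1] by (simp add: z)
  ultimately show False unfolding act_flow[OF d] mem by simp
qed

text \<open>Let \<open>p1, p2\<close> be the \<open>x\<close>-components and \<open>k1, k2\<close>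
  the constant \<open>y\<close>-components of the two basic generators. Commutation makes
  \<open>k2 * p1 - k1 * p2\<close> a constant \<kappa>, and \<kappa> is nonzero because otherwise
  the direction \<open>(k2, - k1)\<close> would have zero generator. In the orthogonal basis
  \<open>(k1, k2)\<close>, \<open>(cnj k2, - cnj k1)\<close> the pair \<open>(p1, p2)\<close> has
  the components \<open>g\<close> and \<mu> = \<open>\<kappa> / N\<close>, the second one constant.
  Integrating \<open>g\<close> along \<open>y\<close> gives the formula.\<close>

lemma standard_form:
  assumes d: "\<And>v. deg0 c v" and B: "\<And>v. \<exists>k. DB v = cst k"
    and A: "\<And>v a b. cf (DA v) a b \<noteq> 0 \<Longrightarrow> a = 0 \<and> int b \<le> m"
  shows "\<exists>c1 c2 \<mu> lam. (c1, c2) \<noteq> (0, 0) \<and> \<mu> \<noteq> 0 \<and> (\<forall>t xy. \<sigma> (t, pt xy) = pt (std_action m lam c1 c2 \<mu> t xy))"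
proof -
  have e: "DA (1, 0) = X1" "DA (0, 1) = X2" "DB (1, 0) = Y1" "DB (0, 1) = Y2"
    unfolding DA_def DB_def by (simp_all flip: one_pCons)
  obtain k1 k2 where k: "Y1 = cst k1" "Y2 = cst k2" using B[of "(1, 0)"] B[of "(0, 1)"] unfolding e by blast
  have DB: "DB v = cst (fst v * k1 + snd v * k2)" for v unfolding DB_def unfolding k by (simp add: mult.commute)
  have A1: "cf X1 a b \<noteq> 0 \<Longrightarrow> a = 0 \<and> int b \<le> m" and A2: "cf X2 a b \<noteq> 0 \<Longrightarrow> a = 0 \<and> int b \<le> m" for a b
    using A[of "(1, 0)" a b] A[of "(0, 1)" a b] unfolding e by blast+
  obtain p1 where p1: "\<And>xy. ev X1 xy = poly p1 (snd xy)" "\<And>b. coeff p1 b = cf X1 0 b"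
    "\<And>xy. ev (pderiv X1) xy = poly (pderiv p1) (snd xy)" "pdx X1 = 0" by (rule only_y[of X1]) (use A1 in blast)+
  obtain p2 where p2: "\<And>xy. ev X2 xy = poly p2 (snd xy)" "\<And>b. coeff p2 b = cf X2 0 b"
    "\<And>xy. ev (pderiv X2) xy = poly (pderiv p2) (snd xy)" "pdx X2 = 0" by (rule only_y[of X2]) (use A2 in blast)+
  have k0: "(k1, k2) \<noteq> (0, 0)"
  proof
    assume "(k1, k2) = (0, 0)"
    then have "DB v = 0" for v unfolding DB by simp
    then show False using DB_nonzero[OF d] by blast
  qed
  have "poly (pderiv (smult k2 p1)) y = poly (pderiv (smult k1 p2)) y" for y
  proof -
    have "ev (DD (0, 1) X1) (0, y) = ev (DD (1, 0) X2) (0, y)" by (simp only: commuting(1))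
    then show ?thesis unfolding der_def DB e(1,2) p1(4) p2(4) by (simp add: p1(3) p2(3) pderiv_smult)
  qed
  then have "pderiv (smult k2 p1) = pderiv (smult k1 p2)" by (rule poly_eqI_all)
  then have kap: "k2 * poly p1 y - k1 * poly p2 y = k2 * poly p1 0 - k1 * poly p2 0" for y
    using pderiv_eq_imp[of "smult k2 p1" "smult k1 p2" y 0] by (simp add: algebra_simps)
  define \<kappa> where "\<kappa> = k2 * poly p1 0 - k1 * poly p2 0"
  note kap = kap[folded \<kappa>_def]
  have \<kappa>: "\<kappa> \<noteq> 0"
  proof
    assume 0: "\<kappa> = 0"
    have "ev (DA (k2, - k1)) xy = 0" for xy using kap[of "snd xy"] by (simp add: p1 p2 0)
    then have "DA (k2, - k1) = 0" using ev_zero_iff by blast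
    moreover have "DB (k2, - k1) = 0" unfolding DB by (simp add: mult.commute)
    moreover have "(k2, - k1) \<noteq> 0" using k0 by (auto simp: zero_prod_def)
    ultimately show False using DD_nonzero by blast
  qed
  define N where "N = cnj k1 * k1 + cnj k2 * k2"
  have N: "N \<noteq> 0"
  proof
    assume "N = 0"
    then have "complex_of_real ((norm k1)\<^sup>2 + (norm k2)\<^sup>2) = 0"
      unfolding N_def of_real_add complex_norm_square by (simp add: mult.commute)
    then have "(norm k1)\<^sup>2 + (norm k2)\<^sup>2 = 0" by (simp only: of_real_eq_0_iff)
    then show False using k0 by (simp add: add_nonneg_eq_0_iff)
  qed
  define \<mu> where "\<mu> = \<kappa> / N"
  define g where "g = smult (1 / N) (smult (cnj k1) p1 + smult (cnj k2) p2)"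
  have gy: "N * poly g y = cnj k1 * poly p1 y + cnj k2 * poly p2 y" for y using N by (simp add: g_def)
  have pg: "poly p1 y = k1 * poly g y + cnj k2 * \<mu>" "poly p2 y = k2 * poly g y - cnj k1 * \<mu>" for y
  proof -
    have m: "N * \<mu> = \<kappa>" using N by (simp add: \<mu>_def)
    have "N * poly p1 y = k1 * (N * poly g y) + cnj k2 * (N * \<mu>)" "N * poly p2 y = k2 * (N * poly g y) - cnj k1 * (N * \<mu>)"
      unfolding gy m kap[of y, symmetric] by (simp_all add: N_def algebra_simps)
    then have "N * poly p1 y = N * (k1 * poly g y + cnj k2 * \<mu>)" "N * poly p2 y = N * (k2 * poly g y - cnj k1 * \<mu>)"
      by (simp_all add: algebra_simps)
    then show "poly p1 y = k1 * poly g y + cnj k2 * \<mu>" "poly p2 y = k2 * poly g y - cnj k1 * \<mu>" using N by simp_all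
  qed
  have gm: "int j \<le> m" if "coeff g j \<noteq> 0" for j
  proof -
    have "coeff p1 j \<noteq> 0 \<or> coeff p2 j \<noteq> 0" using that by (auto simp: g_def)
    then show ?thesis using A1[of 0 j] A2[of 0 j] unfolding p1(2) p2(2) by blast
  qed
  obtain Q where Q: "pderiv Q = g" "\<And>y. poly Q y = Qf m (coeff g) y"
    by (rule poly_eq_Qf_deriv[of g m, OF gm]) (assumption, rule that)
  have "\<sigma> (t, pt xy) = pt (std_action m (coeff g) k1 k2 \<mu> t xy)" for t xy
  proof -
    let ?r = "k1 * fst t + k2 * snd t" and ?w = "\<mu> * (cnj k2 * fst t - cnj k1 * snd t)"
    have y: "fl t xy PY s = snd xy + ?r * s" for s
      using flow_linear[OF d, of t PY ?r xy s] by (simp add: DB algebra_simps)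
    obtain G where G: "\<forall>s. fl t xy PX s = poly G s" using flow_poly[OF deg0D[OF d]] by blast
    \<comment> \<open>An antiderivative in the time \<open>s\<close> of \<open>?r * g + ?w\<close>,
      with \<open>g\<close> taken at \<open>y\<close> moved by \<open>?r * s\<close>.\<close>
    define H where "H = pcompose Q [:snd xy, ?r:] + [:0, ?w:]"
    have "pderiv G = pderiv H"
    proof (rule poly_eqI_all)
      fix s
      have "poly (pderiv G) s = fl t xy (DA t) s"
        using flow_poly_deriv[OF deg0D[OF d] G, rule_format, of s] by simp
      also have "\<dots> = fst t * poly p1 (fl t xy PY s) + snd t * poly p2 (fl t xy PY s)"
        by (simp add: fl_def p1 p2)
      also have "\<dots> = ?r * poly g (fl t xy PY s) + ?w" unfolding pg by (simp add: algebra_simps)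
      also have "\<dots> = poly (pderiv H) s"
        by (simp add: H_def y pderiv_add pderiv_pcompose pderiv_pCons poly_pcompose Q(1) mult.commute)
      finally show "poly (pderiv G) s = poly (pderiv H) s" .
    qed
    from pderiv_eq_imp[OF this, of 1 0]
    have "fl t xy PX 1 - fl t xy PX 0 = Qf m (coeff g) (snd xy + ?r) - Qf m (coeff g) (snd xy) + ?w"
      using G by (simp add: H_def poly_pcompose Q(2))
    moreover have "fl t xy PX 0 = fst xy" using pt_Y by (simp add: fl_def)
    ultimately have "fl t xy PX 1 = fst xy + (Qf m (coeff g) (snd xy + ?r) - Qf m (coeff g) (snd xy) + ?w)"
      by (simp add: algebra_simps)
    then show ?thesis unfolding act_flow[OF d] std_action_eq y by simp
  qed
  then have all: "\<forall>t xy. \<sigma> (t, pt xy) = pt (std_action m (coeff g) k1 k2 \<mu> t xy)" by (intro allI)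
  have "\<mu> \<noteq> 0" using \<kappa> N by (simp add: \<mu>_def)
  with k0 show ?thesis
    by (rule_tac x = k1 in exI, rule_tac x = k2 in exI, rule_tac x = \<mu> in exI, rule_tac x = "coeff g" in exI) (intro conjI all)
qed

lemma deg0_from_drop:
  assumes "\<forall>j\<le>Suc n. Fil c (int (om j) + 1) (DD v (yy j)) 0" shows "deg0 c v"
  unfolding deg0_def
proof (intro allI impI)
  fix j assume "j \<le> Suc n"
  then have "Fil c (int (om j) + 1) (DD v (yy j)) 0" using assms by blast
  from Fil_drop[OF c this] show "\<exists>P. Fil c (int (om j)) (DD v (yy j)) P" by simp
qed

context
  assumes om2: "\<And>j. j \<le> n \<Longrightarrow> 2 \<le> om j" and bez: "\<exists>a b. wt a = Suc (wt b)"
begin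

lemma drop:
  "\<exists>\<gamma>. (\<forall>j\<le>Suc n. Fil c (int (om j) + 1) (DD v (yy j)) (smult (of_nat (om j)) (monom \<gamma> 1 * cc c j))) \<and>
    (2 \<le> om (Suc n) \<longrightarrow> \<gamma> = 0)"
  by (rule degree_drop[OF c _ bez]) (rule om2)

lemma deg0_all: assumes "2 \<le> om (Suc n)" shows "deg0 c v"
proof -
  obtain \<gamma> where g: "\<forall>j\<le>Suc n. Fil c (int (om j) + 1) (DD v (yy j)) (smult (of_nat (om j)) (monom \<gamma> 1 * cc c j))"
    "2 \<le> om (Suc n) \<longrightarrow> \<gamma> = 0"
    using drop[of v] by (elim exE conjE)
  then have "\<gamma> = 0" using assms by blast
  then show ?thesis by (intro deg0_from_drop) (use g(1) in simp)
qed

text \<open>The coefficient \<gamma> of the leading part depends linearly on the direction, and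
  directions form a plane, so some nonzero direction has \<gamma> = 0.\<close>

lemma deg0_some: "\<exists>v. v \<noteq> 0 \<and> deg0 c v"
proof -
  have e1: "DD (1, 0) = der X1 Y1" and e2: "DD (0, 1) = der X2 Y2"
    unfolding DA_def DB_def by (simp_all flip: one_pCons)
  obtain g1 where g1: "\<forall>j\<le>Suc n. Fil c (int (om j) + 1) (der X1 Y1 (yy j)) (smult (of_nat (om j)) (monom g1 1 * cc c j))"
    using drop[of "(1, 0)"] unfolding e1 by (elim exE conjE)
  obtain g2 where g2: "\<forall>j\<le>Suc n. Fil c (int (om j) + 1) (der X2 Y2 (yy j)) (smult (of_nat (om j)) (monom g2 1 * cc c j))"
    using drop[of "(0, 1)"] unfolding e2 by (elim exE conjE)
  have lin: "deg0 c v" if v: "fst v * g1 + snd v * g2 = 0" for v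
  proof (rule deg0_from_drop, intro allI impI)
    fix j assume j: "j \<le> Suc n"
    have "smult (fst v) (smult (of_nat (om j)) (monom g1 1 * cc c j)) + smult (snd v) (smult (of_nat (om j)) (monom g2 1 * cc c j)) =
      smult (of_nat (om j)) (monom (fst v * g1 + snd v * g2) 1 * cc c j)"
      by (rule poly_eqI_all) (simp add: poly_monom algebra_simps)
    then show "Fil c (int (om j) + 1) (DD v (yy j)) 0"
      using Fil_add[OF Fil_cmult[OF g1[rule_format, OF j], of "fst v"] Fil_cmult[OF g2[rule_format, OF j], of "snd v"]]
      unfolding DD_linear by (simp add: v)
  qed
  show ?thesis
  proof (cases "(g2, - g1) = 0")
    case True
    then have "deg0 c (1, 0)" by (intro lin) (simp add: zero_prod_def)
    then show ?thesis by (intro exI[of _ "(1, 0)"]) (simp add: zero_prod_def)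
  next
    case False
    then show ?thesis using lin[of "(g2, - g1)"] by (intro exI[of _ "(g2, - g1)"]) (simp add: mult.commute)
  qed
qed

context
  assumes lt: "om 1 < om 0" and nd: "\<not> om 1 dvd om 0"
begin

lemma deg0_triangular:
  assumes "deg0 c v" shows "(\<exists>k. DB v = cst k) \<and> (\<forall>a b. cf (DA v) a b \<noteq> 0 \<longrightarrow> a = 0 \<and> b * om 1 \<le> om 0)"
proof -
  obtain P0 where P0: "Fil c (int (om 0)) (DA v) P0" using deg0D[OF assms, of 0] by auto
  obtain P1 where P1: "Fil c (int (om 1)) (DB v) P1" using deg0D[OF assms, of 1] by auto
  show ?thesis by (rule triangular[OF c lt nd flow_nilpotent[OF deg0D[OF assms]] P0 P1])
qed

text \<open>The exact degree at \<open>y_{n+1}\<close> is used three times. For one degree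
  preserving direction it gives \<open>om 1 <= om (Suc n)\<close>, which rules out
  \<open>om (Suc n) = 1\<close>, so that all directions preserve degrees. A direction with nonzero
  \<open>y\<close>-component has \<open>e >= 0\<close>, which gives the second claim. The powers of
  \<open>y\<close> in each \<open>DA v\<close> then give the bound \<open>m\<close>.\<close>

lemma classify_pos:
  assumes n: "n \<ge> 1"
  shows "2 \<le> om (Suc n)" "sI (Suc n) \<le> int (om (Suc n))"
    "(\<And>i. i * int (om 1) \<le> int (om 0) + int (om (Suc n)) - sI (Suc n) - int (om 1) \<Longrightarrow> i \<le> m) \<Longrightarrow>
      \<exists>c1 c2 \<mu> lam. (c1, c2) \<noteq> (0, 0) \<and> \<mu> \<noteq> 0 \<and> (\<forall>t xy. \<sigma> (t, pt xy) = pt (std_action m lam c1 c2 \<mu> t xy))"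
proof -
  have ed: "\<exists>e. (DB v \<noteq> 0 \<longrightarrow> 0 \<le> e) \<and> (\<forall>b. cf (DA v) 0 b \<noteq> 0 \<longrightarrow> (int b + 1) * int (om 1) - int (om 0) \<le> e) \<and>
      int (om 1) \<le> sI (Suc n) + e \<and> sI (Suc n) + e \<le> int (om (Suc n))"
    if v: "v \<noteq> 0" "deg0 c v" for v
  proof -
    obtain k where k: "DB v = cst k" and A: "\<And>a b. cf (DA v) a b \<noteq> 0 \<Longrightarrow> a = 0"
      using deg0_triangular[OF v(2)] by blast
    obtain P where P: "Fil c (int (om (Suc n))) (der (DA v) (cst k) (yy (Suc n))) P"
      using deg0D[OF v(2), of "Suc n"] unfolding k by blast
    have nz: "DA v \<noteq> 0 \<or> k \<noteq> 0" using DD_nonzero[OF v(1)] unfolding k by auto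
    obtain e where "k \<noteq> 0 \<Longrightarrow> 0 \<le> e" "\<And>b. cf (DA v) 0 b \<noteq> 0 \<Longrightarrow> (int b + 1) * int (om 1) - int (om 0) \<le> e"
      "int (om 1) \<le> sI (Suc n) + e" "\<And>d Q. Fil c d (der (DA v) (cst k) (yy (Suc n))) Q \<Longrightarrow> sI (Suc n) + e \<le> d"
      by (rule exact_degree[OF c n lt nd _ nz]) (erule A, rule that)
    then show ?thesis using P unfolding k by (intro exI[of _ e]) auto
  qed
  obtain v0 where "v0 \<noteq> 0" "deg0 c v0" using deg0_some by blast
  from ed[OF this] have "int (om 1) \<le> int (om (Suc n))" by linarith
  then show o2: "2 \<le> om (Suc n)" using om2[of 1] n by simp
  note d = deg0_all[OF o2]
  obtain v where v: "DB v \<noteq> 0" using DB_nonzero[OF d] by blast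
  have v1: "v \<noteq> 0" using v by (auto simp: DB_def)
  obtain e where "DB v \<noteq> 0 \<longrightarrow> 0 \<le> e" "sI (Suc n) + e \<le> int (om (Suc n))"
    using ed[OF v1 d] by blast
  with v show s: "sI (Suc n) \<le> int (om (Suc n))" by simp
  assume m: "\<And>i. i * int (om 1) \<le> int (om 0) + int (om (Suc n)) - sI (Suc n) - int (om 1) \<Longrightarrow> i \<le> m"
  show "\<exists>c1 c2 \<mu> lam. (c1, c2) \<noteq> (0, 0) \<and> \<mu> \<noteq> 0 \<and> (\<forall>t xy. \<sigma> (t, pt xy) = pt (std_action m lam c1 c2 \<mu> t xy))"
  proof (rule standard_form[OF d])
    fix v show "\<exists>k. DB v = cst k" using deg0_triangular[OF d] by blast
  next
    fix v a b assume ab: "cf (DA v) a b \<noteq> 0"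
    then have a: "a = 0" using deg0_triangular[OF d, of v] by blast
    have "v \<noteq> 0" using ab by (auto simp: DA_def cf_0)
    from ed[OF this d] obtain e where "(int b + 1) * int (om 1) - int (om 0) \<le> e" "sI (Suc n) + e \<le> int (om (Suc n))"
      using ab a by blast
    then show "a = 0 \<and> int b \<le> m" using a m[of "int b"] by (simp add: algebra_simps)
  qed
qed

lemma classify_0:
  assumes n: "n = 0" and o2: "2 \<le> om 1"
    and m: "\<And>i. i * int (om 1) \<le> int (om 0) \<Longrightarrow> i \<le> m"
  shows "\<exists>c1 c2 \<mu> lam. (c1, c2) \<noteq> (0, 0) \<and> \<mu> \<noteq> 0 \<and> (\<forall>t xy. \<sigma> (t, pt xy) = pt (std_action m lam c1 c2 \<mu> t xy))"
proof -
  have d: "deg0 c v" for v by (rule deg0_all) (use n o2 in simp)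
  show ?thesis
  proof (rule standard_form[OF d])
    fix v show "\<exists>k. DB v = cst k" using deg0_triangular[OF d] by blast
  next
    fix v a b assume "cf (DA v) a b \<noteq> 0"
    then have "a = 0" "b * om 1 \<le> om 0" using deg0_triangular[OF d, of v] by blast+
    moreover from this have "int b * int (om 1) \<le> int (om 0)" by (simp flip: of_nat_mult)
    ultimately show "a = 0 \<and> int b \<le> m" using m[of "int b"] by blast
  qed
qed

end

end

end

end

section \<open>Conjugation by automorphisms\<close>

context keydata
begin

text \<open>Conjugating an action uses the inverse automorphism on the second factor of the product.
  A bigraded form is a sum of products, so it is pulled back term by term, with the common factor
  \<open>c p ^ d\<close>.\<close>

lemma prod_hmap_morphism:
  assumes \<Phi>: "\<And>i. i \<le> n + 2 \<Longrightarrow> Hom (wts i) (\<Phi> i)"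
    and im: "\<And>p. p \<in> Ypts \<Longrightarrow> hmap \<Phi> p \<in> Ypts"
  shows "morphism (prod_fspace affine_plane Y) (prod_fspace affine_plane Y) (\<lambda>z. (fst z, hmap \<Phi> (snd z)))"
proof -
  let ?z = "\<lambda>p i. if i \<le> n + 2 then \<Phi> i (rep p) else 0"
  have "\<forall>p. \<exists>c. c \<noteq> 0 \<and> rep (hmap \<Phi> p) = (\<lambda>i. c ^ wts i * ?z p i)" unfolding hmap_def using rep_worbit by blast
  from choice[OF this] obtain c where c: "\<And>p. c p \<noteq> 0" "\<And>p. rep (hmap \<Phi> p) = (\<lambda>i. c p ^ wts i * ?z p i)" by blast
  have pull: "\<exists>h'. YH d h' \<and> (\<forall>p. h (hmap \<Phi> p) = c p ^ d * h' p)" if "YH d h" for d h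
  proof -
    obtain g where g: "Hom d g" "h = (\<lambda>p. g (rep p))" using \<open>YH d h\<close> unfolding hfun_def by blast
    have "YH d (\<lambda>p. g (\<lambda>i. ?z p i))"
      by (rule whom_subst[of YH "n + 2" wts "\<lambda>i p. ?z p i", OF graded_hfun YH_zero _ g(1)]) (use hfunI[OF \<Phi>] in simp)
    then show ?thesis unfolding g(2) using whom_scale[OF g(1)] c(2) by (intro exI[of _ "\<lambda>p. g (\<lambda>i. ?z p i)"]) simp
  qed
  have bpull: "\<exists>G'. BH d G' \<and> (\<forall>t p. G (t, hmap \<Phi> p) = c p ^ d * G' (t, p))" if "BH d G" for d G
    using that
  proof induction
    case bigraded_zero
    show ?case by (rule exI[of _ "\<lambda>_. 0"]) (simp add: bigraded.bigraded_zero)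
  next
    case (bigraded_step f a b)
    obtain f' where f: "BH d f'" "\<forall>t p. f (t, hmap \<Phi> p) = c p ^ d * f' (t, p)" using bigraded_step.IH by (elim exE conjE)
    obtain b' where b: "YH d b'" "\<forall>p. b (hmap \<Phi> p) = c p ^ d * b' p" using pull[OF bigraded_step.hyps(3)] by (elim exE conjE)
    have "BH d (\<lambda>z. a (fst z) * b' (snd z) + f' z)" by (rule bigraded.bigraded_step[OF f(1) bigraded_step.hyps(2) b(1)])
    moreover have "a t * b (hmap \<Phi> p) + f (t, hmap \<Phi> p) = c p ^ d * (a t * b' p + f' (t, p))" for t p
      unfolding b(2)[rule_format] f(2)[rule_format] by (simp add: algebra_simps)
    ultimately show ?case by (rule_tac x = "\<lambda>z. a (fst z) * b' (snd z) + f' z" in exI) simp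
  qed
  note gB = graded_bigraded[OF graded_pfun graded_hfun]
  show ?thesis
  proof (rule morphismI[OF presents_PY gB presents_PY gB, of _ "\<lambda>z. c (snd z)"])
    fix d G assume "BH d G"
    from bpull[OF this] obtain G' where G': "BH d G'" "\<forall>t p. G (t, hmap \<Phi> p) = c p ^ d * G' (t, p)" by (elim exE conjE)
    show "\<exists>G'. BH d G' \<and> (\<forall>p\<in>UNIV \<times> Ypts. G (fst p, hmap \<Phi> (snd p)) = c (snd p) ^ d * G' p)"
      by (rule exI[of _ G'], rule conjI[OF G'(1)]) (simp add: G'(2))
  qed (use im c in auto)
qed

text \<open>As a homeomorphism \<open>F\<close> carries along the generic open set and the dense
  orbits, and the stabilizer of \<open>F q\<close> under the conjugated action is that of
  \<open>q\<close>.\<close>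

lemma structure_conj:
  assumes FG: "iso_maps Y Y F G"
    and m: "morphism (prod_fspace affine_plane Y) (prod_fspace affine_plane Y) (\<lambda>z. (fst z, G (snd z)))"
    and s: "ga2_structure Y \<sigma>"
  shows "ga2_structure Y (\<lambda>z. F (\<sigma> (fst z, G (snd z))))"
proof -
  have F: "morphism Y Y F" and G: "morphism Y Y G" and GF: "\<And>p. p \<in> Ypts \<Longrightarrow> G (F p) = p" and FG': "\<And>p. p \<in> Ypts \<Longrightarrow> F (G p) = p"
    using FG unfolding iso_maps_def pts_Y by blast+
  have act: "ga2_action Y \<sigma>" using s unfolding ga2_structure_def by blast
  interpret gact n om al be th \<sigma> by unfold_locales (rule act)
  have inF: "F p \<in> Ypts" and inG: "G p \<in> Ypts" if "p \<in> Ypts" for p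
    using F G that unfolding morphism_def continuous_map_def pts_Y by auto
  have hm: "homeomorphic_map (zar Y) (zar Y) F"
    unfolding homeomorphic_map_maps homeomorphic_maps_def
    by (rule exI[of _ G]) (use F G GF FG' in \<open>auto simp: morphism_def pts_Y\<close>)
  let ?\<tau> = "\<lambda>z. F (\<sigma> (fst z, G (snd z)))"
  have a: "ga2_action Y ?\<tau>"
    unfolding ga2_action_def pts_Y
  proof (intro conjI ballI allI)
    show "morphism (prod_fspace affine_plane Y) Y ?\<tau>" by (rule morphism_comp[OF morphism_comp[OF m mor] F])
  next
    fix p assume "p \<in> Ypts" then show "?\<tau> (0, p) = p" using inG FG' by simp
  next
    fix s t p assume p: "p \<in> Ypts"
    then show "?\<tau> (s + t, p) = ?\<tau> (s, ?\<tau> (t, p))" using act_add[OF inG[OF p]] GF[OF act_in[OF inG[OF p]]] by simp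
  qed
  obtain U where U: "openin (zar Y) U" "zar Y closure_of U = pts Y"
    "\<forall>p\<in>U. {t. \<sigma> (t, p) = p} = {0} \<and> zar Y closure_of (range (\<lambda>t. \<sigma> (t, p))) = pts Y"
    using s unfolding ga2_structure_def by blast
  have US: "U \<subseteq> Ypts" using openin_subset[OF U(1)] unfolding pts_Y .
  have cl: "zar Y closure_of (F ` S) = pts Y" if "S \<subseteq> Ypts" "zar Y closure_of S = pts Y" for S
    using homeomorphic_map_closure_of[OF hm, of S] that homeomorphic_imp_surjective_map[OF hm] unfolding pts_Y by simp
  show ?thesis
    unfolding ga2_structure_def
  proof (intro conjI a exI[of _ "F ` U"] ballI)
    show "openin (zar Y) (F ` U)" using homeomorphic_imp_open_map[OF hm] U(1) unfolding open_map_def by blast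
    show "zar Y closure_of F ` U = pts Y" by (rule cl[OF US U(2)])
    fix p assume "p \<in> F ` U"
    then obtain q where q: "q \<in> U" "p = F q" by blast
    have qY: "q \<in> Ypts" using q US by blast
    have \<tau>: "?\<tau> (t, p) = F (\<sigma> (t, q))" for t using GF[OF qY] q by simp
    have "F (\<sigma> (t, q)) = F q \<longleftrightarrow> \<sigma> (t, q) = q" for t using GF[OF qY] GF[OF act_in[OF qY, of t]] by metis
    then show "{t. ?\<tau> (t, p) = p} = {0}" unfolding \<tau> unfolding q(2) using U(3) q(1) by simp
    have "range (\<lambda>t. ?\<tau> (t, p)) = F ` range (\<lambda>t. \<sigma> (t, q))" unfolding \<tau> by auto
    moreover have "zar Y closure_of (F ` range (\<lambda>t. \<sigma> (t, q))) = pts Y" by (rule cl) (use act_in[OF qY] U(3) q(1) in auto)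
    ultimately show "zar Y closure_of range (\<lambda>t. ?\<tau> (t, p)) = pts Y" by (simp only:)
  qed
qed

section \<open>The weighted projective planes with weights 1, q, 1\<close>

text \<open>These surfaces have automorphisms that move the line at infinity, so the affine part need
  not be invariant.\<close>

lemma Mo_0: "n = 0 \<Longrightarrow> Mo a = PX ^ a 0 * PY ^ a 1" unfolding Mo_def by simp
lemma wt_0: "n = 0 \<Longrightarrow> wt a = a 0 * om 0 + a 1 * om 1" unfolding wt_def by simp

text \<open>For \<open>n = 0\<close> the surface has no equations, and the degree is the weighted
  degree in \<open>x, y\<close>.\<close>

lemma Fil_cf: assumes n: "n = 0" and "Fil c d f P" "cf f a b \<noteq> 0" shows "int (a * om 0 + b * om 1) \<le> d"
  using assms(2,3)
proof induction
  case (Fil_step f P e k)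
  have "cf (cst k * Mo e) a b = (if a = e 0 \<and> b = e 1 then k else 0)"
    unfolding Mo_0[OF n] mult.assoc[symmetric] by (rule cf_monomial)
  then show ?case using Fil_step wt_0[OF n, of e] by (cases "cf f a b = 0") (auto simp: cf_add split: if_splits)
qed (simp add: cf_0)

lemma worbit_affine: "ycone z \<Longrightarrow> z 0 \<noteq> 0 \<Longrightarrow> worbit wts z = pt (z 1 / z 0 ^ om 0, z 2 / z 0 ^ om 1)"
  unfolding pt_def by (subst cone_affine[of z]) (simp_all add: worbit_scale)

text \<open>Besides \<open>y^2\<close> the only monomial that can have weight 2 is \<open>x\<close>,
  for \<open>om 0 = 2\<close>. Its leading form is constant in \<open>V\<close>, so the prescribed
  leading form excludes it.\<close>

lemma cf_quadric:
  assumes n: "n = 0" and o: "2 \<le> om 0" "om 1 = 1" and c: "curve c" and B: "Fil c 2 B (monom \<gamma> 2)"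
  obtains \<alpha> \<beta> where "B = cst \<alpha> + cst \<beta> * PY + cst \<gamma> * PY ^ 2"
proof -
  define \<alpha> \<beta> \<delta> \<epsilon> where "\<alpha> = cf B 0 0" and "\<beta> = cf B 0 1" and "\<delta> = cf B 0 2" and "\<epsilon> = cf B 1 0"
  have supp: "a * om 0 + b \<le> 2" if "cf B a b \<noteq> 0" for a b
  proof -
    have "int (a * om 0 + b * om 1) \<le> int 2" using Fil_cf[OF n B that] by simp
    then show ?thesis unfolding o(2) by (simp only: of_nat_le_iff mult_1_right)
  qed
  have ab: "(a, b) \<in> {(0, 0), (0, 1), (0, 2), (1, 0)}" if "cf B a b \<noteq> 0" for a b
  proof -
    have "a * 2 + b \<le> 2" using supp[OF that] mult_le_mono2[OF o(1), of a] by linarith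
    then show ?thesis by auto
  qed
  have m: "cf (cst k * PX ^ i * PY ^ j) a b = (if a = i \<and> b = j then k else 0)" for k i j a b by (rule cf_monomial)
  have Be: "B = cst \<alpha> * PX ^ 0 * PY ^ 0 + cst \<beta> * PX ^ 0 * PY ^ 1 + cst \<delta> * PX ^ 0 * PY ^ 2 + cst \<epsilon> * PX ^ 1 * PY ^ 0"
  proof (rule cf_eqI)
    fix a b
    show "cf B a b = cf (cst \<alpha> * PX ^ 0 * PY ^ 0 + cst \<beta> * PX ^ 0 * PY ^ 1 + cst \<delta> * PX ^ 0 * PY ^ 2 + cst \<epsilon> * PX ^ 1 * PY ^ 0) a b"
      unfolding cf_add m using ab[of a b] by (cases "cf B a b = 0") (auto simp: \<alpha>_def \<beta>_def \<delta>_def \<epsilon>_def)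
  qed
  have "c 0 = 1" using c unfolding curve_def by blast
  then have cc: "cc c 0 = 1" "cc c 1 = [:0, 1:]" unfolding cc_def using n by (simp_all add: one_pCons)
  have mono: "Fil c (int (i * om 0 + j)) (cst k * PX ^ i * PY ^ j) (smult k ([:0, 1:] ^ j))" for k i j
    using Fil_monomial[of c i j k] unfolding cc pw_def qw_def o(2) by simp
  have 0: "Fil c 2 (cst \<alpha> * PX ^ 0 * PY ^ 0) 0" by (rule Fil_less[OF mono]) simp
  have 1: "Fil c 2 (cst \<beta> * PX ^ 0 * PY ^ 1) 0" by (rule Fil_less[OF mono]) simp
  have 2: "Fil c 2 (cst \<delta> * PX ^ 0 * PY ^ 2) (monom \<delta> 2)" using mono[of 0 2 \<delta>] by (simp add: monom_altdef)
  have 3: "Fil c 2 (cst \<epsilon> * PX ^ 1 * PY ^ 0) [:\<epsilon>:]"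
  proof (cases "om 0 = 2")
    case True
    then show ?thesis using mono[of 1 0 \<epsilon>] by simp
  next
    case False
    then have "\<epsilon> = 0" using supp[of 1 0] o(1) by (auto simp: \<epsilon>_def)
    then show ?thesis using Fil_zero[of c 2] by simp
  qed
  have "Fil c 2 B (0 + 0 + monom \<delta> 2 + [:\<epsilon>:])"
    unfolding Be by (rule Fil_add[OF Fil_add[OF Fil_add[OF 0 1] 2] 3])
  from Fil_unique[OF c B this] have e: "monom \<gamma> 2 = monom \<delta> 2 + [:\<epsilon>:]" by simp
  have "\<epsilon> = 0" using arg_cong[OF e, of "\<lambda>p. coeff p 0"] by simp
  moreover have "\<gamma> = \<delta>" using arg_cong[OF e, of "\<lambda>p. coeff p 2"] by (simp add: coeff_pCons numeral_2_eq_2)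
  ultimately show ?thesis using Be by (intro that[of \<alpha> \<beta>]) simp
qed

text \<open>The map from \<open>[w : x : y]\<close> to \<open>[y - a w : x : w]\<close>, with
  inverse \<open>swG\<close>. It respects the grading since \<open>w\<close> and \<open>y\<close>
  both have weight 1, and it takes the line \<open>y = a\<close> to infinity.\<close>

definition swF :: "complex \<Rightarrow> nat \<Rightarrow> (nat \<Rightarrow> complex) \<Rightarrow> complex" where
  "swF a i z = (if i = 0 then z 2 - a * z 0 else if i = 2 then z 0 else z i)"
definition swG :: "complex \<Rightarrow> nat \<Rightarrow> (nat \<Rightarrow> complex) \<Rightarrow> complex" where
  "swG a i z = (if i = 0 then z 2 else if i = 2 then z 0 + a * z 2 else z i)"

context
  assumes n0: "n = 0" and o1: "om 1 = 1"
begin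

lemma sw_Hom: "i \<le> n + 2 \<Longrightarrow> Hom (wts i) (swF a i)" "i \<le> n + 2 \<Longrightarrow> Hom (wts i) (swG a i)"
proof -
  have v: "Hom 1 (\<lambda>z. z 0)" "Hom 1 (\<lambda>z. z 2)"
    using Hom_var[of 0] Hom_var[of 2] o1 by (simp_all add: wts_def numeral_2_eq_2)
  have "Hom 1 (\<lambda>z. z 2 - a * z 0)" "Hom 1 (\<lambda>z. z 0 + a * z 2)" by (intro whom_diff whom_add whom_cmult v)+
  moreover have "wts 2 = 1" using o1 by (simp add: wts_def numeral_2_eq_2)
  ultimately show "i \<le> n + 2 \<Longrightarrow> Hom (wts i) (swF a i)" "i \<le> n + 2 \<Longrightarrow> Hom (wts i) (swG a i)"
    using v Hom_var[of i] unfolding swF_def[abs_def] swG_def[abs_def]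
    by (cases "i = 0"; cases "i = 2"; simp)+
qed

lemma hmap_sw:
  "hmap (swF a) (worbit wts z) = worbit wts (\<lambda>i. if i \<le> n + 2 then swF a i z else 0)"
  "hmap (swG a) (worbit wts z) = worbit wts (\<lambda>i. if i \<le> n + 2 then swG a i z else 0)"
  by (rule hmap_worbit, erule sw_Hom)+

lemma ycone_0: "ycone z \<longleftrightarrow> (\<forall>i>2. z i = 0) \<and> (z 0 \<noteq> 0 \<or> z 1 \<noteq> 0 \<or> z 2 \<noteq> 0)"
proof -
  have "(\<exists>i\<le>2. z i \<noteq> 0) \<longleftrightarrow> z 0 \<noteq> 0 \<or> z 1 \<noteq> 0 \<or> z 2 \<noteq> 0"
    by (auto simp: numeral_2_eq_2 le_Suc_eq)
  note f = this
  have e: "n + 2 = 2" "{1..n} = {}" using n0 by simp_all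
  show ?thesis unfolding ycone_def e f by simp
qed

lemma sw_cone:
  assumes "ycone z"
  shows "ycone (\<lambda>i. if i \<le> n + 2 then swF a i z else 0)" "ycone (\<lambda>i. if i \<le> n + 2 then swG a i z else 0)"
  using assms unfolding ycone_0 by (auto simp: n0 swF_def swG_def)

lemma sw_iso: "iso_maps Y Y (hmap (swF a)) (hmap (swG a))"
  unfolding iso_maps_def pts_Y
proof (intro conjI ballI)
  show "morphism Y Y (hmap (swF a))" by (rule hmap_morphism) (use sw_Hom sw_cone in auto)
  show "morphism Y Y (hmap (swG a))" by (rule hmap_morphism) (use sw_Hom sw_cone in auto)
  fix p assume p: "p \<in> Ypts"
  let ?z = "rep p"
  have z: "ycone ?z" "worbit wts ?z = p" using rep_cone[OF p] by auto
  have "hmap (swG a) (hmap (swF a) (worbit wts ?z)) = worbit wts ?z"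
    unfolding hmap_sw
    by (rule arg_cong[where f = "worbit wts"], rule ext) (use z(1)[unfolded ycone_0] in \<open>auto simp: swF_def swG_def n0\<close>)
  then show "hmap (swG a) (hmap (swF a) p) = p" unfolding z(2) .
  have "hmap (swF a) (hmap (swG a) (worbit wts ?z)) = worbit wts ?z"
    unfolding hmap_sw
    by (rule arg_cong[where f = "worbit wts"], rule ext) (use z(1)[unfolded ycone_0] in \<open>auto simp: swF_def swG_def n0\<close>)
  then show "hmap (swF a) (hmap (swG a) p) = p" unfolding z(2) .
qed

lemma sw_pt:
  "y \<noteq> a \<Longrightarrow> hmap (swF a) (pt (x, y)) = pt (x / (y - a) ^ om 0, 1 / (y - a))"
  "y \<noteq> 0 \<Longrightarrow> hmap (swG a) (pt (x, y)) = pt (x / y ^ om 0, 1 / y + a)"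
proof -
  have z2: "zc (x, y) 2 = y" "zc (x, y) 1 = x" by (simp_all add: zc_def numeral_2_eq_2)
  let ?u = "\<lambda>i. if i \<le> n + 2 then swF a i (zc (x, y)) else 0"
  let ?v = "\<lambda>i. if i \<le> n + 2 then swG a i (zc (x, y)) else 0"
  show "hmap (swF a) (pt (x, y)) = pt (x / (y - a) ^ om 0, 1 / (y - a))" if "y \<noteq> a"
  proof -
    have "hmap (swF a) (pt (x, y)) = worbit wts ?u" unfolding pt_def by (rule hmap_sw)
    also have "\<dots> = pt (?u 1 / ?u 0 ^ om 0, ?u 2 / ?u 0 ^ om 1)"
      by (rule worbit_affine[OF sw_cone(1)[OF cone_zc]]) (use that z2 in \<open>simp add: swF_def\<close>)
    also have "(?u 1 / ?u 0 ^ om 0, ?u 2 / ?u 0 ^ om 1) = (x / (y - a) ^ om 0, 1 / (y - a))"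
      by (simp add: swF_def z2[unfolded One_nat_def] o1[unfolded One_nat_def] del: zc_Suc)
    finally show ?thesis .
  qed
  show "hmap (swG a) (pt (x, y)) = pt (x / y ^ om 0, 1 / y + a)" if "y \<noteq> 0"
  proof -
    have "hmap (swG a) (pt (x, y)) = worbit wts ?v" unfolding pt_def by (rule hmap_sw)
    also have "\<dots> = pt (?v 1 / ?v 0 ^ om 0, ?v 2 / ?v 0 ^ om 1)"
      by (rule worbit_affine[OF sw_cone(2)[OF cone_zc]]) (use that z2 in \<open>simp add: swG_def\<close>)
    also have "(?v 1 / ?v 0 ^ om 0, ?v 2 / ?v 0 ^ om 1) = (x / y ^ om 0, 1 / y + a)"
      using that by (simp add: swG_def z2[unfolded One_nat_def] o1[unfolded One_nat_def] add_divide_distrib del: zc_Suc)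
    finally show ?thesis .
  qed
qed

lemma sw_structure: "ga2_structure Y \<sigma> \<Longrightarrow> ga2_structure Y (\<lambda>z. hmap (swF a) (\<sigma> (fst z, hmap (swG a) (snd z))))"
proof (rule structure_conj[OF sw_iso])
  have "hmap (swG a) p \<in> Ypts" if "p \<in> Ypts" for p
    using sw_iso[of a] that unfolding iso_maps_def morphism_def continuous_map_def pts_Y by auto
  then show "morphism (prod_fspace affine_plane Y) (prod_fspace affine_plane Y) (\<lambda>z. (fst z, hmap (swG a) (snd z)))"
    by (intro prod_hmap_morphism sw_Hom(2))
qed

end

end

section \<open>Generators for the weights 1, q, 1\<close>

context gder
begin

text \<open>The counterpart of \<open>triangular\<close> when \<open>om 1 = 1\<close> divides
  \<open>om 0\<close>. The weights leave \<open>\<alpha> + \<beta> y\<close> for the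
  \<open>y\<close>-component and \<open>\<gamma> x + p(y)\<close> for the
  \<open>x\<close>-component. Flows are polynomial in time, and the difference of two suitable ones
  solves \<open>d' = \<beta> d\<close>, respectively \<open>d' = \<gamma> d\<close>, with
  \<open>d(0) = 1\<close>; a polynomial does so only if the coefficient is 0.\<close>

lemma deg0_linear:
  assumes n: "n = 0" and o: "2 \<le> om 0" "om 1 = 1" and d: "deg0 c v"
  shows "(\<exists>k. DB v = cst k) \<and> (\<forall>a b. cf (DA v) a b \<noteq> 0 \<longrightarrow> a = 0 \<and> b \<le> om 0)"
proof -
  obtain P0 where P0: "Fil c (int (om 0)) (DA v) P0" using deg0D[OF d, of 0] by auto
  obtain P1 where P1: "Fil c (int (om 1)) (DB v) P1" using deg0D[OF d, of 1] by auto
  have B: "a = 0 \<and> b \<le> 1" if "cf (DB v) a b \<noteq> 0" for a b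
  proof -
    have "int (a * om 0 + b * om 1) \<le> int (om 1)" by (rule Fil_cf[OF n P1 that])
    then have "a * om 0 + b \<le> 1" unfolding o(2) by (simp only: of_nat_le_iff mult_1_right)
    then show ?thesis using mult_le_mono2[OF o(1), of a] by linarith
  qed
  have A: "a = 0 \<and> b \<le> om 0 \<or> a = 1 \<and> b = 0" if "cf (DA v) a b \<noteq> 0" for a b
  proof -
    have "int (a * om 0 + b * om 1) \<le> int (om 0)" by (rule Fil_cf[OF n P0 that])
    then have s: "a * om 0 + b \<le> om 0" unfolding o(2) by (simp only: of_nat_le_iff mult_1_right)
    show ?thesis
    proof (cases "a \<le> 1")
      case True
      then show ?thesis using s by (cases a) auto
    next
      case False
      then have "2 * om 0 \<le> a * om 0" by (intro mult_le_mono1) simp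
      then show ?thesis using s o(1) by linarith
    qed
  qed
  have fp: "\<exists>G. \<forall>s. fl v xy f s = poly G s" for xy f by (rule flow_poly[OF deg0D[OF d]])
  have fd: "\<forall>s. fl v xy (DD v f) s = poly (pderiv G) s" if "\<forall>s. fl v xy f s = poly G s" for xy f G
    by (rule flow_poly_deriv[OF deg0D[OF d] that])
  define \<alpha> \<beta> where "\<alpha> = cf (DB v) 0 0" and "\<beta> = cf (DB v) 0 1"
  have DB: "DB v = cst \<alpha> * PX ^ 0 * PY ^ 0 + cst \<beta> * PX ^ 0 * PY ^ 1"
    by (rule cf_eqI, unfold cf_add cf_monomial) (use B \<alpha>_def \<beta>_def in \<open>fastforce simp: le_Suc_eq\<close>)
  have "\<beta> = 0"
  proof -
    obtain G0 where G0: "\<forall>s. fl v (0, 0) PY s = poly G0 s" using fp by blast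
    obtain G1 where G1: "\<forall>s. fl v (0, 1) PY s = poly G1 s" using fp by blast
    have e: "fl v xy (DB v) s = \<alpha> + \<beta> * fl v xy PY s" for xy s
      unfolding DB fl_def by (simp only: ev_simps power_0 power_one_right mult_1_right, simp)
    have p0: "poly (pderiv G0) s = \<alpha> + \<beta> * poly G0 s" and p1: "poly (pderiv G1) s = \<alpha> + \<beta> * poly G1 s" for s
      using fd[OF G0, rule_format, of s] fd[OF G1, rule_format, of s] G0 G1 by (simp_all add: e)
    have "pderiv (G1 - G0) = smult \<beta> (G1 - G0)"
      by (rule poly_eqI_all) (simp add: p0 p1 pderiv_diff algebra_simps)
    moreover have "poly (G1 - G0) 0 = 1" using G0[rule_format, of 0] G1[rule_format, of 0] pt_Y by (simp add: fl_def)
    then have "G1 - G0 \<noteq> 0" by auto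
    ultimately show ?thesis by (rule pderiv_eigen)
  qed
  then have k: "DB v = cst \<alpha>" using DB by simp
  define \<gamma> where "\<gamma> = cf (DA v) 1 0"
  define A' where "A' = DA v - cst \<gamma> * PX ^ 1 * PY ^ 0"
  have "a = 0" if "cf A' a b \<noteq> 0" for a b
    using that A[of a b] unfolding A'_def cf_diff cf_monomial by (auto simp: \<gamma>_def split: if_splits)
  then obtain p where p: "\<And>xy. ev A' xy = poly p (snd xy)" by (rule only_y[of A']) (assumption, rule that)
  have "\<gamma> = 0"
  proof -
    obtain G0 where G0: "\<forall>s. fl v (0, 0) PX s = poly G0 s" using fp by blast
    obtain G1 where G1: "\<forall>s. fl v (1, 0) PX s = poly G1 s" using fp by blast
    have DA: "DA v = cst \<gamma> * PX + A'" unfolding A'_def by simp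
    have y: "fl v xy PY s = snd xy + \<alpha> * s" for xy s using flow_linear[OF d, of PY \<alpha> xy s] by (simp add: k)
    have e: "fl v xy (DA v) s = \<gamma> * fl v xy PX s + poly p (snd xy + \<alpha> * s)" for xy s
      using y[of xy s] unfolding DA fl_def by (simp add: p)
    have p0: "poly (pderiv G0) s = \<gamma> * poly G0 s + poly p (\<alpha> * s)" and p1: "poly (pderiv G1) s = \<gamma> * poly G1 s + poly p (\<alpha> * s)" for s
      using fd[OF G0, rule_format, of s] fd[OF G1, rule_format, of s] G0 G1 by (simp_all add: e)
    have "pderiv (G1 - G0) = smult \<gamma> (G1 - G0)"
      by (rule poly_eqI_all) (simp add: p0 p1 pderiv_diff algebra_simps)
    moreover have "poly (G1 - G0) 0 = 1" using G0[rule_format, of 0] G1[rule_format, of 0] pt_Y by (simp add: fl_def)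
    then have "G1 - G0 \<noteq> 0" by auto
    ultimately show ?thesis by (rule pderiv_eigen)
  qed
  then have "a = 0 \<and> b \<le> om 0" if "cf (DA v) a b \<noteq> 0" for a b using A[OF that] that by (auto simp: \<gamma>_def)
  then show ?thesis using k by blast
qed

text \<open>With two distinct roots, the cross ratio of \<open>y\<close> with them would be a rational function of the
  time that is an exponential.\<close>

lemma double_root:
  assumes B: "DB v = cst \<alpha> + cst \<beta> * PY + cst \<gamma> * PY ^ 2" and g: "\<gamma> \<noteq> 0"
  shows "\<beta>\<^sup>2 = 4 * \<alpha> * \<gamma>"
proof -
  have "\<not> constant (poly [:\<alpha>, \<beta>, \<gamma>:])" using g by (simp add: constant_degree)
  then obtain r1 where r1: "poly [:\<alpha>, \<beta>, \<gamma>:] r1 = 0" using fundamental_theorem_of_algebra by blast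
  define r2 where "r2 = - \<beta> / \<gamma> - r1"
  have be: "\<beta> = - \<gamma> * (r1 + r2)" using g by (simp add: r2_def field_simps)
  have al: "\<alpha> = \<gamma> * r1 * r2" using r1 unfolding be by (simp add: algebra_simps)
  have evB: "ev (DB v) q = \<alpha> + \<beta> * snd q + \<gamma> * (snd q)\<^sup>2" for q unfolding B by (simp only: ev_simps, simp)
  have "r1 = r2"
  proof (rule ccontr)
    assume ne: "r1 \<noteq> r2"
    obtain y0 where y0: "y0 \<noteq> r1" "y0 \<noteq> r2" using ex_new_if_finite[OF infinite_UNIV_char_0, of "{r1, r2}"] by auto
    obtain C where C: "poly C 0 \<noteq> 0" "\<And>s. poly C s \<noteq> 0 \<Longrightarrow> \<sigma> (sm v s, pt (0, y0)) \<in> range pt"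
      "\<And>f. \<exists>k N. \<forall>s. poly C s \<noteq> 0 \<longrightarrow> fl v (0, y0) f s * poly C s ^ k = poly N s"
      by (rule fl_rational[OF start_affine]) (rule that)
    obtain k N where N: "\<forall>s. poly C s \<noteq> 0 \<longrightarrow> fl v (0, y0) PY s * poly C s ^ k = poly N s" using C(3) by blast
    define M where "M = C ^ k"
    have yM: "fl v (0, y0) PY s = poly N s / poly M s" if "poly C s \<noteq> 0" for s
      using N[rule_format, OF that] that by (simp add: M_def field_simps)
    \<comment> \<open>Numerators of \<open>y - r1\<close> and \<open>y - r2\<close> along the orbit;
      neither is zero since the orbit starts away from both roots.\<close>
    define u1 u2 where "u1 = N - smult r1 M" and "u2 = N - smult r2 M"
    have C0: "C \<noteq> 0" using C(1) by auto
    have W: "pderiv N * M - N * pderiv M = smult \<gamma> (u1 * u2)"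
    proof (rule poly_eq_on[OF C0])
      fix s assume s: "poly C s \<noteq> 0"
      have Ms: "poly M s \<noteq> 0" using s by (simp add: M_def)
      have "eventually (\<lambda>r. poly C r \<noteq> 0) (nhds s)" by (rule eventually_nonzero[OF poly_DERIV s])
      then have e: "eventually (\<lambda>r. fl v (0, y0) PY r = poly N r / poly M r) (nhds s)"
        by (rule eventually_mono) (use yM in blast)
      have "(fl v (0, y0) PY has_field_derivative fl v (0, y0) (DB v) s) (at s)"
        using flow_deriv[OF pt_Y C(2)[OF s], of PY] unfolding fl_def[abs_def] by simp
      moreover have "(fl v (0, y0) PY has_field_derivative (poly (pderiv N) s * poly M s - poly N s * poly (pderiv M) s) / (poly M s * poly M s)) (at s)"
        unfolding DERIV_cong_ev[OF refl e refl] by (rule DERIV_divide[OF poly_DERIV poly_DERIV Ms])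
      ultimately have "fl v (0, y0) (DB v) s = (poly (pderiv N) s * poly M s - poly N s * poly (pderiv M) s) / (poly M s * poly M s)"
        by (rule DERIV_unique)
      moreover have "fl v (0, y0) (DB v) s = \<gamma> * (fl v (0, y0) PY s - r1) * (fl v (0, y0) PY s - r2)"
        unfolding fl_def evB by (simp add: be al algebra_simps power2_eq_square)
      ultimately have "\<gamma> * (poly N s / poly M s - r1) * (poly N s / poly M s - r2) * (poly M s * poly M s) =
          poly (pderiv N) s * poly M s - poly N s * poly (pderiv M) s"
        using Ms by (simp add: yM[OF s])
      moreover have "(poly N s / poly M s - r) * poly M s = poly N s - r * poly M s" for r using Ms by (simp add: field_simps)
      then have "\<gamma> * (poly N s / poly M s - r1) * (poly N s / poly M s - r2) * (poly M s * poly M s) =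
          \<gamma> * ((poly N s - r1 * poly M s) * (poly N s - r2 * poly M s))" by (metis (no_types, opaque_lifting) mult.assoc mult.left_commute)
      ultimately show "poly (pderiv N * M - N * pderiv M) s = poly (smult \<gamma> (u1 * u2)) s"
        by (simp add: u1_def u2_def)
    qed
    have M0: "poly M 0 \<noteq> 0" using C(1) by (simp add: M_def)
    have "poly N 0 = y0 * poly M 0" using N[rule_format, OF C(1)] pt_Y by (simp add: fl_def M_def)
    then have "poly u1 0 = (y0 - r1) * poly M 0" "poly u2 0 = (y0 - r2) * poly M 0"
      by (simp_all add: u1_def u2_def algebra_simps)
    then have u: "u1 \<noteq> 0" "u2 \<noteq> 0" using y0 M0 by auto
    have W2: "pderiv u1 * u2 - u1 * pderiv u2 = smult (r1 - r2) (smult \<gamma> (u1 * u2))"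
      unfolding W[symmetric] by (rule poly_eqI_all) (simp add: u1_def u2_def pderiv_diff pderiv_smult algebra_simps)
    \<comment> \<open>The quotient \<open>u1 / u2\<close> solves a linear equation with constant
      coefficient, a system with one unknown, so it is a polynomial.\<close>
    have "u2 dvd (\<lambda>_. u1) (0 :: nat)"
      by (rule rational_solution[of "{0}" u2 "\<lambda>_. u1" "\<lambda>_ _. (r1 - r2) * \<gamma>"])
        (use u W2 in \<open>simp_all add: mult.commute\<close>)
    then obtain h where h: "u1 = u2 * h" by (elim dvdE)
    have "u2 * u2 * pderiv h = u2 * u2 * smult ((r1 - r2) * \<gamma>) h"
      using W2 unfolding h by (simp add: pderiv_mult algebra_simps)
    then have "pderiv h = smult ((r1 - r2) * \<gamma>) h"
      using u(2) by (simp only: mult_cancel_left mult_eq_0_iff simp_thms)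
    moreover have "h \<noteq> 0" using u(1) h by auto
    ultimately have "(r1 - r2) * \<gamma> = 0" by (rule pderiv_eigen)
    then show False using ne g by simp
  qed
  then show ?thesis unfolding be al by (simp add: power2_eq_square algebra_simps)
qed

end

lemma quadric_simps:
  assumes "f = cst \<alpha> + cst \<beta> * PY + cst \<gamma> * PY ^ 2"
  shows "pdx f = 0" "ev f xy = \<alpha> + \<beta> * snd xy + \<gamma> * (snd xy)\<^sup>2" "ev (pderiv f) xy = \<beta> + 2 * \<gamma> * snd xy" "cf f 0 2 = \<gamma>"
proof -
  show "pdx f = 0" unfolding assms power2_eq_square
    by (simp only: pdx_add pdx_mult pd_gens mult_zero_left mult_zero_right add_0_left add_0_right)
  show "ev f xy = \<alpha> + \<beta> * snd xy + \<gamma> * (snd xy)\<^sup>2" unfolding assms by (simp only: ev_simps, simp)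
  have "pderiv f = cst \<beta> + cst \<gamma> * (PY + PY)" unfolding assms power2_eq_square
    by (simp only: pderiv_add pderiv_mult pd_gens mult_zero_left mult_zero_right add_0_left add_0_right mult_1_left mult_1_right)
  then show "ev (pderiv f) xy = \<beta> + 2 * \<gamma> * snd xy" by (simp only: ev_simps) (simp add: algebra_simps)
  show "cf f 0 2 = \<gamma>" unfolding assms by (simp add: cf_def power2_eq_square numeral_2_eq_2)
qed

context gder
begin

context
  fixes c
  assumes n0: "n = 0" and o0: "2 \<le> om 0" and o1: "om 1 = 1" and bez: "\<exists>a b. wt a = Suc (wt b)"
    and str: "ga2_structure Y \<sigma>" and c: "curve c"
begin

text \<open>The generator raises degrees by at most 1, so the image of \<open>y\<close>, which has
  weight 1, has degree 2 with leading form \<open>\<gamma> V^2\<close>; \<gamma> = 0 implies that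
  degrees are preserved.\<close>

lemma quadric_form: "\<exists>\<alpha> \<beta> \<gamma>. DB v = cst \<alpha> + cst \<beta> * PY + cst \<gamma> * PY ^ 2 \<and> (\<gamma> = 0 \<longrightarrow> deg0 c v)"
proof -
  have "\<exists>\<gamma>. (\<forall>j\<le>Suc n. Fil c (int (om j) + 1) (DD v (yy j)) (smult (of_nat (om j)) (monom \<gamma> 1 * cc c j))) \<and>
    (2 \<le> om (Suc n) \<longrightarrow> \<gamma> = 0)"
    by (rule drop[OF str c _ bez]) (use n0 o0 in simp)
  then obtain \<gamma> where g: "\<forall>j\<le>Suc n. Fil c (int (om j) + 1) (DD v (yy j)) (smult (of_nat (om j)) (monom \<gamma> 1 * cc c j))" by (elim exE conjE)
  have m: "smult (of_nat (om 1)) (monom \<gamma> 1 * cc c 1) = monom \<gamma> 2"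
  proof -
    have "cc c 1 = [:0, 1:]" unfolding cc_def using n0 by simp
    then show ?thesis unfolding o1 by (intro poly_eqI_all) (simp add: poly_monom power2_eq_square)
  qed
  have "1 \<le> Suc n" by simp
  from g[rule_format, OF this] have "Fil c (int (om 1) + 1) (DD v (yy 1)) (monom \<gamma> 2)" unfolding m .
  then have "Fil c 2 (DB v) (monom \<gamma> 2)" unfolding o1 by simp
  then obtain \<alpha> \<beta> where B: "DB v = cst \<alpha> + cst \<beta> * PY + cst \<gamma> * PY ^ 2"
    by (rule cf_quadric[OF n0 o0 o1 c]) (rule that)
  have "deg0 c v" if "\<gamma> = 0"
    by (rule deg0_from_drop[OF str c]) (use g that in simp)
  then show ?thesis using B by blast
qed

lemma deg0_if_const: assumes "DB v = cst k" shows "deg0 c v"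
proof -
  obtain \<alpha> \<beta> \<gamma> where q: "DB v = cst \<alpha> + cst \<beta> * PY + cst \<gamma> * PY ^ 2" "\<gamma> = 0 \<longrightarrow> deg0 c v" using quadric_form[of v] by blast
  have "\<gamma> = cf (cst k) 0 2" using quadric_simps(4)[OF q(1)] assms by simp
  then have "\<gamma> = 0" by (simp add: cf_def numeral_2_eq_2)
  then show ?thesis using q(2) by blast
qed

lemma classify_q1_invariant:
  assumes d: "\<And>v. deg0 c v" and m: "\<And>i. i \<le> int (om 0) \<Longrightarrow> i \<le> m"
  shows "\<exists>c1 c2 \<mu> lam. (c1, c2) \<noteq> (0, 0) \<and> \<mu> \<noteq> 0 \<and> (\<forall>t xy. \<sigma> (t, pt xy) = pt (std_action m lam c1 c2 \<mu> t xy))"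
proof (rule standard_form[OF str c d])
  fix v show "\<exists>k. DB v = cst k" using deg0_linear[OF n0 o0 o1 d] by blast
next
  fix v a b assume "cf (DA v) a b \<noteq> 0"
  then have "a = 0" "b \<le> om 0" using deg0_linear[OF n0 o0 o1 d, of v] by blast+
  then show "a = 0 \<and> int b \<le> m" using m[of "int b"] by simp
qed

text \<open>The two \<open>y\<close>-components are quadratics in \<open>y\<close>, and commutation
  makes their Wronskian vanish, so they are proportional. One has a \<open>y^2\<close> term, because
  some direction does not preserve degrees, and by \<open>double_root\<close> its two roots
  coincide. The line \<open>y = a\<close> is then tangent to all generators.\<close>

lemma common_root:
  assumes nd: "\<not> deg0 c v0"
  shows "\<exists>a. \<forall>v. \<exists>\<gamma>. \<forall>xy. ev (DB v) xy = \<gamma> * (snd xy - a)\<^sup>2"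
proof -
  have e: "DB (1, 0) = Y1" "DB (0, 1) = Y2" unfolding DB_def by (simp_all flip: one_pCons)
  obtain \<alpha>1 \<beta>1 \<gamma>1 where 1: "DB (1, 0) = cst \<alpha>1 + cst \<beta>1 * PY + cst \<gamma>1 * PY ^ 2" using quadric_form[of "(1, 0)"] by blast
  obtain \<alpha>2 \<beta>2 \<gamma>2 where 2: "DB (0, 1) = cst \<alpha>2 + cst \<beta>2 * PY + cst \<gamma>2 * PY ^ 2" using quadric_form[of "(0, 1)"] by blast
  note q1 = quadric_simps[OF 1, unfolded e] and q2 = quadric_simps[OF 2, unfolded e]
  have com: "(\<alpha>2 + \<beta>2 * y + \<gamma>2 * y\<^sup>2) * (\<beta>1 + 2 * \<gamma>1 * y) = (\<alpha>1 + \<beta>1 * y + \<gamma>1 * y\<^sup>2) * (\<beta>2 + 2 * \<gamma>2 * y)" for y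
  proof -
    have "ev (DD (0, 1) Y1) (0, y) = ev (DD (1, 0) Y2) (0, y)" by (simp only: commuting(2))
    then show ?thesis unfolding der_def e by (simp add: q1(1,3) q2(1,3)) (simp add: q1(2) q2(2))
  qed
  have p0: "\<alpha>2 * \<beta>1 = \<alpha>1 * \<beta>2" using com[of 0] by simp
  have p1: "(\<alpha>2 + \<beta>2 + \<gamma>2) * (\<beta>1 + 2 * \<gamma>1) = (\<alpha>1 + \<beta>1 + \<gamma>1) * (\<beta>2 + 2 * \<gamma>2)" using com[of 1] by simp
  have p2: "(\<alpha>2 - \<beta>2 + \<gamma>2) * (\<beta>1 - 2 * \<gamma>1) = (\<alpha>1 - \<beta>1 + \<gamma>1) * (\<beta>2 - 2 * \<gamma>2)" using com[of "- 1"] by simp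
  \<comment> \<open>Proportionality of the coefficients, extracted from the Wronskian identity at
    \<open>y = 0\<close>, \<open>1\<close> and \<open>- 1\<close>.\<close>
  have r1: "\<gamma>1 * \<beta>2 = \<gamma>2 * \<beta>1" and r2: "\<gamma>1 * \<alpha>2 = \<gamma>2 * \<alpha>1" using p0 p1 p2 by algebra+
  have pr: "\<gamma>1 * ev Y2 xy = \<gamma>2 * ev Y1 xy" for xy
    unfolding q1(2) q2(2) using r1 r2 by algebra
  have sq: "\<alpha> + \<beta> * y + \<gamma> * y\<^sup>2 = \<gamma> * (y - (- \<beta> / (2 * \<gamma>)))\<^sup>2" if "\<beta>\<^sup>2 = 4 * \<alpha> * \<gamma>" "\<gamma> \<noteq> 0" for \<alpha> \<beta> \<gamma> y :: complex
  proof -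
    have "4 * \<gamma> * (\<gamma> * (y - (- \<beta> / (2 * \<gamma>)))\<^sup>2) = (2 * \<gamma> * (y - (- \<beta> / (2 * \<gamma>))))\<^sup>2" by (simp add: power2_eq_square algebra_simps)
    also have "2 * \<gamma> * (y - (- \<beta> / (2 * \<gamma>))) = 2 * \<gamma> * y + \<beta>" using that(2) by (simp add: field_simps)
    also have "(2 * \<gamma> * y + \<beta>)\<^sup>2 = 4 * \<gamma> * (\<alpha> + \<beta> * y + \<gamma> * y\<^sup>2)" using that(1) by algebra
    finally show ?thesis using that(2) by simp
  qed
  have "\<gamma>1 \<noteq> 0 \<or> \<gamma>2 \<noteq> 0"
  proof (rule ccontr)
    assume "\<not> ?thesis"
    then have z: "cf Y1 0 2 = 0" "cf Y2 0 2 = 0" using q1(4) q2(4) by auto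
    obtain \<alpha> \<beta> \<gamma> where q: "DB v0 = cst \<alpha> + cst \<beta> * PY + cst \<gamma> * PY ^ 2" "\<gamma> = 0 \<longrightarrow> deg0 c v0" using quadric_form[of v0] by blast
    have "\<gamma> = cf (DB v0) 0 2" using quadric_simps(4)[OF q(1)] by simp
    also have "\<dots> = fst v0 * cf Y1 0 2 + snd v0 * cf Y2 0 2" unfolding DB_def cf_def by simp
    finally show False using z q(2) nd by simp
  qed
  then show ?thesis
  proof
    assume g: "\<gamma>1 \<noteq> 0"
    let ?a = "- \<beta>1 / (2 * \<gamma>1)"
    have y1: "ev Y1 xy = \<gamma>1 * (snd xy - ?a)\<^sup>2" for xy
      unfolding q1(2) by (rule sq[OF double_root[OF 1 g] g])
    have "ev Y2 xy = \<gamma>2 * (snd xy - ?a)\<^sup>2" for xy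
    proof -
      have "\<gamma>1 * ev Y2 xy = \<gamma>1 * (\<gamma>2 * (snd xy - ?a)\<^sup>2)" unfolding pr y1 by (simp only: mult_ac)
      then show ?thesis using g by (simp only: mult_cancel_left simp_thms)
    qed
    then have "ev (DB v) xy = (fst v * \<gamma>1 + snd v * \<gamma>2) * (snd xy - ?a)\<^sup>2" for v xy
      unfolding ev_DB y1 by (simp only: distrib_right mult.assoc)
    then show ?thesis by blast
  next
    assume g: "\<gamma>2 \<noteq> 0"
    let ?a = "- \<beta>2 / (2 * \<gamma>2)"
    have y2: "ev Y2 xy = \<gamma>2 * (snd xy - ?a)\<^sup>2" for xy
      unfolding q2(2) by (rule sq[OF double_root[OF 2 g] g])
    have "ev Y1 xy = \<gamma>1 * (snd xy - ?a)\<^sup>2" for xy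
    proof -
      have "\<gamma>2 * ev Y1 xy = \<gamma>2 * (\<gamma>1 * (snd xy - ?a)\<^sup>2)" unfolding pr[symmetric] y2 by (simp only: mult_ac)
      then show ?thesis using g by (simp only: mult_cancel_left simp_thms)
    qed
    then have "ev (DB v) xy = (fst v * \<gamma>1 + snd v * \<gamma>2) * (snd xy - ?a)\<^sup>2" for v xy
      unfolding ev_DB y2 by (simp only: distrib_right mult.assoc)
    then show ?thesis by blast
  qed
qed

end

text \<open>In the coordinate \<open>1 / (y - a)\<close> the field
  \<open>\<gamma> (y - a)^2 d/dy\<close> becomes constant with value \<open>- \<gamma>\<close>. The
  computation takes place where the new \<open>y\<close> is nonzero, that is, on both affine charts;
  multiplying the polynomial identity by \<open>PY\<close> covers the rest.\<close>

lemma sw_generator: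
  assumes n0: "n = 0" and o1: "om 1 = 1"
    and g': "gder n om al be th (\<lambda>z. hmap (swF a) (\<sigma> (fst z, hmap (swG a) (snd z)))) X1' X2' Y1' Y2'"
    and B: "\<And>xy. ev (DB v) xy = \<gamma> * (snd xy - a)\<^sup>2"
  shows "gder.DB Y1' Y2' v = cst (- \<gamma>)"
proof -
  interpret g': gder n om al be th "\<lambda>z. hmap (swF a) (\<sigma> (fst z, hmap (swG a) (snd z)))" X1' X2' Y1' Y2' by (rule g')
  have val: "ev (g'.DB v) (x, y) = - \<gamma>" if y: "y \<noteq> 0" for x y
  proof -
    define xy where "xy = (x / y ^ om 0, 1 / y + a)"
    have G: "hmap (swG a) (pt (x, y)) = pt xy" unfolding xy_def by (rule sw_pt(2)[OF n0 o1 y])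
    let ?Z = "\<lambda>s. ev (PY - cst a) (co (\<sigma> (sm v s, pt xy)))"
    have dZ: "(?Z has_field_derivative \<gamma> * (1 / y)\<^sup>2) (at 0)"
    proof (rule DERIV_cong[OF chain0])
      have "DD v (PY - cst a) = DB v" unfolding derivation.D_diff[OF derivation_der] by simp
      then have "ev (DD v (PY - cst a)) xy = \<gamma> * (snd xy - a)\<^sup>2" by (simp only: B)
      moreover have "snd xy - a = 1 / y" by (simp add: xy_def)
      ultimately show "ev (DD v (PY - cst a)) xy = \<gamma> * (1 / y)\<^sup>2" by (simp only:)
    qed
    have evZ: "ev (PY - cst a) q = snd q - a" for q by (simp only: ev_simps, simp)
    have Z0: "?Z 0 = 1 / y" unfolding evZ using pt_Y by (simp add: xy_def)
    then have "?Z 0 \<noteq> 0" using y by simp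
    from eventually_nonzero[OF dZ this] have ev1: "eventually (\<lambda>s. ?Z s \<noteq> 0) (nhds 0)" .
    have e: "eventually (\<lambda>s. cy (hmap (swF a) (\<sigma> (fst (sm v s, pt (x, y)), hmap (swG a) (snd (sm v s, pt (x, y)))))) = 1 / ?Z s) (nhds 0)"
    proof (rule eventually_mono[OF eventually_conj[OF ev1 near_affine[of v xy]]], elim conjE)
      fix s assume z: "?Z s \<noteq> 0" and r: "\<sigma> (sm v s, pt xy) \<in> range pt"
      obtain u w where uw: "\<sigma> (sm v s, pt xy) = pt (u, w)" using r by auto
      have "w \<noteq> a" using z unfolding evZ uw by simp
      then show "cy (hmap (swF a) (\<sigma> (fst (sm v s, pt (x, y)), hmap (swG a) (snd (sm v s, pt (x, y)))))) = 1 / ?Z s"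
        unfolding fst_conv snd_conv G uw sw_pt(1)[OF n0 o1 \<open>w \<noteq> a\<close>] evZ by simp
    qed
    have d1: "((\<lambda>s. 1 / ?Z s) has_field_derivative fst v * ev Y1' (x, y) + snd v * ev Y2' (x, y)) (at 0)"
      using g'.dY[of v "(x, y)"] unfolding DERIV_cong_ev[OF refl e refl] .
    have "((\<lambda>s. 1 / ?Z s) has_field_derivative (0 * ?Z 0 - 1 * (\<gamma> * (1 / y)\<^sup>2)) / (?Z 0 * ?Z 0)) (at 0)"
      by (rule DERIV_divide[OF DERIV_const dZ \<open>?Z 0 \<noteq> 0\<close>])
    from DERIV_unique[OF d1 this] show ?thesis unfolding Z0 using y by (simp add: power2_eq_square)
  qed
  have "ev ((g'.DB v + cst \<gamma>) * PY) p = 0" for p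
    using val[of "snd p" "fst p"] by (cases "snd p = 0") (simp_all only: ev_simps mult_zero_right, simp)
  then have "(g'.DB v + cst \<gamma>) * PY = 0" using ev_zero_iff by blast
  then have "g'.DB v + cst \<gamma> = 0" by (simp only: mult_eq_0_iff pCons_eq_0_iff one_neq_zero simp_thms)
  then have "g'.DB v = - cst \<gamma>" by (rule eq_neg_iff_add_eq_0[THEN iffD2])
  moreover have "- cst \<gamma> = cst (- \<gamma>)" by simp
  ultimately show ?thesis by (simp only:)
qed

end

context keydata
begin

lemma iso_id: "iso_maps Y Y (\<lambda>p. p) (\<lambda>p. p)"
  unfolding iso_maps_def by (simp add: morphism_id[OF presents_Y graded_hfun])

text \<open>If some direction fails to preserve degrees, the swap at the common root makes every
  \<open>y\<close>-component constant, and then all directions preserve degrees by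
  \<open>deg0_if_const\<close>.\<close>

lemma classify_q1:
  assumes n0: "n = 0" and o0: "2 \<le> om 0" and o1: "om 1 = 1" and bez: "\<exists>a b. wt a = Suc (wt b)"
    and str: "ga2_structure Y \<sigma>" and m: "\<And>i. i \<le> int (om 0) \<Longrightarrow> i \<le> m"
  shows "\<exists>F G. iso_maps Y Y F G \<and> (\<exists>c1 c2 \<mu> lam. (c1, c2) \<noteq> (0, 0) \<and> \<mu> \<noteq> 0 \<and>
    (\<forall>t xy. F (\<sigma> (t, G (pt xy))) = pt (std_action m lam c1 c2 \<mu> t xy)))"
proof -
  interpret gact n om al be th \<sigma> by unfold_locales (use str in \<open>simp add: ga2_structure_def\<close>)
  obtain X1 X2 Y1 Y2 where "gder n om al be th \<sigma> X1 X2 Y1 Y2" using gder_exists by blast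
  then interpret g: gder n om al be th \<sigma> X1 X2 Y1 Y2 .
  obtain c where c: "curve c" using curve_exists by blast
  note as = n0 o0 o1 bez str c
  show ?thesis
  proof (cases "\<forall>v. g.deg0 c v")
    case True
    then have d: "\<And>v. g.deg0 c v" by blast
    show ?thesis
      by (rule exI[of _ "\<lambda>p. p"], rule exI[of _ "\<lambda>p. p"], rule conjI[OF iso_id g.classify_q1_invariant[OF as d m]])
  next
    case False
    then obtain v0 where "\<not> g.deg0 c v0" by blast
    from g.common_root[OF as this] obtain a where a: "\<forall>v. \<exists>\<gamma>. \<forall>xy. ev (g.DB v) xy = \<gamma> * (snd xy - a)\<^sup>2" by blast
    let ?\<tau> = "\<lambda>z. hmap (swF a) (\<sigma> (fst z, hmap (swG a) (snd z)))"
    have str': "ga2_structure Y ?\<tau>" by (rule sw_structure[OF n0 o1 str])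
    interpret a': gact n om al be th ?\<tau> by unfold_locales (use str' in \<open>simp add: ga2_structure_def\<close>)
    obtain X1' X2' Y1' Y2' where g': "gder n om al be th ?\<tau> X1' X2' Y1' Y2'" using a'.gder_exists by blast
    interpret g': gder n om al be th ?\<tau> X1' X2' Y1' Y2' by (rule g')
    have d: "g'.deg0 c v" for v
    proof -
      obtain \<gamma> where "\<forall>xy. ev (g.DB v) xy = \<gamma> * (snd xy - a)\<^sup>2" using a by blast
      then have "g'.DB v = cst (- \<gamma>)" by (intro g.sw_generator[OF n0 o1 g']) blast
      then show ?thesis by (rule g'.deg0_if_const[OF n0 o0 o1 bez str' c])
    qed
    have "\<exists>c1 c2 \<mu> lam. (c1, c2) \<noteq> (0, 0) \<and> \<mu> \<noteq> 0 \<and> (\<forall>t xy. ?\<tau> (t, pt xy) = pt (std_action m lam c1 c2 \<mu> t xy))"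
      by (rule g'.classify_q1_invariant[OF n0 o0 o1 bez str' c d m])
    then show ?thesis unfolding fst_conv snd_conv
      by (rule_tac x = "hmap (swF a)" in exI, rule_tac x = "hmap (swG a)" in exI) (rule conjI[OF sw_iso[OF n0 o1]])
  qed
qed

lemma whom_cong:
  assumes "whom N a d f" "\<And>i. i \<le> N \<Longrightarrow> a i = b i" shows "whom N b d f"
  using assms(1)
proof induction
  case whom_zero
  show ?case by (rule whom.whom_zero)
next
  case (whom_step f m k)
  have "(\<Sum>i\<in>Poly_Mapping.keys m. b i * Poly_Mapping.lookup m i) = d"
    unfolding whom_step.hyps(3)[symmetric] using whom_step.hyps(2) assms(2) by (intro sum.cong) auto
  then show ?case by (rule whom.whom_step[OF whom_step.IH whom_step.hyps(2)])
qed

text \<open>The weights agree with 1 up to index 2, and beyond it all coordinates vanish; so points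
  and forms are literally the same.\<close>

lemma iso_proj_plane:
  assumes n0: "n = 0" and o: "om 0 = 1" "om 1 = 1" shows "isomorphic Y proj_plane"
proof -
  have w: "wts i = 1" if "i \<le> 2" for i
    using that o by (cases i) (auto simp: wts_def le_Suc_eq numeral_2_eq_2)
  have wo: "worbit wts z = worbit (\<lambda>_. 1) z" if "\<forall>i>2. z i = 0" for z
  proof -
    have e: "(\<lambda>i. c ^ wts i * z i) = (\<lambda>i. c ^ 1 * z i)" for c
    proof
      fix i show "c ^ wts i * z i = c ^ 1 * z i" using w[of i] that by (cases "i \<le> 2") simp_all
    qed
    show ?thesis unfolding worbit_def e ..
  qed
  have n2: "n + 2 = 2" using n0 by simp
  have pe: "Ypts = wproj_pts 2 (\<lambda>_. 1)"
  proof -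
    have "Ypts = wproj_pts 2 wts" unfolding Ypts_def n2 using n0 by simp
    also have "\<dots> = wproj_pts 2 (\<lambda>_. 1)" unfolding wproj_pts_def using wo by (intro Collect_cong) metis
    finally show ?thesis .
  qed
  have he: "hfun 2 wts = hfun 2 (\<lambda>_. 1)"
    by (intro ext) (unfold hfun_def, use whom_cong[of 2 wts _ _ "\<lambda>_. 1"] whom_cong[of 2 "\<lambda>_. 1" _ _ wts] w in metis)
  have Yp: "presents Y (wproj_pts 2 (\<lambda>_. 1)) (hfun 2 (\<lambda>_. 1))" using presents_Y unfolding n2 pe he .
  note P = presents_wproj[of 2 "\<lambda>_. 1"] and gh = graded_hfun[of 2 "\<lambda>_. 1"]
  have 1: "morphism Y proj_plane (\<lambda>p. p)" by (rule morphismI[OF Yp gh P gh, of _ "\<lambda>_. 1"]) auto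
  have 2: "morphism proj_plane Y (\<lambda>p. p)" by (rule morphismI[OF P gh Yp gh, of _ "\<lambda>_. 1"]) auto
  show ?thesis unfolding isomorphic_def iso_maps_def using 1 2 by blast
qed

end

section \<open>Arithmetic of key sequences\<close>

lemma key_e_dvd: "j \<le> k \<Longrightarrow> key_e \<omega> k dvd \<omega> j"
  unfolding key_e_def by (metis Gcd_dvd abs_dvd_iff atMost_iff dvd_abs_iff image_eqI)

lemma key_e_0: "key_e \<omega> 0 = \<bar>\<omega> 0\<bar>"
  unfolding key_e_def by simp

lemma key_e_Suc: "key_e \<omega> (Suc k) = gcd (\<omega> (Suc k)) (key_e \<omega> k)"
  unfolding key_e_def by (simp add: atMost_Suc Gcd_insert)

section \<open>From a key sequence in normal form to the abstract data\<close>

locale key_seq =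
  fixes n :: nat and \<omega> :: "nat \<Rightarrow> int" and \<theta> :: "nat \<Rightarrow> complex"
  assumes seq: "key_sequence n \<omega>" and prim: "key_primitive n \<omega>" and alg: "key_algebraic n \<omega>"
    and nf: "normal_form n \<omega>" and th: "\<forall>k\<in>{1..n}. \<theta> k \<noteq> 0"
begin

abbreviation e :: "nat \<Rightarrow> int" where "e \<equiv> key_e \<omega>"
abbreviation alph :: "nat \<Rightarrow> int" where "alph \<equiv> key_alpha \<omega>"

lemma w0: "\<omega> 0 \<ge> 1" and e_last: "e (Suc n) = 1"
  and less: "1 \<le> k \<Longrightarrow> k \<le> n \<Longrightarrow> \<omega> (Suc k) < alph k * \<omega> k"
  using seq unfolding key_sequence_def by auto

lemma e_pos: "0 < e k"
proof (induction k)
  case 0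
  show ?case using w0 by (simp add: key_e_0)
next
  case (Suc k)
  then have "gcd (\<omega> (Suc k)) (e k) \<noteq> 0" by simp
  moreover have "gcd (\<omega> (Suc k)) (e k) \<ge> 0" by (rule gcd_ge_0_int)
  ultimately show ?case unfolding key_e_Suc by linarith
qed

lemma alph_e: "1 \<le> k \<Longrightarrow> alph k * e k = e (k - 1)"
proof -
  assume "1 \<le> k"
  then obtain j where j: "k = Suc j" by (cases k) auto
  have "e k dvd e (k - 1)" unfolding j key_e_Suc by simp
  then show ?thesis unfolding key_alpha_def by simp
qed

lemma alph_pos: "1 \<le> k \<Longrightarrow> 1 \<le> alph k"
proof -
  assume "1 \<le> k"
  then have "0 < alph k * e k" using alph_e e_pos by simp
  then have "0 < alph k" using e_pos[of k] by (simp add: zero_less_mult_iff)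
  then show ?thesis by simp
qed

lemma w_pos: "k \<le> Suc n \<Longrightarrow> 0 < \<omega> k"
proof (induction k rule: inc_induct)
  case base
  show ?case using prim unfolding key_primitive_def by simp
next
  case (step k)
  show ?case
  proof (cases "k = 0")
    case False
    then have "0 < alph k * \<omega> k" using less[of k] step by simp
    then show ?thesis using alph_pos[of k] False by (simp add: zero_less_mult_iff)
  qed (use w0 in simp)
qed

text \<open>Division with remainder from the top: multiples of \<open>alph k\<close> in the
  coefficient of \<open>\<omega> k\<close> are traded for earlier terms by algebraicity.\<close>

lemma reduce:
  assumes "k \<le> Suc n"
  shows "\<exists>b :: nat \<Rightarrow> nat. (\<Sum>j<k. int (c j) * \<omega> j) = (\<Sum>j<k. int (b j) * \<omega> j) \<and> (\<forall>j\<in>{1..<k}. int (b j) < alph j)"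
  using assms
proof (induction k arbitrary: c)
  case 0
  show ?case by simp
next
  case (Suc k)
  show ?case
  proof (cases "k = 0")
    case True
    then show ?thesis by (intro exI[of _ c]) simp
  next
    case False
    then have k: "1 \<le> k" "k \<le> n" using Suc.prems by auto
    obtain d :: "nat \<Rightarrow> nat" where d: "alph k * \<omega> k = (\<Sum>j<k. int (d j) * \<omega> j)"
      using alg k unfolding key_algebraic_def by (meson atLeastAtMost_iff)
    define A where "A = nat (alph k)"
    have A: "int A = alph k" "0 < A" using alph_pos[OF k(1)] by (simp_all add: A_def)
    define q r where "q = c k div A" and "r = c k mod A"
    have ck: "int (c k) = int q * alph k + int r"
      unfolding q_def r_def A(1)[symmetric] by (simp flip: of_nat_mult of_nat_add)
    obtain b where b: "(\<Sum>j<k. int (c j + q * d j) * \<omega> j) = (\<Sum>j<k. int (b j) * \<omega> j)" "\<forall>j\<in>{1..<k}. int (b j) < alph j"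
      using Suc.IH[of "\<lambda>j. c j + q * d j"] Suc.prems by auto
    have "(\<Sum>j<Suc k. int (c j) * \<omega> j) = (\<Sum>j<k. int (c j) * \<omega> j) + int q * (alph k * \<omega> k) + int r * \<omega> k"
      by (simp add: ck algebra_simps)
    also have "\<dots> = (\<Sum>j<k. int (c j + q * d j) * \<omega> j) + int r * \<omega> k"
      unfolding d by (simp add: sum.distrib sum_distrib_left algebra_simps)
    also have "\<dots> = (\<Sum>j<Suc k. int ((b(k := r)) j) * \<omega> j)" unfolding b(1) by simp
    finally have 1: "(\<Sum>j<Suc k. int (c j) * \<omega> j) = (\<Sum>j<Suc k. int ((b(k := r)) j) * \<omega> j)" .
    have "int r < alph k" unfolding r_def A(1)[symmetric] using A(2) by simp
    then have 2: "\<forall>j\<in>{1..<Suc k}. int ((b(k := r)) j) < alph j" using b(2) by (auto simp: less_Suc_eq)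
    show ?thesis using 1 2 by blast
  qed
qed

text \<open>The difference \<open>d\<close> of the top digits satisfies
  \<open>e (k - 1) dvd d * \<omega> k\<close>, so \<open>alph k dvd d\<close> by Bezout, while its
  absolute value is below \<open>alph k\<close>. The coefficient at 0 has no bound; it is settled
  last, since \<open>\<omega> 0\<close> is nonzero.\<close>

lemma unique_rep:
  assumes "k \<le> Suc n" "\<And>j. 1 \<le> j \<Longrightarrow> j < k \<Longrightarrow> 0 \<le> a j \<and> a j < alph j" "\<And>j. 1 \<le> j \<Longrightarrow> j < k \<Longrightarrow> 0 \<le> b j \<and> b j < alph j"
    and "(\<Sum>j<k. a j * \<omega> j) = (\<Sum>j<k. b j * \<omega> j)" "j < k"
  shows "a j = b j"
  using assms
proof (induction k arbitrary: j)
  case (Suc k)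
  have kk: "a k = b k \<and> (\<Sum>j<k. a j * \<omega> j) = (\<Sum>j<k. b j * \<omega> j)"
  proof (cases "k = 0")
    case True
    then show ?thesis using Suc.prems(4) w0 by simp
  next
    case False
    define d where "d = a k - b k"
    have s: "d * \<omega> k = (\<Sum>j<k. (b j - a j) * \<omega> j)"
      using Suc.prems(4) by (simp add: d_def left_diff_distrib sum_subtractf)
    have "e (k - 1) dvd d * \<omega> k" unfolding s
      by (intro dvd_sum dvd_mult key_e_dvd) (use False in auto)
    moreover have ek: "e k = gcd (\<omega> k) (e (k - 1))" using key_e_Suc[of \<omega> "k - 1"] False by simp
    obtain u v where uv: "u * \<omega> k + v * e (k - 1) = e k" unfolding ek using bezout_int by blast
    have "d * e k = u * (d * \<omega> k) + (d * v) * e (k - 1)" unfolding uv[symmetric] by (simp add: algebra_simps)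
    ultimately have "e (k - 1) dvd d * e k" by (metis dvd_add dvd_mult dvd_triv_right)
    then have "alph k * e k dvd d * e k" using alph_e[of k] False by simp
    then have "alph k dvd d" using e_pos[of k] by simp
    moreover have "\<bar>d\<bar> < alph k" using Suc.prems(2)[of k] Suc.prems(3)[of k] False by (auto simp: d_def)
    ultimately have "d = 0" using dvd_imp_le_int[of d "alph k"] by fastforce
    then show ?thesis using Suc.prems(4) by (simp add: d_def)
  qed
  show ?case
  proof (cases "j = k")
    case False
    show ?thesis by (rule Suc.IH) (use Suc.prems kk False in auto)
  qed (use kk in simp)
qed simp

text \<open>\<open>reduce\<close> and \<open>unique_rep\<close> make the description in
  \<open>key_beta\<close> definite. The reduced representation starts from natural coefficients,
  which accounts for the sign of the coefficient at 0.\<close>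

lemma beta:
  assumes "1 \<le> k" "k \<le> n"
  shows "alph k * \<omega> k = (\<Sum>j<k. key_beta \<omega> k j * \<omega> j)" "0 \<le> key_beta \<omega> k j"
    "1 \<le> j \<Longrightarrow> j < k \<Longrightarrow> key_beta \<omega> k j < alph j"
proof -
  obtain d :: "nat \<Rightarrow> nat" where d: "alph k * \<omega> k = (\<Sum>j<k. int (d j) * \<omega> j)"
    using alg assms unfolding key_algebraic_def by (meson atLeastAtMost_iff)
  obtain b where b: "(\<Sum>j<k. int (d j) * \<omega> j) = (\<Sum>j<k. int (b j) * \<omega> j)" "\<forall>j\<in>{1..<k}. int (b j) < alph j"
    using reduce[of k d] assms by auto
  define b' where "b' j = (if j < k then int (b j) else 0)" for j
  have s: "(\<Sum>j<k. b' j * \<omega> j) = (\<Sum>j<k. int (b j) * \<omega> j)" by (rule sum.cong) (simp_all add: b'_def)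
  have kb: "key_beta \<omega> k = b'"
    unfolding key_beta_def
  proof (rule the_equality)
    show "alph k * \<omega> k = (\<Sum>j<k. b' j * \<omega> j) \<and> (\<forall>j\<in>{1..<k}. 0 \<le> b' j \<and> b' j < alph j) \<and> (\<forall>j\<ge>k. b' j = 0)"
      unfolding s using d b by (auto simp: b'_def)
  next
    fix f assume f: "alph k * \<omega> k = (\<Sum>j<k. f j * \<omega> j) \<and> (\<forall>j\<in>{1..<k}. 0 \<le> f j \<and> f j < alph j) \<and> (\<forall>j\<ge>k. f j = 0)"
    show "f = b'"
    proof
      fix j show "f j = b' j"
      proof (cases "j < k")
        case True
        show ?thesis by (rule unique_rep[of k]) (use f d b s True assms in \<open>auto simp: b'_def\<close>)
      qed (use f in \<open>simp add: b'_def\<close>)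
    qed
  qed
  show "alph k * \<omega> k = (\<Sum>j<k. key_beta \<omega> k j * \<omega> j)" unfolding kb s using d b(1) by simp
  show "0 \<le> key_beta \<omega> k j" unfolding kb by (simp add: b'_def)
  show "1 \<le> j \<Longrightarrow> j < k \<Longrightarrow> key_beta \<omega> k j < alph j" unfolding kb using b(2) by (simp add: b'_def)
qed

abbreviation om :: "nat \<Rightarrow> nat" where "om j \<equiv> nat (\<omega> j)"
abbreviation al :: "nat \<Rightarrow> nat" where "al k \<equiv> nat (alph k)"
abbreviation be :: "nat \<Rightarrow> nat \<Rightarrow> nat" where "be k j \<equiv> nat (key_beta \<omega> k j)"

lemma int_om: "k \<le> Suc n \<Longrightarrow> int (om k) = \<omega> k" and int_al: "1 \<le> k \<Longrightarrow> int (al k) = alph k"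
  using w_pos[of k] alph_pos[of k] by simp_all

lemma keydata: "keydata n om al be \<theta>"
proof
  fix k assume "k \<le> Suc n" then show "0 < om k" using w_pos by simp
next
  fix k assume k: "1 \<le> k" "k \<le> n"
  show "0 < al k" using alph_pos[OF k(1)] by simp
  have "int (om (Suc k)) < int (al k * om k)" using less[OF k] int_om[of k] int_om[of "Suc k"] int_al[OF k(1)] k by simp
  then show "om (Suc k) < al k * om k" by (simp only: of_nat_less_iff)
  have "int (\<Sum>j<k. be k j * om j) = (\<Sum>j<k. key_beta \<omega> k j * \<omega> j)"
    unfolding of_nat_sum of_nat_mult by (rule sum.cong) (use beta(2)[OF k] int_om k in auto)
  also have "\<dots> = int (al k * om k)" using beta(1)[OF k] int_om[of k] int_al[OF k(1)] k by simp
  finally show "(\<Sum>j<k. be k j * om j) = al k * om k" by (simp only: of_nat_eq_iff)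
  show "\<theta> k \<noteq> 0" using th k by simp
next
  fix j k assume "1 \<le> j" "j < k" "k \<le> n"
  then show "be k j < al j" using beta(2,3)[of k j] by (simp add: nat_less_iff)
next
  fix a b j
  assume a: "\<And>j. 1 \<le> j \<Longrightarrow> j \<le> n \<Longrightarrow> a j < al j" and b: "\<And>j. 1 \<le> j \<Longrightarrow> j \<le> n \<Longrightarrow> b j < al j"
    and s: "(\<Sum>j\<le>n. a j * om j) = (\<Sum>j\<le>n. b j * om j)" and j: "j \<le> n"
  have c: "int (\<Sum>j\<le>n. c j * om j) = (\<Sum>j<Suc n. int (c j) * \<omega> j)" for c
    unfolding of_nat_sum of_nat_mult lessThan_Suc_atMost by (rule sum.cong) (use int_om in auto)
  have "int (a j) = int (b j)"
  proof (rule unique_rep[of "Suc n" "\<lambda>j. int (a j)" "\<lambda>j. int (b j)"])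
    show "(\<Sum>j<Suc n. int (a j) * \<omega> j) = (\<Sum>j<Suc n. int (b j) * \<omega> j)" unfolding c[symmetric] s ..
    show "0 \<le> int (a i) \<and> int (a i) < alph i" if "1 \<le> i" "i < Suc n" for i using a[of i] that by (simp add: zless_nat_eq_int_zless)
    show "0 \<le> int (b i) \<and> int (b i) < alph i" if "1 \<le> i" "i < Suc n" for i using b[of i] that by (simp add: zless_nat_eq_int_zless)
  qed (use j in auto)
  then show "a j = b j" by simp
qed

lemma bezout_e: "\<exists>z. (\<Sum>j\<le>k. z j * \<omega> j) = e k"
proof (induction k)
  case 0
  show ?case using w0 by (intro exI[of _ "\<lambda>_. 1"]) (simp add: key_e_0)
next
  case (Suc k)
  then obtain z where z: "(\<Sum>j\<le>k. z j * \<omega> j) = e k" by blast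
  obtain u v where uv: "u * \<omega> (Suc k) + v * e k = e (Suc k)" unfolding key_e_Suc using bezout_int by blast
  let ?z = "\<lambda>j. if j \<le> k then v * z j else u"
  have "(\<Sum>j\<le>Suc k. ?z j * \<omega> j) = (\<Sum>j\<le>k. v * z j * \<omega> j) + u * \<omega> (Suc k)" by simp
  also have "(\<Sum>j\<le>k. v * z j * \<omega> j) = v * e k" unfolding z[symmetric] by (simp add: sum_distrib_left mult.assoc)
  finally show ?case using uv by (intro exI[of _ ?z]) simp
qed

text \<open>A term equal to its gcd forces an earlier one, down to a multiple relation between the first
  two terms that the normal form excludes.\<close>

lemma w1: assumes "1 \<le> n" shows "\<omega> 1 < \<omega> 0" "\<not> \<omega> 1 dvd \<omega> 0"
proof -
  have *: "\<omega> 1 < \<omega> 0" "(of_int (\<omega> 1) / of_int (\<omega> 0) :: rat) \<notin> {1 / of_int k | k :: int. k \<ge> 1}"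
    using nf assms unfolding normal_form_def by auto
  then show "\<omega> 1 < \<omega> 0" by blast
  show "\<not> \<omega> 1 dvd \<omega> 0"
  proof
    assume "\<omega> 1 dvd \<omega> 0"
    then obtain k where k: "\<omega> 0 = \<omega> 1 * k" by blast
    have p: "0 < \<omega> 1" using w_pos[of 1] by simp
    have "0 < \<omega> 1 * k" using w0 k by linarith
    then have "1 \<le> k" using p by (simp add: zero_less_mult_iff)
    moreover have "(of_int (\<omega> 1) / of_int (\<omega> 0) :: rat) = 1 / of_int k" unfolding k using p by simp
    ultimately show False using *(2) by blast
  qed
qed

lemma w_ne_e: "1 \<le> j \<Longrightarrow> j \<le> n \<Longrightarrow> \<omega> j \<noteq> e j"
proof (induction j rule: less_induct)
  case (less j)
  show ?case
  proof
    assume we: "\<omega> j = e j"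
    obtain d :: "nat \<Rightarrow> nat" where d: "alph j * \<omega> j = (\<Sum>i<j. int (d i) * \<omega> i)"
      using alg less.prems unfolding key_algebraic_def by (meson atLeastAtMost_iff)
    \<comment> \<open>Every earlier term is a positive multiple of \<open>e (j - 1)\<close>, so a
      sum equal to \<open>e (j - 1)\<close> consists of one term, which is \<open>e (j - 1)\<close>
      itself.\<close>
    have s: "(\<Sum>i<j. int (d i) * \<omega> i) = e (j - 1)" using d alph_e[of j] less.prems by (simp add: we)
    then have "(\<Sum>i<j. int (d i) * \<omega> i) \<noteq> 0" using e_pos[of "j - 1"] by simp
    then obtain i where i: "i < j" "int (d i) * \<omega> i \<noteq> 0" by (meson lessThan_iff sum.not_neutral_contains_not_neutral)
    have p: "0 < \<omega> i'" if "i' < j" for i' using w_pos[of i'] that less.prems by simp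
    have "1 * \<omega> i \<le> int (d i) * \<omega> i" using i p[OF i(1)] by (intro mult_right_mono) auto
    also have "\<dots> \<le> (\<Sum>i<j. int (d i) * \<omega> i)"
    proof (rule member_le_sum)
      show "0 \<le> int (d x) * \<omega> x" if "x \<in> {..<j} - {i}" for x using p[of x] that by simp
    qed (use i in auto)
    finally have le: "\<omega> i \<le> e (j - 1)" using s by simp
    have "e (j - 1) \<le> \<omega> i" by (rule zdvd_imp_le[OF key_e_dvd[of i "j - 1" \<omega>] p[of i]]) (use i in auto)
    then have wi: "\<omega> i = e (j - 1)" using le by simp
    show False
    proof (cases "i = 0")
      case True
      show False
      proof (cases "j = 1")
        case True
        then have "\<omega> 1 dvd \<omega> 0" using we key_e_dvd[of 0 1 \<omega>] by simp
        then show False using w1(2) less.prems by simp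
      next
        case False
        then have "\<omega> 0 dvd \<omega> 1" using wi \<open>i = 0\<close> key_e_dvd[of 1 "j - 1" \<omega>] less.prems by simp
        then have "\<omega> 0 \<le> \<omega> 1" by (rule zdvd_imp_le) (use w_pos[of 1] in simp)
        then show False using w1(1) less.prems by simp
      qed
    next
      case False
      \<comment> \<open>The chain \<open>e (j - 1) <= e i <= \<omega> i = e (j - 1)\<close>
        collapses, so the earlier index \<open>i\<close> has the excluded property too.\<close>
      have "e (j - 1) dvd e i"
      proof -
        have "e (i + m) dvd e i" for m
        proof (induction m)
          case (Suc m)
          then show ?case using key_e_Suc[of \<omega> "i + m"] by (metis add_Suc_right dvd_trans gcd_dvd2)
        qed simp
        from this[of "j - 1 - i"] show ?thesis using i by simp
      qed
      then have "e (j - 1) \<le> e i" by (rule zdvd_imp_le[OF _ e_pos])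
      moreover have "e i \<le> \<omega> i" by (rule zdvd_imp_le[OF key_e_dvd[of i i \<omega>, OF order.refl] p[OF i(1)]])
      ultimately have "\<omega> i = e i" using wi by simp
      then show False using less.IH[OF i(1)] False less.prems i by simp
    qed
  qed
qed

text \<open>For \<open>j >= 1\<close>, a term equal to 1 would be equal to its gcd, against
  \<open>w_ne_e\<close>. This is the bound on the weights in the semigroup argument of
  \<open>degree_drop\<close>.\<close>

lemma om_ge_2: assumes "1 \<le> n" "j \<le> n" shows "2 \<le> om j"
proof -
  have p: "0 < \<omega> j" using w_pos assms by simp
  have "\<omega> j \<noteq> 1"
  proof (cases "j = 0")
    case True
    then show ?thesis using w1(1)[OF assms(1)] w_pos[of 1] by simp
  next
    case False
    have "e j \<le> \<omega> j" by (rule zdvd_imp_le[OF key_e_dvd[of j j \<omega>, OF order.refl] p])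
    then show ?thesis using w_ne_e[of j] False assms e_pos[of j] by fastforce
  qed
  then show ?thesis using p by simp
qed

sublocale K: keydata n om al be \<theta> by (rule keydata)

text \<open>Positive and negative parts of a Bezout relation for the gcd 1.\<close>

lemma bez: "\<exists>a b. K.wt a = Suc (K.wt b)"
proof -
  obtain z where z: "(\<Sum>j\<le>Suc n. z j * \<omega> j) = 1" using bezout_e[of "Suc n"] e_last by auto
  have w: "int (K.wt a) = (\<Sum>j\<le>Suc n. int (a j) * \<omega> j)" for a
    unfolding K.wt_def of_nat_sum of_nat_mult by (rule sum.cong) (use int_om in auto)
  have "int (K.wt (\<lambda>j. nat (z j))) - int (K.wt (\<lambda>j. nat (- z j))) = (\<Sum>j\<le>Suc n. z j * \<omega> j)"
  proof -
    have "int (nat a) * x - int (nat (- a)) * x = a * x" for a x by (cases "0 \<le> a") auto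
    then show ?thesis unfolding w sum_subtractf[symmetric] by (simp only:)
  qed
  then have "K.wt (\<lambda>j. nat (z j)) = Suc (K.wt (\<lambda>j. nat (- z j)))" unfolding z by simp
  then show ?thesis by blast
qed

lemma sI_last: "(\<Sum>k=1..n. (alph k - 1) * \<omega> k) = K.sI (Suc n)"
proof -
  have "(\<Sum>k=1..n. (alph k - 1) * \<omega> k) = (\<Sum>k=1..n. (int (al k) - 1) * int (om k))"
  proof (rule sum.cong[OF refl])
    fix k assume "k \<in> {1..n}"
    then have "int (al k) = alph k" "int (om k) = \<omega> k" using int_al[of k] int_om[of k] by auto
    then show "(alph k - 1) * \<omega> k = (int (al k) - 1) * int (om k)" by (simp only:)
  qed
  then show ?thesis unfolding K.sI_def atLeastLessThanSuc_atLeastAtMost by simp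
qed

lemma k_condition: "\<omega> 0 + k_xbar n \<omega> < 0 \<longleftrightarrow> K.sI (Suc n) \<le> int (om (Suc n))"
  unfolding k_xbar_def sI_last using int_om[of "Suc n"] by auto

text \<open>The floor in \<open>m_omega\<close> as a largest exponent: \<open>y^i\<close> is
  admissible in the \<open>x\<close>-component exactly under the degree condition at
  \<open>y_{n+1}\<close>.\<close>

lemma le_m_omega: "i \<le> m_omega n \<omega> \<longleftrightarrow> i * int (om 1) \<le> int (om 0) + int (om (Suc n)) - K.sI (Suc n) - int (om 1)"
proof -
  have p: "(0 :: rat) < of_int (\<omega> 1)" using w_pos[of 1] by simp
  have "i \<le> m_omega n \<omega> \<longleftrightarrow> (of_int i :: rat) * of_int (\<omega> 1) \<le> of_int (- (k_xbar n \<omega> + \<omega> 1 + 1))"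
    unfolding m_omega_def le_floor_iff using pos_le_divide_eq[OF p] by blast
  also have "\<dots> \<longleftrightarrow> i * \<omega> 1 \<le> - (k_xbar n \<omega> + \<omega> 1 + 1)" by (simp only: of_int_mult[symmetric] of_int_le_iff)
  finally show ?thesis unfolding k_xbar_def sI_last using int_om[of "Suc n"] int_om[of 0] int_om[of 1] by auto
qed

section \<open>Identification with the given surface\<close>

lemma weights: "xbar_weights \<omega> = K.wts"
  by (rule ext) (simp add: xbar_weights_def K.wts_def)

lemma xbar_pts: "xbar_pts n \<omega> \<theta> = K.Ypts"
proof -
  have "nat (alph k * \<omega> k - \<omega> (k + 1)) = al k * om k - om (k + 1)" if "k \<in> {1..n}" for k
    using that w_pos[of "k + 1"] w_pos[of k] alph_pos[of k] by (simp add: nat_diff_distrib' nat_mult_distrib)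
  then show ?thesis unfolding xbar_pts_def K.Ypts_def K.eqn_def weights by (intro Collect_cong conj_cong ball_cong refl) simp
qed

lemma xbar: "xbar n \<omega> \<theta> = K.Y"
  unfolding xbar_def K.Y_def weights xbar_pts ..

lemma xbar_affine: "xbar_affine n \<omega> \<theta> = range K.pt"
proof -
  have "(\<forall>z\<in>p. z 0 \<noteq> 0) \<longleftrightarrow> rep p 0 \<noteq> 0" if p: "p \<in> K.Ypts" for p
  proof -
    have e: "worbit K.wts (rep p) = p" by (rule K.rep_cone(2)[OF p])
    show ?thesis
    proof
      assume "\<forall>z\<in>p. z 0 \<noteq> 0"
      moreover have "rep p \<in> p" using worbit_self[of "rep p" K.wts] unfolding e .
      ultimately show "rep p 0 \<noteq> 0" by blast
    next
      assume r: "rep p 0 \<noteq> 0"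
      show "\<forall>z\<in>p. z 0 \<noteq> 0"
      proof
        fix z assume "z \<in> p"
        then have "z \<in> worbit K.wts (rep p)" unfolding e .
        then show "z 0 \<noteq> 0" using r unfolding worbit_def by auto
      qed
    qed
  qed
  then show ?thesis unfolding xbar_affine_def xbar_pts K.range_pt by blast
qed

lemma coords: "xbar_coords \<omega> (K.pt xy) = xy"
  unfolding xbar_coords_def by (rule K.coords_pt)

lemma restrictsI:
  assumes "\<And>t xy. \<tau> (t, K.pt xy) = K.pt (A t xy)" shows "restricts_to n \<omega> \<theta> \<tau> A"
  unfolding restricts_to_def xbar_affine
proof (intro allI ballI)
  fix t p assume "p \<in> range K.pt"
  then obtain xy where p: "p = K.pt xy" by blast
  show "\<tau> (t, p) \<in> range K.pt \<and> xbar_coords \<omega> (\<tau> (t, p)) = A t (xbar_coords \<omega> p)" unfolding p assms coords by simp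
qed

lemma om1_le: "om 1 \<le> om 0"
proof -
  have "\<omega> 1 \<le> \<omega> 0" using nf unfolding normal_form_def by auto
  then show ?thesis by (rule nat_mono)
qed

lemma pos_case: assumes "1 \<le> n" shows "om 1 < om 0" "\<not> om 1 dvd om 0"
proof -
  have i: "int (om 0) = \<omega> 0" "int (om 1) = \<omega> 1" using int_om[of 0] int_om[of 1] by simp_all
  show "om 1 < om 0" using w1(1)[OF assms] i by linarith
  show "\<not> om 1 dvd om 0" using w1(2)[OF assms] i by (metis int_dvd_int_iff)
qed

lemma zero_case: assumes "n = 0" shows "coprime (om 0) (om 1)"
proof -
  have "gcd (\<omega> 1) \<bar>\<omega> 0\<bar> = 1" using e_last key_e_Suc[of \<omega> 0] unfolding assms key_e_0 by simp
  then have "gcd (int (om 1)) (int (om 0)) = 1" using int_om[of 0] int_om[of 1] w0 by simp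
  then have "gcd (om 1) (om 0) = 1" by (metis gcd_int_int_eq of_nat_eq_1_iff)
  then show ?thesis by (simp add: coprime_iff_gcd_eq_1 gcd.commute)
qed

section \<open>Existence, necessity and classification\<close>

lemma standard:
  assumes "\<omega> 0 + k_xbar n \<omega> < 0" "(c1, c2) \<noteq> (0, 0)" "\<mu> \<noteq> 0"
  shows "\<exists>\<sigma>. ga2_structure (xbar n \<omega> \<theta>) \<sigma> \<and> restricts_to n \<omega> \<theta> \<sigma> (std_action (m_omega n \<omega>) lam c1 c2 \<mu>)"
proof -
  have s: "K.sI (Suc n) \<le> int (om (Suc n))" using assms(1) unfolding k_condition .
  have m: "m_omega n \<omega> * int (om 1) \<le> int (om 0) + int (om (Suc n)) - K.sI (Suc n) - int (om 1)"
    using le_m_omega[of "m_omega n \<omega>"] by simp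
  obtain \<sigma> where \<sigma>: "ga2_structure K.Y \<sigma>" "\<forall>t xy. \<sigma> (t, K.pt xy) = K.pt (std_action (m_omega n \<omega>) lam c1 c2 \<mu> t xy)"
    using K.standard_structure[OF s om1_le m assms(2,3), of lam] by (elim exE conjE)
  show ?thesis unfolding xbar by (rule exI[of _ \<sigma>], rule conjI[OF \<sigma>(1)], rule restrictsI) (rule \<sigma>(2)[rule_format])
qed

lemma obtain_generators:
  assumes "ga2_structure K.Y \<sigma>"
  obtains X1 X2 Y1 Y2 c where "gder n om al be \<theta> \<sigma> X1 X2 Y1 Y2" "K.curve c"
proof -
  interpret gact n om al be \<theta> \<sigma> by unfold_locales (use assms in \<open>simp add: ga2_structure_def\<close>)
  show ?thesis using gder_exists K.curve_exists that by blast
qed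

lemma necessary:
  assumes str: "ga2_structure K.Y \<sigma>" shows "K.sI (Suc n) \<le> int (om (Suc n))"
proof (cases "n = 0")
  case True
  then show ?thesis using K.sI_1 by simp
next
  case False
  then have n: "1 \<le> n" by simp
  obtain X1 X2 Y1 Y2 c where g: "gder n om al be \<theta> \<sigma> X1 X2 Y1 Y2" and c: "K.curve c" by (rule obtain_generators[OF str])
  interpret gder n om al be \<theta> \<sigma> X1 X2 Y1 Y2 by (rule g)
  show ?thesis by (rule classify_pos(2)[OF str c om_ge_2[OF n] bez pos_case[OF n] n])
qed

text \<open>For \<open>n = 0\<close> the weights are coprime, so \<open>om 1 >= 2\<close> excludes
  that \<open>om 1\<close> divides \<open>om 0\<close>; then \<open>X\<close> is invariant and the
  identity serves as \<open>F\<close>, as for \<open>n >= 1\<close>. If \<open>om 1 = 1\<close>,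
  excluding the projective plane leaves \<open>om 0 >= 2\<close>, where a swap may be
  required.\<close>

lemma classification:
  assumes str: "ga2_structure K.Y \<sigma>" and np: "\<not> isomorphic K.Y proj_plane"
  shows "\<exists>F G. iso_maps K.Y K.Y F G \<and> (\<exists>c1 c2 \<mu> lam. (c1, c2) \<noteq> (0, 0) \<and> \<mu> \<noteq> 0 \<and>
    (\<forall>t xy. F (\<sigma> (t, G (K.pt xy))) = K.pt (std_action (m_omega n \<omega>) lam c1 c2 \<mu> t xy)))"
proof -
  obtain X1 X2 Y1 Y2 c where g: "gder n om al be \<theta> \<sigma> X1 X2 Y1 Y2" and c: "K.curve c" by (rule obtain_generators[OF str])
  interpret gder n om al be \<theta> \<sigma> X1 X2 Y1 Y2 by (rule g)
  have id: ?thesis if "\<exists>c1 c2 \<mu> lam. (c1, c2) \<noteq> (0, 0) \<and> \<mu> \<noteq> 0 \<and> (\<forall>t xy. \<sigma> (t, K.pt xy) = K.pt (std_action (m_omega n \<omega>) lam c1 c2 \<mu> t xy))"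
    by (rule exI[of _ "\<lambda>p. p"], rule exI[of _ "\<lambda>p. p"], rule conjI[OF K.iso_id that])
  note le = le_m_omega[THEN iffD2]
  show ?thesis
  proof (cases "n = 0")
    case False
    then have n: "1 \<le> n" by simp
    show ?thesis by (rule id, rule classify_pos(3)[OF str c om_ge_2[OF n] bez pos_case[OF n] n le])
  next
    case True
    have o: "0 < om 1" "om 1 \<le> om 0" using K.om_pos[of 1] om1_le by simp_all
    have s0: "K.sI (Suc n) = 0" using True K.sI_1 by simp
    have le0: "i \<le> m_omega n \<omega>" if "i * int (om 1) \<le> int (om 0)" for i
      by (rule le) (use that True s0 in simp)
    show ?thesis
    proof (cases "om 1 = 1")
      case False
      then have o2: "2 \<le> om 1" using o by simp
      have nd: "\<not> om 1 dvd om 0"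
      proof
        assume "om 1 dvd om 0"
        then have "om 1 dvd 1" using zero_case[OF True] by (metis coprime_common_divisor_nat dvd_refl nat_dvd_1_iff_1)
        then show False using o2 by simp
      qed
      then have "om 1 \<noteq> om 0" by auto
      then have lt: "om 1 < om 0" using o(2) by linarith
      have "2 \<le> om 0" using o2 lt by linarith
      then have om2: "2 \<le> om j" if "j \<le> n" for j using that True by simp
      show ?thesis by (rule id, rule classify_0[OF str c om2 bez lt nd True o2 le0])
    next
      case o1: True
      have "om 0 \<noteq> 1" using K.iso_proj_plane[OF True _ o1] np by blast
      then have o2: "2 \<le> om 0" using o by simp
      show ?thesis by (rule K.classify_q1[OF True o2 o1 bez str]) (rule le0, use o1 in simp)
    qed
  qed
qed

end

theorem theorem4p2:
  fixes n :: nat and \<omega> :: "nat \<Rightarrow> int" and \<theta> :: "nat \<Rightarrow> complex"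
  assumes "key_sequence n \<omega>"
    and "key_primitive n \<omega>"
    and "key_algebraic n \<omega>"
    and "normal_form n \<omega>"
    and "\<forall>k\<in>{1..n}. \<theta> k \<noteq> 0"
  shows
    "((\<exists>\<sigma>. ga2_structure (xbar n \<omega> \<theta>) \<sigma>) \<longleftrightarrow> \<omega> 0 + k_xbar n \<omega> < 0) \<and>
     (\<not> isomorphic (xbar n \<omega> \<theta>) proj_plane \<longrightarrow>
       (\<forall>\<sigma>. ga2_structure (xbar n \<omega> \<theta>) \<sigma> \<longrightarrow>
         (\<exists>F G. iso_maps (xbar n \<omega> \<theta>) (xbar n \<omega> \<theta>) F G \<and>
           (\<exists>c1 c2 \<mu> lam. (c1, c2) \<noteq> (0, 0) \<and> \<mu> \<noteq> 0 \<and>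
             restricts_to n \<omega> \<theta> (\<lambda>(t, p). F (\<sigma> (t, G p)))
               (std_action (m_omega n \<omega>) lam c1 c2 \<mu>))))) \<and>
     (\<omega> 0 + k_xbar n \<omega> < 0 \<longrightarrow>
       (\<forall>c1 c2 \<mu> lam. (c1, c2) \<noteq> (0, 0) \<and> \<mu> \<noteq> 0 \<longrightarrow>
         (\<exists>\<sigma>. ga2_structure (xbar n \<omega> \<theta>) \<sigma> \<and>
           restricts_to n \<omega> \<theta> \<sigma> (std_action (m_omega n \<omega>) lam c1 c2 \<mu>))))"
proof -
  interpret key_seq n \<omega> \<theta> by (rule key_seq.intro[OF assms])
  show ?thesis
  proof (intro conjI impI allI)
    show "(\<exists>\<sigma>. ga2_structure (xbar n \<omega> \<theta>) \<sigma>) \<longleftrightarrow> \<omega> 0 + k_xbar n \<omega> < 0"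
    proof
      assume "\<exists>\<sigma>. ga2_structure (xbar n \<omega> \<theta>) \<sigma>"
      then show "\<omega> 0 + k_xbar n \<omega> < 0" unfolding k_condition xbar using necessary by (elim exE)
    next
      assume "\<omega> 0 + k_xbar n \<omega> < 0"
      \<comment> \<open>With all \<open>lam j\<close> equal to 0 the action is by translations of
        the plane.\<close>
      from standard[OF this, of 1 0 1 "\<lambda>_. 0"] show "\<exists>\<sigma>. ga2_structure (xbar n \<omega> \<theta>) \<sigma>" by simp blast
    qed
  next
    fix \<sigma> assume np: "\<not> isomorphic (xbar n \<omega> \<theta>) proj_plane" and str: "ga2_structure (xbar n \<omega> \<theta>) \<sigma>"
    from classification[OF str[unfolded xbar] np[unfolded xbar]]
    obtain F G c1 c2 \<mu> lam where *: "iso_maps K.Y K.Y F G" "(c1, c2) \<noteq> (0, 0)" "\<mu> \<noteq> 0"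
      "\<forall>t xy. F (\<sigma> (t, G (K.pt xy))) = K.pt (std_action (m_omega n \<omega>) lam c1 c2 \<mu> t xy)" by (elim exE conjE)
    have "restricts_to n \<omega> \<theta> (\<lambda>(t, p). F (\<sigma> (t, G p))) (std_action (m_omega n \<omega>) lam c1 c2 \<mu>)"
      by (rule restrictsI, unfold prod.case) (rule *(4)[rule_format])
    with *(2,3) show "\<exists>F G. iso_maps (xbar n \<omega> \<theta>) (xbar n \<omega> \<theta>) F G \<and> (\<exists>c1 c2 \<mu> lam. (c1, c2) \<noteq> (0, 0) \<and> \<mu> \<noteq> 0 \<and>
        restricts_to n \<omega> \<theta> (\<lambda>(t, p). F (\<sigma> (t, G p))) (std_action (m_omega n \<omega>) lam c1 c2 \<mu>))"
      unfolding xbar by (intro exI conjI) (rule *(1))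
  next
    fix c1 c2 \<mu> :: complex and lam assume "\<omega> 0 + k_xbar n \<omega> < 0" "(c1, c2) \<noteq> (0, 0) \<and> \<mu> \<noteq> 0"
    then show "\<exists>\<sigma>. ga2_structure (xbar n \<omega> \<theta>) \<sigma> \<and> restricts_to n \<omega> \<theta> \<sigma> (std_action (m_omega n \<omega>) lam c1 c2 \<mu>)"
      by (intro standard) blast+
  qed
qed

end
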